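(* Let $R$ be an excellent henselian Cohen--Macaulay local ring with completion $\widehat{R}$. If $R$ satisfies the Auslander Condition, then so does $\widehat{R}$. If $R$ satisfies the Uniform Auslander Condition, then so does $\widehat{R}$.
   Context: All local rings are commutative and noetherian, and $\widehat{R}$ is the completion of $R$ with respect to its maximal ideal. A commutative noetherian local ring $A$ satisfies the Auslander Condition if for every finitely generated $A$-module $M$ there exists an integer $b_M$ such that, for every finitely generated $A$-module $X$, if $\operatorname{Ext}_A^{i}(M,X)=0$ for all $i\gg 0$, then $\operatorname{Ext}_A^{i}(M,X)=0$ for all $i>b_M$. The ring $A$ satisfies the Uniform Auslander Condition if there is an integer $b\geq 0$ such that, for all finitely generated $A$-modules $M$ and $X$, if $\operatorname{Ext}_A^{i}(M,X)=0$ for all $i\gg 0$, then $\operatorname{Ext}_A^{i}(M,X)=0$ for all $i>b$. *)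

theory Defs
  imports
    "HOL-Library.Poly_Mapping"
    "HOL-Library.Extended_Nat"
    "HOL-Algebra.UnivPoly"
    "HOL-Algebra.Ring_Divisibility"
    "HOL-Algebra.Generated_Rings"
    "HOL-Algebra.Ideal_Product"
begin

(* otherwise it shadows the record field mult of monoids *)
hide_const (open) Multiset.mult

definition noetherian_local_ring :: "('a, 'm) ring_scheme \<Rightarrow> bool" where
  "noetherian_local_ring A \<longleftrightarrow>
     cring A \<and> noetherian_ring A \<and> (\<exists>!I. maximalideal I A)"

definition max_ideal :: "('a, 'm) ring_scheme \<Rightarrow> 'a set" where
  "max_ideal A = (THE I. maximalideal I A)"

definition residue_field :: "('a, 'm) ring_scheme \<Rightarrow> 'a set ring" where
  "residue_field A = A Quot max_ideal A"

definition frac_rel :: "('a, 'm) ring_scheme \<Rightarrow> 'a set \<Rightarrow> (('a \<times> 'a) \<times> ('a \<times> 'a)) set" where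
  "frac_rel A S = {((r, s), (r', s')). r \<in> carrier A \<and> s \<in> S \<and> r' \<in> carrier A \<and> s' \<in> S \<and>
     (\<exists>u\<in>S. u \<otimes>\<^bsub>A\<^esub> ((r \<otimes>\<^bsub>A\<^esub> s') \<ominus>\<^bsub>A\<^esub> (r' \<otimes>\<^bsub>A\<^esub> s)) = \<zero>\<^bsub>A\<^esub>)}"

definition fraction :: "('a, 'm) ring_scheme \<Rightarrow> 'a set \<Rightarrow> 'a \<Rightarrow> 'a \<Rightarrow> ('a \<times> 'a) set" where
  "fraction A S r s = frac_rel A S `` {(r, s)}"

definition ring_of_fractions :: "('a, 'm) ring_scheme \<Rightarrow> 'a set \<Rightarrow> ('a \<times> 'a) set ring" where
  "ring_of_fractions A S =
     \<lparr>carrier = (carrier A \<times> S) // frac_rel A S,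
      mult = (\<lambda>U V. \<Union>{fraction A S (r \<otimes>\<^bsub>A\<^esub> r') (s \<otimes>\<^bsub>A\<^esub> s') |r s r' s'.
               (r, s) \<in> U \<and> (r', s') \<in> V}),
      one = fraction A S \<one>\<^bsub>A\<^esub> \<one>\<^bsub>A\<^esub>,
      zero = fraction A S \<zero>\<^bsub>A\<^esub> \<one>\<^bsub>A\<^esub>,
      add = (\<lambda>U V. \<Union>{fraction A S ((r \<otimes>\<^bsub>A\<^esub> s') \<oplus>\<^bsub>A\<^esub> (r' \<otimes>\<^bsub>A\<^esub> s)) (s \<otimes>\<^bsub>A\<^esub> s') |r s r' s'.
               (r, s) \<in> U \<and> (r', s') \<in> V})\<rparr>"

definition localization_at :: "('a, 'm) ring_scheme \<Rightarrow> 'a set \<Rightarrow> ('a \<times> 'a) set ring" where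
  "localization_at A P = ring_of_fractions A (carrier A - P)"

definition residue_field_at :: "('a, 'm) ring_scheme \<Rightarrow> 'a set \<Rightarrow> ('a \<times> 'a) set set ring" where
  "residue_field_at A P = residue_field (localization_at A P)"

definition residue_field_at_map :: "('a, 'm) ring_scheme \<Rightarrow> 'a set \<Rightarrow> 'a \<Rightarrow> ('a \<times> 'a) set set" where
  "residue_field_at_map A P a =
     max_ideal (localization_at A P) +>\<^bsub>localization_at A P\<^esub> fraction A (carrier A - P) a \<one>\<^bsub>A\<^esub>"

abbreviation ideal_power :: "('a, 'm) ring_scheme \<Rightarrow> 'a set \<Rightarrow> nat \<Rightarrow> 'a set" where
  "ideal_power A I n \<equiv> I [^]\<^bsub>ideals_set A\<^esub> n"

text \<open>
  The \<open>I\<close>-adic completion is the inverse limit of the rings \<open>A / I^n\<close>. An element is a sequence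
  of cosets, and a coset of \<open>I^(n+1)\<close> maps to the coset of \<open>I^n\<close> that contains it, so
  compatibility is inclusion.
\<close>
definition adic_completion :: "('a, 'm) ring_scheme \<Rightarrow> 'a set \<Rightarrow> (nat \<Rightarrow> 'a set) ring" where
  "adic_completion A I =
     \<lparr>carrier = {x. \<forall>n. x n \<in> carrier (A Quot ideal_power A I n) \<and> x (Suc n) \<subseteq> x n},
      mult = (\<lambda>x y n. x n \<otimes>\<^bsub>A Quot ideal_power A I n\<^esub> y n),
      one = (\<lambda>n. \<one>\<^bsub>A Quot ideal_power A I n\<^esub>),
      zero = (\<lambda>n. \<zero>\<^bsub>A Quot ideal_power A I n\<^esub>),
      add = (\<lambda>x y n. x n \<oplus>\<^bsub>A Quot ideal_power A I n\<^esub> y n)\<rparr>"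

definition completion :: "('a, 'm) ring_scheme \<Rightarrow> (nat \<Rightarrow> 'a set) ring" where
  "completion A = adic_completion A (max_ideal A)"

definition completion_map :: "('a, 'm) ring_scheme \<Rightarrow> 'a \<Rightarrow> nat \<Rightarrow> 'a set" where
  "completion_map A a = (\<lambda>n. ideal_power A (max_ideal A) n +>\<^bsub>A\<^esub> a)"

definition poly_deriv :: "('a, 'm) ring_scheme \<Rightarrow> (nat \<Rightarrow> 'a) \<Rightarrow> nat \<Rightarrow> 'a" where
  "poly_deriv A f = (\<lambda>n. add_pow A (Suc n) (coeff (UP A) f (Suc n)))"

text \<open>
  Simple roots in the residue field of monic polynomials lift to roots. Evaluating \<open>f\<close> along
  \<open>A \<rightarrow> residue_field A\<close> is evaluating its reduction.
\<close>
definition henselian_local_ring :: "('a, 'm) ring_scheme \<Rightarrow> bool" where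
  "henselian_local_ring A \<longleftrightarrow> noetherian_local_ring A \<and>
     (\<forall>f \<in> carrier (UP A). \<forall>\<alpha> \<in> carrier (residue_field A).
        coeff (UP A) f (deg A f) = \<one>\<^bsub>A\<^esub> \<and>
        eval A (residue_field A) (\<lambda>r. max_ideal A +>\<^bsub>A\<^esub> r) \<alpha> f = \<zero>\<^bsub>residue_field A\<^esub> \<and>
        eval A (residue_field A) (\<lambda>r. max_ideal A +>\<^bsub>A\<^esub> r) \<alpha> (poly_deriv A f)
          \<noteq> \<zero>\<^bsub>residue_field A\<^esub> \<longrightarrow>
        (\<exists>a \<in> carrier A. eval A A id a f = \<zero>\<^bsub>A\<^esub> \<and> max_ideal A +>\<^bsub>A\<^esub> a = \<alpha>))"

definition prime_chain :: "('a, 'm) ring_scheme \<Rightarrow> (nat \<Rightarrow> 'a set) \<Rightarrow> nat \<Rightarrow> bool" where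
  "prime_chain A P n \<longleftrightarrow> (\<forall>i\<le>n. primeideal (P i) A) \<and> (\<forall>i<n. P i \<subset> P (Suc i))"

definition krull_dim :: "('a, 'm) ring_scheme \<Rightarrow> enat" where
  "krull_dim A = Sup {enat n |n. \<exists>P. prime_chain A P n}"

text \<open>
  Each \<open>xs ! i\<close> is a nonzerodivisor on the quotient of \<open>A\<close> by the preceding elements, expressed
  in \<open>A\<close>.
\<close>
definition regular_sequence :: "('a, 'm) ring_scheme \<Rightarrow> 'a list \<Rightarrow> bool" where
  "regular_sequence A xs \<longleftrightarrow>
     set xs \<subseteq> carrier A \<and> genideal A (set xs) \<noteq> carrier A \<and>
     (\<forall>i<length xs. \<forall>a\<in>carrier A.
        (xs ! i) \<otimes>\<^bsub>A\<^esub> a \<in> genideal A (set (take i xs)) \<longrightarrow> a \<in> genideal A (set (take i xs)))"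

definition depth :: "('a, 'm) ring_scheme \<Rightarrow> enat" where
  "depth A = Sup {enat (length xs) |xs. regular_sequence A xs \<and> set xs \<subseteq> max_ideal A}"

definition cohen_macaulay_local_ring :: "('a, 'm) ring_scheme \<Rightarrow> bool" where
  "cohen_macaulay_local_ring A \<longleftrightarrow> noetherian_local_ring A \<and> depth A = krull_dim A"

definition regular_local_ring :: "('a, 'm) ring_scheme \<Rightarrow> bool" where
  "regular_local_ring A \<longleftrightarrow> noetherian_local_ring A \<and>
     (\<exists>G \<subseteq> carrier A. finite G \<and> genideal A G = max_ideal A \<and> enat (card G) = krull_dim A)"

definition regular_ring :: "('a, 'm) ring_scheme \<Rightarrow> bool" where
  "regular_ring A \<longleftrightarrow> cring A \<and> noetherian_ring A \<and>
     (\<forall>P. primeideal P A \<longrightarrow> regular_local_ring (localization_at A P))"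

definition fg_module :: "('a, 'm) ring_scheme \<Rightarrow> ('a, 'b, 'n) module_scheme \<Rightarrow> bool" where
  "fg_module A M \<longleftrightarrow> module A M \<and>
     (\<exists>S \<subseteq> carrier M. finite S \<and> (\<forall>N. submodule N A M \<and> S \<subseteq> N \<longrightarrow> N = carrier M))"

definition fg_algebra ::
  "('a, 'm) ring_scheme \<Rightarrow> ('b, 'n) ring_scheme \<Rightarrow> ('a \<Rightarrow> 'b) \<Rightarrow> bool" where
  "fg_algebra A B \<phi> \<longleftrightarrow> cring A \<and> cring B \<and> \<phi> \<in> ring_hom A B \<and>
     (\<exists>F \<subseteq> carrier B. finite F \<and> generate_ring B (\<phi> ` carrier A \<union> F) = carrier B)"

definition module_of_hom ::
  "('b, 'n) ring_scheme \<Rightarrow> ('a \<Rightarrow> 'b) \<Rightarrow> ('a, 'b) module" where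
  "module_of_hom B \<phi> =
     \<lparr>carrier = carrier B, mult = mult B, one = one B, zero = zero B, add = add B,
      smult = (\<lambda>a b. \<phi> a \<otimes>\<^bsub>B\<^esub> b)\<rparr>"

definition finite_field_extension ::
  "('a, 'm) ring_scheme \<Rightarrow> ('b, 'n) ring_scheme \<Rightarrow> ('a \<Rightarrow> 'b) \<Rightarrow> bool" where
  "finite_field_extension K L \<phi> \<longleftrightarrow>
     field K \<and> field L \<and> \<phi> \<in> ring_hom K L \<and> fg_module K (module_of_hom L \<phi>)"

definition monoid_ring :: "('c, 'm) monoid_scheme \<Rightarrow> ('c \<Rightarrow>\<^sub>0 int) ring" where
  "monoid_ring G =
     \<lparr>carrier = {f. Poly_Mapping.keys f \<subseteq> carrier G},
      mult = (\<lambda>f g. \<Sum>x\<in>Poly_Mapping.keys f. \<Sum>y\<in>Poly_Mapping.keys g.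
                Poly_Mapping.single (x \<otimes>\<^bsub>G\<^esub> y) (Poly_Mapping.lookup f x * Poly_Mapping.lookup g y)),
      one = Poly_Mapping.single \<one>\<^bsub>G\<^esub> 1,
      zero = 0,
      add = (+)\<rparr>"

text \<open>
  For \<open>A\<close>-algebras \<open>B\<close> and \<open>C\<close> (along \<open>\<phi>\<close> and \<open>\<psi>\<close>), \<open>B \<otimes>\<^sub>A C\<close> is the free abelian group on
  \<open>B \<times> C\<close> modulo the bilinearity relations. The free group carries the ring structure of the
  integral monoid ring of the multiplicative monoid \<open>B \<times> C\<close>; the subgroup generated by the
  relations is stable under multiplication, hence equal to the ideal generated by them.
\<close>
definition tensor_relations ::
  "('a, 'm) ring_scheme \<Rightarrow> ('b, 'n) ring_scheme \<Rightarrow> ('a \<Rightarrow> 'b) \<Rightarrow>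
   ('c, 'k) ring_scheme \<Rightarrow> ('a \<Rightarrow> 'c) \<Rightarrow> (('b \<times> 'c) \<Rightarrow>\<^sub>0 int) set" where
  "tensor_relations A B \<phi> C \<psi> =
     (let e = (\<lambda>b c. Poly_Mapping.single (b, c) (1::int)) in
       {e (b \<oplus>\<^bsub>B\<^esub> b') c - e b c - e b' c |b b' c.
          b \<in> carrier B \<and> b' \<in> carrier B \<and> c \<in> carrier C} \<union>
       {e b (c \<oplus>\<^bsub>C\<^esub> c') - e b c - e b c' |b c c'.
          b \<in> carrier B \<and> c \<in> carrier C \<and> c' \<in> carrier C} \<union>
       {e (\<phi> a \<otimes>\<^bsub>B\<^esub> b) c - e b (\<psi> a \<otimes>\<^bsub>C\<^esub> c) |a b c.
          a \<in> carrier A \<and> b \<in> carrier B \<and> c \<in> carrier C})"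

definition tensor_ideal ::
  "('a, 'm) ring_scheme \<Rightarrow> ('b, 'n) ring_scheme \<Rightarrow> ('a \<Rightarrow> 'b) \<Rightarrow>
   ('c, 'k) ring_scheme \<Rightarrow> ('a \<Rightarrow> 'c) \<Rightarrow> (('b \<times> 'c) \<Rightarrow>\<^sub>0 int) set" where
  "tensor_ideal A B \<phi> C \<psi> = genideal (monoid_ring (B \<times>\<times> C)) (tensor_relations A B \<phi> C \<psi>)"

definition tensor_ring ::
  "('a, 'm) ring_scheme \<Rightarrow> ('b, 'n) ring_scheme \<Rightarrow> ('a \<Rightarrow> 'b) \<Rightarrow>
   ('c, 'k) ring_scheme \<Rightarrow> ('a \<Rightarrow> 'c) \<Rightarrow> (('b \<times> 'c) \<Rightarrow>\<^sub>0 int) set ring" where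
  "tensor_ring A B \<phi> C \<psi> = monoid_ring (B \<times>\<times> C) Quot tensor_ideal A B \<phi> C \<psi>"

definition pure_tensor ::
  "('a, 'm) ring_scheme \<Rightarrow> ('b, 'n) ring_scheme \<Rightarrow> ('a \<Rightarrow> 'b) \<Rightarrow>
   ('c, 'k) ring_scheme \<Rightarrow> ('a \<Rightarrow> 'c) \<Rightarrow> 'b \<Rightarrow> 'c \<Rightarrow> (('b \<times> 'c) \<Rightarrow>\<^sub>0 int) set" where
  "pure_tensor A B \<phi> C \<psi> b c =
     tensor_ideal A B \<phi> C \<psi> +>\<^bsub>monoid_ring (B \<times>\<times> C)\<^esub> Poly_Mapping.single (b, c) 1"

text \<open>
  Quantification over algebras or modules of arbitrary type is not possible inside a definition.
  Below it is done over carriers in \<open>'a list\<close>, where \<open>'a\<close> is the element type of the base ring.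
  This loses nothing up to isomorphism: \<open>'a list\<close> is infinite, and finitely generated algebras
  and finitely generated modules over \<open>A\<close> have at most \<open>max |'a| \<aleph>\<^sub>0\<close> elements.
\<close>

definition geometrically_regular ::
  "('a, 'm) ring_scheme \<Rightarrow> ('b, 'n) ring_scheme \<Rightarrow> ('a \<Rightarrow> 'b) \<Rightarrow> bool" where
  "geometrically_regular K B \<phi> \<longleftrightarrow>
     (\<forall>(L :: 'a list ring) \<psi>. finite_field_extension K L \<psi> \<longrightarrow>
        regular_ring (tensor_ring K B \<phi> L \<psi>))"

definition formal_fibre ::
  "('a, 'm) ring_scheme \<Rightarrow> 'a set \<Rightarrow> (((nat \<Rightarrow> 'a set) \<times> ('a \<times> 'a) set set) \<Rightarrow>\<^sub>0 int) set ring" where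
  "formal_fibre A Q =
     tensor_ring A (completion A) (completion_map A) (residue_field_at A Q) (residue_field_at_map A Q)"

definition formal_fibre_map ::
  "('a, 'm) ring_scheme \<Rightarrow> 'a set \<Rightarrow> ('a \<times> 'a) set set \<Rightarrow>
   (((nat \<Rightarrow> 'a set) \<times> ('a \<times> 'a) set set) \<Rightarrow>\<^sub>0 int) set" where
  "formal_fibre_map A Q =
     pure_tensor A (completion A) (completion_map A) (residue_field_at A Q) (residue_field_at_map A Q)
       \<one>\<^bsub>completion A\<^esub>"

definition geometrically_regular_formal_fibres :: "('a, 'm) ring_scheme \<Rightarrow> bool" where
  "geometrically_regular_formal_fibres A \<longleftrightarrow>
     (\<forall>Q. primeideal Q A \<longrightarrow>
        geometrically_regular (residue_field_at A Q) (formal_fibre A Q) (formal_fibre_map A Q))"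

text \<open>
  A G-ring asks for \<open>A_P \<rightarrow> completion of A_P\<close> to be a regular homomorphism, that is, flat with
  geometrically regular fibres. Flatness is automatic for noetherian \<open>A\<close>, so, as in EGA IV 7.8.2,
  only the formal fibres are mentioned.
\<close>
definition G_ring :: "('a, 'm) ring_scheme \<Rightarrow> bool" where
  "G_ring A \<longleftrightarrow> cring A \<and> noetherian_ring A \<and>
     (\<forall>P. primeideal P A \<longrightarrow> geometrically_regular_formal_fibres (localization_at A P))"

text \<open>Open in the Zariski topology: the complement of the closed set of primes containing \<open>I\<close>.\<close>
definition J1_ring :: "('a, 'm) ring_scheme \<Rightarrow> bool" where
  "J1_ring A \<longleftrightarrow>
     (\<exists>I. ideal I A \<and>
        {P. primeideal P A \<and> regular_local_ring (localization_at A P)} =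
        {P. primeideal P A \<and> \<not> I \<subseteq> P})"

definition J2_ring :: "('a, 'm) ring_scheme \<Rightarrow> bool" where
  "J2_ring A \<longleftrightarrow> (\<forall>(B :: 'a list ring) \<phi>. fg_algebra A B \<phi> \<longrightarrow> J1_ring B)"

definition saturated_prime_chain :: "('a, 'm) ring_scheme \<Rightarrow> (nat \<Rightarrow> 'a set) \<Rightarrow> nat \<Rightarrow> bool" where
  "saturated_prime_chain A P n \<longleftrightarrow> prime_chain A P n \<and>
     (\<forall>i<n. \<not> (\<exists>Q. primeideal Q A \<and> P i \<subset> Q \<and> Q \<subset> P (Suc i)))"

definition catenary_ring :: "('a, 'm) ring_scheme \<Rightarrow> bool" where
  "catenary_ring A \<longleftrightarrow>
     (\<forall>p q. primeideal p A \<and> primeideal q A \<and> p \<subseteq> q \<longrightarrow>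
        (\<exists>N. \<forall>P n. prime_chain A P n \<and> P 0 = p \<and> P n = q \<longrightarrow> n \<le> N) \<and>
        (\<forall>P n P' n'.
           saturated_prime_chain A P n \<and> P 0 = p \<and> P n = q \<and>
           saturated_prime_chain A P' n' \<and> P' 0 = p \<and> P' n' = q \<longrightarrow> n = n'))"

definition universally_catenary_ring :: "('a, 'm) ring_scheme \<Rightarrow> bool" where
  "universally_catenary_ring A \<longleftrightarrow>
     (\<forall>(B :: 'a list ring) \<phi>. fg_algebra A B \<phi> \<longrightarrow> catenary_ring B)"

definition excellent_ring :: "('a, 'm) ring_scheme \<Rightarrow> bool" where
  "excellent_ring A \<longleftrightarrow> cring A \<and> noetherian_ring A \<and>
     universally_catenary_ring A \<and> G_ring A \<and> J2_ring A"

text \<open>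
  The type of module records has multiplicative fields \<open>mult\<close> and \<open>one\<close>, which the theory of
  modules never uses; they are left \<open>undefined\<close> below.
\<close>

definition lin_maps ::
  "('a, 'm) ring_scheme \<Rightarrow> ('a, 'b, 'n) module_scheme \<Rightarrow> ('a, 'c, 'k) module_scheme \<Rightarrow> ('b \<Rightarrow> 'c) set"
  where
  "lin_maps A M N = {h \<in> carrier M \<rightarrow>\<^sub>E carrier N.
     (\<forall>x\<in>carrier M. \<forall>y\<in>carrier M. h (x \<oplus>\<^bsub>M\<^esub> y) = h x \<oplus>\<^bsub>N\<^esub> h y) \<and>
     (\<forall>a\<in>carrier A. \<forall>x\<in>carrier M. h (a \<odot>\<^bsub>M\<^esub> x) = a \<odot>\<^bsub>N\<^esub> h x)}"

definition Hom_module ::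
  "('a, 'm) ring_scheme \<Rightarrow> ('a, 'b, 'n) module_scheme \<Rightarrow> ('a, 'c, 'k) module_scheme \<Rightarrow>
   ('a, 'b \<Rightarrow> 'c) module" where
  "Hom_module A M N =
     \<lparr>carrier = lin_maps A M N, mult = undefined, one = undefined,
      zero = (\<lambda>x\<in>carrier M. \<zero>\<^bsub>N\<^esub>),
      add = (\<lambda>f g. \<lambda>x\<in>carrier M. f x \<oplus>\<^bsub>N\<^esub> g x),
      smult = (\<lambda>a f. \<lambda>x\<in>carrier M. a \<odot>\<^bsub>N\<^esub> f x)\<rparr>"

definition free_module :: "('a, 'm) ring_scheme \<Rightarrow> nat \<Rightarrow> ('a, nat \<Rightarrow> 'a) module" where
  "free_module A n =
     \<lparr>carrier = {..<n} \<rightarrow>\<^sub>E carrier A, mult = undefined, one = undefined,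
      zero = (\<lambda>i\<in>{..<n}. \<zero>\<^bsub>A\<^esub>),
      add = (\<lambda>v w. \<lambda>i\<in>{..<n}. v i \<oplus>\<^bsub>A\<^esub> w i),
      smult = (\<lambda>a v. \<lambda>i\<in>{..<n}. a \<otimes>\<^bsub>A\<^esub> v i)\<rparr>"

definition quotient_module :: "('a, 'b, 'n) module_scheme \<Rightarrow> 'b set \<Rightarrow> ('a, 'b set) module" where
  "quotient_module M N =
     \<lparr>carrier = a_rcosets\<^bsub>M\<^esub> N, mult = undefined, one = undefined,
      zero = N,
      add = set_add M,
      smult = (\<lambda>a U. \<Union>x\<in>U. N +>\<^bsub>M\<^esub> (a \<odot>\<^bsub>M\<^esub> x))\<rparr>"

record ('a, 'b) resolution =
  rank :: "nat \<Rightarrow> nat"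
  differential :: "nat \<Rightarrow> (nat \<Rightarrow> 'a) \<Rightarrow> (nat \<Rightarrow> 'a)"
  augmentation :: "(nat \<Rightarrow> 'a) \<Rightarrow> 'b"

abbreviation res_module ::
  "('a, 'm) ring_scheme \<Rightarrow> ('a, 'b) resolution \<Rightarrow> nat \<Rightarrow> ('a, nat \<Rightarrow> 'a) module" where
  "res_module A F i \<equiv> free_module A (rank F i)"

text \<open>\<open>differential F i\<close> goes from degree \<open>i + 1\<close> to degree \<open>i\<close>.\<close>
definition free_resolution ::
  "('a, 'm) ring_scheme \<Rightarrow> ('a, 'b, 'n) module_scheme \<Rightarrow> ('a, 'b) resolution \<Rightarrow> bool" where
  "free_resolution A M F \<longleftrightarrow>
     augmentation F \<in> lin_maps A (res_module A F 0) M \<and>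
     augmentation F ` carrier (res_module A F 0) = carrier M \<and>
     (\<forall>i. differential F i \<in> lin_maps A (res_module A F (Suc i)) (res_module A F i)) \<and>
     differential F 0 ` carrier (res_module A F 1) =
       {v \<in> carrier (res_module A F 0). augmentation F v = \<zero>\<^bsub>M\<^esub>} \<and>
     (\<forall>i. differential F (Suc i) ` carrier (res_module A F (Suc (Suc i))) =
       {v \<in> carrier (res_module A F (Suc i)).
          differential F i v = \<zero>\<^bsub>res_module A F i\<^esub>})"

definition coboundary_map ::
  "('a, 'm) ring_scheme \<Rightarrow> ('a, 'b) resolution \<Rightarrow> nat \<Rightarrow>
   ((nat \<Rightarrow> 'a) \<Rightarrow> 'c) \<Rightarrow> ((nat \<Rightarrow> 'a) \<Rightarrow> 'c)" where
  "coboundary_map A F i h = (\<lambda>v\<in>carrier (res_module A F (Suc i)). h (differential F i v))"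

definition cocycles ::
  "('a, 'm) ring_scheme \<Rightarrow> ('a, 'b) resolution \<Rightarrow> ('a, 'c, 'k) module_scheme \<Rightarrow> nat \<Rightarrow>
   ((nat \<Rightarrow> 'a) \<Rightarrow> 'c) set" where
  "cocycles A F N i = {h \<in> carrier (Hom_module A (res_module A F i) N).
     coboundary_map A F i h = \<zero>\<^bsub>Hom_module A (res_module A F (Suc i)) N\<^esub>}"

primrec coboundaries ::
  "('a, 'm) ring_scheme \<Rightarrow> ('a, 'b) resolution \<Rightarrow> ('a, 'c, 'k) module_scheme \<Rightarrow> nat \<Rightarrow>
   ((nat \<Rightarrow> 'a) \<Rightarrow> 'c) set" where
  "coboundaries A F N 0 = {\<zero>\<^bsub>Hom_module A (res_module A F 0) N\<^esub>}"
| "coboundaries A F N (Suc i) = coboundary_map A F i ` carrier (Hom_module A (res_module A F i) N)"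

text \<open>
  Finitely generated modules over a noetherian ring have resolutions by free modules of finite
  rank, and \<open>Ext\<close> does not depend on the resolution up to isomorphism. One is chosen.
\<close>
definition Ext ::
  "('a, 'm) ring_scheme \<Rightarrow> nat \<Rightarrow> ('a, 'b, 'n) module_scheme \<Rightarrow> ('a, 'c, 'k) module_scheme \<Rightarrow>
   ('a, ((nat \<Rightarrow> 'a) \<Rightarrow> 'c) set) module" where
  "Ext A i M N =
     (let F = (SOME F. free_resolution A M F) in
       quotient_module ((Hom_module A (res_module A F i) N)\<lparr>carrier := cocycles A F N i\<rparr>)
         (coboundaries A F N i))"

definition Ext_vanishes ::
  "('a, 'm) ring_scheme \<Rightarrow> nat \<Rightarrow> ('a, 'b, 'n) module_scheme \<Rightarrow> ('a, 'c, 'k) module_scheme \<Rightarrow> bool"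
  where
  "Ext_vanishes A i M N \<longleftrightarrow> carrier (Ext A i M N) = {\<zero>\<^bsub>Ext A i M N\<^esub>}"

definition auslander_condition :: "('a, 'm) ring_scheme \<Rightarrow> bool" where
  "auslander_condition A \<longleftrightarrow>
     (\<forall>M :: ('a, 'a list) module. fg_module A M \<longrightarrow>
        (\<exists>b :: int. \<forall>N :: ('a, 'a list) module. fg_module A N \<longrightarrow>
           (\<exists>n. \<forall>i\<ge>n. Ext_vanishes A i M N) \<longrightarrow>
           (\<forall>i. int i > b \<longrightarrow> Ext_vanishes A i M N)))"

definition uniform_auslander_condition :: "('a, 'm) ring_scheme \<Rightarrow> bool" where
  "uniform_auslander_condition A \<longleftrightarrow>
     (\<exists>b :: int. b \<ge> 0 \<and>
        (\<forall>(M :: ('a, 'a list) module) (N :: ('a, 'a list) module).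
           fg_module A M \<longrightarrow> fg_module A N \<longrightarrow>
           (\<exists>n. \<forall>i\<ge>n. Ext_vanishes A i M N) \<longrightarrow>
           (\<forall>i. int i > b \<longrightarrow> Ext_vanishes A i M N)))"

end

theory Submission
  imports Defs "HOL-Library.Function_Algebras"
begin

text \<open>
  Let \<open>R\<close> be Cohen--Macaulay with residue field \<open>k\<close> and let \<open>x = (x\<^sub>1, ..., x\<^sub>d)\<close> be a regular
  sequence whose length is the dimension of \<open>R\<close>. Then \<open>Q = R/(x)\<close> is artinian, so a power of the maximal ideal
  lies in \<open>(x)\<close> and \<open>Q\<close> is also the quotient of the completion \<open>S\<close> of \<open>R\<close> by \<open>(x)\<close>; moreover \<open>x\<close> is
  a regular sequence in \<open>S\<close>. The bounds on the vanishing of Ext are first moved from \<open>R\<close> down to \<open>Q\<close>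
  and then from \<open>Q\<close> up to \<open>S\<close>.

  Descent (\<open>bounded_at_descent_list\<close>). Let \<open>x\<close> be a regular element of a ring \<open>A\<close> and let \<open>D\<close> be a
  matrix lift to \<open>A\<close> of a free resolution over \<open>A/x\<close>. The product of two consecutive matrices is \<open>x H\<close>, and
  \<open>D\<close>, \<open>x\<close> and \<open>H\<close> combine into a free resolution \<open>G\<close> over \<open>A\<close> of the same module (Eisenbud). For a
  module \<open>Z\<close> over \<open>A/x\<close>, the cohomology of \<open>Hom(G, Z)\<close> and that of \<open>Hom(D, Z)\<close> are related by a long
  exact sequence with period 2, so a bound for \<open>G\<close> is a bound for \<open>D\<close>.

  Ascent (\<open>bounded_at_ascent\<close>). Let \<open>D\<close> be a free resolution over \<open>S\<close>, let \<open>V\<close> be a finitely generated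
  \<open>S\<close>-module and \<open>F\<close> a free resolution of \<open>V\<close>. The cohomology of \<open>Hom(D, V)\<close> is that of \<open>Hom(D, F)\<close>,
  and its vanishing passes to \<open>Hom(D/x, F/x)\<close>, and back because \<open>S\<close> is complete along \<open>x\<close>. Over
  \<open>Q\<close> the complex \<open>F/x\<close> is exact from degree \<open>d\<close> on and may be truncated to a complex of \<open>d + 1\<close> modules.
  An artinian ring has enough finitely generated injectives: embedding the top module in one and forming a
  pushout shortens the truncated complex by one without changing the cohomology above degree \<open>d\<close>. What remains
  is a single module \<open>Z\<close> over \<open>Q\<close>, to which the bound over \<open>Q\<close> applies; \<open>D/x\<close> is a resolution from
  degree \<open>d\<close> on, and the bound for \<open>D\<close> is larger by \<open>d\<close>.

  Existence of \<open>x\<close> (\<open>maximal_regular_sequence\<close>). Universal catenarity bounds the chains between two given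
  primes, and a noetherian ring has finitely many minimal primes; so the dimension is finite, the depth is
  attained by a regular sequence, and its length is the dimension. The quotient is artinian since a prime over it
  other than the maximal ideal would give a chain of primes that is too long (\<open>prime_over_maximal_regular_sequence\<close>).

  Completion (\<open>completion_properties\<close>). That \<open>x\<close> stays regular in \<open>S\<close> and that \<open>S\<close> is noetherian is
  derived from a weak Artin--Rees property of regular sequences and from completeness.

  All rings are represented as quotients of one polynomial ring over the integers, which maps onto \<open>R\<close> and onto
  \<open>S\<close>. An \<open>R\<close>-module is a submodule of relations on vectors over this polynomial ring, and resolutions are
  sequences of matrices with exactness \<^emph>\<open>modulo\<close> an ideal. Then \<open>R\<close>, \<open>S\<close> and \<open>Q\<close> differ only in that
  ideal, and \<open>Ext_vanishes_iff_hom_exact\<close> gives the translation to Ext.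
\<close>

section \<open>Families of maps between two complexes\<close>

text \<open>
  For two complexes with differentials inducing \<open>d\<close> and \<open>e\<close> on maps between their
  terms, \<open>\<phi> i\<close> stands for a map from degree \<open>m + 1 + i\<close> of the first to degree
  \<open>i\<close> of the second. A cyclic family is a chain map from the first complex, shifted, to the second,
  and a null family is a null-homotopic one; equations hold modulo the subgroups \<open>N\<close>. Both
  differentials commute with each other, so that no signs occur.
\<close>
definition cyclic_family ::
  "(nat \<Rightarrow> 'g \<Rightarrow> 'g) \<Rightarrow> (nat \<Rightarrow> 'g \<Rightarrow> 'g) \<Rightarrow> (nat \<Rightarrow> nat \<Rightarrow> 'g set) \<Rightarrow> nat \<Rightarrow> (nat \<Rightarrow> 'g::ab_group_add) \<Rightarrow> bool" where
  "cyclic_family d e N m \<phi> \<longleftrightarrow>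
     (\<forall>i. d (Suc (m + i)) (\<phi> i) - e i (\<phi> (Suc i)) \<in> N (Suc (Suc (m + i))) i)"

definition null_family ::
  "(nat \<Rightarrow> 'g \<Rightarrow> 'g) \<Rightarrow> (nat \<Rightarrow> 'g \<Rightarrow> 'g) \<Rightarrow> (nat \<Rightarrow> nat \<Rightarrow> 'g set) \<Rightarrow> nat \<Rightarrow> (nat \<Rightarrow> 'g::ab_group_add) \<Rightarrow> bool" where
  "null_family d e N m \<phi> \<longleftrightarrow>
     (\<exists>s. \<forall>i. \<phi> i - d (m + i) (s i) - e i (s (Suc i)) \<in> N (Suc (m + i)) i)"

definition acyclic_at ::
  "(nat \<Rightarrow> 'g \<Rightarrow> 'g) \<Rightarrow> (nat \<Rightarrow> 'g \<Rightarrow> 'g) \<Rightarrow> (nat \<Rightarrow> nat \<Rightarrow> 'g::ab_group_add set) \<Rightarrow> nat \<Rightarrow> bool" where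
  "acyclic_at d e N m \<longleftrightarrow> (\<forall>\<phi>. cyclic_family d e N m \<phi> \<longrightarrow> null_family d e N m \<phi>)"

text \<open>The same notions for a second complex that stops in degree \<open>j\<close>.\<close>
definition trunc_cyclic ::
  "(nat \<Rightarrow> 'g \<Rightarrow> 'g) \<Rightarrow> (nat \<Rightarrow> 'g \<Rightarrow> 'g) \<Rightarrow> (nat \<Rightarrow> nat \<Rightarrow> 'g set) \<Rightarrow> nat \<Rightarrow> nat \<Rightarrow> (nat \<Rightarrow> 'g::ab_group_add) \<Rightarrow> bool" where
  "trunc_cyclic d e N j m \<phi> \<longleftrightarrow>
     (\<forall>i<j. d (Suc (m + i)) (\<phi> i) - e i (\<phi> (Suc i)) \<in> N (Suc (Suc (m + i))) i) \<and>
     d (Suc (m + j)) (\<phi> j) \<in> N (Suc (Suc (m + j))) j"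

definition trunc_null ::
  "(nat \<Rightarrow> 'g \<Rightarrow> 'g) \<Rightarrow> (nat \<Rightarrow> 'g \<Rightarrow> 'g) \<Rightarrow> (nat \<Rightarrow> nat \<Rightarrow> 'g set) \<Rightarrow> nat \<Rightarrow> nat \<Rightarrow> (nat \<Rightarrow> 'g::ab_group_add) \<Rightarrow> bool" where
  "trunc_null d e N j m \<phi> \<longleftrightarrow>
     (\<exists>s. (\<forall>i<j. \<phi> i - d (m + i) (s i) - e i (s (Suc i)) \<in> N (Suc (m + i)) i) \<and>
          \<phi> j - d (m + j) (s j) \<in> N (Suc (m + j)) j)"

definition trunc_acyclic_at ::
  "(nat \<Rightarrow> 'g \<Rightarrow> 'g) \<Rightarrow> (nat \<Rightarrow> 'g \<Rightarrow> 'g) \<Rightarrow> (nat \<Rightarrow> nat \<Rightarrow> 'g::ab_group_add set) \<Rightarrow> nat \<Rightarrow> nat \<Rightarrow> bool" where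
  "trunc_acyclic_at d e N j m \<longleftrightarrow> (\<forall>\<phi>. trunc_cyclic d e N j m \<phi> \<longrightarrow> trunc_null d e N j m \<phi>)"

text \<open>
  Truncating a complex in degree \<open>j\<close> replaces its term there by the cokernel of the incoming
  differential.
\<close>
definition top_cokernel ::
  "(nat \<Rightarrow> 'g \<Rightarrow> 'g) \<Rightarrow> (nat \<Rightarrow> nat \<Rightarrow> 'g::ab_group_add set) \<Rightarrow> nat \<Rightarrow> nat \<Rightarrow> nat \<Rightarrow> 'g set" where
  "top_cokernel e N j k i = (if i = j then {x. \<exists>y. x - e j y \<in> N k j} else N k i)"

locale double_complex =
  fixes d e :: "nat \<Rightarrow> 'g::ab_group_add \<Rightarrow> 'g" and N :: "nat \<Rightarrow> nat \<Rightarrow> 'g set"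
  assumes d_add: "d k (x + y) = d k x + d k y"
    and e_add: "e i (x + y) = e i x + e i y"
    and N0: "0 \<in> N k i"
    and N_diff: "x \<in> N k i \<Longrightarrow> y \<in> N k i \<Longrightarrow> x - y \<in> N k i"
    and dN: "x \<in> N k i \<Longrightarrow> d k x \<in> N (Suc k) i"
    and eN: "x \<in> N k (Suc i) \<Longrightarrow> e i x \<in> N k i"
    and de: "d k (e i x) = e i (d k x)"
    and dd: "d (Suc k) (d k x) \<in> N (Suc (Suc k)) i"
    and ee: "e i (e (Suc i) x) \<in> N k i"
begin

lemma d_zero [simp]: "d k 0 = 0"
  using d_add[of k 0 0] by simp

lemma e_zero [simp]: "e i 0 = 0"
  using e_add[of i 0 0] by simp

lemma d_uminus: "d k (- x) = - d k x"
  using d_add[of k x "- x"] by (simp add: eq_neg_iff_add_eq_0 add.commute)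

lemma e_uminus: "e i (- x) = - e i x"
  using e_add[of i x "- x"] by (simp add: eq_neg_iff_add_eq_0 add.commute)

lemma d_diff: "d k (x - y) = d k x - d k y"
  using d_add[of k x "- y"] by (simp add: d_uminus)

lemma e_diff: "e i (x - y) = e i x - e i y"
  using e_add[of i x "- y"] by (simp add: e_uminus)

lemma N_uminus: "x \<in> N k i \<Longrightarrow> - x \<in> N k i"
  using N_diff[OF N0, of x] by simp

lemma N_add: "x \<in> N k i \<Longrightarrow> y \<in> N k i \<Longrightarrow> x + y \<in> N k i"
  using N_diff[of x k i "- y"] N_uminus by simp

text \<open>
  An exact tail of the second complex does not affect acyclicity: beyond degree \<open>j\<close> the components
  of a family, and of a homotopy, can be chosen one after the other by exactness.
\<close>
lemma trunc_acyclic_iff: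
  assumes exact: "\<And>k i h. j \<le> i \<Longrightarrow> e i h \<in> N k i \<Longrightarrow> \<exists>g. h - e (Suc i) g \<in> N k (Suc i)"
  shows "trunc_acyclic_at d e (top_cokernel e N j) j m \<longleftrightarrow> acyclic_at d e N m"
proof
  assume ac: "trunc_acyclic_at d e (top_cokernel e N j) j m"
  show "acyclic_at d e N m"
    unfolding acyclic_at_def
  proof (intro allI impI)
    fix \<phi> assume cyc: "cyclic_family d e N m \<phi>"
    have cyc': "d (Suc (m + i)) (\<phi> i) - e i (\<phi> (Suc i)) \<in> N (Suc (Suc (m + i))) i" for i
      using cyc by (auto simp: cyclic_family_def)
    have "\<exists>y. d (Suc (m + j)) (\<phi> j) - e j y \<in> N (Suc (Suc (m + j))) j"
      using cyc'[of j] by blast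
    then have "trunc_cyclic d e (top_cokernel e N j) j m \<phi>"
      unfolding trunc_cyclic_def top_cokernel_def using cyc' by simp
    obtain s where s: "\<And>i. i < j \<Longrightarrow> \<phi> i - d (m + i) (s i) - e i (s (Suc i)) \<in> N (Suc (m + i)) i"
      and sj: "\<phi> j - d (m + j) (s j) \<in> top_cokernel e N j (Suc (m + j)) j"
    proof -
      obtain s where s: "\<And>i. i < j \<Longrightarrow> \<phi> i - d (m + i) (s i) - e i (s (Suc i)) \<in> top_cokernel e N j (Suc (m + i)) i"
        "\<phi> j - d (m + j) (s j) \<in> top_cokernel e N j (Suc (m + j)) j"
        using ac \<open>trunc_cyclic d e (top_cokernel e N j) j m \<phi>\<close>
        unfolding trunc_acyclic_at_def trunc_null_def by blast
      show ?thesis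
        by (rule that[of s]) (use s in \<open>auto simp: top_cokernel_def split: if_splits\<close>)
    qed
    then obtain y0 where y0: "\<phi> j - d (m + j) (s j) - e j y0 \<in> N (Suc (m + j)) j"
      by (auto simp: top_cokernel_def)
    have step: "\<exists>y'. \<phi> (Suc i) - d (Suc (m + i)) y - e (Suc i) y' \<in> N (Suc (Suc (m + i))) (Suc i)"
      if i: "j \<le> i" and y: "\<phi> i - d (m + i) x - e i y \<in> N (Suc (m + i)) i" for i x y
    proof -
      have "d (Suc (m + i)) (\<phi> i - d (m + i) x - e i y) \<in> N (Suc (Suc (m + i))) i"
        by (rule dN[OF y])
      from N_diff[OF N_add[OF this dd[of "m + i" x]] cyc'[of i]]
      have "e i (\<phi> (Suc i) - d (Suc (m + i)) y) \<in> N (Suc (Suc (m + i))) i"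
        by (simp add: d_diff d_add e_diff de algebra_simps)
      from exact[OF i this] show ?thesis .
    qed
    define P where "P n y \<longleftrightarrow> (n = 0 \<longrightarrow> y = y0) \<and> (\<exists>x. \<phi> (j + n) - d (m + (j + n)) x - e (j + n) y \<in> N (Suc (m + (j + n))) (j + n))" for n y
    define Q where "Q n y y' \<longleftrightarrow> \<phi> (Suc (j + n)) - d (Suc (m + (j + n))) y - e (Suc (j + n)) y' \<in> N (Suc (Suc (m + (j + n)))) (Suc (j + n))" for n y y'
    have "\<exists>f. \<forall>n. P n (f n) \<and> Q n (f n) (f (Suc n))"
    proof (rule dependent_nat_choice)
      show "\<exists>x. P 0 x" using y0 by (auto simp: P_def)
    next
      fix y n assume "P n y"
      then obtain x where "\<phi> (j + n) - d (m + (j + n)) x - e (j + n) y \<in> N (Suc (m + (j + n))) (j + n)"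
        by (auto simp: P_def)
      from step[OF _ this] obtain y' where "Q n y y'" by (auto simp: Q_def)
      then show "\<exists>y'. P (Suc n) y' \<and> Q n y y'"
        by (auto simp: P_def Q_def)
    qed
    then obtain f where f: "\<And>n. P n (f n)" "\<And>n. Q n (f n) (f (Suc n))" by blast
    have f0: "f 0 = y0" using f(1)[of 0] by (simp add: P_def)
    define t where "t i = (if i \<le> j then s i else f (i - Suc j))" for i
    have "\<phi> i - d (m + i) (t i) - e i (t (Suc i)) \<in> N (Suc (m + i)) i" for i
    proof (cases "i < j")
      case True then show ?thesis using s by (simp add: t_def)
    next
      case False
      show ?thesis
      proof (cases "i = j")
        case True then show ?thesis using y0 f0 by (simp add: t_def)
      next
        case f1: False
        define n where "n = i - Suc j"
        have i: "i = Suc (j + n)" using False f1 by (simp add: n_def)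
        show ?thesis using f(2)[of n] by (simp add: t_def i Q_def)
      qed
    qed
    then show "null_family d e N m \<phi>" unfolding null_family_def by blast
  qed
next
  assume ac: "acyclic_at d e N m"
  show "trunc_acyclic_at d e (top_cokernel e N j) j m"
    unfolding trunc_acyclic_at_def
  proof (intro allI impI)
    fix \<phi> assume cyc: "trunc_cyclic d e (top_cokernel e N j) j m \<phi>"
    have c1: "\<And>i. i < j \<Longrightarrow> d (Suc (m + i)) (\<phi> i) - e i (\<phi> (Suc i)) \<in> N (Suc (Suc (m + i))) i"
      and "d (Suc (m + j)) (\<phi> j) \<in> top_cokernel e N j (Suc (Suc (m + j))) j"
      using cyc by (auto simp: trunc_cyclic_def top_cokernel_def)
    then obtain z where z: "d (Suc (m + j)) (\<phi> j) - e j z \<in> N (Suc (Suc (m + j))) j"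
      by (auto simp: top_cokernel_def)
    define P where "P n y \<longleftrightarrow> (n = 0 \<longrightarrow> y = \<phi> j) \<and>
      (\<exists>z. d (Suc (m + (j + n))) y - e (j + n) z \<in> N (Suc (Suc (m + (j + n)))) (j + n))" for n y
    define Q where "Q n y z \<longleftrightarrow> d (Suc (m + (j + n))) y - e (j + n) z \<in> N (Suc (Suc (m + (j + n)))) (j + n)" for n y z
    have "\<exists>f. \<forall>n. P n (f n) \<and> Q n (f n) (f (Suc n))"
    proof (rule dependent_nat_choice)
      show "\<exists>x. P 0 x" using z by (auto simp: P_def)
    next
      fix y n assume "P n y"
      then obtain z where z: "Q n y z"
        by (auto simp: P_def Q_def)
      let ?k = "Suc (m + (j + n))" and ?i = "j + n"
      have "d (Suc ?k) (d ?k y - e ?i z) \<in> N (Suc (Suc ?k)) ?i"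
        using z dN unfolding Q_def by blast
      then have "d (Suc ?k) (d ?k y) - (d (Suc ?k) (d ?k y - e ?i z)) \<in> N (Suc (Suc ?k)) ?i"
        using N_diff dd by blast
      then have "e ?i (d (Suc ?k) z) \<in> N (Suc (Suc ?k)) ?i" by (simp add: d_diff de)
      from exact[OF _ this] obtain z' where
        "d (Suc ?k) z - e (Suc ?i) z' \<in> N (Suc (Suc ?k)) (Suc ?i)" by auto
      then show "\<exists>y'. P (Suc n) y' \<and> Q n y y'"
        using z by (auto simp: P_def)
    qed
    then obtain f where f: "\<And>n. P n (f n)" "\<And>n. Q n (f n) (f (Suc n))" by blast
    have f0: "f 0 = \<phi> j" using f(1)[of 0] by (simp add: P_def)
    define t where "t i = (if i < j then \<phi> i else f (i - j))" for i
    have tphi: "t i = \<phi> i" if "i \<le> j" for i using that f0 by (auto simp: t_def)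
    have "d (Suc (m + i)) (t i) - e i (t (Suc i)) \<in> N (Suc (Suc (m + i))) i" for i
    proof (cases "i < j")
      case True then show ?thesis using c1 tphi by simp
    next
      case False
      define n where "n = i - j"
      have i: "i = j + n" using False by (simp add: n_def)
      show ?thesis using f(2)[of n] by (simp add: t_def i Q_def)
    qed
    then have "null_family d e N m t" using ac by (auto simp: acyclic_at_def cyclic_family_def)
    then obtain s where s: "\<And>i. t i - d (m + i) (s i) - e i (s (Suc i)) \<in> N (Suc (m + i)) i"
      by (auto simp: null_family_def)
    show "trunc_null d e (top_cokernel e N j) j m \<phi>"
      unfolding trunc_null_def
    proof (intro exI[of _ s] conjI allI impI)
      fix i assume "i < j"
      then show "\<phi> i - d (m + i) (s i) - e i (s (Suc i)) \<in> top_cokernel e N j (Suc (m + i)) i"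
        using s[of i] tphi[of i] by (simp add: top_cokernel_def)
    next
      show "\<phi> j - d (m + j) (s j) \<in> top_cokernel e N j (Suc (m + j)) j"
        using s[of j] tphi[of j] by (auto simp: top_cokernel_def)
    qed
  qed
qed

end

locale double_complex_mult = double_complex d e N
  for d e :: "nat \<Rightarrow> 'g::ab_group_add \<Rightarrow> 'g" and N :: "nat \<Rightarrow> nat \<Rightarrow> 'g set" +
  fixes mul :: "'g \<Rightarrow> 'g"
  assumes mul_add: "mul (x + y) = mul x + mul y"
    and mul_d: "mul (d k x) = d k (mul x)"
    and mul_e: "mul (e i x) = e i (mul x)"
    and mulN: "x \<in> N k i \<Longrightarrow> mul x \<in> N k i"
    and mul_regular: "mul x \<in> N k i \<Longrightarrow> x \<in> N k i"
begin

definition "Nmod k i = {h. \<exists>g. h - mul g \<in> N k i}"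

lemma mul_zero [simp]: "mul 0 = 0"
  using mul_add[of 0 0] by simp

lemma mul_uminus: "mul (- x) = - mul x"
  using mul_add[of x "- x"] by (simp add: eq_neg_iff_add_eq_0 add.commute)

lemma mul_diff: "mul (x - y) = mul x - mul y"
  using mul_add[of x "- y"] by (simp add: mul_uminus)

text \<open>
  The long exact sequence for multiplication by a regular element: a family that is cyclic modulo
  \<open>mul\<close> has a boundary \<open>mul \<psi>\<close> with \<open>\<psi>\<close> cyclic in the next
  degree; a homotopy for \<open>\<psi>\<close> corrects the family to a cyclic one.
\<close>
lemma acyclic_mod:
  assumes a: "acyclic_at d e N m" "acyclic_at d e N (Suc m)"
  shows "acyclic_at d e Nmod m"
  unfolding acyclic_at_def
proof (intro allI impI)
  fix \<phi> assume "cyclic_family d e Nmod m \<phi>"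
  then have "\<forall>i. \<exists>g. d (Suc (m + i)) (\<phi> i) - e i (\<phi> (Suc i)) - mul g \<in> N (Suc (Suc (m + i))) i"
    by (auto simp: cyclic_family_def Nmod_def)
  then obtain \<psi> where \<psi>: "\<And>i. d (Suc (m + i)) (\<phi> i) - e i (\<phi> (Suc i)) - mul (\<psi> i) \<in> N (Suc (Suc (m + i))) i"
    by metis
  define sg where "sg i x = (if even i then x else - x)" for i :: nat and x :: 'g
  have sgN: "sg i x \<in> N k l \<longleftrightarrow> x \<in> N k l" for i x k l
    using N_uminus[of x k l] N_uminus[of "- x" k l] by (auto simp: sg_def)
  have anti: "d (Suc (Suc (m + i))) (\<psi> i) + e i (\<psi> (Suc i)) \<in> N (Suc (Suc (Suc (m + i)))) i" for i
  proof -
    let ?k = "Suc (m + i)"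
    have 1: "d (Suc ?k) (d ?k (\<phi> i) - e i (\<phi> (Suc i)) - mul (\<psi> i)) \<in> N (Suc (Suc ?k)) i"
      by (rule dN[OF \<psi>])
    have 2: "e i (d (Suc ?k) (\<phi> (Suc i)) - e (Suc i) (\<phi> (Suc (Suc i))) - mul (\<psi> (Suc i))) \<in> N (Suc (Suc ?k)) i"
      using eN[OF \<psi>[of "Suc i"]] by simp
    have eq: "mul (d (Suc ?k) (\<psi> i) + e i (\<psi> (Suc i))) =
        d (Suc ?k) (d ?k (\<phi> i)) - e i (e (Suc i) (\<phi> (Suc (Suc i))))
        - d (Suc ?k) (d ?k (\<phi> i) - e i (\<phi> (Suc i)) - mul (\<psi> i))
        - e i (d (Suc ?k) (\<phi> (Suc i)) - e (Suc i) (\<phi> (Suc (Suc i))) - mul (\<psi> (Suc i)))"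
      by (simp add: d_diff e_diff de mul_add mul_d mul_e)
    have "mul (d (Suc ?k) (\<psi> i) + e i (\<psi> (Suc i))) \<in> N (Suc (Suc ?k)) i"
      unfolding eq by (intro N_diff dd ee 1 2)
    then show ?thesis by (rule mul_regular)
  qed
  have "cyclic_family d e N (Suc m) (\<lambda>i. sg i (\<psi> i))"
    unfolding cyclic_family_def
  proof
    fix i
    have "d (Suc (Suc m + i)) (sg i (\<psi> i)) - e i (sg (Suc i) (\<psi> (Suc i))) =
       sg i (d (Suc (Suc (m + i))) (\<psi> i) + e i (\<psi> (Suc i)))"
      by (simp add: sg_def d_uminus e_uminus)
    then show "d (Suc (Suc m + i)) (sg i (\<psi> i)) - e i (sg (Suc i) (\<psi> (Suc i))) \<in> N (Suc (Suc (Suc m + i))) i"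
      using anti[of i] sgN by simp
  qed
  then obtain s where s: "\<And>i. sg i (\<psi> i) - d (Suc m + i) (s i) - e i (s (Suc i)) \<in> N (Suc (Suc m + i)) i"
    using a(2) unfolding acyclic_at_def null_family_def by blast
  define s' where "s' i = sg i (s i)" for i
  have s': "\<psi> i - d (Suc m + i) (s' i) + e i (s' (Suc i)) \<in> N (Suc (Suc m + i)) i" for i
  proof -
    have "\<psi> i - d (Suc m + i) (s' i) + e i (s' (Suc i)) = sg i (sg i (\<psi> i) - d (Suc m + i) (s i) - e i (s (Suc i)))"
      by (simp add: s'_def sg_def d_uminus e_uminus)
    then show ?thesis using s[of i] sgN by simp
  qed
  have "cyclic_family d e N m (\<lambda>i. \<phi> i - mul (s' i))"
    unfolding cyclic_family_def
  proof
    fix i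
    have eq: "d (Suc (m + i)) (\<phi> i - mul (s' i)) - e i (\<phi> (Suc i) - mul (s' (Suc i))) =
       (d (Suc (m + i)) (\<phi> i) - e i (\<phi> (Suc i)) - mul (\<psi> i)) +
       mul (\<psi> i - d (Suc m + i) (s' i) + e i (s' (Suc i)))"
      by (simp add: d_diff e_diff mul_add mul_diff mul_d mul_e)
    show "d (Suc (m + i)) (\<phi> i - mul (s' i)) - e i (\<phi> (Suc i) - mul (s' (Suc i))) \<in> N (Suc (Suc (m + i))) i"
      unfolding eq using N_add[OF \<psi>[of i]] mulN[OF s'[of i]] by simp
  qed
  then obtain t where t: "\<And>i. \<phi> i - mul (s' i) - d (m + i) (t i) - e i (t (Suc i)) \<in> N (Suc (m + i)) i"
    using a(1) unfolding acyclic_at_def null_family_def by blast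
  have "\<phi> i - d (m + i) (t i) - e i (t (Suc i)) \<in> Nmod (Suc (m + i)) i" for i
    unfolding Nmod_def using t[of i] by (auto intro!: exI[of _ "s' i"] simp: algebra_simps)
  then show "null_family d e Nmod m \<phi>" by (auto simp: null_family_def)
qed

lemma mul_pow_add: "(mul ^^ n) (x + y) = (mul ^^ n) x + (mul ^^ n) y"
  by (induction n) (auto simp: mul_add)

lemma mul_pow_zero [simp]: "(mul ^^ n) 0 = 0"
  by (induction n) auto

lemma mul_pow_diff: "(mul ^^ n) (x - y) = (mul ^^ n) x - (mul ^^ n) y"
  by (induction n) (auto simp: mul_diff)

lemma mul_pow_d: "(mul ^^ n) (d k x) = d k ((mul ^^ n) x)"
  by (induction n) (auto simp: mul_d)

lemma mul_pow_e: "(mul ^^ n) (e k x) = e k ((mul ^^ n) x)"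
  by (induction n) (auto simp: mul_e)

lemma mul_powN: "x \<in> N k i \<Longrightarrow> (mul ^^ n) x \<in> N k i"
  by (induction n) (auto simp: mulN)

lemma d_sum: "d k (\<Sum>t<n. f t) = (\<Sum>t<(n::nat). d k (f t))"
  by (induction n) (auto simp: d_add)

lemma e_sum: "e k (\<Sum>t<n. f t) = (\<Sum>t<(n::nat). e k (f t))"
  by (induction n) (auto simp: e_add)

text \<open>
  The Nakayama argument: a cyclic family is homotopic to \<open>mul\<close> times another one, which is cyclic
  because \<open>mul\<close> is regular. Iterating, the series of the homotopies multiplied by powers of
  \<open>mul\<close> converges to a homotopy by completeness.
\<close>
lemma acyclic_lift:
  assumes a: "acyclic_at d e Nmod m"
    and complete: "\<And>k i g. \<exists>x. \<forall>n. \<exists>y. x - (\<Sum>t<n. (mul ^^ t) (g t)) - (mul ^^ n) y \<in> N k i"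
    and separated: "\<And>k i x. (\<And>n. \<exists>y. x - (mul ^^ n) y \<in> N k i) \<Longrightarrow> x \<in> N k i"
  shows "acyclic_at d e N m"
  unfolding acyclic_at_def
proof (intro allI impI)
  fix \<phi> assume cyc: "cyclic_family d e N m \<phi>"
  \<comment> \<open>One step of the iteration: \<open>\<phi>\<close> is homotopic, by \<open>s\<close>, to a multiple of \<open>\<phi>'\<close>.\<close>
  define R where "R \<phi> s \<phi>' \<longleftrightarrow> (\<forall>i. \<phi> i - d (m + i) (s i) - e i (s (Suc i)) - mul (\<phi>' i) \<in> N (Suc (m + i)) i)"
    for \<phi> s \<phi>' :: "nat \<Rightarrow> 'g"
  have step: "\<exists>s \<phi>'. cyclic_family d e N m \<phi>' \<and> R \<phi> s \<phi>'" if cyc: "cyclic_family d e N m \<phi>" for \<phi>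
  proof -
    have "cyclic_family d e Nmod m \<phi>"
      using cyc unfolding cyclic_family_def Nmod_def by (auto intro!: exI[of _ 0])
    then obtain s where "\<forall>i. \<phi> i - d (m + i) (s i) - e i (s (Suc i)) \<in> Nmod (Suc (m + i)) i"
      using a unfolding acyclic_at_def null_family_def by blast
    then have "\<forall>i. \<exists>g. \<phi> i - d (m + i) (s i) - e i (s (Suc i)) - mul g \<in> N (Suc (m + i)) i"
      by (auto simp: Nmod_def)
    then obtain \<phi>' where \<phi>': "\<And>i. \<phi> i - d (m + i) (s i) - e i (s (Suc i)) - mul (\<phi>' i) \<in> N (Suc (m + i)) i"
      by metis
    have "cyclic_family d e N m \<phi>'"
      unfolding cyclic_family_def
    proof
      fix i
      let ?k = "Suc (m + i)"
      let ?g = "\<lambda>i. \<phi> i - d (m + i) (s i) - e i (s (Suc i)) - mul (\<phi>' i)"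
      have eq: "mul (d ?k (\<phi>' i) - e i (\<phi>' (Suc i))) =
         (d ?k (\<phi> i) - e i (\<phi> (Suc i))) - d ?k (?g i) + e i (?g (Suc i)) - d ?k (d (m + i) (s i))
         + e i (e (Suc i) (s (Suc (Suc i))))"
        by (simp add: d_diff e_diff mul_diff mul_d mul_e de)
      have g: "e i (?g (Suc i)) \<in> N (Suc ?k) i"
        using eN[OF \<phi>'[of "Suc i"]] by simp
      have "mul (d ?k (\<phi>' i) - e i (\<phi>' (Suc i))) \<in> N (Suc ?k) i"
        unfolding eq
        by (rule N_add[OF N_diff[OF N_add[OF N_diff[OF cyc[unfolded cyclic_family_def, rule_format]
            dN[OF \<phi>'[of i]]] g] dd] ee])
      then show "d ?k (\<phi>' i) - e i (\<phi>' (Suc i)) \<in> N (Suc ?k) i" by (rule mul_regular)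
    qed
    then show ?thesis using \<phi>' by (auto simp: R_def)
  qed
  have "\<exists>f. \<forall>n. (cyclic_family d e N m (f n) \<and> (n = 0 \<longrightarrow> f n = \<phi>)) \<and> (\<exists>s. R (f n) s (f (Suc n)))"
  proof (rule dependent_nat_choice)
    show "\<exists>x. cyclic_family d e N m x \<and> ((0::nat) = 0 \<longrightarrow> x = \<phi>)" using cyc by auto
  next
    fix x :: "nat \<Rightarrow> 'g" and n :: nat
    assume "cyclic_family d e N m x \<and> (n = 0 \<longrightarrow> x = \<phi>)"
    then obtain s y where "cyclic_family d e N m y" "R x s y" using step[of x] by auto
    then show "\<exists>y. (cyclic_family d e N m y \<and> (Suc n = 0 \<longrightarrow> y = \<phi>)) \<and> (\<exists>s. R x s y)"
      by auto
  qed
  then obtain f where f0: "f 0 = \<phi>" and "\<forall>n. \<exists>s. R (f n) s (f (Suc n))" by blast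
  then obtain s where s: "\<And>n. R (f n) (s n) (f (Suc n))" by metis
  have "\<exists>x. \<forall>n. \<exists>y. x - (\<Sum>t<n. (mul ^^ t) (s t i)) - (mul ^^ n) y \<in> N (m + i) i" for i
    by (rule complete)
  then obtain S where S: "\<And>i n. \<exists>y. S i - (\<Sum>t<n. (mul ^^ t) (s t i)) - (mul ^^ n) y \<in> N (m + i) i"
    by metis
  have S2: "\<exists>y. S (Suc i) - (\<Sum>t<n. (mul ^^ t) (s t (Suc i))) - (mul ^^ n) y \<in> N (Suc (m + i)) (Suc i)" for i n
    using S[of "Suc i" n] by simp
  have fin: "\<phi> i - (\<Sum>t<n. (mul ^^ t) (d (m + i) (s t i) + e i (s t (Suc i)))) - (mul ^^ n) (f n i) \<in> N (Suc (m + i)) i" for n i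
  proof (induction n)
    case 0 then show ?case using f0 N0 by simp
  next
    case (Suc n)
    have "(mul ^^ n) (f n i - d (m + i) (s n i) - e i (s n (Suc i)) - mul (f (Suc n) i)) \<in> N (Suc (m + i)) i"
      using s[of n] by (intro mul_powN) (auto simp: R_def)
    from N_add[OF Suc.IH this] show ?case
      by (simp add: mul_pow_diff mul_pow_add funpow_swap1 algebra_simps)
  qed
  have "\<phi> i - d (m + i) (S i) - e i (S (Suc i)) \<in> N (Suc (m + i)) i" for i
  proof (rule separated)
    fix n
    obtain y where y: "S i - (\<Sum>t<n. (mul ^^ t) (s t i)) - (mul ^^ n) y \<in> N (m + i) i" using S by blast
    obtain z where z: "S (Suc i) - (\<Sum>t<n. (mul ^^ t) (s t (Suc i))) - (mul ^^ n) z \<in> N (Suc (m + i)) (Suc i)"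
      using S2 by blast
    show "\<exists>y. \<phi> i - d (m + i) (S i) - e i (S (Suc i)) - (mul ^^ n) y \<in> N (Suc (m + i)) i"
    proof
      have eq: "\<phi> i - d (m + i) (S i) - e i (S (Suc i)) - (mul ^^ n) (f n i - d (m + i) y - e i z) =
        (\<phi> i - (\<Sum>t<n. (mul ^^ t) (d (m + i) (s t i) + e i (s t (Suc i)))) - (mul ^^ n) (f n i))
        - d (m + i) (S i - (\<Sum>t<n. (mul ^^ t) (s t i)) - (mul ^^ n) y)
        - e i (S (Suc i) - (\<Sum>t<n. (mul ^^ t) (s t (Suc i))) - (mul ^^ n) z)"
        by (simp add: d_diff e_diff mul_pow_diff mul_pow_add mul_pow_d mul_pow_e d_sum e_sum d_add e_add sum.distrib algebra_simps)
      show "\<phi> i - d (m + i) (S i) - e i (S (Suc i)) - (mul ^^ n) (f n i - d (m + i) y - e i z) \<in> N (Suc (m + i)) i"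
        unfolding eq by (intro N_diff fin dN[OF y] eN[OF z])
    qed
  qed
  then show "null_family d e N m \<phi>" by (auto simp: null_family_def)
qed

end

section \<open>Vectors, matrices and ideals\<close>

type_synonym 'p vec = "nat \<Rightarrow> 'p"

definition scale :: "'p::comm_ring_1 \<Rightarrow> 'p vec \<Rightarrow> 'p vec" (infixr "\<cdot>\<^sub>v" 75) where
  "c \<cdot>\<^sub>v w = (\<lambda>i. c * w i)"

text \<open>
  The product of the row vector \<open>w\<close> of length \<open>r\<close> with the matrix whose rows are
  \<open>A 0, ..., A (r - 1)\<close>. Vectors have infinitely many entries; a module of relations containing
  \<open>free_rel J n\<close> ignores the entries from \<open>n\<close> on. Thus all modules live on one type,
  whatever their number of generators is.
\<close>
definition comb :: "nat \<Rightarrow> 'p::comm_ring_1 vec \<Rightarrow> (nat \<Rightarrow> 'p vec) \<Rightarrow> 'p vec" where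
  "comb r w A = (\<lambda>k. \<Sum>a<r. w a * A a k)"

definition unit_vec :: "nat \<Rightarrow> 'p::comm_ring_1 vec" where
  "unit_vec a = (\<lambda>k. if k = a then 1 else 0)"

definition submod :: "'p::comm_ring_1 vec set \<Rightarrow> bool" where
  "submod V \<longleftrightarrow> 0 \<in> V \<and> (\<forall>v\<in>V. \<forall>w\<in>V. v + w \<in> V) \<and> (\<forall>c. \<forall>v\<in>V. c \<cdot>\<^sub>v v \<in> V)"

definition is_ideal :: "'p::comm_ring_1 set \<Rightarrow> bool" where
  "is_ideal J \<longleftrightarrow> 0 \<in> J \<and> (\<forall>a\<in>J. \<forall>b\<in>J. a + b \<in> J) \<and> (\<forall>c. \<forall>a\<in>J. c * a \<in> J)"

definition lin :: "('p::comm_ring_1 vec \<Rightarrow> 'p vec) \<Rightarrow> bool" where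
  "lin g \<longleftrightarrow> (\<forall>v w. g (v + w) = g v + g w) \<and> (\<forall>c v. g (c \<cdot>\<^sub>v v) = c \<cdot>\<^sub>v g v)"

definition free_rel :: "'p::comm_ring_1 set \<Rightarrow> nat \<Rightarrow> 'p vec set" where
  "free_rel J n = {w. \<forall>i<n. w i \<in> J}"

lemma scale_apply [simp]: "(c \<cdot>\<^sub>v w) i = c * w i"
  by (simp add: scale_def)

lemma unit_vec_apply [simp]: "unit_vec a k = (if k = a then 1 else 0)"
  by (simp add: unit_vec_def)

lemma scale_zero [simp]: "c \<cdot>\<^sub>v 0 = 0" "0 \<cdot>\<^sub>v w = 0"
  by (auto simp: fun_eq_iff)

lemma scale_one [simp]: "1 \<cdot>\<^sub>v w = w"
  by (auto simp: fun_eq_iff)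

lemma scale_scale: "c \<cdot>\<^sub>v d \<cdot>\<^sub>v w = (c * d) \<cdot>\<^sub>v w"
  by (auto simp: fun_eq_iff algebra_simps)

lemma scale_add: "c \<cdot>\<^sub>v (v + w) = c \<cdot>\<^sub>v v + c \<cdot>\<^sub>v w"
  by (auto simp: fun_eq_iff algebra_simps)

lemma scale_diff: "c \<cdot>\<^sub>v (v - w) = c \<cdot>\<^sub>v v - c \<cdot>\<^sub>v w"
  by (auto simp: fun_eq_iff algebra_simps)

lemma scale_left_add: "(c + d) \<cdot>\<^sub>v w = c \<cdot>\<^sub>v w + d \<cdot>\<^sub>v w"
  by (auto simp: fun_eq_iff algebra_simps)

lemma scale_left_diff: "(c - d) \<cdot>\<^sub>v w = c \<cdot>\<^sub>v w - d \<cdot>\<^sub>v w"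
  by (auto simp: fun_eq_iff algebra_simps)

lemma scale_minus_one: "(-1) \<cdot>\<^sub>v w = - w"
  by (auto simp: fun_eq_iff)

subsection \<open>Submodules\<close>

lemma submod0: "submod V \<Longrightarrow> 0 \<in> V"
  by (simp add: submod_def)

lemma submod_add: "submod V \<Longrightarrow> v \<in> V \<Longrightarrow> w \<in> V \<Longrightarrow> v + w \<in> V"
  by (simp add: submod_def)

lemma submod_scale: "submod V \<Longrightarrow> v \<in> V \<Longrightarrow> c \<cdot>\<^sub>v v \<in> V"
  by (simp add: submod_def)

lemma submod_uminus: "submod V \<Longrightarrow> v \<in> V \<Longrightarrow> - v \<in> V"
  using submod_scale[of V v "-1"] by (simp add: scale_minus_one)

lemma submod_diff: "submod V \<Longrightarrow> v \<in> V \<Longrightarrow> w \<in> V \<Longrightarrow> v - w \<in> V"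
  using submod_add[of V v "- w"] submod_uminus[of V w] by simp

lemma submod_sum: "submod V \<Longrightarrow> (\<And>i. i \<in> I \<Longrightarrow> f i \<in> V) \<Longrightarrow> sum f I \<in> V"
  by (induction I rule: infinite_finite_induct) (auto intro: submod0 submod_add)

lemma submod_add_iff:
  assumes "submod V" "w \<in> V"
  shows "v + w \<in> V \<longleftrightarrow> v \<in> V" "w + v \<in> V \<longleftrightarrow> v \<in> V" "v - w \<in> V \<longleftrightarrow> v \<in> V" "w - v \<in> V \<longleftrightarrow> v \<in> V"
proof -
  show 1: "v + w \<in> V \<longleftrightarrow> v \<in> V"
    using submod_add[OF assms(1), of v w] submod_diff[OF assms(1), of "v + w" w] assms by auto
  show "w + v \<in> V \<longleftrightarrow> v \<in> V" using 1 by (simp add: add.commute)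
  show 3: "v - w \<in> V \<longleftrightarrow> v \<in> V"
    using submod_add[OF assms(1), of "v - w" w] submod_diff[OF assms(1), of v w] assms by auto
  show "w - v \<in> V \<longleftrightarrow> v \<in> V"
    using 3 submod_uminus[OF assms(1), of "w - v"] submod_uminus[OF assms(1), of "v - w"] by auto
qed

lemma submod_swap: "submod V \<Longrightarrow> v - w \<in> V \<Longrightarrow> w - v \<in> V"
  using submod_uminus[of V "v - w"] by simp

subsection \<open>Ideals\<close>

lemma ideal0: "is_ideal J \<Longrightarrow> 0 \<in> J"
  by (simp add: is_ideal_def)

lemma ideal_add: "is_ideal J \<Longrightarrow> v \<in> J \<Longrightarrow> w \<in> J \<Longrightarrow> v + w \<in> J"
  by (simp add: is_ideal_def)

lemma ideal_mult: "is_ideal J \<Longrightarrow> v \<in> J \<Longrightarrow> c * v \<in> J" "is_ideal J \<Longrightarrow> v \<in> J \<Longrightarrow> v * c \<in> J"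
  by (simp_all add: is_ideal_def mult.commute)

lemma ideal_uminus: "is_ideal J \<Longrightarrow> v \<in> J \<Longrightarrow> - v \<in> J"
  using ideal_mult(1)[of J v "-1"] by simp

lemma ideal_diff: "is_ideal J \<Longrightarrow> v \<in> J \<Longrightarrow> w \<in> J \<Longrightarrow> v - w \<in> J"
  using ideal_add[of J v "- w"] ideal_uminus[of J w] by simp

lemma ideal_sum: "is_ideal J \<Longrightarrow> (\<And>i. i \<in> I \<Longrightarrow> f i \<in> J) \<Longrightarrow> sum f I \<in> J"
  by (induction I rule: infinite_finite_induct) (auto intro: ideal0 ideal_add)

lemma submod_free_rel: "is_ideal J \<Longrightarrow> submod (free_rel J n)"
  by (auto simp: submod_def free_rel_def ideal0 ideal_add ideal_mult)

lemma free_rel_mono: "J \<subseteq> K \<Longrightarrow> free_rel J n \<subseteq> free_rel K n"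
  by (auto simp: free_rel_def)

lemma scale_free_rel: "is_ideal J \<Longrightarrow> c \<in> J \<Longrightarrow> c \<cdot>\<^sub>v w \<in> free_rel J n"
  by (auto simp: free_rel_def ideal_mult)

subsection \<open>Products with matrices\<close>

lemma comb_add_left: "comb r (v + w) A = comb r v A + comb r w A"
  by (auto simp: comb_def fun_eq_iff algebra_simps sum.distrib)

lemma comb_diff_left: "comb r (v - w) A = comb r v A - comb r w A"
  by (auto simp: comb_def fun_eq_iff algebra_simps sum_subtractf)

lemma comb_scale_left: "comb r (c \<cdot>\<^sub>v v) A = c \<cdot>\<^sub>v comb r v A"
  by (auto simp: comb_def fun_eq_iff algebra_simps sum_distrib_left)

lemma comb_zero_left [simp]: "comb r 0 A = 0"
  by (auto simp: comb_def fun_eq_iff)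

lemma comb_add_right: "comb r v (A + B) = comb r v A + comb r v B"
  by (auto simp: comb_def fun_eq_iff algebra_simps sum.distrib)

lemma comb_diff_right: "comb r v (A - B) = comb r v A - comb r v B"
  by (auto simp: comb_def fun_eq_iff algebra_simps sum_subtractf)

lemma comb_rows:
  "comb r v (\<lambda>a. A a + B a) = comb r v A + comb r v B"
  "comb r v (\<lambda>a. A a - B a) = comb r v A - comb r v B"
  "comb r v (\<lambda>a. - A a) = - comb r v A"
  by (auto simp: comb_def fun_eq_iff algebra_simps sum.distrib sum_subtractf sum_negf)

lemma comb_scale_right: "comb r v (\<lambda>a. c \<cdot>\<^sub>v A a) = c \<cdot>\<^sub>v comb r v A"
  by (auto simp: comb_def fun_eq_iff algebra_simps sum_distrib_left)

lemma comb_alt: "comb r w A = (\<Sum>a<r. w a \<cdot>\<^sub>v A a)"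
  by (induction r) (auto simp: comb_def fun_eq_iff)

lemma comb_assoc: "comb r (comb s w A) B = comb s w (\<lambda>a. comb r (A a) B)"
proof (rule ext)
  fix k
  have "comb r (comb s w A) B k = (\<Sum>a<r. \<Sum>b<s. w b * A b a * B a k)"
    by (simp add: comb_def sum_distrib_right)
  also have "\<dots> = (\<Sum>b<s. \<Sum>a<r. w b * A b a * B a k)" by (rule sum.swap)
  also have "\<dots> = comb s w (\<lambda>a. comb r (A a) B) k"
    by (simp add: comb_def sum_distrib_left mult.assoc)
  finally show "comb r (comb s w A) B k = comb s w (\<lambda>a. comb r (A a) B) k" .
qed

lemma comb_cong: "(\<And>a. a < r \<Longrightarrow> w a = w' a) \<Longrightarrow> (\<And>a. a < r \<Longrightarrow> A a = A' a) \<Longrightarrow> comb r w A = comb r w' A'"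
  by (auto simp: comb_def fun_eq_iff)

lemma comb_in: "submod V \<Longrightarrow> (\<And>a. a < r \<Longrightarrow> A a \<in> V) \<Longrightarrow> comb r w A \<in> V"
  unfolding comb_alt by (auto intro!: submod_sum submod_scale)

lemma comb_in_left:
  assumes "submod V" "free_rel J n \<subseteq> V" "\<And>a. a < r \<Longrightarrow> w a \<in> J" "is_ideal J"
  shows "comb r w A \<in> V"
  unfolding comb_alt using assms scale_free_rel by (blast intro!: submod_sum)

lemma comb_unit [simp]: "a < r \<Longrightarrow> comb r (unit_vec a) A = A a"
  by (auto simp: comb_def fun_eq_iff if_distrib[of "\<lambda>x. x * _"] cong: if_cong)

lemma comb_unit_vec: "comb r w unit_vec = (\<lambda>k. if k < r then w k else 0)"
  by (auto simp: comb_def fun_eq_iff if_distrib[of "\<lambda>x. _ * x"] cong: if_cong)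

lemma comb_unit_diff: "w - comb r w unit_vec \<in> free_rel J r" if "is_ideal J"
  using that by (auto simp: comb_unit_vec free_rel_def ideal0)

lemma lin_comb: "lin (\<lambda>w. comb r w A)"
  by (auto simp: lin_def comb_add_left comb_scale_left)

lemma lin_add: "lin g \<Longrightarrow> g (v + w) = g v + g w"
  by (simp add: lin_def)

lemma lin_scale: "lin g \<Longrightarrow> g (c \<cdot>\<^sub>v w) = c \<cdot>\<^sub>v g w"
  by (simp add: lin_def)

lemma lin_zero: "lin g \<Longrightarrow> g 0 = 0"
  using lin_scale[of g 0 0] by simp

lemma lin_diff: "lin g \<Longrightarrow> g (v - w) = g v - g w"
  using lin_add[of g v "(-1) \<cdot>\<^sub>v w"] lin_scale[of g "-1" w] by (simp add: scale_minus_one)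

lemma lin_uminus: "lin g \<Longrightarrow> g (- w) = - g w"
  using lin_scale[of g "-1" w] by (simp add: scale_minus_one)

lemma lin_comb_eq: "lin g \<Longrightarrow> g (comb r w A) = comb r w (\<lambda>a. g (A a))"
proof -
  assume g: "lin g"
  have "g (\<Sum>a<r. w a \<cdot>\<^sub>v A a) = (\<Sum>a<r. w a \<cdot>\<^sub>v g (A a))"
  proof (induction r)
    case 0 then show ?case unfolding lessThan_0 sum.empty by (rule lin_zero[OF g])
  next
    case (Suc r)
    then show ?case
      unfolding sum.lessThan_Suc lin_add[OF g] lin_scale[OF g] by (rule arg_cong)
  qed
  then show ?thesis unfolding comb_alt .
qed

lemma submod_vimage: "lin g \<Longrightarrow> submod V \<Longrightarrow> submod {w. g w \<in> V}"
  unfolding submod_def mem_Collect_eq Ball_def by (metis lin_add lin_scale lin_zero)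

lemma comb_append:
  "comb (r + s) w (\<lambda>a. if a < r then A a else B (a - r)) = comb r w A + comb s (\<lambda>a. w (r + a)) B"
proof (rule ext)
  fix k
  show "comb (r + s) w (\<lambda>a. if a < r then A a else B (a - r)) k = (comb r w A + comb s (\<lambda>a. w (r + a)) B) k"
    by (induction s) (simp_all add: comb_def add.assoc)
qed

lemmas vec_simps = scale_apply unit_vec_apply plus_fun_apply zero_fun_apply minus_apply uminus_apply

declare vec_simps [simp del]

section \<open>Hom complexes modulo an ideal\<close>

definition fg_mod :: "'p::comm_ring_1 set \<Rightarrow> 'p vec set \<Rightarrow> bool" where
  "fg_mod J V \<longleftrightarrow> submod V \<and> (\<exists>n. free_rel J n \<subseteq> V)"

text \<open>
  Row \<open>a\<close> of \<open>D i\<close> is the image of the basis vector \<open>a\<close> of degree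
  \<open>i + 1\<close> in degree \<open>i\<close>, and a homomorphism from a free module to the module with
  relations \<open>V\<close> is given by the images of the basis vectors. The condition is exactness of
  \<open>Hom(D, vectors / V)\<close> at degree \<open>m + 1\<close>, that is, vanishing of Ext in that degree
  when \<open>D\<close> is a resolution.
\<close>
definition hom_exact :: "(nat \<Rightarrow> nat) \<Rightarrow> (nat \<Rightarrow> nat \<Rightarrow> 'p::comm_ring_1 vec) \<Rightarrow> 'p vec set \<Rightarrow> nat \<Rightarrow> bool" where
  "hom_exact r D V m \<longleftrightarrow>
     (\<forall>h. (\<forall>a<r (Suc (Suc m)). comb (r (Suc m)) (D (Suc m) a) h \<in> V) \<longrightarrow>
          (\<exists>g. \<forall>a<r (Suc m). h a - comb (r m) (D m a) g \<in> V))"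

definition complex_mod :: "'p::comm_ring_1 set \<Rightarrow> (nat \<Rightarrow> nat) \<Rightarrow> (nat \<Rightarrow> nat \<Rightarrow> 'p vec) \<Rightarrow> bool" where
  "complex_mod J r D \<longleftrightarrow>
     (\<forall>m. \<forall>a<r (Suc (Suc m)). comb (r (Suc m)) (D (Suc m) a) (D m) \<in> free_rel J (r m))"

definition exact_mod :: "'p::comm_ring_1 set \<Rightarrow> (nat \<Rightarrow> nat) \<Rightarrow> (nat \<Rightarrow> nat \<Rightarrow> 'p vec) \<Rightarrow> nat \<Rightarrow> bool" where
  "exact_mod J r D m \<longleftrightarrow>
     (\<forall>w. comb (r (Suc m)) w (D m) \<in> free_rel J (r m) \<longrightarrow>
        (\<exists>u. w - comb (r (Suc (Suc m))) u (D (Suc m)) \<in> free_rel J (r (Suc m))))"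

definition dmap :: "(nat \<Rightarrow> nat) \<Rightarrow> (nat \<Rightarrow> nat \<Rightarrow> 'p::comm_ring_1 vec) \<Rightarrow> nat \<Rightarrow> (nat \<Rightarrow> 'p vec) \<Rightarrow> (nat \<Rightarrow> 'p vec)" where
  "dmap r D k h = (\<lambda>a. comb (r k) (D k a) h)"

definition emap :: "(nat \<Rightarrow> 'p vec \<Rightarrow> 'p vec) \<Rightarrow> nat \<Rightarrow> (nat \<Rightarrow> 'p vec) \<Rightarrow> (nat \<Rightarrow> 'p::comm_ring_1 vec)" where
  "emap \<delta> i h = (\<lambda>a. \<delta> i (h a))"

definition Nset :: "(nat \<Rightarrow> nat) \<Rightarrow> (nat \<Rightarrow> 'p::comm_ring_1 vec set) \<Rightarrow> nat \<Rightarrow> nat \<Rightarrow> (nat \<Rightarrow> 'p vec) set" where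
  "Nset r V k i = {h. \<forall>a<r k. h a \<in> V i}"

lemma dmap_dmap_in:
  assumes "is_ideal J" "complex_mod J r D" "fg_mod J V" "a < r (Suc (Suc k))"
  shows "dmap r D (Suc k) (dmap r D k h) a \<in> V"
proof -
  have "dmap r D (Suc k) (dmap r D k h) a = comb (r k) (comb (r (Suc k)) (D (Suc k) a) (D k)) h"
    by (simp add: dmap_def comb_assoc)
  moreover have "comb (r (Suc k)) (D (Suc k) a) (D k) \<in> free_rel J (r k)"
    using assms by (auto simp: complex_mod_def)
  ultimately show ?thesis
    using assms comb_in_left[of V J _ "r k"] by (auto simp: fg_mod_def free_rel_def)
qed

lemma double_complex_modules:
  assumes J: "is_ideal J" and D: "complex_mod J r D"
    and V: "\<And>i. fg_mod J (V i)" and lin: "\<And>i. lin (\<delta> i)"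
    and \<delta>: "\<And>i w. w \<in> V (Suc i) \<Longrightarrow> \<delta> i w \<in> V i"
    and \<delta>\<delta>: "\<And>i w. \<delta> i (\<delta> (Suc i) w) \<in> V i"
  shows "double_complex (dmap r D) (emap \<delta>) (Nset r V)"
proof
  have V': "submod (V i)" for i using V by (simp add: fg_mod_def)
  fix x y :: "nat \<Rightarrow> 'a vec" and k i
  show "dmap r D k (x + y) = dmap r D k x + dmap r D k y"
    by (simp add: dmap_def fun_eq_iff vec_simps comb_add_right)
  show "emap \<delta> i (x + y) = emap \<delta> i x + emap \<delta> i y"
    using lin_add[OF lin] by (simp add: emap_def fun_eq_iff vec_simps)
  show "0 \<in> Nset r V k i" using submod0[OF V'] by (auto simp: Nset_def vec_simps)
  show "x \<in> Nset r V k i \<Longrightarrow> y \<in> Nset r V k i \<Longrightarrow> x - y \<in> Nset r V k i"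
    using submod_diff[OF V'] by (auto simp: Nset_def vec_simps)
  show "x \<in> Nset r V k i \<Longrightarrow> dmap r D k x \<in> Nset r V (Suc k) i"
    using comb_in[OF V'] by (auto simp: Nset_def vec_simps dmap_def)
  show "x \<in> Nset r V k (Suc i) \<Longrightarrow> emap \<delta> i x \<in> Nset r V k i"
    using \<delta> by (auto simp: Nset_def vec_simps emap_def)
  show "dmap r D k (emap \<delta> i x) = emap \<delta> i (dmap r D k x)"
    by (simp add: dmap_def emap_def lin_comb_eq[OF lin])
  show "dmap r D (Suc k) (dmap r D k x) \<in> Nset r V (Suc (Suc k)) i"
    using dmap_dmap_in[OF J D V] by (simp add: Nset_def vec_simps)
  show "emap \<delta> i (emap \<delta> (Suc i) x) \<in> Nset r V k i"
    using \<delta>\<delta> by (auto simp: Nset_def vec_simps emap_def)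
qed

definition mat_map :: "(nat \<Rightarrow> nat) \<Rightarrow> (nat \<Rightarrow> nat \<Rightarrow> 'p::comm_ring_1 vec) \<Rightarrow> nat \<Rightarrow> 'p vec \<Rightarrow> 'p vec" where
  "mat_map f F i w = comb (f (Suc i)) w (F i)"

definition free_rels :: "'p::comm_ring_1 set \<Rightarrow> (nat \<Rightarrow> nat) \<Rightarrow> nat \<Rightarrow> 'p vec set" where
  "free_rels J f i = free_rel J (f i)"

lemma fg_mod_free: "is_ideal J \<Longrightarrow> fg_mod J (free_rel J n)"
  by (auto simp: fg_mod_def submod_free_rel)

lemma mat_map_free_rels: "is_ideal J \<Longrightarrow> w \<in> free_rels J f (Suc i) \<Longrightarrow> mat_map f F i w \<in> free_rels J f i"
  unfolding mat_map_def free_rels_def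
  by (rule comb_in_left[of _ J "f i"]) (auto simp: submod_free_rel, auto simp: free_rel_def)

lemma mat_map_mat_map:
  assumes "is_ideal J" "complex_mod J f F"
  shows "mat_map f F i (mat_map f F (Suc i) w) \<in> free_rels J f i"
proof -
  have "mat_map f F i (mat_map f F (Suc i) w) =
      comb (f (Suc (Suc i))) w (\<lambda>a. comb (f (Suc i)) (F (Suc i) a) (F i))"
    by (simp add: mat_map_def comb_assoc)
  also have "\<dots> \<in> free_rel J (f i)"
    by (rule comb_in[OF submod_free_rel[OF assms(1)]]) (use assms(2) in \<open>simp add: complex_mod_def\<close>)
  finally show ?thesis by (simp add: free_rels_def)
qed

lemma lin_mat_map: "lin (mat_map f F i)"
  unfolding mat_map_def by (rule lin_comb)

lemma double_complex_free:
  assumes "is_ideal J" "complex_mod J r D" "complex_mod J f F"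
  shows "double_complex (dmap r D) (emap (mat_map f F)) (Nset r (free_rels J f))"
  by (rule double_complex_modules[OF assms(1,2)])
    (use assms in \<open>simp_all add: mat_map_free_rels mat_map_mat_map lin_mat_map\<close>,
     simp add: free_rels_def fg_mod_free)

definition hom_acyclic where
  "hom_acyclic J r D f F m \<longleftrightarrow> acyclic_at (dmap r D) (emap (mat_map f F)) (Nset r (free_rels J f)) m"

lemma top_cokernel_Nset:
  "top_cokernel (emap \<delta>) (Nset r V) j = Nset r (\<lambda>i. if i = j then {w. \<exists>u. w - \<delta> j u \<in> V j} else V i)"
proof (intro ext Set.set_eqI iffI)
  fix k i h
  assume h: "h \<in> Nset r (\<lambda>i. if i = j then {w. \<exists>u. w - \<delta> j u \<in> V j} else V i) k i"
  show "h \<in> top_cokernel (emap \<delta>) (Nset r V) j k i"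
  proof (cases "i = j")
    case True
    then have "\<forall>a. \<exists>u. a < r k \<longrightarrow> h a - \<delta> j u \<in> V j" using h by (auto simp: Nset_def vec_simps)
    then obtain u where "\<And>a. a < r k \<Longrightarrow> h a - \<delta> j (u a) \<in> V j" by metis
    then show ?thesis using True by (auto simp: top_cokernel_def Nset_def vec_simps emap_def intro!: exI[of _ u])
  qed (use h in \<open>auto simp: top_cokernel_def Nset_def vec_simps\<close>)
qed (auto simp: top_cokernel_def Nset_def vec_simps emap_def split: if_splits)

lemma hom_acyclic_iff_trunc:
  assumes J: "is_ideal J" and D: "complex_mod J r D" and F: "complex_mod J f F"
    and ex: "\<And>i. j \<le> i \<Longrightarrow> exact_mod J f F i"
  shows "hom_acyclic J r D f F m \<longleftrightarrow>
    trunc_acyclic_at (dmap r D) (emap (mat_map f F))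
      (Nset r (\<lambda>i. if i = j then {w. \<exists>u. w - mat_map f F j u \<in> free_rels J f j} else free_rels J f i)) j m"
proof -
  interpret double_complex "dmap r D" "emap (mat_map f F)" "Nset r (free_rels J f)"
    by (rule double_complex_free[OF J D F])
  show ?thesis unfolding hom_acyclic_def top_cokernel_Nset[symmetric]
  proof (rule trunc_acyclic_iff[symmetric])
    fix k i h assume "j \<le> i" and h: "emap (mat_map f F) i h \<in> Nset r (free_rels J f) k i"
    have "\<forall>a. \<exists>u. a < r k \<longrightarrow> h a - mat_map f F (Suc i) u \<in> free_rels J f (Suc i)"
      using ex[OF \<open>j \<le> i\<close>] h by (auto simp: exact_mod_def emap_def Nset_def vec_simps mat_map_def free_rels_def)
    then obtain u where "\<And>a. a < r k \<Longrightarrow> h a - mat_map f F (Suc i) (u a) \<in> free_rels J f (Suc i)" by metis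
    then show "\<exists>g. h - emap (mat_map f F) (Suc i) g \<in> Nset r (free_rels J f) k (Suc i)"
      by (auto simp: Nset_def vec_simps emap_def intro!: exI[of _ u])
  qed
qed

lemma trunc_acyclic_0: "trunc_acyclic_at (dmap r D) e (Nset r V) 0 m \<longleftrightarrow> hom_exact r D (V 0) m"
proof
  assume a: "trunc_acyclic_at (dmap r D) e (Nset r V) 0 m"
  show "hom_exact r D (V 0) m" unfolding hom_exact_def
  proof (intro allI impI)
    fix h assume "\<forall>a<r (Suc (Suc m)). comb (r (Suc m)) (D (Suc m) a) h \<in> V 0"
    then have "trunc_cyclic (dmap r D) e (Nset r V) 0 m (\<lambda>_. h)"
      by (auto simp: trunc_cyclic_def Nset_def vec_simps dmap_def)
    then have "trunc_null (dmap r D) e (Nset r V) 0 m (\<lambda>_. h)"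
      using a by (auto simp: trunc_acyclic_at_def)
    then show "\<exists>g. \<forall>a<r (Suc m). h a - comb (r m) (D m a) g \<in> V 0"
      by (auto simp: trunc_null_def Nset_def vec_simps dmap_def)
  qed
next
  assume a: "hom_exact r D (V 0) m"
  show "trunc_acyclic_at (dmap r D) e (Nset r V) 0 m"
    unfolding trunc_acyclic_at_def
  proof (intro allI impI)
    fix \<phi> assume "trunc_cyclic (dmap r D) e (Nset r V) 0 m \<phi>"
    then have "\<forall>a<r (Suc (Suc m)). comb (r (Suc m)) (D (Suc m) a) (\<phi> 0) \<in> V 0"
      by (auto simp: trunc_cyclic_def Nset_def vec_simps dmap_def)
    then obtain g where "\<forall>a<r (Suc m). \<phi> 0 a - comb (r m) (D m a) g \<in> V 0"
      using a unfolding hom_exact_def by blast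
    then show "trunc_null (dmap r D) e (Nset r V) 0 m \<phi>"
      by (auto simp: trunc_null_def Nset_def vec_simps dmap_def intro!: exI[of _ "\<lambda>_. g"])
  qed
qed

text \<open>
  Replacing a module by a free resolution of it does not change the cohomology of \<open>Hom\<close> from a
  complex of free modules: the resolution truncated in degree 0 is the module itself.
\<close>
lemma hom_exact_iff_acyclic:
  assumes J: "is_ideal J" and D: "complex_mod J r D" and F: "complex_mod J f F"
    and ex: "\<And>i. exact_mod J f F i"
    and V: "V = {w. \<exists>u. w - mat_map f F 0 u \<in> free_rel J (f 0)}"
  shows "hom_exact r D V m \<longleftrightarrow> hom_acyclic J r D f F m"
proof -
  have "hom_acyclic J r D f F m \<longleftrightarrow>
    trunc_acyclic_at (dmap r D) (emap (mat_map f F))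
      (Nset r (\<lambda>i. if i = 0 then {w. \<exists>u. w - mat_map f F 0 u \<in> free_rels J f 0} else free_rels J f i)) 0 m"
    by (rule hom_acyclic_iff_trunc[OF J D F ex])
  then show ?thesis unfolding trunc_acyclic_0 by (simp add: V free_rels_def)
qed

subsection \<open>Passing to the quotient by a regular element\<close>

definition adjoin :: "'p::comm_ring_1 set \<Rightarrow> 'p \<Rightarrow> 'p set" where
  "adjoin J x = {c. \<exists>d. c - x * d \<in> J}"

definition regular_mod :: "'p::comm_ring_1 set \<Rightarrow> 'p \<Rightarrow> bool" where
  "regular_mod J x \<longleftrightarrow> (\<forall>c. x * c \<in> J \<longrightarrow> c \<in> J)"

definition adically_complete :: "'p::comm_ring_1 set \<Rightarrow> 'p \<Rightarrow> bool" where
  "adically_complete J x \<longleftrightarrow>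
     (\<forall>g. \<exists>c. \<forall>n. \<exists>y. c - (\<Sum>t<n. x ^ t * g t) - x ^ n * y \<in> J) \<and>
     (\<forall>c. (\<forall>n. \<exists>y. c - x ^ n * y \<in> J) \<longrightarrow> c \<in> J)"

lemma ideal_adjoin: "is_ideal J \<Longrightarrow> is_ideal (adjoin J x)"
proof -
  assume J: "is_ideal J"
  show ?thesis
    unfolding is_ideal_def
  proof (intro conjI ballI allI)
    show "0 \<in> adjoin J x" using ideal0[OF J] by (auto simp: adjoin_def intro: exI[of _ 0])
  next
    fix a b assume "a \<in> adjoin J x" "b \<in> adjoin J x"
    then obtain d d' where "a - x * d \<in> J" "b - x * d' \<in> J" by (auto simp: adjoin_def)
    from ideal_add[OF J this] show "a + b \<in> adjoin J x"
      by (auto simp: adjoin_def algebra_simps intro!: exI[of _ "d + d'"])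
  next
    fix c a assume "a \<in> adjoin J x"
    then obtain d where "a - x * d \<in> J" by (auto simp: adjoin_def)
    from ideal_mult(1)[OF J this, of c] show "c * a \<in> adjoin J x"
      by (auto simp: adjoin_def algebra_simps intro!: exI[of _ "c * d"])
  qed
qed

lemma adjoin_superset: "is_ideal J \<Longrightarrow> J \<subseteq> adjoin J x"
  by (auto simp: adjoin_def intro: exI[of _ 0])

lemma adjoin_self: "is_ideal J \<Longrightarrow> x \<in> adjoin J x"
  by (auto simp: adjoin_def ideal0 intro: exI[of _ 1])

lemma adjoin_subset: "is_ideal K \<Longrightarrow> J \<subseteq> K \<Longrightarrow> x \<in> K \<Longrightarrow> adjoin J x \<subseteq> K"
proof
  fix c assume K: "is_ideal K" "J \<subseteq> K" "x \<in> K" and "c \<in> adjoin J x"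
  then obtain d where "c - x * d \<in> K" by (auto simp: adjoin_def)
  moreover have "x * d \<in> K" using K ideal_mult by blast
  ultimately show "c \<in> K" using ideal_add[OF K(1)] by fastforce
qed

lemma adjoin_mono: "J \<subseteq> K \<Longrightarrow> adjoin J x \<subseteq> adjoin K x"
  by (auto simp: adjoin_def)

lemma free_rel_adjoin: "w \<in> free_rel (adjoin J x) n \<longleftrightarrow> (\<exists>u. w - x \<cdot>\<^sub>v u \<in> free_rel J n)"
proof
  assume "w \<in> free_rel (adjoin J x) n"
  then have "\<forall>i. \<exists>d. i < n \<longrightarrow> w i - x * d \<in> J" by (auto simp: free_rel_def adjoin_def)
  then obtain u where "\<And>i. i < n \<Longrightarrow> w i - x * u i \<in> J" by metis
  then show "\<exists>u. w - x \<cdot>\<^sub>v u \<in> free_rel J n" by (auto simp: free_rel_def vec_simps intro!: exI[of _ u])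
qed (auto simp: free_rel_def adjoin_def vec_simps)

lemma regular_free_rel: "regular_mod J x \<Longrightarrow> x \<cdot>\<^sub>v w \<in> free_rel J n \<Longrightarrow> w \<in> free_rel J n"
  by (auto simp: free_rel_def regular_mod_def vec_simps)

lemma complex_mod_mono: "J \<subseteq> K \<Longrightarrow> complex_mod J r D \<Longrightarrow> complex_mod K r D"
  unfolding complex_mod_def using free_rel_mono by blast

text \<open>
  Exactness modulo \<open>x\<close> one degree higher: if \<open>w D = x v\<close>, then \<open>v D\<close>
  vanishes since \<open>x\<close> is regular, so that \<open>v = u D\<close> and exactness applies to \<open>w -
  x u\<close>.
\<close>
lemma exact_mod_adjoin:
  assumes J: "is_ideal J" and x: "regular_mod J x" and D: "complex_mod J r D"
    and ex: "exact_mod J r D m" "exact_mod J r D (Suc m)"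
  shows "exact_mod (adjoin J x) r D (Suc m)"
  unfolding exact_mod_def
proof (intro allI impI)
  fix w assume "comb (r (Suc (Suc m))) w (D (Suc m)) \<in> free_rel (adjoin J x) (r (Suc m))"
  then obtain e where e: "comb (r (Suc (Suc m))) w (D (Suc m)) - x \<cdot>\<^sub>v e \<in> free_rel J (r (Suc m))"
    by (auto simp: free_rel_adjoin)
  note sub = submod_free_rel[OF J]
  have 1: "mat_map r D m (comb (r (Suc (Suc m))) w (D (Suc m))) \<in> free_rel J (r m)"
    using mat_map_mat_map[OF J D, of m w] by (simp add: mat_map_def free_rels_def)
  have 2: "mat_map r D m (comb (r (Suc (Suc m))) w (D (Suc m)) - x \<cdot>\<^sub>v e) \<in> free_rel J (r m)"
    using mat_map_free_rels[OF J, of _ r m D] e by (simp add: free_rels_def)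
  have "x \<cdot>\<^sub>v mat_map r D m e \<in> free_rel J (r m)"
    using submod_diff[OF sub 1 2] by (simp add: lin_diff[OF lin_mat_map] lin_scale[OF lin_mat_map])
  then have "comb (r (Suc m)) e (D m) \<in> free_rel J (r m)"
    using regular_free_rel[OF x] by (simp add: mat_map_def)
  then obtain f where f: "e - comb (r (Suc (Suc m))) f (D (Suc m)) \<in> free_rel J (r (Suc m))"
    using ex(1) by (auto simp: exact_mod_def)
  have "comb (r (Suc (Suc m))) (w - x \<cdot>\<^sub>v f) (D (Suc m)) \<in> free_rel J (r (Suc m))"
  proof -
    have "comb (r (Suc (Suc m))) (w - x \<cdot>\<^sub>v f) (D (Suc m)) =
      (comb (r (Suc (Suc m))) w (D (Suc m)) - x \<cdot>\<^sub>v e) + x \<cdot>\<^sub>v (e - comb (r (Suc (Suc m))) f (D (Suc m)))"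
      by (simp add: comb_diff_left comb_scale_left scale_diff)
    then show ?thesis using submod_add[OF sub e submod_scale[OF sub f]] by simp
  qed
  then obtain u where u: "w - x \<cdot>\<^sub>v f - comb (r (Suc (Suc (Suc m)))) u (D (Suc (Suc m))) \<in> free_rel J (r (Suc (Suc m)))"
    using ex(2) by (auto simp: exact_mod_def)
  have "(w - comb (r (Suc (Suc (Suc m)))) u (D (Suc (Suc m)))) - x \<cdot>\<^sub>v f \<in> free_rel J (r (Suc (Suc m)))"
    using u by (simp add: algebra_simps)
  then show "\<exists>u. w - comb (r (Suc (Suc (Suc m)))) u (D (Suc (Suc m))) \<in> free_rel (adjoin J x) (r (Suc (Suc m)))"
    using free_rel_adjoin by blast
qed

definition scale_rows :: "'p::comm_ring_1 \<Rightarrow> (nat \<Rightarrow> 'p vec) \<Rightarrow> (nat \<Rightarrow> 'p vec)" where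
  "scale_rows x h = (\<lambda>a. x \<cdot>\<^sub>v h a)"

lemma scale_rows_pow: "(scale_rows x ^^ n) h = (\<lambda>a k. x ^ n * h a k)"
  by (induction n) (auto simp: scale_rows_def fun_eq_iff vec_simps)

lemma double_complex_mult_free:
  assumes "is_ideal J" "complex_mod J r D" "complex_mod J f F" "regular_mod J x"
  shows "double_complex_mult (dmap r D) (emap (mat_map f F)) (Nset r (free_rels J f)) (scale_rows x)"
proof -
  interpret double_complex "dmap r D" "emap (mat_map f F)" "Nset r (free_rels J f)"
    by (rule double_complex_free[OF assms(1-3)])
  show ?thesis
  proof
    fix u v :: "nat \<Rightarrow> 'a vec" and k i
    show "scale_rows x (u + v) = scale_rows x u + scale_rows x v"
      by (simp add: scale_rows_def fun_eq_iff vec_simps algebra_simps)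
    show "scale_rows x (dmap r D k u) = dmap r D k (scale_rows x u)"
      by (simp add: scale_rows_def dmap_def comb_scale_right)
    show "scale_rows x (emap (mat_map f F) i u) = emap (mat_map f F) i (scale_rows x u)"
      unfolding scale_rows_def emap_def lin_scale[OF lin_mat_map] ..
    show "u \<in> Nset r (free_rels J f) k i \<Longrightarrow> scale_rows x u \<in> Nset r (free_rels J f) k i"
      using submod_scale[OF submod_free_rel[OF assms(1)]] by (auto simp: scale_rows_def Nset_def vec_simps free_rels_def)
    show "scale_rows x u \<in> Nset r (free_rels J f) k i \<Longrightarrow> u \<in> Nset r (free_rels J f) k i"
      using regular_free_rel[OF assms(4)] by (auto simp: scale_rows_def Nset_def vec_simps free_rels_def)
  qed
qed

lemma Nmod_free_rels:
  assumes "is_ideal J" "complex_mod J r D" "complex_mod J f F" "regular_mod J x"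
  shows "double_complex_mult.Nmod (Nset r (free_rels J f)) (scale_rows x) = Nset r (free_rels (adjoin J x) f)"
proof -
  interpret double_complex_mult "dmap r D" "emap (mat_map f F)" "Nset r (free_rels J f)" "scale_rows x"
    by (rule double_complex_mult_free[OF assms])
  show ?thesis
  proof (intro ext Set.set_eqI iffI)
    fix k i h assume "h \<in> Nset r (free_rels (adjoin J x) f) k i"
    then have "\<forall>a. \<exists>u. a < r k \<longrightarrow> h a - x \<cdot>\<^sub>v u \<in> free_rel J (f i)"
      by (auto simp: Nset_def vec_simps free_rels_def free_rel_adjoin)
    then obtain u where "\<And>a. a < r k \<Longrightarrow> h a - x \<cdot>\<^sub>v u a \<in> free_rel J (f i)" by metis
    then show "h \<in> Nmod k i"
      by (auto simp: Nmod_def Nset_def vec_simps free_rels_def scale_rows_def intro!: exI[of _ u])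
  qed (auto simp: Nmod_def Nset_def vec_simps free_rels_def scale_rows_def free_rel_adjoin)
qed

lemma hom_acyclic_adjoin:
  assumes "is_ideal J" "complex_mod J r D" "complex_mod J f F" "regular_mod J x"
    and "hom_acyclic J r D f F m" "hom_acyclic J r D f F (Suc m)"
  shows "hom_acyclic (adjoin J x) r D f F m"
proof -
  interpret double_complex_mult "dmap r D" "emap (mat_map f F)" "Nset r (free_rels J f)" "scale_rows x"
    by (rule double_complex_mult_free[OF assms(1-4)])
  show ?thesis
    using acyclic_mod[of m] assms(5,6) Nmod_free_rels[OF assms(1-4)] by (simp add: hom_acyclic_def)
qed

lemma hom_acyclic_lift:
  assumes "is_ideal J" "complex_mod J r D" "complex_mod J f F" "regular_mod J x"
    and "adically_complete J x" "hom_acyclic (adjoin J x) r D f F m"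
  shows "hom_acyclic J r D f F m"
proof -
  interpret double_complex_mult "dmap r D" "emap (mat_map f F)" "Nset r (free_rels J f)" "scale_rows x"
    by (rule double_complex_mult_free[OF assms(1-4)])
  have sums: "(\<Sum>t<n. (scale_rows x ^^ t) (g t)) a b = (\<Sum>t<n. x ^ t * g t a b)" for g :: "nat \<Rightarrow> nat \<Rightarrow> 'a vec" and n a b
    by (induction n) (auto simp: scale_rows_pow vec_simps)
  have pow: "(scale_rows x ^^ n) h a b = x ^ n * h a b" for n and h :: "nat \<Rightarrow> 'a vec" and a b
    by (simp add: scale_rows_pow)
  show ?thesis unfolding hom_acyclic_def
  proof (rule acyclic_lift)
    show "acyclic_at (dmap r D) (emap (mat_map f F)) Nmod m"
      using assms(6) Nmod_free_rels[OF assms(1-4)] by (simp add: hom_acyclic_def)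
  next
    fix k i and g :: "nat \<Rightarrow> nat \<Rightarrow> 'a vec"
    have "\<forall>a b. \<exists>c. \<forall>n. \<exists>y. c - (\<Sum>t<n. x ^ t * g t a b) - x ^ n * y \<in> J"
      using assms(5) unfolding adically_complete_def by fast
    then obtain c where "\<forall>a b n. \<exists>y. c a b - (\<Sum>t<n. x ^ t * g t a b) - x ^ n * y \<in> J" by metis
    then obtain y where y: "\<And>a b n. c a b - (\<Sum>t<n. x ^ t * g t a b) - x ^ n * y a b n \<in> J" by metis
    show "\<exists>c. \<forall>n. \<exists>y. c - (\<Sum>t<n. (scale_rows x ^^ t) (g t)) - (scale_rows x ^^ n) y \<in> Nset r (free_rels J f) k i"
    proof (rule exI[of _ c], rule allI)
      fix n
      show "\<exists>y. c - (\<Sum>t<n. (scale_rows x ^^ t) (g t)) - (scale_rows x ^^ n) y \<in> Nset r (free_rels J f) k i"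
        using y by (intro exI[of _ "\<lambda>a b. y a b n"]) (simp add: Nset_def vec_simps free_rels_def free_rel_def sums pow)
    qed
  next
    fix k i and h :: "nat \<Rightarrow> 'a vec"
    assume a: "\<And>n. \<exists>y. h - (scale_rows x ^^ n) y \<in> Nset r (free_rels J f) k i"
    have "h a b \<in> J" if "a < r k" "b < f i" for a b
    proof -
      have "\<exists>y. h a b - x ^ n * y \<in> J" for n
        using a[of n] that by (auto simp: Nset_def vec_simps free_rels_def free_rel_def scale_rows_pow)
      then show ?thesis using assms(5) by (auto simp: adically_complete_def)
    qed
    then show "h \<in> Nset r (free_rels J f) k i"
      by (auto simp: Nset_def vec_simps free_rels_def free_rel_def)
  qed
qed

subsection \<open>Regular sequences\<close>

primrec adjoin_list :: "'p::comm_ring_1 set \<Rightarrow> 'p list \<Rightarrow> 'p set" where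
  "adjoin_list J [] = J"
| "adjoin_list J (x # xs) = adjoin_list (adjoin J x) xs"

primrec regular_seq :: "'p::comm_ring_1 set \<Rightarrow> 'p list \<Rightarrow> bool" where
  "regular_seq J [] \<longleftrightarrow> True"
| "regular_seq J (x # xs) \<longleftrightarrow> regular_mod J x \<and> regular_seq (adjoin J x) xs"

primrec complete_seq :: "'p::comm_ring_1 set \<Rightarrow> 'p list \<Rightarrow> bool" where
  "complete_seq J [] \<longleftrightarrow> True"
| "complete_seq J (x # xs) \<longleftrightarrow> adically_complete J x \<and> complete_seq (adjoin J x) xs"

lemma ideal_adjoin_list: "is_ideal J \<Longrightarrow> is_ideal (adjoin_list J xs)"
  by (induction xs arbitrary: J) (auto simp: ideal_adjoin)

lemma adjoin_list_superset: "is_ideal J \<Longrightarrow> J \<subseteq> adjoin_list J xs"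
proof (induction xs arbitrary: J)
  case (Cons x xs)
  then show ?case using adjoin_superset[of J x] ideal_adjoin[of J x] by fastforce
qed simp

lemma complex_mod_adjoin_list:
  "is_ideal J \<Longrightarrow> complex_mod J r D \<Longrightarrow> complex_mod (adjoin_list J xs) r D"
  using complex_mod_mono[OF adjoin_list_superset] .

lemma exact_mod_adjoin_list:
  assumes "is_ideal J" "complex_mod J r D" "regular_seq J xs" "\<And>m. k \<le> m \<Longrightarrow> exact_mod J r D m"
    and "k + length xs \<le> m"
  shows "exact_mod (adjoin_list J xs) r D m"
  using assms
proof (induction xs arbitrary: J k)
  case (Cons x xs)
  have "exact_mod (adjoin J x) r D l" if l: "Suc k \<le> l" for l
  proof -
    have "l = Suc (l - 1)" "k \<le> l - 1" using l by auto
    then obtain l' where "l = Suc l'" "k \<le> l'" by blast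
    then show ?thesis using exact_mod_adjoin[OF Cons.prems(1) _ Cons.prems(2), of x l'] Cons.prems by auto
  qed
  moreover have "complex_mod (adjoin J x) r D"
    using Cons.prems complex_mod_mono[OF adjoin_superset] by blast
  ultimately show ?case
    using Cons.prems Cons.IH[of "adjoin J x" "Suc k"] by (simp add: ideal_adjoin)
qed simp

lemma hom_acyclic_adjoin_list:
  assumes "is_ideal J" "complex_mod J r D" "complex_mod J f F" "regular_seq J xs"
    and "\<And>m. k \<le> m \<Longrightarrow> hom_acyclic J r D f F m" and "k \<le> m"
  shows "hom_acyclic (adjoin_list J xs) r D f F m"
  using assms
proof (induction xs arbitrary: J)
  case (Cons x xs)
  have "hom_acyclic (adjoin J x) r D f F l" if "k \<le> l" for l
    using hom_acyclic_adjoin[of J r D f F x l] Cons.prems that by auto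
  moreover have "complex_mod (adjoin J x) r D" "complex_mod (adjoin J x) f F"
    using Cons.prems complex_mod_mono[OF adjoin_superset] by blast+
  ultimately show ?case
    using Cons.prems Cons.IH[of "adjoin J x"] by (simp add: ideal_adjoin)
qed simp

lemma hom_acyclic_lift_list:
  assumes "is_ideal J" "complex_mod J r D" "complex_mod J f F" "regular_seq J xs" "complete_seq J xs"
    and "hom_acyclic (adjoin_list J xs) r D f F m"
  shows "hom_acyclic J r D f F m"
  using assms
proof (induction xs arbitrary: J)
  case (Cons x xs)
  have "hom_acyclic (adjoin J x) r D f F m"
    using Cons.prems Cons.IH[of "adjoin J x"] complex_mod_mono[OF adjoin_superset]
    by (auto simp: ideal_adjoin)
  then show ?case using hom_acyclic_lift[of J r D f F x m] Cons.prems by auto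
qed simp

section \<open>Injective modules over an artinian quotient\<close>

definition span1 :: "'p::comm_ring_1 vec set \<Rightarrow> 'p vec \<Rightarrow> 'p vec set" where
  "span1 V y = {w. \<exists>c. w - c \<cdot>\<^sub>v y \<in> V}"

text \<open>
  A substitute for length: a strictly monotone function, with values up to \<open>n\<close>, on the modules
  between \<open>V\<close> and \<open>W\<close>. A finite composition series provides such a function without
  the Jordan--Hoelder theorem.
\<close>
definition bounded_rank :: "'p::comm_ring_1 vec set \<Rightarrow> 'p vec set \<Rightarrow> nat \<Rightarrow> bool" where
  "bounded_rank V W n \<longleftrightarrow> (\<exists>\<rho> :: 'p vec set \<Rightarrow> nat.
     (\<forall>U. submod U \<longrightarrow> V \<subseteq> U \<longrightarrow> U \<subseteq> W \<longrightarrow> \<rho> U \<le> n) \<and>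
     (\<forall>U U'. submod U \<longrightarrow> submod U' \<longrightarrow> V \<subseteq> U \<longrightarrow> U \<subset> U' \<longrightarrow> U' \<subseteq> W \<longrightarrow> \<rho> U < \<rho> U'))"

definition residue_ideal :: "'p::comm_ring_1 set \<Rightarrow> bool" where
  "residue_ideal \<mm> \<longleftrightarrow> is_ideal \<mm> \<and> (\<forall>c. c \<notin> \<mm> \<longrightarrow> (\<exists>c'. c' * c - 1 \<in> \<mm>))"

text \<open>
  The list consists of generators of the successive steps of a chain of ideals from \<open>J\<close> up to the
  whole ring, each step being killed by \<open>\<mm>\<close>.
\<close>
primrec comp_series :: "'p::comm_ring_1 set \<Rightarrow> 'p set \<Rightarrow> 'p list \<Rightarrow> bool" where
  "comp_series \<mm> J [] \<longleftrightarrow> J = UNIV"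
| "comp_series \<mm> J (q # qs) \<longleftrightarrow> (\<forall>y\<in>\<mm>. y * q \<in> J) \<and> comp_series \<mm> (adjoin J q) qs"

lemma bounded_rankE:
  assumes "bounded_rank V W n"
  obtains \<rho> where "\<And>U. submod U \<Longrightarrow> V \<subseteq> U \<Longrightarrow> U \<subseteq> W \<Longrightarrow> \<rho> U \<le> n"
    "\<And>U U'. submod U \<Longrightarrow> submod U' \<Longrightarrow> V \<subseteq> U \<Longrightarrow> U \<subset> U' \<Longrightarrow> U' \<subseteq> W \<Longrightarrow> \<rho> U < (\<rho> U' :: nat)"
proof -
  from assms[unfolded bounded_rank_def] show thesis
  proof (elim exE conjE)
    fix \<rho> :: "'a vec set \<Rightarrow> nat"
    assume r: "\<forall>U. submod U \<longrightarrow> V \<subseteq> U \<longrightarrow> U \<subseteq> W \<longrightarrow> \<rho> U \<le> n"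
      "\<forall>U U'. submod U \<longrightarrow> submod U' \<longrightarrow> V \<subseteq> U \<longrightarrow> U \<subset> U' \<longrightarrow> U' \<subseteq> W \<longrightarrow> \<rho> U < \<rho> U'"
    show thesis by (rule that[of \<rho>]) (simp_all only: r)
  qed
qed

lemma submod_span1: "submod V \<Longrightarrow> submod (span1 V y)"
proof -
  assume V: "submod V"
  show ?thesis unfolding submod_def
  proof (intro conjI ballI allI)
    show "0 \<in> span1 V y" using submod0[OF V] by (auto simp: span1_def intro!: exI[of _ 0])
  next
    fix v w assume "v \<in> span1 V y" "w \<in> span1 V y"
    then obtain c d where "v - c \<cdot>\<^sub>v y \<in> V" "w - d \<cdot>\<^sub>v y \<in> V" by (auto simp: span1_def)
    from submod_add[OF V this] have "(v + w) - (c + d) \<cdot>\<^sub>v y \<in> V"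
      unfolding scale_left_add by (simp add: algebra_simps)
    then show "v + w \<in> span1 V y" by (auto simp: span1_def)
  next
    fix c v assume "v \<in> span1 V y"
    then obtain d where "v - d \<cdot>\<^sub>v y \<in> V" by (auto simp: span1_def)
    from submod_scale[OF V this, of c] have "c \<cdot>\<^sub>v v - (c * d) \<cdot>\<^sub>v y \<in> V"
      unfolding scale_diff scale_scale .
    then show "c \<cdot>\<^sub>v v \<in> span1 V y" by (auto simp: span1_def)
  qed
qed

lemma span1_superset: "V \<subseteq> span1 V y"
  by (auto simp: span1_def intro!: exI[of _ 0])

lemma span1_self: "submod V \<Longrightarrow> y \<in> span1 V y"
  by (auto simp: span1_def submod0 intro!: exI[of _ 1])

definition msum :: "'p::comm_ring_1 vec set \<Rightarrow> 'p vec set \<Rightarrow> 'p vec set" where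
  "msum U M = {w. \<exists>u\<in>U. w - u \<in> M}"

lemma submod_msum:
  assumes U: "submod U" and M: "submod M"
  shows "submod (msum U M)"
  unfolding submod_def
proof (intro conjI ballI allI)
  show "0 \<in> msum U M" using submod0[OF U] submod0[OF M] by (auto simp: msum_def intro!: bexI[of _ 0])
next
  fix v w assume "v \<in> msum U M" "w \<in> msum U M"
  then obtain a b where ab: "a \<in> U" "b \<in> U" and "v - a \<in> M" "w - b \<in> M" by (auto simp: msum_def)
  from submod_add[OF M this(3,4)] have "(v + w) - (a + b) \<in> M" by (simp add: algebra_simps)
  then show "v + w \<in> msum U M" using submod_add[OF U ab] by (auto simp: msum_def)
next
  fix c v assume "v \<in> msum U M"
  then obtain a where a: "a \<in> U" and "v - a \<in> M" by (auto simp: msum_def)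
  from submod_scale[OF M this(2), of c] have "c \<cdot>\<^sub>v v - c \<cdot>\<^sub>v a \<in> M" unfolding scale_diff .
  then show "c \<cdot>\<^sub>v v \<in> msum U M" using submod_scale[OF U a] by (auto simp: msum_def)
qed

lemma bounded_rank_refl: "bounded_rank V V 0"
  unfolding bounded_rank_def by (rule exI[of _ "\<lambda>_. 0"]) auto

text \<open>
  Ranks add up along an extension: a submodule is determined, among those that contain a given one, by its sum
  and its intersection with the middle module.
\<close>
lemma bounded_rank_trans:
  assumes M: "submod M" and sub: "V \<subseteq> M" "M \<subseteq> W" and W: "submod W"
    and a: "bounded_rank V M a" and b: "bounded_rank M W b"
  shows "bounded_rank V W (a + b)"
proof -
  obtain \<rho>1 where r1: "\<And>U. submod U \<Longrightarrow> V \<subseteq> U \<Longrightarrow> U \<subseteq> M \<Longrightarrow> \<rho>1 U \<le> a"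
      "\<And>U U'. submod U \<Longrightarrow> submod U' \<Longrightarrow> V \<subseteq> U \<Longrightarrow> U \<subset> U' \<Longrightarrow> U' \<subseteq> M \<Longrightarrow> \<rho>1 U < \<rho>1 U'"
    by (rule bounded_rankE[OF a]) blast
  obtain \<rho>2 where r2: "\<And>U. submod U \<Longrightarrow> M \<subseteq> U \<Longrightarrow> U \<subseteq> W \<Longrightarrow> \<rho>2 U \<le> b"
      "\<And>U U'. submod U \<Longrightarrow> submod U' \<Longrightarrow> M \<subseteq> U \<Longrightarrow> U \<subset> U' \<Longrightarrow> U' \<subseteq> W \<Longrightarrow> \<rho>2 U < \<rho>2 U'"
    by (rule bounded_rankE[OF b]) blast
  have I: "submod (U \<inter> M)" if "submod U" for U using that M by (auto simp: submod_def)
  have S: "M \<subseteq> msum U M" if "submod U" for U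
    using submod0[OF that] by (auto simp: msum_def intro!: bexI[of _ 0])
  have SW: "msum U M \<subseteq> W" if U: "submod U" "U \<subseteq> W" for U
  proof
    fix w assume "w \<in> msum U M"
    then obtain u where "u \<in> W" "w - u \<in> W" using U sub by (auto simp: msum_def)
    from submod_add[OF W this] show "w \<in> W" by simp
  qed
  let ?\<rho> = "\<lambda>U. \<rho>1 (U \<inter> M) + \<rho>2 (msum U M)"
  show ?thesis unfolding bounded_rank_def
  proof (intro exI[of _ ?\<rho>] conjI allI impI)
    fix U assume U: "submod U" "V \<subseteq> U" "U \<subseteq> W"
    show "?\<rho> U \<le> a + b"
      using r1(1)[OF I[OF U(1)]] r2(1)[OF submod_msum[OF U(1) M] S[OF U(1)] SW[OF U(1,3)]] U sub
      by (intro add_mono) auto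
  next
    fix U U' assume U: "submod U" "submod U'" "V \<subseteq> U" "U \<subset> U'" "U' \<subseteq> W"
    have le1: "U \<inter> M \<subset> U' \<inter> M \<Longrightarrow> \<rho>1 (U \<inter> M) < \<rho>1 (U' \<inter> M)"
      using r1(2)[OF I[OF U(1)] I[OF U(2)]] U sub by auto
    have le2: "msum U M \<subset> msum U' M \<Longrightarrow> \<rho>2 (msum U M) < \<rho>2 (msum U' M)"
      using r2(2)[OF submod_msum[OF U(1) M] submod_msum[OF U(2) M] S[OF U(1)] _ SW[OF U(2,5)]] by blast
    have s: "U \<inter> M \<subseteq> U' \<inter> M" "msum U M \<subseteq> msum U' M" using U(4) by (auto simp: msum_def)
    have "U \<inter> M \<noteq> U' \<inter> M \<or> msum U M \<noteq> msum U' M"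
    proof (rule ccontr)
      assume "\<not> ?thesis"
      then have eq: "U \<inter> M = U' \<inter> M" "msum U M = msum U' M" by auto
      have "U' \<subseteq> U"
      proof
        fix w assume w: "w \<in> U'"
        then have "w \<in> msum U' M" using submod0[OF M] by (auto simp: msum_def intro!: bexI[of _ w])
        then obtain u where u: "u \<in> U" "w - u \<in> M" unfolding eq(2)[symmetric] by (auto simp: msum_def)
        then have "w - u \<in> U'" using submod_diff[OF U(2) w] U(4) by auto
        then have "w - u \<in> U" using eq(1) u by blast
        from submod_add[OF U(1) this u(1)] show "w \<in> U" by simp
      qed
      then show False using U(4) by auto
    qed
    then show "?\<rho> U < ?\<rho> U'"
    proof
      assume "U \<inter> M \<noteq> U' \<inter> M"
      then have "\<rho>1 (U \<inter> M) < \<rho>1 (U' \<inter> M)" using le1 s by blast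
      moreover have "\<rho>2 (msum U M) \<le> \<rho>2 (msum U' M)" using le2 s by (cases "msum U M = msum U' M") (auto simp: psubset_eq less_imp_le)
      ultimately show ?thesis by simp
    next
      assume "msum U M \<noteq> msum U' M"
      then have "\<rho>2 (msum U M) < \<rho>2 (msum U' M)" using le2 s by blast
      moreover have "\<rho>1 (U \<inter> M) \<le> \<rho>1 (U' \<inter> M)" using le1 s by (cases "U \<inter> M = U' \<inter> M") (auto simp: psubset_eq less_imp_le)
      ultimately show ?thesis by simp
    qed
  qed
qed

lemma residue_ideal_unit:
  assumes \<mm>: "residue_ideal \<mm>" and V: "submod V" and y: "\<And>c. c \<in> \<mm> \<Longrightarrow> c \<cdot>\<^sub>v y \<in> V" and c: "c \<notin> \<mm>"
  obtains c' where "y - (c' * c) \<cdot>\<^sub>v y \<in> V"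
proof -
  obtain c' where "c' * c - 1 \<in> \<mm>" using \<mm> c by (auto simp: residue_ideal_def)
  from y[OF this] have "(c' * c) \<cdot>\<^sub>v y - y \<in> V" unfolding scale_left_diff scale_one .
  from submod_swap[OF V this] show thesis by (rule that)
qed

lemma bounded_rank_span1_simple:
  assumes \<mm>: "residue_ideal \<mm>" and V: "submod V" and y: "\<And>c. c \<in> \<mm> \<Longrightarrow> c \<cdot>\<^sub>v y \<in> V"
  shows "bounded_rank V (span1 V y) 1"
proof -
  have full: "U = span1 V y" if U: "submod U" "V \<subseteq> U" "U \<subseteq> span1 V y" "U \<noteq> V" for U
  proof -
    obtain w where w: "w \<in> U" "w \<notin> V" using U by auto
    then obtain c where c: "w - c \<cdot>\<^sub>v y \<in> V" using U by (auto simp: span1_def)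
    have "c \<notin> \<mm>"
    proof
      assume "c \<in> \<mm>"
      from submod_add[OF V c y[OF this]] w show False by simp
    qed
    then obtain c' where c': "y - (c' * c) \<cdot>\<^sub>v y \<in> V" using residue_ideal_unit[OF \<mm> V y] by blast
    have "c' \<cdot>\<^sub>v w \<in> U" "c' \<cdot>\<^sub>v (w - c \<cdot>\<^sub>v y) \<in> U" "y - (c' * c) \<cdot>\<^sub>v y \<in> U"
      using U w c c' submod_scale by blast+
    then have "(y - (c' * c) \<cdot>\<^sub>v y) + (c' \<cdot>\<^sub>v w - c' \<cdot>\<^sub>v (w - c \<cdot>\<^sub>v y)) \<in> U"
      using submod_add submod_diff U(1) by blast
    then have yU: "y \<in> U" unfolding scale_diff scale_scale by simp
    have "span1 V y \<subseteq> U"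
    proof
      fix v assume "v \<in> span1 V y"
      then obtain d where "v - d \<cdot>\<^sub>v y \<in> U" using U(2) by (auto simp: span1_def)
      from submod_add[OF U(1) this submod_scale[OF U(1) yU, of d]] show "v \<in> U" by simp
    qed
    then show ?thesis using U by auto
  qed
  show ?thesis unfolding bounded_rank_def
    by (rule exI[of _ "\<lambda>U. if U = V then 0 else 1"]) (use full in \<open>auto; blast\<close>)
qed

lemma bounded_rank_span1:
  assumes \<mm>: "residue_ideal \<mm>" and "comp_series \<mm> J qs" "is_ideal J" "submod V"
    and "\<And>c. c \<in> J \<Longrightarrow> c \<cdot>\<^sub>v y \<in> V"
  shows "\<exists>n. bounded_rank V (span1 V y) n"
  using assms(2-)
proof (induction qs arbitrary: J V)
  case Nil
  have "1 \<cdot>\<^sub>v y \<in> V" by (rule Nil.prems(4)) (use Nil.prems in simp)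
  then have y: "y \<in> V" by simp
  have "span1 V y = V"
  proof
    show "span1 V y \<subseteq> V"
    proof
      fix v assume "v \<in> span1 V y"
      then obtain d where "v - d \<cdot>\<^sub>v y \<in> V" by (auto simp: span1_def)
      from submod_add[OF Nil.prems(3) this submod_scale[OF Nil.prems(3) y, of d]] show "v \<in> V" by simp
    qed
  qed (rule span1_superset)
  then show ?case using bounded_rank_refl[of V] by auto
next
  case (Cons q qs)
  let ?V1 = "span1 V (q \<cdot>\<^sub>v y)"
  have V1: "submod ?V1" by (rule submod_span1) fact
  have simple: "bounded_rank V ?V1 1"
  proof (rule bounded_rank_span1_simple[OF \<mm> Cons.prems(3)])
    fix c assume "c \<in> \<mm>"
    then have "c * q \<in> J" using Cons.prems(1) by simp
    then show "c \<cdot>\<^sub>v q \<cdot>\<^sub>v y \<in> V" unfolding scale_scale by (rule Cons.prems(4))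
  qed
  have in1: "c \<cdot>\<^sub>v y \<in> ?V1" if c: "c \<in> adjoin J q" for c
  proof -
    obtain d where "c - q * d \<in> J" using c by (auto simp: adjoin_def)
    from Cons.prems(4)[OF this] have "c \<cdot>\<^sub>v y - d \<cdot>\<^sub>v q \<cdot>\<^sub>v y \<in> V"
      unfolding scale_left_diff scale_scale by (simp add: mult.commute)
    then show ?thesis by (auto simp: span1_def)
  qed
  have eq: "span1 ?V1 y = span1 V y"
  proof (intro Set.set_eqI iffI)
    fix w assume "w \<in> span1 ?V1 y"
    then obtain c d where "w - c \<cdot>\<^sub>v y - d \<cdot>\<^sub>v q \<cdot>\<^sub>v y \<in> V" by (auto simp: span1_def)
    then have "w - (c + d * q) \<cdot>\<^sub>v y \<in> V" unfolding scale_left_add scale_scale by (simp add: algebra_simps)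
    then show "w \<in> span1 V y" by (auto simp: span1_def)
  next
    fix w assume "w \<in> span1 V y"
    then obtain c where "w - c \<cdot>\<^sub>v y \<in> V" by (auto simp: span1_def)
    then have "w - c \<cdot>\<^sub>v y \<in> ?V1" using span1_superset by blast
    then show "w \<in> span1 ?V1 y" by (subst span1_def) blast
  qed
  have "comp_series \<mm> (adjoin J q) qs" using Cons.prems(1) by simp
  from Cons.IH[OF this ideal_adjoin[OF Cons.prems(2)] V1 in1]
  obtain n where "bounded_rank ?V1 (span1 V y) n" unfolding eq by blast
  then have "bounded_rank V (span1 V y) (1 + n)"
    using bounded_rank_trans[OF V1 span1_superset _ submod_span1[OF Cons.prems(3)] simple]
      span1_superset[of ?V1 y] unfolding eq by blast
  then show ?case by blast
qed

lemma bounded_rank_fg: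
  assumes \<mm>: "residue_ideal \<mm>" and cs: "comp_series \<mm> J qs" and J: "is_ideal J" and V: "fg_mod J V"
  shows "\<exists>n. bounded_rank V UNIV n"
proof -
  have sV: "submod V" using V by (simp add: fg_mod_def)
  obtain N where N: "free_rel J N \<subseteq> V" using V by (auto simp: fg_mod_def)
  define W where "W k = {w. \<exists>u. w - comb k u unit_vec \<in> V}" for k
  have W0: "W 0 = V" by (simp add: W_def comb_alt)
  have VW: "V \<subseteq> W k" for k by (auto simp: W_def intro!: exI[of _ 0])
  have WS: "W (Suc k) = span1 (W k) (unit_vec k)" for k
  proof (intro Set.set_eqI iffI)
    fix w assume "w \<in> W (Suc k)"
    then obtain u where "w - comb (Suc k) u unit_vec \<in> V" by (auto simp: W_def)
    then have "(w - u k \<cdot>\<^sub>v unit_vec k) - comb k u unit_vec \<in> V"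
      unfolding comb_alt by (simp add: algebra_simps)
    then show "w \<in> span1 (W k) (unit_vec k)" by (auto simp: span1_def W_def)
  next
    fix w assume "w \<in> span1 (W k) (unit_vec k)"
    then obtain c u where cu: "w - c \<cdot>\<^sub>v unit_vec k - comb k u unit_vec \<in> V" by (auto simp: span1_def W_def)
    have "comb k (u(k := c)) unit_vec = comb k u unit_vec" by (rule comb_cong) auto
    then have "comb (Suc k) (u(k := c)) unit_vec = comb k u unit_vec + c \<cdot>\<^sub>v unit_vec k"
      unfolding comb_alt by simp
    then have "w - comb (Suc k) (u(k := c)) unit_vec \<in> V" using cu by (simp add: algebra_simps)
    then show "w \<in> W (Suc k)" by (auto simp: W_def)
  qed
  have sW: "submod (W k)" for k by (induction k) (simp_all add: W0 sV WS submod_span1)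
  have "\<exists>n. bounded_rank V (W k) n" for k
  proof (induction k)
    case 0 then show ?case using bounded_rank_refl[of V] W0 by auto
  next
    case (Suc k)
    then obtain n where n: "bounded_rank V (W k) n" by blast
    have "c \<cdot>\<^sub>v unit_vec k \<in> W k" if "c \<in> J" for c
      using scale_free_rel[OF J that] N VW by blast
    from bounded_rank_span1[OF \<mm> cs J sW this]
    obtain l where l: "bounded_rank (W k) (W (Suc k)) l" unfolding WS by blast
    have "W k \<subseteq> W (Suc k)" unfolding WS by (rule span1_superset)
    from bounded_rank_trans[OF sW VW this sW n l] show ?case by blast
  qed
  moreover have "W N = UNIV"
    using comb_unit_diff[OF J, of _ N] N by (auto simp: W_def)
  ultimately show ?thesis by metis
qed

definition essential_ext :: "'p::comm_ring_1 vec set \<Rightarrow> ('p vec \<Rightarrow> 'p vec) \<Rightarrow> 'p vec set \<Rightarrow> bool" where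
  "essential_ext V \<iota> I \<longleftrightarrow> lin \<iota> \<and> (\<forall>w. \<iota> w \<in> I \<longleftrightarrow> w \<in> V) \<and>
     (\<forall>U. submod U \<longrightarrow> I \<subset> U \<longrightarrow> (\<exists>z. \<iota> z \<in> U \<and> z \<notin> V))"

text \<open>
  An element killed by \<open>\<mm>\<close> generates a simple or zero submodule, which an essential extension
  cannot add.
\<close>
lemma socle_in_essential:
  assumes \<mm>: "residue_ideal \<mm>" and I: "submod I" and e: "essential_ext V \<iota> I"
    and y: "\<And>c. c \<in> \<mm> \<Longrightarrow> c \<cdot>\<^sub>v y \<in> I"
  obtains z where "\<iota> z - y \<in> I"
proof (cases "y \<in> I")
  case True
  have "\<iota> 0 = 0" using e lin_zero by (auto simp: essential_ext_def)
  then show thesis using True submod_uminus[OF I True] that[of 0] by simp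
next
  case False
  have lin: "lin \<iota>" using e by (simp add: essential_ext_def)
  have "I \<subset> span1 I y" using span1_superset[of I y] span1_self[OF I, of y] False by auto
  then obtain z where z: "\<iota> z \<in> span1 I y" "z \<notin> V"
    using e submod_span1[OF I] unfolding essential_ext_def by blast
  then obtain c where c: "\<iota> z - c \<cdot>\<^sub>v y \<in> I" by (auto simp: span1_def)
  have zI: "\<iota> z \<notin> I" using z e by (auto simp: essential_ext_def)
  have "c \<notin> \<mm>"
  proof
    assume "c \<in> \<mm>"
    from submod_add[OF I c y[OF this]] zI show False by simp
  qed
  then obtain c' where c': "y - (c' * c) \<cdot>\<^sub>v y \<in> I" using residue_ideal_unit[OF \<mm> I y] by blast
  have "c' \<cdot>\<^sub>v (\<iota> z - c \<cdot>\<^sub>v y) - (y - (c' * c) \<cdot>\<^sub>v y) \<in> I"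
    using submod_diff[OF I submod_scale[OF I c] c'] .
  then have "\<iota> (c' \<cdot>\<^sub>v z) - y \<in> I" unfolding scale_diff scale_scale lin_scale[OF lin] by simp
  then show thesis by (rule that)
qed

text \<open>
  An essential extension of \<open>V\<close> is no longer than the number of steps of the composition series
  times the rank of \<open>V\<close>: multiplication by a generator of a step embeds the corresponding layer of
  the extension into its socle, which lies in \<open>V\<close>.
\<close>
lemma essential_bounded_rank:
  assumes \<mm>: "residue_ideal \<mm>" and I: "submod I" and e: "essential_ext V \<iota> I" and V: "submod V"
    and n: "bounded_rank V UNIV n" and cs: "comp_series \<mm> J qs" "is_ideal J"
  shows "bounded_rank I {w. \<forall>c\<in>J. c \<cdot>\<^sub>v w \<in> I} (length qs * n)"
  using cs
proof (induction qs arbitrary: J)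
  case Nil
  then have "{w. \<forall>c\<in>J. c \<cdot>\<^sub>v w \<in> I} = I"
    using submod_scale[OF I] by (auto dest!: spec[of _ 1])
  then show ?case using bounded_rank_refl[of I] by simp
next
  case (Cons q qs)
  define W where "W J = {w. \<forall>c\<in>J. c \<cdot>\<^sub>v w \<in> I}" for J :: "'a set"
  have sW: "submod (W J)" for J
    unfolding submod_def W_def using submod_add[OF I] submod0[OF I] submod_scale[OF I]
    by (auto simp: scale_add scale_scale) (metis mult.commute scale_scale)
  have lin: "lin \<iota>" and ker: "\<And>w. \<iota> w \<in> I \<longleftrightarrow> w \<in> V" using e by (simp_all add: essential_ext_def)
  obtain \<rho> where r: "\<And>U. submod U \<Longrightarrow> V \<subseteq> U \<Longrightarrow> \<rho> U \<le> n"
      "\<And>U U'. submod U \<Longrightarrow> submod U' \<Longrightarrow> V \<subseteq> U \<Longrightarrow> U \<subset> U' \<Longrightarrow> \<rho> U < \<rho> U'"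
    by (rule bounded_rankE[OF n]) (metis subset_UNIV)
  define T where "T U = {z. \<exists>u\<in>U. \<iota> z - q \<cdot>\<^sub>v u \<in> I}" for U :: "'a vec set"
  have sT: "submod (T U)" if U: "submod U" for U :: "'a vec set"
    unfolding submod_def
  proof (intro conjI ballI allI)
    show "0 \<in> T U" using submod0[OF U] submod0[OF I] lin_zero[OF lin] by (auto simp: T_def intro!: bexI[of _ 0])
  next
    fix v w assume "v \<in> T U" "w \<in> T U"
    then obtain a b where ab: "a \<in> U" "b \<in> U" and "\<iota> v - q \<cdot>\<^sub>v a \<in> I" "\<iota> w - q \<cdot>\<^sub>v b \<in> I" by (auto simp: T_def)
    from submod_add[OF I this(3,4)] have "\<iota> (v + w) - q \<cdot>\<^sub>v (a + b) \<in> I"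
      unfolding scale_add lin_add[OF lin] by (simp add: algebra_simps)
    then show "v + w \<in> T U" using submod_add[OF U ab] by (auto simp: T_def)
  next
    fix c v assume "v \<in> T U"
    then obtain a where a: "a \<in> U" and "\<iota> v - q \<cdot>\<^sub>v a \<in> I" by (auto simp: T_def)
    from submod_scale[OF I this(2), of c] have "\<iota> (c \<cdot>\<^sub>v v) - q \<cdot>\<^sub>v c \<cdot>\<^sub>v a \<in> I"
      unfolding scale_diff lin_scale[OF lin] scale_scale by (simp add: mult.commute)
    then show "c \<cdot>\<^sub>v v \<in> T U" using submod_scale[OF U a] by (auto simp: T_def)
  qed
  have VT: "V \<subseteq> T U" if "submod U" for U :: "'a vec set"
    using ker submod0[OF that] by (auto simp: T_def intro!: bexI[of _ 0])
  have step: "bounded_rank (W (adjoin J q)) (W J) n"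
    unfolding bounded_rank_def
  proof (intro exI[of _ "\<lambda>U. \<rho> (T U)"] conjI allI impI)
    fix U :: "'a vec set" assume "submod U"
    then show "\<rho> (T U) \<le> n" using r(1) sT VT by blast
  next
    fix U U' :: "'a vec set" assume U: "submod U" "submod U'" "W (adjoin J q) \<subseteq> U" "U \<subset> U'" "U' \<subseteq> W J"
    obtain u' where u': "u' \<in> U'" "u' \<notin> U" using U(4) by auto
    have "c \<cdot>\<^sub>v q \<cdot>\<^sub>v u' \<in> I" if "c \<in> \<mm>" for c
      using Cons.prems(1) that U(5) u' by (auto simp: W_def scale_scale)
    then obtain z where z: "\<iota> z - q \<cdot>\<^sub>v u' \<in> I" using socle_in_essential[OF \<mm> I e] by blast
    then have "z \<in> T U'" using u' by (auto simp: T_def)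
    moreover have "z \<notin> T U"
    proof
      assume "z \<in> T U"
      then obtain u where u: "u \<in> U" "\<iota> z - q \<cdot>\<^sub>v u \<in> I" by (auto simp: T_def)
      from submod_diff[OF I this(2) z] have qu: "q \<cdot>\<^sub>v (u' - u) \<in> I" unfolding scale_diff by simp
      have "u' - u \<in> W J" using u u' U submod_diff[OF sW] by (meson psubsetD subset_eq)
      then have Ju: "\<And>c. c \<in> J \<Longrightarrow> c \<cdot>\<^sub>v (u' - u) \<in> I" by (auto simp: W_def)
      have "c \<cdot>\<^sub>v (u' - u) \<in> I" if c: "c \<in> adjoin J q" for c
      proof -
        obtain d where "c - q * d \<in> J" using c by (auto simp: adjoin_def)
        from Ju[OF this] submod_scale[OF I qu, of d]
        have "(c - q * d) \<cdot>\<^sub>v (u' - u) + d \<cdot>\<^sub>v q \<cdot>\<^sub>v (u' - u) \<in> I" by (rule submod_add[OF I])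
        then show ?thesis unfolding scale_left_diff scale_scale by (simp add: mult.commute)
      qed
      then have "u' - u \<in> U" using U(3) by (auto simp: W_def)
      from submod_add[OF U(1) this u(1)] u' show False by simp
    qed
    moreover have "T U \<subseteq> T U'" using U(4) by (auto simp: T_def)
    ultimately have "T U \<subset> T U'" by blast
    then show "\<rho> (T U) < \<rho> (T U')" using r(2) sT VT U by blast
  qed
  have IH: "bounded_rank I (W (adjoin J q)) (length qs * n)"
    unfolding W_def using Cons.IH[of "adjoin J q"] Cons.prems ideal_adjoin by auto
  have "I \<subseteq> W K" for K using submod_scale[OF I] by (auto simp: W_def)
  moreover have "W (adjoin J q) \<subseteq> W J" using adjoin_superset[OF Cons.prems(2)] by (auto simp: W_def)
  ultimately have "bounded_rank I (W J) (length qs * n + n)"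
    using bounded_rank_trans[OF sW _ _ sW IH step] by blast
  then show ?case by (simp add: W_def add.commute)
qed

definition has_chain :: "'p::comm_ring_1 vec set \<Rightarrow> nat \<Rightarrow> bool" where
  "has_chain I n \<longleftrightarrow> (\<exists>U. (\<forall>i\<le>n. submod (U i)) \<and> I \<subseteq> U 0 \<and> (\<forall>i<n. U i \<subset> U (Suc i)))"

lemma has_chain_bound:
  assumes "bounded_rank I UNIV B" "has_chain I n"
  shows "n \<le> B"
proof -
  obtain \<rho> where r: "\<And>U. submod U \<Longrightarrow> I \<subseteq> U \<Longrightarrow> \<rho> U \<le> B"
      "\<And>U U'. submod U \<Longrightarrow> submod U' \<Longrightarrow> I \<subseteq> U \<Longrightarrow> U \<subset> U' \<Longrightarrow> \<rho> U < \<rho> U'"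
    by (rule bounded_rankE[OF assms(1)]) (metis subset_UNIV)
  obtain U where U: "\<And>i. i \<le> n \<Longrightarrow> submod (U i)" "I \<subseteq> U 0" "\<And>i. i < n \<Longrightarrow> U i \<subset> U (Suc i)"
    using assms(2) unfolding has_chain_def by blast
  have "I \<subseteq> U i \<and> i \<le> \<rho> (U i)" if "i \<le> n" for i
    using that
  proof (induction i)
    case (Suc i)
    then have "I \<subseteq> U i" "i \<le> \<rho> (U i)" by auto
    moreover have "\<rho> (U i) < \<rho> (U (Suc i))"
      by (rule r(2)) (use Suc.prems U calculation in auto)
    ultimately show ?case using U(3)[of i] Suc.prems by auto
  qed (use U in auto)
  then show ?thesis using r(1)[of "U n"] U(1)[of n] by (meson le_refl order_trans)
qed

text \<open>
  Injectivity as a splitting of every embedding into a finitely generated module; \<open>\<kappa>\<close> embeds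
  the module with relations \<open>I\<close> into the one with relations \<open>Y\<close>.
\<close>
definition injective_mod :: "'p::comm_ring_1 set \<Rightarrow> 'p vec set \<Rightarrow> bool" where
  "injective_mod J I \<longleftrightarrow> (\<forall>Y \<kappa>. fg_mod J Y \<longrightarrow> lin \<kappa> \<longrightarrow> (\<forall>w. \<kappa> w \<in> Y \<longleftrightarrow> w \<in> I) \<longrightarrow>
     (\<exists>\<rho>. lin \<rho> \<and> (\<forall>w\<in>Y. \<rho> w \<in> I) \<and> (\<forall>w. \<rho> (\<kappa> w) - w \<in> I)))"

lemma lin_comp: "lin f \<Longrightarrow> lin g \<Longrightarrow> lin (\<lambda>w. f (g w))"
  unfolding lin_def by simp

lemma maximal_complement:
  assumes Y: "submod Y" and \<kappa>: "\<And>w. \<kappa> w \<in> Y \<Longrightarrow> w \<in> I"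
  obtains U where "submod U" "Y \<subseteq> U" "\<And>w. \<kappa> w \<in> U \<Longrightarrow> w \<in> I"
    "\<And>U'. submod U' \<Longrightarrow> U \<subset> U' \<Longrightarrow> \<exists>w. \<kappa> w \<in> U' \<and> w \<notin> I"
proof -
  let ?A = "{U. submod U \<and> Y \<subseteq> U \<and> (\<forall>w. \<kappa> w \<in> U \<longrightarrow> w \<in> I)}"
  have "\<exists>M\<in>?A. \<forall>X\<in>?A. M \<subseteq> X \<longrightarrow> X = M"
  proof (rule subset_Zorn_nonempty)
    show "?A \<noteq> {}" using assms by blast
  next
    fix C assume C: "C \<noteq> {}" "subset.chain ?A C"
    then have mem: "\<And>U. U \<in> C \<Longrightarrow> submod U \<and> Y \<subseteq> U \<and> (\<forall>w. \<kappa> w \<in> U \<longrightarrow> w \<in> I)"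
      by (auto simp: subset.chain_def)
    have tot: "\<And>U U'. U \<in> C \<Longrightarrow> U' \<in> C \<Longrightarrow> U \<subseteq> U' \<or> U' \<subseteq> U" using C(2) by (auto simp: subset_chain_def)
    have "submod (\<Union>C)"
      unfolding submod_def
    proof (intro conjI ballI allI)
      show "0 \<in> \<Union>C" using C(1) mem submod0 by blast
    next
      fix v w assume "v \<in> \<Union>C" "w \<in> \<Union>C"
      then obtain U where "U \<in> C" "v \<in> U" "w \<in> U" using tot by blast
      then show "v + w \<in> \<Union>C" using mem submod_add by blast
    next
      fix c v assume "v \<in> \<Union>C"
      then show "c \<cdot>\<^sub>v v \<in> \<Union>C" using mem submod_scale by blast
    qed
    then show "\<Union>C \<in> ?A" using C(1) mem by blast
  qed
  then obtain U where UA: "U \<in> ?A" and mx: "\<forall>X\<in>?A. U \<subseteq> X \<longrightarrow> X = U" by (rule bexE)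
  have U: "submod U" "Y \<subseteq> U" "\<And>w. \<kappa> w \<in> U \<Longrightarrow> w \<in> I" using UA by simp_all
  show thesis
  proof (rule that[OF U])
    fix U' assume U': "submod U'" "U \<subset> U'"
    show "\<exists>w. \<kappa> w \<in> U' \<and> w \<notin> I"
    proof (rule ccontr)
      assume "\<not> ?thesis"
      then have "U' \<in> ?A" using U' U(2) by auto
      then have "U' = U" using mx U'(2) by auto
      then show False using U'(2) by auto
    qed
  qed
qed

text \<open>
  Essential extensions of \<open>V\<close> have bounded length over an artinian ring. One of maximal length is
  injective: in any module containing it, a maximal submodule that meets it trivially leaves a quotient in which
  it is essential, hence everything.
\<close>
lemma injective_embedding:
  assumes \<mm>: "residue_ideal \<mm>" and cs: "comp_series \<mm> J qs" and J: "is_ideal J" and V: "fg_mod J V"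
  obtains I \<iota> where "fg_mod J I" "lin \<iota>" "\<And>w. \<iota> w \<in> I \<longleftrightarrow> w \<in> V" "injective_mod J I"
proof -
  obtain B where B: "bounded_rank V UNIV B" using bounded_rank_fg[OF \<mm> cs J V] by blast
  define S where "S n \<longleftrightarrow> (\<exists>I \<iota>. fg_mod J I \<and> essential_ext V \<iota> I \<and> has_chain I n)" for n
  have sV: "submod V" using V by (simp add: fg_mod_def)
  have bound: "n \<le> length qs * B" if Sn: "S n" for n
  proof -
    obtain I \<iota> where I: "fg_mod J I" "essential_ext V \<iota> I" "has_chain I n" using Sn by (auto simp: S_def)
    have sI: "submod I" using I by (simp add: fg_mod_def)
    have "{w. \<forall>c\<in>J. c \<cdot>\<^sub>v w \<in> I} = UNIV"
      using I(1) scale_free_rel[OF J] by (auto simp: fg_mod_def)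
    then have "bounded_rank I UNIV (length qs * B)"
      using essential_bounded_rank[OF \<mm> sI I(2) sV B cs J] by simp
    then show ?thesis using has_chain_bound I(3) by blast
  qed
  have "lin (\<lambda>w::'a vec. w)" by (simp add: lin_def)
  moreover have "submod (UNIV :: 'a vec set)" by (simp add: submod_def)
  moreover have "\<exists>z. z \<in> U \<and> z \<notin> V" if "V \<subset> U" for U using that by blast
  ultimately have "S 0" unfolding S_def essential_ext_def has_chain_def using V
    by (intro exI[of _ V] exI[of _ "\<lambda>w. w"]) (auto intro!: exI[of _ "\<lambda>_. UNIV"])
  \<comment> \<open>An essential extension of maximal length.\<close>
  then obtain n where n: "S n" "\<And>n'. S n' \<Longrightarrow> n' \<le> n"
    using bound by (metis GreatestI_nat Greatest_le_nat)
  then obtain I \<iota> where I: "fg_mod J I" "essential_ext V \<iota> I" "has_chain I n" by (auto simp: S_def)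
  have lin: "lin \<iota>" and ker: "\<And>w. \<iota> w \<in> I \<longleftrightarrow> w \<in> V"
    and ess: "\<And>U. submod U \<Longrightarrow> I \<subset> U \<Longrightarrow> \<exists>z. \<iota> z \<in> U \<and> z \<notin> V"
    using I(2) by (simp_all add: essential_ext_def)
  have sI: "submod I" using I by (simp add: fg_mod_def)
  have "injective_mod J I"
    unfolding injective_mod_def
  proof (intro allI impI)
    fix Y \<kappa> assume Y: "fg_mod J Y" and lk: "lin \<kappa>" and kk: "\<forall>w. \<kappa> w \<in> Y \<longleftrightarrow> w \<in> I"
    have sY: "submod Y" using Y by (simp add: fg_mod_def)
    obtain N where N: "free_rel J N \<subseteq> Y" using Y by (auto simp: fg_mod_def)
    obtain U where U: "submod U" "Y \<subseteq> U" "\<And>w. \<kappa> w \<in> U \<Longrightarrow> w \<in> I"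
      "\<And>U'. submod U' \<Longrightarrow> U \<subset> U' \<Longrightarrow> \<exists>w. \<kappa> w \<in> U' \<and> w \<notin> I"
      using maximal_complement[OF sY, of \<kappa> I] kk by blast
    have kU: "\<kappa> w \<in> U \<longleftrightarrow> w \<in> I" for w using U kk by blast
    have fgU: "fg_mod J U" using U(1) order_trans[OF N U(2)] by (auto simp: fg_mod_def)
    have essU: "essential_ext V (\<lambda>w. \<kappa> (\<iota> w)) U"
      unfolding essential_ext_def
    proof (intro conjI allI impI)
      show "lin (\<lambda>w. \<kappa> (\<iota> w))" by (rule lin_comp[OF lk lin])
      show "\<kappa> (\<iota> w) \<in> U \<longleftrightarrow> w \<in> V" for w using kU ker by simp
      fix U' assume U': "submod U'" "U \<subset> U'"
      let ?W = "{w. \<kappa> w \<in> U'}"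
      have "I \<subset> ?W" using U(4)[OF U'] U'(2) kU by blast
      then show "\<exists>z. \<kappa> (\<iota> z) \<in> U' \<and> z \<notin> V" using ess[OF submod_vimage[OF lk U'(1)]] by blast
    qed
    have onto: "\<exists>a. w - \<kappa> a \<in> U" for w
    proof (rule ccontr)
      assume no: "\<not> ?thesis"
      obtain C where C: "\<And>i. i \<le> n \<Longrightarrow> submod (C i)" "I \<subseteq> C 0" "\<And>i. i < n \<Longrightarrow> C i \<subset> C (Suc i)"
        using I(3) unfolding has_chain_def by blast
      have IC: "I \<subseteq> C i" if "i \<le> n" for i
        using that
      proof (induction i)
        case (Suc i) then show ?case using C(3)[of i] by auto
      qed (use C in auto)
      define E where "E i = (if i \<le> n then {w. \<exists>a\<in>C i. w - \<kappa> a \<in> U} else UNIV)" for i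
      have sE: "submod (E i)" for i
      proof (cases "i \<le> n")
        case True
        have "submod {w. \<exists>a\<in>C i. w - \<kappa> a \<in> U}"
          unfolding submod_def
        proof (intro conjI ballI allI)
          show "0 \<in> {w. \<exists>a\<in>C i. w - \<kappa> a \<in> U}"
            using submod0[OF C(1)[OF True]] submod0[OF U(1)] lin_zero[OF lk] by (auto intro!: bexI[of _ 0])
        next
          fix v w assume "v \<in> {w. \<exists>a\<in>C i. w - \<kappa> a \<in> U}" "w \<in> {w. \<exists>a\<in>C i. w - \<kappa> a \<in> U}"
          then obtain a b where ab: "a \<in> C i" "b \<in> C i" and "v - \<kappa> a \<in> U" "w - \<kappa> b \<in> U" by auto
          from submod_add[OF U(1) this(3,4)] have "(v + w) - \<kappa> (a + b) \<in> U"
            unfolding lin_add[OF lk] by (simp add: algebra_simps)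
          then show "v + w \<in> {w. \<exists>a\<in>C i. w - \<kappa> a \<in> U}" using submod_add[OF C(1)[OF True] ab] by auto
        next
          fix c v assume "v \<in> {w. \<exists>a\<in>C i. w - \<kappa> a \<in> U}"
          then obtain a where a: "a \<in> C i" "v - \<kappa> a \<in> U" by auto
          from submod_scale[OF U(1) this(2), of c] have "c \<cdot>\<^sub>v v - \<kappa> (c \<cdot>\<^sub>v a) \<in> U"
            unfolding lin_scale[OF lk] scale_diff .
          then show "c \<cdot>\<^sub>v v \<in> {w. \<exists>a\<in>C i. w - \<kappa> a \<in> U}" using submod_scale[OF C(1)[OF True] a(1)] by auto
        qed
        then show ?thesis using True by (simp add: E_def)
      qed (simp add: E_def submod_def)
      have "E i \<subset> E (Suc i)" if i: "i \<le> n" for i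
      proof (cases "i = n")
        case True
        then show ?thesis using no by (auto simp: E_def)
      next
        case False
        then have "i < n" using i by simp
        then obtain w where w: "w \<in> C (Suc i)" "w \<notin> C i" using C(3) by blast
        have "\<kappa> w \<in> E (Suc i)" using w \<open>i < n\<close> submod0[OF U(1)] by (auto simp: E_def intro!: bexI[of _ w])
        moreover have "\<kappa> w \<notin> E i"
        proof
          assume "\<kappa> w \<in> E i"
          then obtain a where a: "a \<in> C i" "\<kappa> w - \<kappa> a \<in> U" using i by (auto simp: E_def)
          then have "w - a \<in> I" using kU[of "w - a"] lin_diff[OF lk, of w a] by simp
          then have "w - a \<in> C i" using IC[OF i] by blast
          from submod_add[OF C(1)[OF i] this a(1)] w show False by simp
        qed
        moreover have "E i \<subseteq> E (Suc i)" using C(3)[OF \<open>i < n\<close>] \<open>i < n\<close> by (auto simp: E_def)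
        ultimately show ?thesis by blast
      qed
      moreover have "U \<subseteq> E 0"
        using submod0[OF C(1)[of 0]] lin_zero[OF lk] by (auto simp: E_def intro!: bexI[of _ 0])
      ultimately have "has_chain U (Suc n)" unfolding has_chain_def using sE by (intro exI[of _ E]) auto
      then have "S (Suc n)" unfolding S_def using fgU essU by blast
      then show False using n(2) by force
    qed
    then have "\<forall>b. \<exists>a. unit_vec b - \<kappa> a \<in> U" by blast
    from choice[OF this] obtain R where R: "\<And>b. unit_vec b - \<kappa> (R b) \<in> U" by blast
    define \<rho> where "\<rho> w = comb N w R" for w
    have lr: "lin \<rho>" unfolding \<rho>_def by (rule lin_comb)
    have wr: "w - \<kappa> (\<rho> w) \<in> U" for w
    proof -
      have "w - comb N w unit_vec \<in> U" using comb_unit_diff[OF J] N U(2) by blast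
      moreover have "comb N w (unit_vec - (\<lambda>b. \<kappa> (R b))) \<in> U"
        by (rule comb_in[OF U(1)]) (use R in \<open>simp add: minus_apply\<close>)
      ultimately have "(w - comb N w unit_vec) + comb N w (unit_vec - (\<lambda>b. \<kappa> (R b))) \<in> U"
        by (rule submod_add[OF U(1)])
      then show ?thesis unfolding \<rho>_def lin_comb_eq[OF lk] comb_diff_right by simp
    qed
    show "\<exists>\<rho>. lin \<rho> \<and> (\<forall>w\<in>Y. \<rho> w \<in> I) \<and> (\<forall>w. \<rho> (\<kappa> w) - w \<in> I)"
    proof (intro exI[of _ \<rho>] conjI ballI allI)
      show "lin \<rho>" by (rule lr)
    next
      fix w assume "w \<in> Y"
      then have "w \<in> U" using U by blast
      from submod_diff[OF U(1) this wr[of w]] have "\<kappa> (\<rho> w) \<in> U" by simp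
      then show "\<rho> w \<in> I" using kU by simp
    next
      fix w
      have "\<kappa> (w - \<rho> (\<kappa> w)) \<in> U" using wr[of "\<kappa> w"] unfolding lin_diff[OF lk] .
      then show "\<rho> (\<kappa> w) - w \<in> I" using kU submod_swap[OF sI] by blast
    qed
  qed
  then show thesis using that I(1) lin ker by blast
qed

section \<open>Replacing a truncated complex by a module\<close>

definition evens :: "'p::comm_ring_1 vec \<Rightarrow> 'p vec" where "evens w = (\<lambda>i. w (2 * i))"
definition odds :: "'p::comm_ring_1 vec \<Rightarrow> 'p vec" where "odds w = (\<lambda>i. w (Suc (2 * i)))"
definition join :: "'p::comm_ring_1 vec \<Rightarrow> 'p vec \<Rightarrow> 'p vec" where
  "join v w = (\<lambda>i. if even i then v (i div 2) else w (i div 2))"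

lemma evens_join [simp]: "evens (join v w) = v"
  by (simp add: evens_def join_def)

lemma odds_join [simp]: "odds (join v w) = w"
  by (simp add: odds_def join_def)

lemma lin_evens: "lin evens"
  by (simp add: lin_def evens_def fun_eq_iff vec_simps)

lemma lin_odds: "lin odds"
  by (simp add: lin_def odds_def fun_eq_iff vec_simps)

lemma lin_join_left: "lin (\<lambda>v. join v 0)"
  by (simp add: lin_def join_def fun_eq_iff vec_simps)

lemma lin_join_right: "lin (join 0)"
  by (simp add: lin_def join_def fun_eq_iff vec_simps)

text \<open>
  Relations of the pushout of the modules with relations \<open>I\<close> and \<open>W\<close> along
  \<open>\<iota>\<close> and \<open>g\<close>. Generators of the direct sum are interleaved, since a module can
  use any number of coordinates.
\<close>
definition pushout :: "('p::comm_ring_1 vec \<Rightarrow> 'p vec) \<Rightarrow> 'p vec set \<Rightarrow> ('p vec \<Rightarrow> 'p vec) \<Rightarrow> 'p vec set \<Rightarrow> 'p vec set" where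
  "pushout \<iota> I g W = {w. \<exists>z. evens w - \<iota> z \<in> I \<and> odds w + g z \<in> W}"

lemma submod_pushout:
  assumes "lin \<iota>" "submod I" "lin g" "submod W"
  shows "submod (pushout \<iota> I g W)"
  unfolding submod_def
proof (intro conjI ballI allI)
  show "0 \<in> pushout \<iota> I g W"
    using assms submod0 unfolding pushout_def
    by (auto simp: lin_zero lin_zero[OF lin_evens] lin_zero[OF lin_odds] intro!: exI[of _ 0])
next
  fix v w assume "v \<in> pushout \<iota> I g W" "w \<in> pushout \<iota> I g W"
  then obtain a b where *: "evens v - \<iota> a \<in> I" "evens w - \<iota> b \<in> I" "odds v + g a \<in> W" "odds w + g b \<in> W"
    unfolding pushout_def by blast
  have "evens (v + w) - \<iota> (a + b) \<in> I"
    using submod_add[OF assms(2) *(1,2)] unfolding lin_add[OF assms(1)] lin_add[OF lin_evens] by (simp add: algebra_simps)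
  moreover have "odds (v + w) + g (a + b) \<in> W"
    using submod_add[OF assms(4) *(3,4)] unfolding lin_add[OF assms(3)] lin_add[OF lin_odds] by (simp add: algebra_simps)
  ultimately show "v + w \<in> pushout \<iota> I g W" unfolding pushout_def by blast
next
  fix c v assume "v \<in> pushout \<iota> I g W"
  then obtain a where *: "evens v - \<iota> a \<in> I" "odds v + g a \<in> W" unfolding pushout_def by blast
  have "evens (c \<cdot>\<^sub>v v) - \<iota> (c \<cdot>\<^sub>v a) \<in> I"
    using submod_scale[OF assms(2) *(1), of c] unfolding scale_diff lin_scale[OF assms(1)] lin_scale[OF lin_evens] .
  moreover have "odds (c \<cdot>\<^sub>v v) + g (c \<cdot>\<^sub>v a) \<in> W"
    using submod_scale[OF assms(4) *(2), of c] unfolding scale_add lin_scale[OF assms(3)] lin_scale[OF lin_odds] .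
  ultimately show "c \<cdot>\<^sub>v v \<in> pushout \<iota> I g W" unfolding pushout_def by blast
qed

lemma fg_mod_pushout:
  assumes "lin \<iota>" "fg_mod J I" "lin g" "fg_mod J W"
  shows "fg_mod J (pushout \<iota> I g W)"
proof -
  have s: "submod I" "submod W" using assms by (simp_all add: fg_mod_def)
  obtain m n where mn: "free_rel J m \<subseteq> I" "free_rel J n \<subseteq> W" using assms by (auto simp: fg_mod_def)
  have "free_rel J (2 * (m + n)) \<subseteq> pushout \<iota> I g W"
  proof
    fix w assume w: "w \<in> free_rel J (2 * (m + n))"
    have "evens w \<in> free_rel J m" "odds w \<in> free_rel J n"
      using w by (auto simp: free_rel_def evens_def odds_def)
    then show "w \<in> pushout \<iota> I g W"
      unfolding pushout_def using mn lin_zero[OF assms(1)] lin_zero[OF assms(3)] by (auto intro!: exI[of _ 0])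
  qed
  then show ?thesis using submod_pushout[OF assms(1) s(1) assms(3) s(2)] by (auto simp: fg_mod_def)
qed

text \<open>
  A homomorphism that vanishes on the kernel of a differential is defined on the image of that differential, and
  extends from this image to the next free module by injectivity. The extension is read off from a splitting of
  the pushout.
\<close>
lemma hom_exact_injective:
  assumes J: "is_ideal J" and I: "fg_mod J I" "injective_mod J I"
    and D: "complex_mod J r D" "exact_mod J r D m"
  shows "hom_exact r D I m"
  unfolding hom_exact_def
proof (intro allI impI)
  fix h assume h: "\<forall>a<r (Suc (Suc m)). comb (r (Suc m)) (D (Suc m) a) h \<in> I"
  have sI: "submod I" using I by (simp add: fg_mod_def)
  obtain N where N: "free_rel J N \<subseteq> I" using I by (auto simp: fg_mod_def)
  let ?\<iota> = "\<lambda>c. comb (r (Suc m)) c h" and ?g = "\<lambda>c. comb (r (Suc m)) c (D m)"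
  define Y where "Y = pushout ?\<iota> I ?g (free_rel J (r m))"
  have fgY: "fg_mod J Y" unfolding Y_def
    by (rule fg_mod_pushout[OF lin_comb I(1) lin_comb fg_mod_free[OF J]])
  have sY: "submod Y" using fgY by (simp add: fg_mod_def)
  have kY: "join w 0 \<in> Y \<longleftrightarrow> w \<in> I" for w
  proof
    assume "join w 0 \<in> Y"
    then obtain c where c: "w - comb (r (Suc m)) c h \<in> I" "comb (r (Suc m)) c (D m) \<in> free_rel J (r m)"
      unfolding Y_def pushout_def by auto
    then obtain u where u: "c - comb (r (Suc (Suc m))) u (D (Suc m)) \<in> free_rel J (r (Suc m))"
      using D(2) by (auto simp: exact_mod_def)
    have "comb (r (Suc m)) (c - comb (r (Suc (Suc m))) u (D (Suc m))) h \<in> I"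
      by (rule comb_in_left[OF sI N _ J]) (use u in \<open>auto simp: free_rel_def\<close>)
    moreover have "comb (r (Suc m)) (comb (r (Suc (Suc m))) u (D (Suc m))) h \<in> I"
      unfolding comb_assoc by (rule comb_in[OF sI]) (use h in auto)
    ultimately have "comb (r (Suc m)) c h \<in> I"
      unfolding comb_diff_left using submod_add[OF sI] by fastforce
    from submod_add[OF sI c(1) this] show "w \<in> I" by simp
  next
    assume "w \<in> I"
    then show "join w 0 \<in> Y" unfolding Y_def pushout_def
      using submod0[OF submod_free_rel[OF J]] by (auto intro!: exI[of _ 0])
  qed
  obtain \<rho> where \<rho>: "lin \<rho>" "\<And>w. w \<in> Y \<Longrightarrow> \<rho> w \<in> I" "\<And>w. \<rho> (join w 0) - w \<in> I"
    using I(2) fgY lin_join_left kY unfolding injective_mod_def by metis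
  define s where "s b = \<rho> (join 0 (unit_vec b))" for b
  have "h a - comb (r m) (D m a) s \<in> I" if a: "a < r (Suc m)" for a
  proof -
    let ?c = "comb (r m) (D m a) unit_vec"
    have "join (h a) 0 - join 0 ?c \<in> Y"
      unfolding Y_def pushout_def mem_Collect_eq lin_diff[OF lin_evens] lin_diff[OF lin_odds]
    proof (rule exI[of _ "unit_vec a"], intro conjI)
      show "evens (join (h a) 0) - evens (join 0 ?c) - comb (r (Suc m)) (unit_vec a) h \<in> I"
        using a submod0[OF sI] by simp
      have "D m a - ?c \<in> free_rel J (r m)" by (rule comb_unit_diff[OF J])
      then show "odds (join (h a) 0) - odds (join 0 ?c) + comb (r (Suc m)) (unit_vec a) (D m) \<in> free_rel J (r m)"
        using a by simp
    qed
    from \<rho>(2)[OF this] have "\<rho> (join (h a) 0) - \<rho> (join 0 ?c) \<in> I" unfolding lin_diff[OF \<rho>(1)] .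
    moreover have "\<rho> (join 0 ?c) = comb (r m) (D m a) s"
      unfolding s_def lin_comb_eq[OF lin_join_right] lin_comb_eq[OF \<rho>(1)] ..
    ultimately have "\<rho> (join (h a) 0) - comb (r m) (D m a) s \<in> I" by simp
    from submod_diff[OF sI this \<rho>(3)[of "h a"]] show ?thesis by simp
  qed
  then show "\<exists>g. \<forall>a<r (Suc m). h a - comb (r m) (D m a) g \<in> I" by blast
qed

definition mod_complex :: "'p::comm_ring_1 set \<Rightarrow> nat \<Rightarrow> (nat \<Rightarrow> 'p vec set) \<Rightarrow> (nat \<Rightarrow> 'p vec \<Rightarrow> 'p vec) \<Rightarrow> bool" where
  "mod_complex J j V \<delta> \<longleftrightarrow> (\<forall>i\<le>j. fg_mod J (V i)) \<and>
     (\<forall>i<j. lin (\<delta> i) \<and> (\<forall>w\<in>V (Suc i). \<delta> i w \<in> V i)) \<and>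
     (\<forall>i. Suc i < j \<longrightarrow> (\<forall>w. \<delta> i (\<delta> (Suc i) w) \<in> V i))"

lemma trunc_cyclic_rows:
  "trunc_cyclic (dmap r D) (emap \<delta>) (Nset r V) j m \<phi> \<longleftrightarrow>
   (\<forall>i<j. \<forall>a<r (Suc (Suc (m + i))). comb (r (Suc (m + i))) (D (Suc (m + i)) a) (\<phi> i) - \<delta> i (\<phi> (Suc i) a) \<in> V i) \<and>
   (\<forall>a<r (Suc (Suc (m + j))). comb (r (Suc (m + j))) (D (Suc (m + j)) a) (\<phi> j) \<in> V j)"
  by (simp add: trunc_cyclic_def dmap_def emap_def Nset_def minus_apply)

lemma trunc_null_rows:
  "trunc_null (dmap r D) (emap \<delta>) (Nset r V) j m \<phi> \<longleftrightarrow>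
   (\<exists>s. (\<forall>i<j. \<forall>a<r (Suc (m + i)). \<phi> i a - comb (r (m + i)) (D (m + i) a) (s i) - \<delta> i (s (Suc i) a) \<in> V i) \<and>
   (\<forall>a<r (Suc (m + j)). \<phi> j a - comb (r (m + j)) (D (m + j) a) (s j) \<in> V j))"
  by (simp add: trunc_null_def dmap_def emap_def Nset_def minus_apply)

lemma comb_comb_in:
  assumes "is_ideal J" "complex_mod J r D" "fg_mod J V" "a < r (Suc (Suc k))"
  shows "comb (r (Suc k)) (D (Suc k) a) (\<lambda>b. comb (r k) (D k b) h) \<in> V"
  using dmap_dmap_in[OF assms, of h] by (simp add: dmap_def)

text \<open>
  The top module is embedded into an injective module, and the pushout in the degree below has the cokernel of
  that embedding as an additional quotient. Maps into the injective module are exact in the two degrees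
  concerned, which lets components of families and of homotopies be moved between the two complexes.
\<close>
lemma trunc_acyclic_pushout:
  fixes V :: "nat \<Rightarrow> 'p::comm_ring_1 vec set"
  assumes J: "is_ideal J" and D: "complex_mod J r D"
    and C: "mod_complex J (Suc j) V \<delta>"
    and I: "fg_mod J I" and lin: "lin \<iota>" and ker: "\<And>w. \<iota> w \<in> I \<longleftrightarrow> w \<in> V (Suc j)"
    and ex: "hom_exact r D I (m + j)" "hom_exact r D I (Suc (m + j))"
    and V': "V' = V(j := pushout \<iota> I (\<delta> j) (V j))"
    and \<delta>': "\<delta>' = (\<lambda>i w. if Suc i = j then \<delta> i (odds w) else \<delta> i w)"
  shows "trunc_acyclic_at (dmap r D) (emap \<delta>) (Nset r V) (Suc j) m \<longleftrightarrow>
         trunc_acyclic_at (dmap r D) (emap \<delta>') (Nset r V') j m"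
proof -
  have sI: "submod I" using I by (simp add: fg_mod_def)
  have fg: "fg_mod J (V i)" if "i \<le> Suc j" for i using C that by (simp add: mod_complex_def)
  then have sV: "submod (V i)" if "i \<le> Suc j" for i using that by (simp add: fg_mod_def)
  have ld: "lin (\<delta> i)" if "i \<le> j" for i using C that by (simp add: mod_complex_def)
  note le = le_refl le_SucI[OF le_refl]
  show ?thesis
  proof
    assume ac: "trunc_acyclic_at (dmap r D) (emap \<delta>) (Nset r V) (Suc j) m"
    show "trunc_acyclic_at (dmap r D) (emap \<delta>') (Nset r V') j m"
      unfolding trunc_acyclic_at_def
    proof (intro allI impI)
      fix \<phi>' assume cyc: "trunc_cyclic (dmap r D) (emap \<delta>') (Nset r V') j m \<phi>'"
      note c = cyc[unfolded trunc_cyclic_rows]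
      define x where "x a = evens (\<phi>' j a)" for a
      define c0 where "c0 a = odds (\<phi>' j a)" for a
      have "\<exists>z. comb (r (Suc (m + j))) (D (Suc (m + j)) a) x - \<iota> z \<in> I \<and>
          comb (r (Suc (m + j))) (D (Suc (m + j)) a) c0 + \<delta> j z \<in> V j"
        if a: "a < r (Suc (Suc (m + j)))" for a
      proof -
        have "comb (r (Suc (m + j))) (D (Suc (m + j)) a) (\<phi>' j) \<in> pushout \<iota> I (\<delta> j) (V j)"
          using conjunct2[OF c] a by (simp add: V')
        then show ?thesis
          unfolding pushout_def mem_Collect_eq lin_comb_eq[OF lin_evens] lin_comb_eq[OF lin_odds]
            x_def c0_def .
      qed
      then have "\<forall>a. \<exists>z. a < r (Suc (Suc (m + j))) \<longrightarrow>
          comb (r (Suc (m + j))) (D (Suc (m + j)) a) x - \<iota> z \<in> I \<and>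
          comb (r (Suc (m + j))) (D (Suc (m + j)) a) c0 + \<delta> j z \<in> V j" by blast
      from choice[OF this] obtain z where
        z: "\<And>a. a < r (Suc (Suc (m + j))) \<Longrightarrow> comb (r (Suc (m + j))) (D (Suc (m + j)) a) x - \<iota> (z a) \<in> I"
        "\<And>a. a < r (Suc (Suc (m + j))) \<Longrightarrow> comb (r (Suc (m + j))) (D (Suc (m + j)) a) c0 + \<delta> j (z a) \<in> V j" by blast
      define \<phi> where "\<phi> i = (if i = Suc j then (\<lambda>a. - z a) else if i = j then c0 else \<phi>' i)" for i
      have "trunc_cyclic (dmap r D) (emap \<delta>) (Nset r V) (Suc j) m \<phi>"
        unfolding trunc_cyclic_rows
      proof (intro conjI allI impI)
        fix i a assume i: "i < Suc j" and a: "a < r (Suc (Suc (m + i)))"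
        show "comb (r (Suc (m + i))) (D (Suc (m + i)) a) (\<phi> i) - \<delta> i (\<phi> (Suc i) a) \<in> V i"
        proof (cases "i = j")
          case True
          then show ?thesis using z(2) a lin_diff[OF ld[of j], of 0 "z a"] lin_zero[OF ld[of j]] by (simp add: \<phi>_def)
        next
          case False
          then have "i < j" using i by simp
          then have "comb (r (Suc (m + i))) (D (Suc (m + i)) a) (\<phi>' i) - \<delta>' i (\<phi>' (Suc i) a) \<in> V i"
            using c a unfolding V' by auto
          then show ?thesis using \<open>i < j\<close> by (auto simp: \<delta>' \<phi>_def c0_def)
        qed
      next
        fix a assume a: "a < r (Suc (Suc (m + Suc j)))"
        let ?k = "Suc (m + j)"
        have "comb (r (Suc ?k)) (D (Suc ?k) a) (\<lambda>b. comb (r ?k) (D ?k b) x) \<in> I"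
          by (rule comb_comb_in[OF J D I]) (use a in simp)
        moreover have "comb (r (Suc ?k)) (D (Suc ?k) a) (\<lambda>b. comb (r ?k) (D ?k b) x - \<iota> (z b)) \<in> I"
          by (rule comb_in[OF sI]) (use z in simp)
        ultimately have "comb (r (Suc ?k)) (D (Suc ?k) a) (\<lambda>b. comb (r ?k) (D ?k b) x - \<iota> (z b)) -
            comb (r (Suc ?k)) (D (Suc ?k) a) (\<lambda>b. comb (r ?k) (D ?k b) x) \<in> I"
          using submod_diff[OF sI] by blast
        then have "comb (r (Suc ?k)) (D (Suc ?k) a) (\<lambda>b. \<iota> (- z b)) \<in> I"
          unfolding lin_uminus[OF lin] comb_rows by simp
        then show "comb (r (Suc (m + Suc j))) (D (Suc (m + Suc j)) a) (\<phi> (Suc j)) \<in> V (Suc j)"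
          unfolding ker[symmetric] lin_comb_eq[OF lin] by (simp add: \<phi>_def)
      qed
      then have "trunc_null (dmap r D) (emap \<delta>) (Nset r V) (Suc j) m \<phi>"
        using ac by (simp add: trunc_acyclic_at_def)
      then obtain s where s: "\<And>i a. i < Suc j \<Longrightarrow> a < r (Suc (m + i)) \<Longrightarrow> \<phi> i a - comb (r (m + i)) (D (m + i) a) (s i) - \<delta> i (s (Suc i) a) \<in> V i"
        "\<And>a. a < r (Suc (m + Suc j)) \<Longrightarrow> \<phi> (Suc j) a - comb (r (m + Suc j)) (D (m + Suc j) a) (s (Suc j)) \<in> V (Suc j)"
        unfolding trunc_null_rows by blast
      have "comb (r (Suc (m + j))) (D (Suc (m + j)) a) (\<lambda>b. x b + \<iota> (s (Suc j) b)) \<in> I"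
        if a: "a < r (Suc (Suc (m + j)))" for a
      proof -
        have "\<iota> (- z a - comb (r (Suc (m + j))) (D (Suc (m + j)) a) (s (Suc j))) \<in> I"
          using s(2)[of a] a ker by (simp add: \<phi>_def)
        from submod_diff[OF sI z(1)[OF a] this]
        show ?thesis
          unfolding lin_diff[OF lin] lin_uminus[OF lin] lin_comb_eq[OF lin] comb_rows by simp
      qed
      then obtain u where u: "\<And>a. a < r (Suc (m + j)) \<Longrightarrow>
          x a + \<iota> (s (Suc j) a) - comb (r (m + j)) (D (m + j) a) u \<in> I"
        using ex(1) unfolding hom_exact_def by blast
      define s' where "s' i = (if i = j then (\<lambda>a. join (u a) 0 + join 0 (s j a)) else s i)" for i
      show "trunc_null (dmap r D) (emap \<delta>') (Nset r V') j m \<phi>'"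
        unfolding trunc_null_rows
      proof (intro exI[of _ s'] conjI allI impI)
        fix i a assume i: "i < j" and a: "a < r (Suc (m + i))"
        have "\<phi> i a - comb (r (m + i)) (D (m + i) a) (s i) - \<delta> i (s (Suc i) a) \<in> V i"
          using s(1)[of i a] i a by simp
        moreover have "\<phi> i = \<phi>' i" "s' i = s i" "\<delta>' i (s' (Suc i) a) = \<delta> i (s (Suc i) a)"
          using i by (auto simp: \<phi>_def s'_def \<delta>' lin_add[OF lin_odds])
        ultimately show "\<phi>' i a - comb (r (m + i)) (D (m + i) a) (s' i) - \<delta>' i (s' (Suc i) a) \<in> V' i"
          using i by (simp add: V')
      next
        fix a assume a: "a < r (Suc (m + j))"
        have e: "evens (\<phi>' j a - comb (r (m + j)) (D (m + j) a) (s' j)) = x a - comb (r (m + j)) (D (m + j) a) u"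
          by (simp add: lin_diff[OF lin_evens] lin_comb_eq[OF lin_evens] s'_def lin_add[OF lin_evens] x_def)
        have o: "odds (\<phi>' j a - comb (r (m + j)) (D (m + j) a) (s' j)) = c0 a - comb (r (m + j)) (D (m + j) a) (s j)"
          by (simp add: lin_diff[OF lin_odds] lin_comb_eq[OF lin_odds] s'_def lin_add[OF lin_odds] c0_def)
        have "x a - comb (r (m + j)) (D (m + j) a) u - \<iota> (- s (Suc j) a) \<in> I"
          using u[OF a] lin_diff[OF lin, of 0 "s (Suc j) a"] by (simp add: lin_zero[OF lin] algebra_simps)
        moreover have "c0 a - comb (r (m + j)) (D (m + j) a) (s j) + \<delta> j (- s (Suc j) a) \<in> V j"
          using s(1)[of j a] a lin_diff[OF ld[of j], of 0 "s (Suc j) a"] by (simp add: \<phi>_def lin_zero[OF ld[of j]])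
        ultimately show "\<phi>' j a - comb (r (m + j)) (D (m + j) a) (s' j) \<in> V' j"
          unfolding V' fun_upd_same pushout_def mem_Collect_eq e o by blast
      qed
    qed
  next
    assume ac: "trunc_acyclic_at (dmap r D) (emap \<delta>') (Nset r V') j m"
    show "trunc_acyclic_at (dmap r D) (emap \<delta>) (Nset r V) (Suc j) m"
      unfolding trunc_acyclic_at_def
    proof (intro allI impI)
      fix \<phi> assume cyc: "trunc_cyclic (dmap r D) (emap \<delta>) (Nset r V) (Suc j) m \<phi>"
      note c = cyc[unfolded trunc_cyclic_rows]
      have "\<forall>a<r (Suc (Suc (Suc (m + j)))). comb (r (Suc (Suc (m + j)))) (D (Suc (Suc (m + j))) a) (\<lambda>b. \<iota> (\<phi> (Suc j) b)) \<in> I"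
        using c unfolding lin_comb_eq[OF lin, symmetric] ker by simp
      then obtain t where t: "\<And>a. a < r (Suc (Suc (m + j))) \<Longrightarrow> \<iota> (\<phi> (Suc j) a) - comb (r (Suc (m + j))) (D (Suc (m + j)) a) t \<in> I"
        using ex(2) unfolding hom_exact_def by blast
      define \<phi>' where "\<phi>' i = (if i = j then (\<lambda>a. join 0 (\<phi> j a) - join (t a) 0) else \<phi> i)" for i
      have ee: "evens (\<phi>' j a) = - t a" "odds (\<phi>' j a) = \<phi> j a" for a
        by (simp_all add: \<phi>'_def lin_diff[OF lin_evens] lin_diff[OF lin_odds])
      have "trunc_cyclic (dmap r D) (emap \<delta>') (Nset r V') j m \<phi>'"
        unfolding trunc_cyclic_rows
      proof (intro conjI allI impI)
        fix i a assume i: "i < j" and a: "a < r (Suc (Suc (m + i)))"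
        have "comb (r (Suc (m + i))) (D (Suc (m + i)) a) (\<phi> i) - \<delta> i (\<phi> (Suc i) a) \<in> V i"
          using c i a by simp
        moreover have "\<phi>' i = \<phi> i" "\<delta>' i (\<phi>' (Suc i) a) = \<delta> i (\<phi> (Suc i) a)"
          using i ee by (auto simp: \<phi>'_def \<delta>')
        ultimately show "comb (r (Suc (m + i))) (D (Suc (m + i)) a) (\<phi>' i) - \<delta>' i (\<phi>' (Suc i) a) \<in> V' i"
          using i by (simp add: V')
      next
        fix a assume a: "a < r (Suc (Suc (m + j)))"
        have "- comb (r (Suc (m + j))) (D (Suc (m + j)) a) t - \<iota> (- \<phi> (Suc j) a) \<in> I"
          using t[OF a] lin_diff[OF lin, of 0 "\<phi> (Suc j) a"] by (simp add: lin_zero[OF lin])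
        moreover have "comb (r (Suc (m + j))) (D (Suc (m + j)) a) (\<phi> j) + \<delta> j (- \<phi> (Suc j) a) \<in> V j"
          using c a lin_diff[OF ld[of j], of 0 "\<phi> (Suc j) a"] by (simp add: lin_zero[OF ld[of j]])
        ultimately show "comb (r (Suc (m + j))) (D (Suc (m + j)) a) (\<phi>' j) \<in> V' j"
          unfolding V' fun_upd_same pushout_def mem_Collect_eq lin_comb_eq[OF lin_evens] lin_comb_eq[OF lin_odds] ee comb_rows
          by blast
      qed
      then have "trunc_null (dmap r D) (emap \<delta>') (Nset r V') j m \<phi>'"
        using ac by (simp add: trunc_acyclic_at_def)
      then obtain s' where s': "\<And>i a. i < j \<Longrightarrow> a < r (Suc (m + i)) \<Longrightarrow> \<phi>' i a - comb (r (m + i)) (D (m + i) a) (s' i) - \<delta>' i (s' (Suc i) a) \<in> V' i"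
        "\<And>a. a < r (Suc (m + j)) \<Longrightarrow> \<phi>' j a - comb (r (m + j)) (D (m + j) a) (s' j) \<in> V' j"
        unfolding trunc_null_rows by blast
      define x where "x a = evens (s' j a)" for a
      define c0 where "c0 a = odds (s' j a)" for a
      have "\<exists>z. - t a - comb (r (m + j)) (D (m + j) a) x - \<iota> z \<in> I \<and>
          \<phi> j a - comb (r (m + j)) (D (m + j) a) c0 + \<delta> j z \<in> V j"
        if a: "a < r (Suc (m + j))" for a
      proof -
        have "\<phi>' j a - comb (r (m + j)) (D (m + j) a) (s' j) \<in> pushout \<iota> I (\<delta> j) (V j)"
          using s'(2)[OF a] by (simp add: V')
        then show ?thesis
          unfolding pushout_def mem_Collect_eq lin_diff[OF lin_evens] lin_diff[OF lin_odds]
            lin_comb_eq[OF lin_evens] lin_comb_eq[OF lin_odds] ee x_def c0_def .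
      qed
      then have "\<forall>a. \<exists>z. a < r (Suc (m + j)) \<longrightarrow>
          - t a - comb (r (m + j)) (D (m + j) a) x - \<iota> z \<in> I \<and>
          \<phi> j a - comb (r (m + j)) (D (m + j) a) c0 + \<delta> j z \<in> V j" by blast
      from choice[OF this] obtain z where
        z: "\<And>a. a < r (Suc (m + j)) \<Longrightarrow> - t a - comb (r (m + j)) (D (m + j) a) x - \<iota> (z a) \<in> I"
        "\<And>a. a < r (Suc (m + j)) \<Longrightarrow> \<phi> j a - comb (r (m + j)) (D (m + j) a) c0 + \<delta> j (z a) \<in> V j" by blast
      define s where "s i = (if i = Suc j then (\<lambda>a. - z a) else if i = j then c0 else s' i)" for i
      show "trunc_null (dmap r D) (emap \<delta>) (Nset r V) (Suc j) m \<phi>"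
        unfolding trunc_null_rows
      proof (intro exI[of _ s] conjI allI impI)
        fix i a assume i: "i < Suc j" and a: "a < r (Suc (m + i))"
        show "\<phi> i a - comb (r (m + i)) (D (m + i) a) (s i) - \<delta> i (s (Suc i) a) \<in> V i"
        proof (cases "i = j")
          case True
          then show ?thesis using z(2)[of a] a lin_diff[OF ld[of j], of 0 "z a"] by (simp add: s_def lin_zero[OF ld[of j]])
        next
          case False
          then have "i < j" using i by simp
          then have "\<phi>' i a - comb (r (m + i)) (D (m + i) a) (s' i) - \<delta>' i (s' (Suc i) a) \<in> V i"
            using s'(1)[of i a] a by (simp add: V')
          moreover have "\<phi>' i = \<phi> i" "s i = s' i" "\<delta>' i (s' (Suc i) a) = \<delta> i (s (Suc i) a)"
            using \<open>i < j\<close> by (auto simp: \<phi>'_def s_def c0_def \<delta>')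
          ultimately show ?thesis by simp
        qed
      next
        fix a assume a: "a < r (Suc (m + Suc j))"
        let ?k = "m + j"
        have 1: "comb (r (Suc ?k)) (D (Suc ?k) a) (\<lambda>b. - t b - comb (r ?k) (D ?k b) x - \<iota> (z b)) \<in> I"
          by (rule comb_in[OF sI]) (use z in simp)
        have 2: "comb (r (Suc ?k)) (D (Suc ?k) a) (\<lambda>b. comb (r ?k) (D ?k b) x) \<in> I"
          by (rule comb_comb_in[OF J D I]) (use a in simp)
        have 3: "\<iota> (\<phi> (Suc j) a) - comb (r (Suc ?k)) (D (Suc ?k) a) t \<in> I" using t a by simp
        have dd: "comb (r (Suc ?k)) (D (Suc ?k) a) (\<lambda>b. - t b - comb (r ?k) (D ?k b) x - \<iota> (z b)) =
          - comb (r (Suc ?k)) (D (Suc ?k) a) t - comb (r (Suc ?k)) (D (Suc ?k) a) (\<lambda>b. comb (r ?k) (D ?k b) x)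
          - comb (r (Suc ?k)) (D (Suc ?k) a) (\<lambda>b. \<iota> (z b))"
          unfolding comb_rows ..
        have "\<iota> (\<phi> (Suc j) a) + comb (r (Suc ?k)) (D (Suc ?k) a) (\<lambda>b. \<iota> (z b)) \<in> I"
          using submod_diff[OF sI submod_diff[OF sI 3 1] 2] unfolding dd by simp
        then have "\<iota> (\<phi> (Suc j) a - comb (r (Suc ?k)) (D (Suc ?k) a) (\<lambda>b. - z b)) \<in> I"
          unfolding lin_diff[OF lin] lin_uminus[OF lin] lin_comb_eq[OF lin] comb_rows by simp
        then show "\<phi> (Suc j) a - comb (r (m + Suc j)) (D (m + Suc j) a) (s (Suc j)) \<in> V (Suc j)"
          unfolding ker by (simp add: s_def)
      qed
    qed
  qed
qed

text \<open>Induction on the length of the truncated complex; each pushout step removes its top module.\<close>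
lemma module_for_truncated_complex:
  assumes \<mm>: "residue_ideal \<mm>" and cs: "comp_series \<mm> J qs" and J: "is_ideal J"
    and C: "mod_complex J j V \<delta>"
  shows "\<exists>Z. fg_mod J Z \<and> (\<forall>r D m. complex_mod J r D \<longrightarrow> (\<forall>l\<ge>m. exact_mod J r D l) \<longrightarrow>
     (trunc_acyclic_at (dmap r D) (emap \<delta>) (Nset r V) j m \<longleftrightarrow> hom_exact r D Z m))"
  using C
proof (induction j arbitrary: V \<delta>)
  case 0
  then show ?case
    by (intro exI[of _ "V 0"] conjI allI impI trunc_acyclic_0) (simp add: mod_complex_def)
next
  case (Suc j)
  have fg: "fg_mod J (V i)" if "i \<le> Suc j" for i using Suc.prems that by (simp add: mod_complex_def)
  have ld: "lin (\<delta> i)" if "i \<le> j" for i using Suc.prems that by (simp add: mod_complex_def)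
  have dV: "\<delta> i w \<in> V i" if "i \<le> j" "w \<in> V (Suc i)" for i w
    using Suc.prems that by (simp add: mod_complex_def)
  have dd: "\<delta> i (\<delta> (Suc i) w) \<in> V i" if "i < j" for i w
    using Suc.prems that by (simp add: mod_complex_def)
  obtain I \<iota> where I: "fg_mod J I" "lin \<iota>" "\<And>w. \<iota> w \<in> I \<longleftrightarrow> w \<in> V (Suc j)" "injective_mod J I"
    using injective_embedding[OF \<mm> cs J fg[OF le_refl]] by blast
  define V' where "V' = V(j := pushout \<iota> I (\<delta> j) (V j))"
  define \<delta>' where "\<delta>' = (\<lambda>i w. if Suc i = j then \<delta> i (odds w) else \<delta> i w)"
  have "mod_complex J j V' \<delta>'"
    unfolding mod_complex_def
  proof (intro conjI allI impI ballI)
    fix i assume "i \<le> j"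
    then show "fg_mod J (V' i)"
      using fg fg_mod_pushout[OF I(2,1) ld[OF le_refl]] by (auto simp: V'_def)
  next
    fix i assume "i < j"
    then show "lin (\<delta>' i)" using ld[of i] lin_comp[OF ld[of i] lin_odds] by (cases "Suc i = j") (simp_all add: \<delta>'_def)
  next
    fix i w assume i: "i < j" and w: "w \<in> V' (Suc i)"
    show "\<delta>' i w \<in> V' i"
    proof (cases "Suc i = j")
      case True
      then obtain z where z: "odds w + \<delta> j z \<in> V j" using w by (auto simp: V'_def pushout_def)
      have "\<delta> i (odds w + \<delta> j z) \<in> V i" using dV[of i] z True i by simp
      moreover have "\<delta> i (\<delta> j z) \<in> V i" using dd[OF i] True by simp
      moreover have "submod (V i)" using fg[of i] i by (simp add: fg_mod_def)
      ultimately have "\<delta> i (odds w) \<in> V i"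
        using submod_diff lin_add[OF ld[of i]] i by (metis add_diff_cancel_right' less_imp_le)
      then show ?thesis using True i by (simp add: \<delta>'_def V'_def)
    next
      case False
      then show ?thesis using dV[of i w] i w by (simp add: \<delta>'_def V'_def)
    qed
  next
    fix i w assume "Suc i < j"
    then show "\<delta>' i (\<delta>' (Suc i) w) \<in> V' i" using dd[of i] by (simp add: \<delta>'_def V'_def)
  qed
  from Suc.IH[OF this] obtain Z where Z: "fg_mod J Z"
    "\<And>r D m. complex_mod J r D \<Longrightarrow> (\<forall>l\<ge>m. exact_mod J r D l) \<Longrightarrow>
      (trunc_acyclic_at (dmap r D) (emap \<delta>') (Nset r V') j m \<longleftrightarrow> hom_exact r D Z m)" by blast
  show ?case
  proof (intro exI[of _ Z] conjI allI impI)
    fix r D m assume D: "complex_mod J r D" "\<forall>l\<ge>m. exact_mod J r D l"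
    have "hom_exact r D I (m + j)" "hom_exact r D I (Suc (m + j))"
      using hom_exact_injective[OF J I(1,4) D(1)] D(2) by simp_all
    from trunc_acyclic_pushout[OF J D(1) Suc.prems I(1,2,3) this V'_def \<delta>'_def] Z(2)[OF D]
    show "trunc_acyclic_at (dmap r D) (emap \<delta>) (Nset r V) (Suc j) m \<longleftrightarrow> hom_exact r D Z m" by simp
  qed (rule Z)
qed

section \<open>Ascent along a complete regular sequence\<close>

subsection \<open>Noetherian quotients\<close>

definition noeth :: "'p::comm_ring_1 set \<Rightarrow> bool" where
  "noeth J \<longleftrightarrow> is_ideal J \<and> (\<forall>\<aa>. is_ideal \<aa> \<longrightarrow> J \<subseteq> \<aa> \<longrightarrow> (\<exists>hs. \<aa> = adjoin_list J hs))"

primrec span_list :: "'p::comm_ring_1 vec set \<Rightarrow> 'p vec list \<Rightarrow> 'p vec set" where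
  "span_list V [] = V"
| "span_list V (y # ys) = span_list (span1 V y) ys"

lemma adjoin_list_mem: "is_ideal J \<Longrightarrow> x \<in> set xs \<Longrightarrow> x \<in> adjoin_list J xs"
proof (induction xs arbitrary: J)
  case (Cons y xs)
  then show ?case
    using adjoin_self[of J y] adjoin_list_superset[of "adjoin J y" xs] ideal_adjoin[of J y] by auto
qed simp

lemma adjoin_list_least:
  "is_ideal K \<Longrightarrow> J \<subseteq> K \<Longrightarrow> set xs \<subseteq> K \<Longrightarrow> adjoin_list J xs \<subseteq> K"
proof (induction xs arbitrary: J)
  case (Cons y xs)
  then show ?case using adjoin_subset[of K J y] by simp
qed simp

lemma adjoin_list_mono: "is_ideal K \<Longrightarrow> J \<subseteq> K \<Longrightarrow> adjoin_list J xs \<subseteq> adjoin_list K xs"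
  using adjoin_list_least[of "adjoin_list K xs" J xs] adjoin_list_superset[of K xs]
    ideal_adjoin_list[of K xs] adjoin_list_mem[of K _ xs] by blast

lemma submod_span_list: "submod V \<Longrightarrow> submod (span_list V ys)"
  by (induction ys arbitrary: V) (simp_all add: submod_span1)

lemma span_list_superset: "V \<subseteq> span_list V ys"
proof (induction ys arbitrary: V)
  case (Cons y ys) then show ?case using span1_superset[of V y] by fastforce
qed simp

lemma span_list_mem: "submod V \<Longrightarrow> y \<in> set ys \<Longrightarrow> y \<in> span_list V ys"
proof (induction ys arbitrary: V)
  case (Cons z ys)
  then show ?case using span1_self[of V z] span_list_superset[of "span1 V z" ys] submod_span1[of V z] by auto
qed simp

lemma span1_least: "submod W \<Longrightarrow> V \<subseteq> W \<Longrightarrow> y \<in> W \<Longrightarrow> span1 V y \<subseteq> W"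
proof
  fix w assume W: "submod W" "V \<subseteq> W" "y \<in> W" and "w \<in> span1 V y"
  then obtain c where "w - c \<cdot>\<^sub>v y \<in> W" by (auto simp: span1_def)
  from submod_add[OF W(1) this submod_scale[OF W(1,3), of c]] show "w \<in> W" by simp
qed

lemma span_list_least: "submod W \<Longrightarrow> V \<subseteq> W \<Longrightarrow> set ys \<subseteq> W \<Longrightarrow> span_list V ys \<subseteq> W"
proof (induction ys arbitrary: V)
  case (Cons y ys) then show ?case using span1_least[of W V y] by simp
qed simp

lemma submod_comb_plus: "submod V \<Longrightarrow> submod {w. \<exists>u. w - comb s u H \<in> V}"
  unfolding submod_def[of "{w. \<exists>u. w - comb s u H \<in> V}"]
proof (intro conjI ballI allI)
  assume V: "submod V"
  show "0 \<in> {w. \<exists>u. w - comb s u H \<in> V}" using submod0[OF V] by (auto intro!: exI[of _ 0])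
  fix v w assume "v \<in> {w. \<exists>u. w - comb s u H \<in> V}" "w \<in> {w. \<exists>u. w - comb s u H \<in> V}"
  then obtain a b where "v - comb s a H \<in> V" "w - comb s b H \<in> V" by auto
  from submod_add[OF V this] have "(v + w) - comb s (a + b) H \<in> V"
    unfolding comb_add_left by (simp add: algebra_simps)
  then show "v + w \<in> {w. \<exists>u. w - comb s u H \<in> V}" by blast
next
  assume V: "submod V"
  fix c v assume "v \<in> {w. \<exists>u. w - comb s u H \<in> V}"
  then obtain a where "v - comb s a H \<in> V" by auto
  from submod_scale[OF V this, of c] have "c \<cdot>\<^sub>v v - comb s (c \<cdot>\<^sub>v a) H \<in> V"
    unfolding comb_scale_left scale_diff .
  then show "c \<cdot>\<^sub>v v \<in> {w. \<exists>u. w - comb s u H \<in> V}" by blast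
qed

lemma span_list_comb:
  assumes V: "submod V"
  shows "span_list V ys = {w. \<exists>u. w - comb (length ys) u (\<lambda>a. ys ! a) \<in> V}" (is "_ = ?R")
proof
  show "span_list V ys \<subseteq> ?R"
  proof (rule span_list_least[OF submod_comb_plus[OF V]])
    show "V \<subseteq> ?R" by (auto intro!: exI[of _ 0])
    show "set ys \<subseteq> ?R"
    proof
      fix y assume "y \<in> set ys"
      then obtain a where "a < length ys" "y = ys ! a" by (auto simp: in_set_conv_nth)
      then show "y \<in> ?R" using submod0[OF V] by (auto intro!: exI[of _ "unit_vec a"])
    qed
  qed
  show "?R \<subseteq> span_list V ys"
  proof
    fix w assume "w \<in> ?R"
    then obtain u where u: "w - comb (length ys) u (\<lambda>a. ys ! a) \<in> span_list V ys"
      using span_list_superset[of V ys] by auto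
    have "comb (length ys) u (\<lambda>a. ys ! a) \<in> span_list V ys"
      by (rule comb_in[OF submod_span_list[OF V]]) (use span_list_mem[OF V] in auto)
    from submod_add[OF submod_span_list[OF V] u this] show "w \<in> span_list V ys" by simp
  qed
qed

text \<open>
  Hilbert's basis argument for submodules of a free module: the last coordinates of the elements form a finitely
  generated ideal.
\<close>
lemma noeth_submod_fg:
  assumes J: "noeth J" and V: "submod V" "free_rel J n \<subseteq> V"
  shows "\<exists>ys. V = span_list (free_rel J n) ys"
  using V
proof (induction n arbitrary: V)
  case 0
  then have "V = free_rel J 0" by (auto simp: free_rel_def)
  then show ?case by (intro exI[of _ "[]"]) simp
next
  case (Suc n)
  have idJ: "is_ideal J" using J by (simp add: noeth_def)
  note sV = Suc.prems(1)
  define zap where "zap w = w(n := 0)" for w :: "'a vec"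
  have zap_lin: "lin zap" by (auto simp: lin_def zap_def fun_eq_iff vec_simps)
  have zap_V: "zap w \<in> V" if w: "w \<in> V" "w n \<in> J" for w
  proof -
    have "w - zap w \<in> free_rel J (Suc n)" using w ideal0[OF idJ] by (auto simp: free_rel_def zap_def vec_simps)
    then have "w - zap w \<in> V" using Suc.prems by blast
    from submod_diff[OF sV w(1) this] show ?thesis by simp
  qed
  let ?\<aa> = "{c. \<exists>v\<in>V. v n - c \<in> J}"
  have "is_ideal ?\<aa>"
    unfolding is_ideal_def
  proof (intro conjI ballI allI)
    show "0 \<in> ?\<aa>" using submod0[OF sV] ideal0[OF idJ] by (auto simp: vec_simps intro!: bexI[of _ 0])
  next
    fix a b assume "a \<in> ?\<aa>" "b \<in> ?\<aa>"
    then obtain v w where vw: "v \<in> V" "w \<in> V" and "v n - a \<in> J" "w n - b \<in> J" by auto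
    from ideal_add[OF idJ this(3,4)] have "(v + w) n - (a + b) \<in> J" by (simp add: vec_simps algebra_simps)
    then show "a + b \<in> ?\<aa>" using submod_add[OF sV vw] by blast
  next
    fix c a assume "a \<in> ?\<aa>"
    then obtain v where v: "v \<in> V" and "v n - a \<in> J" by auto
    from ideal_mult(1)[OF idJ this(2), of c] have "(c \<cdot>\<^sub>v v) n - c * a \<in> J" by (simp add: vec_simps algebra_simps)
    then show "c * a \<in> ?\<aa>" using submod_scale[OF sV v] by blast
  qed
  moreover have "J \<subseteq> ?\<aa>"
    using submod0[OF sV] ideal_uminus[OF idJ] by (auto simp: vec_simps intro!: bexI[of _ 0])
  ultimately obtain hs where hs: "?\<aa> = adjoin_list J hs" using J unfolding noeth_def by blast
  have "\<forall>h. \<exists>v. h \<in> set hs \<longrightarrow> v \<in> V \<and> v n - h \<in> J"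
    using adjoin_list_mem[OF idJ, of _ hs] unfolding hs[symmetric] by blast
  then obtain l where l: "\<And>h. h \<in> set hs \<Longrightarrow> l h \<in> V \<and> l h n - h \<in> J" by metis
  let ?V' = "{w. zap w \<in> V}"
  have "free_rel J n \<subseteq> ?V'"
  proof
    fix w assume "w \<in> free_rel J n"
    then have "zap w \<in> free_rel J (Suc n)" using ideal0[OF idJ] by (auto simp: free_rel_def zap_def less_Suc_eq)
    then show "w \<in> ?V'" using Suc.prems by blast
  qed
  from Suc.IH[OF submod_vimage[OF zap_lin sV] this] obtain zs where zs: "?V' = span_list (free_rel J n) zs" by blast
  note sf = submod_free_rel[OF idJ, of "Suc n"] and sfn = submod_free_rel[OF idJ, of n]
  define ys where "ys = map zap zs @ map l hs"
  define S where "S = span_list (free_rel J (Suc n)) ys"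
  have sS: "submod S" unfolding S_def by (rule submod_span_list[OF sf])
  have frS: "free_rel J (Suc n) \<subseteq> S" unfolding S_def by (rule span_list_superset)
  have ysS: "y \<in> S" if "y \<in> set ys" for y unfolding S_def by (rule span_list_mem[OF sf that])
  have ysV: "set ys \<subseteq> V"
  proof -
    have "zap z \<in> V" if "z \<in> set zs" for z using span_list_mem[OF sfn that] zs by blast
    then show ?thesis using l by (auto simp: ys_def)
  qed
  have "S \<subseteq> V" unfolding S_def by (rule span_list_least[OF sV Suc.prems(2) ysV])
  moreover have "V \<subseteq> S"
  proof
    fix w assume w: "w \<in> V"
    let ?B = "{c. \<exists>v\<in>S. v n - c \<in> J}"
    have "is_ideal ?B"
      unfolding is_ideal_def
    proof (intro conjI ballI allI)
      show "0 \<in> ?B" using submod0[OF sS] ideal0[OF idJ] by (auto simp: vec_simps intro!: bexI[of _ 0])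
    next
      fix a b assume "a \<in> ?B" "b \<in> ?B"
      then obtain v w where vw: "v \<in> S" "w \<in> S" and "v n - a \<in> J" "w n - b \<in> J" by auto
      from ideal_add[OF idJ this(3,4)] have "(v + w) n - (a + b) \<in> J" by (simp add: vec_simps algebra_simps)
      then show "a + b \<in> ?B" using submod_add[OF sS vw] by blast
    next
      fix c a assume "a \<in> ?B"
      then obtain v where v: "v \<in> S" and "v n - a \<in> J" by auto
      from ideal_mult(1)[OF idJ this(2), of c] have "(c \<cdot>\<^sub>v v) n - c * a \<in> J" by (simp add: vec_simps algebra_simps)
      then show "c * a \<in> ?B" using submod_scale[OF sS v] by blast
    qed
    moreover have "J \<subseteq> ?B"
      using submod0[OF sS] ideal_uminus[OF idJ] by (auto simp: vec_simps intro!: bexI[of _ 0])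
    moreover have "set hs \<subseteq> ?B"
    proof
      fix h assume "h \<in> set hs"
      then show "h \<in> ?B" using l[of h] ysS[of "l h"] by (auto simp: ys_def)
    qed
    ultimately have "?\<aa> \<subseteq> ?B" unfolding hs by (rule adjoin_list_least)
    moreover have "w n \<in> ?\<aa>" using w ideal0[OF idJ] by (auto intro!: bexI[of _ w])
    ultimately obtain v where v: "v \<in> S" "v n - w n \<in> J" by blast
    have wv: "w - v \<in> V" "(w - v) n \<in> J"
      using submod_diff[OF sV w, of v] v \<open>S \<subseteq> V\<close> ideal_uminus[OF idJ v(2)] by (auto simp: vec_simps)
    have "span_list (free_rel J n) zs \<subseteq> {u. zap u \<in> S}"
    proof (rule span_list_least[OF submod_vimage[OF zap_lin sS]])
      show "free_rel J n \<subseteq> {u. zap u \<in> S}"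
      proof
        fix w assume "w \<in> free_rel J n"
        then have "zap w \<in> free_rel J (Suc n)" using ideal0[OF idJ] by (auto simp: free_rel_def zap_def less_Suc_eq)
        then show "w \<in> {u. zap u \<in> S}" using frS by blast
      qed
      show "set zs \<subseteq> {u. zap u \<in> S}" using ysS by (auto simp: ys_def)
    qed
    then have "zap (w - v) \<in> S" using zap_V[OF wv] unfolding zs[symmetric] by auto
    moreover have "(w - v) - zap (w - v) \<in> free_rel J (Suc n)"
      using wv(2) ideal0[OF idJ] by (auto simp: free_rel_def zap_def vec_simps)
    ultimately have "((w - v) - zap (w - v)) + zap (w - v) \<in> S" using frS submod_add[OF sS] by blast
    then have "w - v \<in> S" by simp
    from submod_add[OF sS this v(1)] show "w \<in> S" by simp
  qed
  ultimately show ?case unfolding S_def by blast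
qed

lemma noeth_mono:
  assumes J: "noeth J" and K: "is_ideal K" "J \<subseteq> K"
  shows "noeth K"
  unfolding noeth_def
proof (intro conjI allI impI)
  fix \<aa> assume a: "is_ideal \<aa>" "K \<subseteq> \<aa>"
  then obtain hs where hs: "\<aa> = adjoin_list J hs" using J K unfolding noeth_def by blast
  have idJ: "is_ideal J" using J by (simp add: noeth_def)
  have "adjoin_list K hs \<subseteq> \<aa>"
    by (rule adjoin_list_least[OF a]) (use adjoin_list_mem[OF idJ] hs in blast)
  moreover have "\<aa> \<subseteq> adjoin_list K hs" unfolding hs by (rule adjoin_list_mono[OF K])
  ultimately show "\<exists>hs. \<aa> = adjoin_list K hs" by blast
qed (rule K)

lemma noeth_maximal:
  assumes J: "noeth J" and A: "A \<noteq> {}" "\<And>\<aa>. \<aa> \<in> A \<Longrightarrow> is_ideal \<aa> \<and> J \<subseteq> \<aa>"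
  obtains M where "M \<in> A" "\<And>X. X \<in> A \<Longrightarrow> M \<subseteq> X \<Longrightarrow> X = M"
proof -
  have "\<exists>M\<in>A. \<forall>X\<in>A. M \<subseteq> X \<longrightarrow> X = M"
  proof (rule subset_Zorn_nonempty[OF A(1)])
    fix C assume C: "C \<noteq> {}" "subset.chain A C"
    have mem: "\<And>U. U \<in> C \<Longrightarrow> is_ideal U \<and> J \<subseteq> U \<and> U \<in> A" using C(2) A(2) by (auto simp: subset_chain_def)
    have tot: "\<And>U U'. U \<in> C \<Longrightarrow> U' \<in> C \<Longrightarrow> U \<subseteq> U' \<or> U' \<subseteq> U" using C(2) by (auto simp: subset_chain_def)
    have idU: "is_ideal (\<Union>C)"
      unfolding is_ideal_def
    proof (intro conjI ballI allI)
      show "0 \<in> \<Union>C" using C(1) mem ideal0 by blast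
    next
      fix v w assume "v \<in> \<Union>C" "w \<in> \<Union>C"
      then obtain U where "U \<in> C" "v \<in> U" "w \<in> U" using tot by blast
      then show "v + w \<in> \<Union>C" using mem ideal_add by blast
    next
      fix c v assume "v \<in> \<Union>C"
      then show "c * v \<in> \<Union>C" using mem ideal_mult by blast
    qed
    moreover have JU: "J \<subseteq> \<Union>C" using C(1) mem by blast
    ultimately obtain hs where hs: "\<Union>C = adjoin_list J hs" using J unfolding noeth_def by blast
    have idJ: "is_ideal J" using J by (simp add: noeth_def)
    have "set hs \<subseteq> \<Union>C" using adjoin_list_mem[OF idJ] hs by blast
    then have "\<exists>U\<in>C. set hs \<subseteq> U"
    proof (induction hs)
      case Nil then show ?case using C(1) by auto
    next
      case (Cons h hs)
      then obtain U U' where "U \<in> C" "set hs \<subseteq> U" "U' \<in> C" "h \<in> U'" by auto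
      then show ?case using tot[of U U'] by auto
    qed
    then obtain U where U: "U \<in> C" "set hs \<subseteq> U" by blast
    then have "\<Union>C \<subseteq> U" unfolding hs using mem adjoin_list_least by blast
    then have "\<Union>C = U" using U by blast
    then show "\<Union>C \<in> A" using mem U by simp
  qed
  then obtain M where M: "M \<in> A" and mx: "\<forall>X\<in>A. M \<subseteq> X \<longrightarrow> X = M" by (rule bexE)
  show thesis by (rule that[OF M]) (use mx in simp)
qed

lemma noeth_chain_stable:
  assumes J: "noeth J" and K: "\<And>i. is_ideal (K i)" "\<And>i. J \<subseteq> K i" "\<And>i. K i \<subseteq> K (Suc i)"
  obtains N where "\<And>i. N \<le> i \<Longrightarrow> K i = K N"
proof -
  have "is_ideal \<aa> \<and> J \<subseteq> \<aa>" if "\<aa> \<in> range K" for \<aa> using that K(1,2) by blast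
  then obtain M where M: "M \<in> range K" "\<And>X. X \<in> range K \<Longrightarrow> M \<subseteq> X \<Longrightarrow> X = M"
    by (rule noeth_maximal[OF J, of "range K", rotated]) blast+
  then obtain N where N: "M = K N" by auto
  have "K N \<subseteq> K i" if "N \<le> i" for i using lift_Suc_mono_le[of K, OF K(3) that] .
  then show thesis using M(2) N by (intro that[of N]) auto
qed

subsection \<open>Free resolutions\<close>

definition resolution_mod :: "'p::comm_ring_1 set \<Rightarrow> (nat \<Rightarrow> nat) \<Rightarrow> (nat \<Rightarrow> nat \<Rightarrow> 'p vec) \<Rightarrow> bool" where
  "resolution_mod J r D \<longleftrightarrow> complex_mod J r D \<and> (\<forall>m. exact_mod J r D m)"

lemma noeth_presentation:
  assumes J: "noeth J" and V: "submod V" "free_rel J n \<subseteq> V"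
  shows "\<exists>s H. V = {w. \<exists>u. w - comb s u H \<in> free_rel J n}"
proof -
  have idJ: "is_ideal J" using J by (simp add: noeth_def)
  obtain ys where ys: "V = span_list (free_rel J n) ys" using noeth_submod_fg[OF J V] by blast
  show ?thesis unfolding ys span_list_comb[OF submod_free_rel[OF idJ]] by blast
qed

lemma resolution_exists:
  assumes J: "noeth J" and V: "submod V" "free_rel J n \<subseteq> V"
  obtains f F where "f 0 = n" "resolution_mod J f F"
    "V = {w. \<exists>u. w - comb (f (Suc 0)) u (F 0) \<in> free_rel J n}"
proof -
  have idJ: "is_ideal J" using J by (simp add: noeth_def)
  obtain s0 H0 where s0: "V = {w. \<exists>u. w - comb s0 u H0 \<in> free_rel J n}"
    using noeth_presentation[OF J V] by blast
  define P :: "nat \<Rightarrow> nat \<times> nat \<times> (nat \<Rightarrow> 'a vec) \<Rightarrow> bool" where "P i t \<longleftrightarrow> (i = 0 \<longrightarrow> t = (n, s0, H0))" for i t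
  define Q :: "nat \<Rightarrow> nat \<times> nat \<times> (nat \<Rightarrow> 'a vec) \<Rightarrow> nat \<times> nat \<times> (nat \<Rightarrow> 'a vec) \<Rightarrow> bool" where
    "Q i t t' \<longleftrightarrow> fst t' = fst (snd t) \<and>
       {w. comb (fst (snd t)) w (snd (snd t)) \<in> free_rel J (fst t)} =
       {w. \<exists>u. w - comb (fst (snd t')) u (snd (snd t')) \<in> free_rel J (fst t')}" for i t t'
  have "\<exists>f. \<forall>i. P i (f i) \<and> Q i (f i) (f (Suc i))"
  proof (rule dependent_nat_choice)
    show "\<exists>x. P 0 x" by (simp add: P_def)
  next
    fix t :: "nat \<times> nat \<times> (nat \<Rightarrow> 'a vec)" and i
    obtain k s H where t: "t = (k, s, H)" by (cases t)
    let ?K = "{w. comb s w H \<in> free_rel J k}"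
    have "submod ?K" by (rule submod_vimage[OF lin_comb submod_free_rel[OF idJ]])
    moreover have "free_rel J s \<subseteq> ?K"
    proof
      fix w assume "w \<in> free_rel J s"
      then have "w a \<in> J" if "a < s" for a using that by (simp add: free_rel_def)
      then show "w \<in> ?K"
        using comb_in_left[OF submod_free_rel[OF idJ, of k] order_refl _ idJ] by blast
    qed
    ultimately obtain s' H' where "?K = {w. \<exists>u. w - comb s' u H' \<in> free_rel J s}"
      using noeth_presentation[OF J] by blast
    then show "\<exists>t'. P (Suc i) t' \<and> Q i t t'"
      by (intro exI[of _ "(s, s', H')"]) (simp add: P_def Q_def t)
  qed
  then obtain T where T: "\<And>i. P i (T i)" "\<And>i. Q i (T i) (T (Suc i))" by blast
  define f where "f i = fst (T i)" for i
  define F where "F i = snd (snd (T i))" for i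
  have f1: "fst (snd (T i)) = f (Suc i)" for i using T(2)[of i] by (simp add: Q_def f_def)
  have eq: "{w. comb (f (Suc i)) w (F i) \<in> free_rel J (f i)} =
      {w. \<exists>u. w - comb (f (Suc (Suc i))) u (F (Suc i)) \<in> free_rel J (f (Suc i))}" for i
    using T(2)[of i] unfolding Q_def f1 by (simp add: f_def F_def)
  have T0: "T 0 = (n, s0, H0)" using T(1)[of 0] by (simp add: P_def)
  show thesis
  proof (rule that[of f F])
    show "f 0 = n" using T0 by (simp add: f_def)
    show "V = {w. \<exists>u. w - comb (f (Suc 0)) u (F 0) \<in> free_rel J n}"
      unfolding s0 f1[symmetric] F_def T0 by simp
    show "resolution_mod J f F"
      unfolding resolution_mod_def complex_mod_def exact_mod_def
    proof (intro conjI allI impI)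
      fix m a assume a: "a < f (Suc (Suc m))"
      have "F (Suc m) a - comb (f (Suc (Suc m))) (unit_vec a) (F (Suc m)) \<in> free_rel J (f (Suc m))"
        using a submod0[OF submod_free_rel[OF idJ]] by simp
      then show "comb (f (Suc m)) (F (Suc m) a) (F m) \<in> free_rel J (f m)" using eq[of m] by blast
    next
      fix m w assume "comb (f (Suc m)) w (F m) \<in> free_rel J (f m)"
      then show "\<exists>u. w - comb (f (Suc (Suc m))) u (F (Suc m)) \<in> free_rel J (f (Suc m))" using eq[of m] by blast
    qed
  qed
qed

text \<open>
  For a free resolution \<open>D\<close> of a module \<open>M\<close>: whenever \<open>Ext(M, V)\<close>
  vanishes eventually, it vanishes in all degrees above \<open>b\<close>.
\<close>
definition bounded_at :: "'p::comm_ring_1 set \<Rightarrow> (nat \<Rightarrow> nat) \<Rightarrow> (nat \<Rightarrow> nat \<Rightarrow> 'p vec) \<Rightarrow> nat \<Rightarrow> bool" where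
  "bounded_at J r D b \<longleftrightarrow>
     (\<forall>V. fg_mod J V \<longrightarrow> (\<exists>n. \<forall>m\<ge>n. hom_exact r D V m) \<longrightarrow> (\<forall>m\<ge>b. hom_exact r D V m))"

lemma hom_exact_shift:
  "hom_exact (\<lambda>i. r (i + d)) (\<lambda>i. D (i + d)) V m \<longleftrightarrow> hom_exact r D V (m + d)"
  by (simp add: hom_exact_def)

text \<open>
  Reduction modulo a regular sequence keeps a resolution exact from the degree given by the length of the
  sequence on.
\<close>
lemma resolution_shift:
  assumes "is_ideal J" "resolution_mod J r D" "regular_seq J xs"
  shows "resolution_mod (adjoin_list J xs) (\<lambda>i. r (i + length xs)) (\<lambda>i. D (i + length xs))"
proof -
  have "exact_mod (adjoin_list J xs) r D m" if "length xs \<le> m" for m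
    using exact_mod_adjoin_list[OF assms(1) _ assms(3), of r D 0 m] assms(2) that by (simp add: resolution_mod_def)
  moreover have "complex_mod (adjoin_list J xs) r D"
    using complex_mod_adjoin_list[OF assms(1)] assms(2) by (simp add: resolution_mod_def)
  ultimately show ?thesis by (simp add: resolution_mod_def complex_mod_def exact_mod_def)
qed

theorem bounded_at_ascent:
  assumes J: "noeth J" and xs: "regular_seq J xs" "complete_seq J xs"
    and \<mm>: "residue_ideal \<mm>" and cs: "comp_series \<mm> (adjoin_list J xs) qs"
    and D: "resolution_mod J r D"
    and b: "bounded_at (adjoin_list J xs) (\<lambda>i. r (i + length xs)) (\<lambda>i. D (i + length xs)) b"
  shows "bounded_at J r D (b + length xs)"
  unfolding bounded_at_def
proof (intro allI impI)
  fix V m assume V: "fg_mod J V" and ev: "\<exists>n. \<forall>m\<ge>n. hom_exact r D V m" and m: "b + length xs \<le> m"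
  let ?K = "adjoin_list J xs" and ?d = "length xs"
  have idJ: "is_ideal J" using J by (simp add: noeth_def)
  have idK: "is_ideal ?K" by (rule ideal_adjoin_list[OF idJ])
  obtain n where n: "free_rel J n \<subseteq> V" and sV: "submod V" using V by (auto simp: fg_mod_def)
  obtain f F where f0: "f 0 = n" and F: "resolution_mod J f F"
    and VF: "V = {w. \<exists>u. w - comb (f (Suc 0)) u (F 0) \<in> free_rel J n}"
    by (rule resolution_exists[OF J sV n])
  have cD: "complex_mod J r D" and cF: "complex_mod J f F" and exF: "\<And>i. exact_mod J f F i"
    and exD: "\<And>i. exact_mod J r D i"
    using D F by (simp_all add: resolution_mod_def)
  have VF': "V = {w. \<exists>u. w - mat_map f F 0 u \<in> free_rel J (f 0)}"
    using VF by (simp add: mat_map_def f0)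
  have hV: "hom_exact r D V l \<longleftrightarrow> hom_acyclic J r D f F l" for l
    by (rule hom_exact_iff_acyclic[OF idJ cD cF exF VF'])
  have cDK: "complex_mod ?K r D" and cFK: "complex_mod ?K f F"
    using complex_mod_adjoin_list[OF idJ] cD cF by blast+
  have exDK: "exact_mod ?K r D l" and exFK: "exact_mod ?K f F l" if "?d \<le> l" for l
    using exact_mod_adjoin_list[OF idJ _ xs(1), of _ _ 0 l] cD cF exD exF that by simp_all
  \<comment> \<open>\<open>F\<close> is exact modulo the sequence from degree \<open>?d\<close> on, so it is truncated there.\<close>
  define W where "W i = (if i = ?d then {w. \<exists>u. w - mat_map f F ?d u \<in> free_rels ?K f ?d} else free_rels ?K f i)" for i
  have hK: "hom_acyclic ?K r D f F l \<longleftrightarrow> trunc_acyclic_at (dmap r D) (emap (mat_map f F)) (Nset r W) ?d l" for l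
    unfolding W_def by (rule hom_acyclic_iff_trunc[OF idK cDK cFK exFK])
  have "mod_complex ?K ?d W (mat_map f F)"
    unfolding mod_complex_def
  proof (intro conjI allI impI ballI)
    fix i assume "i \<le> ?d"
    have "free_rel ?K (f ?d) \<subseteq> {w. \<exists>u. w - mat_map f F ?d u \<in> free_rels ?K f ?d}"
      by (auto simp: free_rels_def mat_map_def intro!: exI[of _ 0])
    moreover have "submod {w. \<exists>u. w - mat_map f F ?d u \<in> free_rels ?K f ?d}"
      unfolding mat_map_def free_rels_def by (rule submod_comb_plus[OF submod_free_rel[OF idK]])
    ultimately have "fg_mod ?K {w. \<exists>u. w - mat_map f F ?d u \<in> free_rels ?K f ?d}"
      unfolding fg_mod_def by blast
    then show "fg_mod ?K (W i)" using fg_mod_free[OF idK] by (simp add: W_def free_rels_def)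
  next
    fix i w assume i: "i < ?d" and w: "w \<in> W (Suc i)"
    show "mat_map f F i w \<in> W i"
    proof (cases "Suc i = ?d")
      case True
      then obtain u where u: "w - mat_map f F (Suc i) u \<in> free_rels ?K f (Suc i)" using w by (auto simp: W_def)
      have s: "submod (free_rels ?K f i)" unfolding free_rels_def by (rule submod_free_rel[OF idK])
      have "mat_map f F i (w - mat_map f F (Suc i) u) \<in> free_rels ?K f i" by (rule mat_map_free_rels[OF idK u])
      from submod_add[OF s this mat_map_mat_map[OF idK cFK, of i u]] show ?thesis
        using i by (simp add: lin_diff[OF lin_mat_map] W_def)
    next
      case False
      then show ?thesis using mat_map_free_rels[OF idK, of w f i F] w i by (simp add: W_def)
    qed
  next
    fix i w assume "Suc i < ?d"
    then show "mat_map f F i (mat_map f F (Suc i) w) \<in> W i"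
      using mat_map_mat_map[OF idK cFK] by (simp add: W_def)
  qed (rule lin_mat_map)
  from module_for_truncated_complex[OF \<mm> cs idK this] obtain Z where Z: "fg_mod ?K Z"
    "\<And>l. ?d \<le> l \<Longrightarrow> trunc_acyclic_at (dmap r D) (emap (mat_map f F)) (Nset r W) ?d l \<longleftrightarrow> hom_exact r D Z l"
    using cDK exDK by (meson order_trans)
  from ev obtain n0 where n0: "\<And>l. n0 \<le> l \<Longrightarrow> hom_acyclic J r D f F l" unfolding hV by blast
  have "hom_acyclic ?K r D f F l" if "n0 \<le> l" for l
    by (rule hom_acyclic_adjoin_list[OF idJ cD cF xs(1) n0 that])
  then have "hom_exact r D Z l" if "n0 + ?d \<le> l" for l using Z(2)[of l] hK that by simp
  then have "\<forall>l\<ge>n0. hom_exact (\<lambda>i. r (i + ?d)) (\<lambda>i. D (i + ?d)) Z l" by (simp add: hom_exact_shift)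
  then have "\<forall>l\<ge>b. hom_exact (\<lambda>i. r (i + ?d)) (\<lambda>i. D (i + ?d)) Z l"
    using b Z(1) unfolding bounded_at_def by blast
  then have "hom_exact r D Z m"
    using m hom_exact_shift[of r ?d D Z "m - ?d"] by (auto simp: le_diff_conv2)
  then have "hom_acyclic ?K r D f F m" using Z(2)[of m] hK m by simp
  then show "hom_exact r D V m" unfolding hV by (rule hom_acyclic_lift_list[OF idJ cD cF xs])
qed

section \<open>Descent along a regular element\<close>

definition block :: "nat \<Rightarrow> 'p::comm_ring_1 vec \<Rightarrow> 'p vec \<Rightarrow> 'p vec" where
  "block k v w = (\<lambda>i. if i < k then v i else w (i - k))"

lemma block_free_rel: "block k v w \<in> free_rel J (k + l) \<longleftrightarrow> v \<in> free_rel J k \<and> w \<in> free_rel J l"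
proof
  assume a: "block k v w \<in> free_rel J (k + l)"
  have "v i \<in> J" if "i < k" for i using a that by (auto simp: free_rel_def block_def dest!: spec[of _ i])
  moreover have "w i \<in> J" if "i < l" for i using a that by (auto simp: free_rel_def block_def dest!: spec[of _ "k + i"])
  ultimately show "v \<in> free_rel J k \<and> w \<in> free_rel J l" by (simp add: free_rel_def)
qed (auto simp: free_rel_def block_def)

lemma comb_block_rows: "comb r w (\<lambda>a. block k (A a) (B a)) = block k (comb r w A) (comb r w B)"
  by (auto simp: comb_def block_def fun_eq_iff)

lemma block_add: "block k v w + block k v' w' = block k (v + v') (w + w')"
  by (auto simp: block_def fun_eq_iff vec_simps)

lemma block_diff: "block k v w - block k v' w' = block k (v - v') (w - w')"
  by (auto simp: block_def fun_eq_iff vec_simps)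

lemma comb_split: "comb (k + l) w A = comb k w A + comb l (\<lambda>i. w (k + i)) (\<lambda>i. A (k + i))"
proof -
  have "(\<lambda>a. if a < k then A a else A (k + (a - k))) = A" by auto
  then show ?thesis using comb_append[of k l w A "\<lambda>i. A (k + i)"] by simp
qed

lemma scale_uminus: "c \<cdot>\<^sub>v (- w) = - (c \<cdot>\<^sub>v w)"
  by (simp add: fun_eq_iff vec_simps)

lemma comb_block: "comb (k + l) (block k v w) A = comb k v A + comb l w (\<lambda>i. A (k + i))"
  unfolding comb_split by (rule arg_cong2[of _ _ _ _ "(+)"]; rule comb_cong) (simp_all add: block_def)

definition lift_rank :: "(nat \<Rightarrow> nat) \<Rightarrow> nat \<Rightarrow> nat" where
  "lift_rank r n = r n + (case n of 0 \<Rightarrow> 0 | Suc l \<Rightarrow> r l)"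

text \<open>
  Eisenbud's construction. In degree \<open>n\<close> the module is \<open>F\<^sub>n \<oplus>
  F\<^bsub>n-1\<^esub>\<close>, and the differential sends \<open>(f, g)\<close> to \<open>(D f + x g, - H f - D
  g)\<close>, where \<open>D D = x H\<close>. It squares to zero because \<open>D H = H D\<close>.
\<close>
definition lift_diff :: "'p::comm_ring_1 \<Rightarrow> (nat \<Rightarrow> nat) \<Rightarrow> (nat \<Rightarrow> nat \<Rightarrow> 'p vec) \<Rightarrow> (nat \<Rightarrow> nat \<Rightarrow> 'p vec) \<Rightarrow> nat \<Rightarrow> nat \<Rightarrow> 'p vec" where
  "lift_diff x r D H n a =
     (if a < r (Suc n) then block (r n) (D n a) (- H (n - 1) a)
      else block (r n) (x \<cdot>\<^sub>v unit_vec (a - r (Suc n))) (- D (n - 1) (a - r (Suc n))))"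

lemma lift_rank_0 [simp]: "lift_rank r 0 = r 0"
  by (simp add: lift_rank_def)

lemma lift_rank_Suc [simp]: "lift_rank r (Suc n) = r (Suc n) + r n"
  by (simp add: lift_rank_def)

lemma comb_lift_diff:
  "comb (r (Suc n) + r n) w (lift_diff x r D H n) =
     block (r n) (comb (r (Suc n)) w (D n) + x \<cdot>\<^sub>v comb (r n) (\<lambda>i. w (r (Suc n) + i)) unit_vec)
       (- comb (r (Suc n)) w (H (n - 1)) - comb (r n) (\<lambda>i. w (r (Suc n) + i)) (D (n - 1)))"
proof -
  have "comb (r (Suc n)) w (lift_diff x r D H n) = comb (r (Suc n)) w (\<lambda>a. block (r n) (D n a) (- H (n - 1) a))"
    by (rule comb_cong) (simp_all add: lift_diff_def)
  moreover have "comb (r n) (\<lambda>i. w (r (Suc n) + i)) (\<lambda>i. lift_diff x r D H n (r (Suc n) + i)) =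
      comb (r n) (\<lambda>i. w (r (Suc n) + i)) (\<lambda>i. block (r n) (x \<cdot>\<^sub>v unit_vec i) (- D (n - 1) i))"
    by (rule comb_cong) (simp_all add: lift_diff_def)
  ultimately show ?thesis
    unfolding comb_split comb_block_rows comb_rows comb_scale_right by (simp add: block_add)
qed

locale descent =
  fixes J :: "'p::comm_ring_1 set" and x r D H
  assumes J: "is_ideal J" and x: "regular_mod J x" and res: "resolution_mod (adjoin J x) r D"
    and H: "\<And>m a. a < r (Suc (Suc m)) \<Longrightarrow> comb (r (Suc m)) (D (Suc m) a) (D m) - x \<cdot>\<^sub>v H m a \<in> free_rel J (r m)"
begin

abbreviation "R \<equiv> lift_rank r"
abbreviation "G \<equiv> lift_diff x r D H"

lemma sub: "submod (free_rel J n)"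
  by (rule submod_free_rel[OF J])

lemma H_comb: "comb (r (Suc m)) (comb (r (Suc (Suc m))) w (D (Suc m))) (D m) - x \<cdot>\<^sub>v comb (r (Suc (Suc m))) w (H m) \<in> free_rel J (r m)"
proof -
  have "comb (r (Suc (Suc m))) w (\<lambda>a. comb (r (Suc m)) (D (Suc m) a) (D m) - x \<cdot>\<^sub>v H m a) \<in> free_rel J (r m)"
    by (rule comb_in[OF sub H])
  then show ?thesis unfolding comb_rows comb_scale_right comb_assoc .
qed

lemma comb_free_rel: "w \<in> free_rel J k \<Longrightarrow> comb k w A \<in> free_rel J l"
  by (rule comb_in_left[OF sub order_refl _ J]) (auto simp: free_rel_def)

text \<open>
  Both \<open>x (D H)\<close> and \<open>x (H D)\<close> are \<open>D D D\<close>, and \<open>x\<close> is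
  regular.
\<close>
lemma H_commute:
  "comb (r (Suc m)) (comb (r (Suc (Suc (Suc m)))) w (H (Suc m))) (D m) -
   comb (r (Suc (Suc m))) (comb (r (Suc (Suc (Suc m)))) w (D (Suc (Suc m)))) (H m) \<in> free_rel J (r m)"
proof -
  let ?wD = "comb (r (Suc (Suc (Suc m)))) w (D (Suc (Suc m)))"
  let ?wH = "comb (r (Suc (Suc (Suc m)))) w (H (Suc m))"
  have 1: "comb (r (Suc m)) (comb (r (Suc (Suc m))) ?wD (D (Suc m)) - x \<cdot>\<^sub>v ?wH) (D m) \<in> free_rel J (r m)"
    by (rule comb_free_rel[OF H_comb])
  have 2: "comb (r (Suc m)) (comb (r (Suc (Suc m))) ?wD (D (Suc m))) (D m) - x \<cdot>\<^sub>v comb (r (Suc (Suc m))) ?wD (H m) \<in> free_rel J (r m)"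
    by (rule H_comb)
  have "x \<cdot>\<^sub>v (comb (r (Suc m)) ?wH (D m) - comb (r (Suc (Suc m))) ?wD (H m)) \<in> free_rel J (r m)"
    using submod_diff[OF sub 2 1] by (simp add: comb_diff_left comb_scale_left scale_diff)
  then show ?thesis by (rule regular_free_rel[OF x])
qed

lemma unit_diff: "x \<cdot>\<^sub>v comb n g unit_vec - x \<cdot>\<^sub>v g \<in> free_rel J n"
  unfolding scale_diff[symmetric]
  by (rule submod_scale[OF sub]) (rule submod_swap[OF sub comb_unit_diff[OF J]])

text \<open>
  If \<open>D f + x g = 0\<close>, then \<open>f\<close> is a cycle modulo \<open>x\<close>, so \<open>f = D u +
  x v\<close>. Subtracting the boundary of \<open>(u, v)\<close> removes \<open>f\<close>, and then \<open>x g =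
  0\<close> removes \<open>g\<close>.
\<close>
lemma resolution_lift: "resolution_mod J R G"
  unfolding resolution_mod_def complex_mod_def exact_mod_def
proof (intro conjI allI impI)
  fix m a assume a: "a < R (Suc (Suc m))"
  define w where "w = (unit_vec a :: 'p vec)"
  define f where "f = w"
  define g where "g = (\<lambda>i. w (r (Suc (Suc m)) + i))"
  let ?f = "comb (r (Suc (Suc m)))" and ?g = "comb (r (Suc m))"
  define g' where "g' = ?g g unit_vec"
  define p where "p = ?f f (D (Suc m)) + x \<cdot>\<^sub>v g'"
  define q where "q = - ?f f (H m) - ?g g (D m)"
  have gg': "?g g' A = ?g g A" for A
    unfolding g'_def comb_unit_vec by (rule comb_cong) auto
  have Ga: "G (Suc m) a = block (r (Suc m)) p q"
  proof -
    have "G (Suc m) a = comb (R (Suc (Suc m))) w (G (Suc m))" using a unfolding w_def by simp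
    then show ?thesis unfolding lift_rank_Suc comb_lift_diff p_def q_def f_def g_def g'_def by simp
  qed
  have pD: "?g p (D m) + x \<cdot>\<^sub>v q \<in> free_rel J (r m)"
    using H_comb[of m f] unfolding p_def q_def comb_add_left comb_scale_left gg' scale_diff scale_uminus
    by simp
  have eq: "comb (R (Suc m)) (G (Suc m) a) (G m) = comb (r (Suc m) + r m) (block (r (Suc m)) p q) (G m)"
    unfolding Ga by simp
  have qi: "(\<lambda>i. block (r (Suc m)) p q (r (Suc m) + i)) = q" by (simp add: block_def)
  have pp: "?g (block (r (Suc m)) p q) A = ?g p A" for A by (rule comb_cong) (simp_all add: block_def)
  have main: "comb (R (Suc m)) (G (Suc m) a) (G m) =
     block (r m) (?g p (D m) + x \<cdot>\<^sub>v comb (r m) q unit_vec) (- ?g p (H (m - 1)) - comb (r m) q (D (m - 1)))"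
    unfolding eq comb_lift_diff qi pp ..
  have first: "?g p (D m) + x \<cdot>\<^sub>v comb (r m) q unit_vec \<in> free_rel J (r m)"
    using submod_add[OF sub pD unit_diff[of "r m" q]] by simp
  show "comb (R (Suc m)) (G (Suc m) a) (G m) \<in> free_rel J (R m)"
  proof (cases m)
    case 0
    have "block (r m) v w \<in> free_rel J (r m) \<longleftrightarrow> v \<in> free_rel J (r m)" for v w
      by (auto simp: block_def free_rel_def)
    then show ?thesis using first unfolding main by (simp add: 0)
  next
    case (Suc l)
    have 1: "comb (r (Suc l)) (?f f (H (Suc l))) (D l) - ?g (?f f (D (Suc m))) (H l) \<in> free_rel J (r l)"
      using H_commute[of l f] by (simp add: Suc)
    have 2: "comb (r (Suc l)) (?g g (D m)) (D l) - x \<cdot>\<^sub>v ?g g (H l) \<in> free_rel J (r l)"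
      using H_comb[of l g] by (simp add: Suc)
    have "- ?g p (H l) - comb (r m) q (D l) =
       (comb (r (Suc l)) (?f f (H (Suc l))) (D l) - ?g (?f f (D (Suc m))) (H l)) +
       (comb (r (Suc l)) (?g g (D m)) (D l) - x \<cdot>\<^sub>v ?g g (H l))"
    proof -
      have q: "q = (0 - ?f f (H m)) - ?g g (D m)" by (simp add: q_def)
      show ?thesis
        unfolding p_def q comb_add_left comb_diff_left comb_scale_left gg' by (simp add: Suc)
    qed
    then have "- ?g p (H l) - comb (r m) q (D l) \<in> free_rel J (r l)" using submod_add[OF sub 1 2] by simp
    then show ?thesis unfolding main using first by (simp add: Suc block_free_rel)
  qed
next
  fix m w assume w: "comb (R (Suc m)) w (G m) \<in> free_rel J (R m)"
  define g where "g = (\<lambda>i. w (r (Suc m) + i))"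
  have first: "v \<in> free_rel J (r m)" if "block (r m) v u \<in> free_rel J (R m)" for v u
    using that by (cases m) (auto simp: block_free_rel, auto simp: block_def free_rel_def)
  have "comb (r (Suc m)) w (D m) + x \<cdot>\<^sub>v comb (r m) g unit_vec \<in> free_rel J (r m)"
    using w unfolding lift_rank_Suc comb_lift_diff g_def by (rule first)
  from submod_diff[OF sub this unit_diff[of "r m" g]]
  have wg: "comb (r (Suc m)) w (D m) + x \<cdot>\<^sub>v g \<in> free_rel J (r m)" by simp
  then have "comb (r (Suc m)) w (D m) - x \<cdot>\<^sub>v (- g) \<in> free_rel J (r m)"
    by (simp add: scale_uminus)
  then have "comb (r (Suc m)) w (D m) \<in> free_rel (adjoin J x) (r m)" using free_rel_adjoin by blast
  then obtain f' where "w - comb (r (Suc (Suc m))) f' (D (Suc m)) \<in> free_rel (adjoin J x) (r (Suc m))"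
    using res unfolding resolution_mod_def exact_mod_def by blast
  then obtain g1 where g1: "w - comb (r (Suc (Suc m))) f' (D (Suc m)) - x \<cdot>\<^sub>v g1 \<in> free_rel J (r (Suc m))"
    using free_rel_adjoin by blast
  define u where "u = block (r (Suc (Suc m))) f' g1"
  have ui: "(\<lambda>i. u (r (Suc (Suc m)) + i)) = g1" by (simp add: block_def u_def)
  have uu: "comb (r (Suc (Suc m))) u A = comb (r (Suc (Suc m))) f' A" for A
    by (rule comb_cong) (simp_all add: block_def u_def)
  have img: "comb (R (Suc (Suc m))) u (G (Suc m)) =
    block (r (Suc m)) (comb (r (Suc (Suc m))) f' (D (Suc m)) + x \<cdot>\<^sub>v comb (r (Suc m)) g1 unit_vec)
      (- comb (r (Suc (Suc m))) f' (H m) - comb (r (Suc m)) g1 (D m))"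
    unfolding lift_rank_Suc comb_lift_diff ui uu by simp
  define g2 where "g2 = g + comb (r (Suc (Suc m))) f' (H m) + comb (r (Suc m)) g1 (D m)"
  have wb: "w = block (r (Suc m)) w g" by (auto simp: block_def g_def)
  have "w - comb (R (Suc (Suc m))) u (G (Suc m)) = block (r (Suc m))
     (w - (comb (r (Suc (Suc m))) f' (D (Suc m)) + x \<cdot>\<^sub>v comb (r (Suc m)) g1 unit_vec)) g2"
    unfolding img by (subst wb) (simp add: block_diff g2_def algebra_simps)
  moreover have "w - (comb (r (Suc (Suc m))) f' (D (Suc m)) + x \<cdot>\<^sub>v comb (r (Suc m)) g1 unit_vec) \<in> free_rel J (r (Suc m))"
    using submod_diff[OF sub g1 unit_diff[of "r (Suc m)" g1]] by (simp add: algebra_simps)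
  moreover have "g2 \<in> free_rel J (r m)"
  proof -
    have 1: "comb (r (Suc m)) (w - comb (r (Suc (Suc m))) f' (D (Suc m)) - x \<cdot>\<^sub>v g1) (D m) \<in> free_rel J (r m)"
      by (rule comb_free_rel[OF g1])
    have 2: "comb (r (Suc m)) (comb (r (Suc (Suc m))) f' (D (Suc m))) (D m) - x \<cdot>\<^sub>v comb (r (Suc (Suc m))) f' (H m) \<in> free_rel J (r m)"
      by (rule H_comb)
    have "x \<cdot>\<^sub>v g2 = (comb (r (Suc m)) w (D m) + x \<cdot>\<^sub>v g)
        - comb (r (Suc m)) (w - comb (r (Suc (Suc m))) f' (D (Suc m)) - x \<cdot>\<^sub>v g1) (D m)
        - (comb (r (Suc m)) (comb (r (Suc (Suc m))) f' (D (Suc m))) (D m) - x \<cdot>\<^sub>v comb (r (Suc (Suc m))) f' (H m))"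
      unfolding g2_def comb_diff_left comb_scale_left scale_add by simp
    then have "x \<cdot>\<^sub>v g2 \<in> free_rel J (r m)" using submod_diff[OF sub submod_diff[OF sub wg 1] 2] by simp
    then show ?thesis by (rule regular_free_rel[OF x])
  qed
  ultimately have "w - comb (R (Suc (Suc m))) u (G (Suc m)) \<in> free_rel J (r (Suc m) + r m)"
    by (simp add: block_free_rel)
  then show "\<exists>u. w - comb (R (Suc (Suc m))) u (G (Suc m)) \<in> free_rel J (R (Suc m))" by auto
qed

context
  fixes Z :: "'p vec set"
  assumes Z: "fg_mod (adjoin J x) Z"
begin

lemma sZ: "submod Z" using Z by (simp add: fg_mod_def)

lemma xZ: "x \<cdot>\<^sub>v w \<in> Z"
  using Z scale_free_rel[OF ideal_adjoin[OF J] adjoin_self[OF J]] unfolding fg_mod_def by blast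

lemma combZ: "w \<in> free_rel J k \<Longrightarrow> comb k w h \<in> Z"
proof -
  assume w: "w \<in> free_rel J k"
  obtain n where "free_rel (adjoin J x) n \<subseteq> Z" using Z by (auto simp: fg_mod_def)
  then have "free_rel J n \<subseteq> Z" using free_rel_mono[OF adjoin_superset[OF J]] by blast
  then show "comb k w h \<in> Z"
    by (rule comb_in_left[OF sZ _ _ J]) (use w in \<open>auto simp: free_rel_def\<close>)
qed

lemma G_row_upper: "a < r (Suc n) \<Longrightarrow> n = Suc l \<Longrightarrow>
   comb (R n) (G n a) h = comb (r n) (D n a) h - comb (r l) (H l a) (\<lambda>i. h (r n + i))"
  by (simp add: lift_diff_def comb_block) (metis (no_types, lifting) comb_diff_left comb_zero_left diff_0 diff_conv_add_uminus)

lemma G_row_lower: "b < r n \<Longrightarrow> n = Suc l \<Longrightarrow>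
   comb (R n) (G n (r (Suc n) + b)) h = x \<cdot>\<^sub>v h b - comb (r l) (D l b) (\<lambda>i. h (r n + i))"
  by (simp add: lift_diff_def comb_block comb_scale_left) (metis (no_types, lifting) comb_diff_left comb_zero_left diff_0 diff_conv_add_uminus)

text \<open>
  \<open>Hom(G, Z)\<close> is an extension of two shifted copies of \<open>Hom(D, Z)\<close>, since
  \<open>x\<close> is zero on \<open>Z\<close>.
\<close>
lemma hom_exact_lift:
  assumes ex: "hom_exact r D Z m" "hom_exact r D Z (Suc m)"
  shows "hom_exact R G Z (Suc m)"
  unfolding hom_exact_def
proof (intro allI impI)
  fix h assume h: "\<forall>a<R (Suc (Suc (Suc m))). comb (R (Suc (Suc m))) (G (Suc (Suc m)) a) h \<in> Z"
  define v where "v = (\<lambda>i. h (r (Suc (Suc m)) + i))"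
  have hu: "comb (r (Suc (Suc m))) (D (Suc (Suc m)) a) h - comb (r (Suc m)) (H (Suc m) a) v \<in> Z" if "a < r (Suc (Suc (Suc m)))" for a
    using h[rule_format, of a] that G_row_upper[of a "Suc (Suc m)" "Suc m" h] by (simp add: v_def)
  have hv: "comb (r (Suc m)) (D (Suc m) b) v \<in> Z" if "b < r (Suc (Suc m))" for b
  proof -
    have "x \<cdot>\<^sub>v h b - comb (r (Suc m)) (D (Suc m) b) v \<in> Z"
      using h[rule_format, of "r (Suc (Suc (Suc m))) + b"] that G_row_lower[of b "Suc (Suc m)" "Suc m" h] by (simp add: v_def)
    then show ?thesis using submod_add_iff(4)[OF sZ xZ] submod_swap[OF sZ] submod_diff[OF sZ xZ] by fastforce
  qed
  then obtain w where w: "\<And>b. b < r (Suc m) \<Longrightarrow> v b - comb (r m) (D m b) w \<in> Z"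
    using ex(1) unfolding hom_exact_def by blast
  define u' where "u' = (\<lambda>a. h a - comb (r m) (H m a) w)"
  have "comb (r (Suc (Suc m))) (D (Suc (Suc m)) a) u' \<in> Z" if a: "a < r (Suc (Suc (Suc m)))" for a
  proof -
    let ?Ha = "H (Suc m) a" and ?Da = "D (Suc (Suc m)) a"
    have 1: "comb (r (Suc m)) ?Ha (\<lambda>b. v b - comb (r m) (D m b) w) \<in> Z" by (rule comb_in[OF sZ w])
    have 2: "comb (r (Suc m)) ?Ha (D m) - comb (r (Suc (Suc m))) ?Da (H m) \<in> free_rel J (r m)"
      using H_commute[of m "unit_vec a"] a by simp
    have "comb (r (Suc (Suc m))) ?Da u' =
       (comb (r (Suc (Suc m))) ?Da h - comb (r (Suc m)) ?Ha v) + comb (r (Suc m)) ?Ha (\<lambda>b. v b - comb (r m) (D m b) w)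
       + comb (r m) (comb (r (Suc m)) ?Ha (D m) - comb (r (Suc (Suc m))) ?Da (H m)) w"
      unfolding u'_def comb_rows comb_diff_left comb_assoc by simp
    then show ?thesis using submod_add[OF sZ submod_add[OF sZ hu[OF a] 1] combZ[OF 2]] by simp
  qed
  then obtain t where t: "\<And>a. a < r (Suc (Suc m)) \<Longrightarrow> u' a - comb (r (Suc m)) (D (Suc m) a) t \<in> Z"
    using ex(2) unfolding hom_exact_def by blast
  define g where "g = (\<lambda>i. if i < r (Suc m) then t i else - w (i - r (Suc m)))"
  have gt: "comb (r (Suc m)) A g = comb (r (Suc m)) A t" for A by (rule comb_cong) (simp_all add: g_def)
  have gw: "(\<lambda>i. g (r (Suc m) + i)) = (\<lambda>i. - w i)" by (simp add: g_def)
  show "\<exists>g. \<forall>a<R (Suc (Suc m)). h a - comb (R (Suc m)) (G (Suc m) a) g \<in> Z"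
  proof (intro exI[of _ g] allI impI)
    fix a assume a: "a < R (Suc (Suc m))"
    show "h a - comb (R (Suc m)) (G (Suc m) a) g \<in> Z"
    proof (cases "a < r (Suc (Suc m))")
      case True
      have "comb (R (Suc m)) (G (Suc m) a) g = comb (r (Suc m)) (D (Suc m) a) t + comb (r m) (H m a) w"
        using G_row_upper[OF True refl, of g] unfolding gt gw comb_rows by simp
      then show ?thesis using t[OF True] by (simp add: u'_def algebra_simps)
    next
      case False
      define b where "b = a - r (Suc (Suc m))"
      have ab: "a = r (Suc (Suc m)) + b" "b < r (Suc m)" using False a by (auto simp: b_def)
      have "comb (R (Suc m)) (G (Suc m) a) g = x \<cdot>\<^sub>v g b + comb (r m) (D m b) w"
        using G_row_lower[OF ab(2) refl, of g] unfolding gw comb_rows ab(1) by simp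
      moreover have "h a = v b" by (simp add: v_def ab)
      ultimately show ?thesis using submod_diff[OF sZ w[OF ab(2)] xZ[of "g b"]] by (simp add: algebra_simps)
    qed
  qed
qed

text \<open>
  The other part of the long exact sequence. For a cocycle \<open>v\<close> of \<open>Hom(D, Z)\<close>,
  composition with \<open>H\<close> is a cocycle two degrees higher; bounding it yields a cocycle of
  \<open>Hom(G, Z)\<close> with second component \<open>v\<close>.
\<close>
lemma hom_exact_descend:
  assumes ex: "hom_exact R G Z (Suc m)" "hom_exact r D Z (Suc (Suc m))"
  shows "hom_exact r D Z m"
  unfolding hom_exact_def
proof (intro allI impI)
  fix v assume v: "\<forall>a<r (Suc (Suc m)). comb (r (Suc m)) (D (Suc m) a) v \<in> Z"
  \<comment> \<open>The obstruction to extending \<open>v\<close> by a first component.\<close>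
  define y where "y = (\<lambda>a. comb (r (Suc m)) (H (Suc m) a) v)"
  have "comb (r (Suc (Suc (Suc m)))) (D (Suc (Suc (Suc m))) a) y \<in> Z" if a: "a < r (Suc (Suc (Suc (Suc m))))" for a
  proof -
    let ?Ha = "H (Suc (Suc m)) a" and ?Da = "D (Suc (Suc (Suc m))) a"
    have 1: "comb (r (Suc (Suc m))) ?Ha (D (Suc m)) - comb (r (Suc (Suc (Suc m)))) ?Da (H (Suc m)) \<in> free_rel J (r (Suc m))"
      using H_commute[of "Suc m" "unit_vec a"] a by simp
    have 2: "comb (r (Suc (Suc m))) ?Ha (\<lambda>b. comb (r (Suc m)) (D (Suc m) b) v) \<in> Z"
      by (rule comb_in[OF sZ]) (use v in simp)
    have "comb (r (Suc (Suc (Suc m)))) ?Da y = comb (r (Suc (Suc m))) ?Ha (\<lambda>b. comb (r (Suc m)) (D (Suc m) b) v)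
       - comb (r (Suc m)) (comb (r (Suc (Suc m))) ?Ha (D (Suc m)) - comb (r (Suc (Suc (Suc m)))) ?Da (H (Suc m))) v"
      unfolding y_def comb_diff_left comb_assoc by simp
    then show ?thesis using submod_diff[OF sZ 2 combZ[OF 1]] by simp
  qed
  then obtain u where u: "\<And>a. a < r (Suc (Suc (Suc m))) \<Longrightarrow> y a - comb (r (Suc (Suc m))) (D (Suc (Suc m)) a) u \<in> Z"
    using ex(2) unfolding hom_exact_def by blast
  define h where "h = (\<lambda>i. if i < r (Suc (Suc m)) then u i else v (i - r (Suc (Suc m))))"
  have hu: "comb (r (Suc (Suc m))) A h = comb (r (Suc (Suc m))) A u" for A by (rule comb_cong) (simp_all add: h_def)
  have hv: "(\<lambda>i. h (r (Suc (Suc m)) + i)) = v" by (simp add: h_def)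
  have "comb (R (Suc (Suc m))) (G (Suc (Suc m)) a) h \<in> Z" if a: "a < R (Suc (Suc (Suc m)))" for a
  proof (cases "a < r (Suc (Suc (Suc m)))")
    case True
    have "comb (R (Suc (Suc m))) (G (Suc (Suc m)) a) h = comb (r (Suc (Suc m))) (D (Suc (Suc m)) a) u - y a"
      using G_row_upper[OF True refl, of h] unfolding hu hv y_def .
    then show ?thesis using submod_swap[OF sZ u[OF True]] by simp
  next
    case False
    define b where "b = a - r (Suc (Suc (Suc m)))"
    have ab: "a = r (Suc (Suc (Suc m))) + b" "b < r (Suc (Suc m))" using False a by (auto simp: b_def)
    have "comb (R (Suc (Suc m))) (G (Suc (Suc m)) a) h = x \<cdot>\<^sub>v h b - comb (r (Suc m)) (D (Suc m) b) v"
      using G_row_lower[OF ab(2) refl, of h] unfolding hv ab(1) .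
    then show ?thesis using submod_diff[OF sZ xZ] v ab by simp
  qed
  then obtain g where g: "\<And>a. a < R (Suc (Suc m)) \<Longrightarrow> h a - comb (R (Suc m)) (G (Suc m) a) g \<in> Z"
    using ex(1) unfolding hom_exact_def by blast
  show "\<exists>g. \<forall>a<r (Suc m). v a - comb (r m) (D m a) g \<in> Z"
  proof (intro exI[of _ "\<lambda>i. - g (r (Suc m) + i)"] allI impI)
    fix b assume b: "b < r (Suc m)"
    have "h (r (Suc (Suc m)) + b) - comb (R (Suc m)) (G (Suc m) (r (Suc (Suc m)) + b)) g \<in> Z" by (rule g) (use b in simp)
    then have "v b - (x \<cdot>\<^sub>v g b - comb (r m) (D m b) (\<lambda>i. g (r (Suc m) + i))) \<in> Z"
      using G_row_lower[OF b refl, of g] by (simp add: h_def)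
    from submod_add[OF sZ this xZ[of "g b"]]
    show "v b - comb (r m) (D m b) (\<lambda>i. - g (r (Suc m) + i)) \<in> Z" unfolding comb_rows by (simp add: algebra_simps)
  qed
qed

end

text \<open>Downward induction in steps of two, from the degrees where the cohomology is known to vanish.\<close>
lemma bounded_at_descend:
  assumes b: "bounded_at J R G b"
  shows "bounded_at (adjoin J x) r D b"
  unfolding bounded_at_def
proof (intro allI impI)
  fix Z m assume Z: "fg_mod (adjoin J x) Z" and ev: "\<exists>n. \<forall>m\<ge>n. hom_exact r D Z m" and m: "b \<le> m"
  have ZJ: "fg_mod J Z" using Z free_rel_mono[OF adjoin_superset[OF J]] unfolding fg_mod_def by blast
  obtain n where n: "\<And>m. n \<le> m \<Longrightarrow> hom_exact r D Z m" using ev by blast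
  have "hom_exact R G Z l" if "Suc n \<le> l" for l
    using hom_exact_lift[OF Z n n, of "l - 1"] that by simp
  then have G: "\<And>l. b \<le> l \<Longrightarrow> hom_exact R G Z l" using b ZJ unfolding bounded_at_def by blast
  have "b \<le> m \<Longrightarrow> hom_exact r D Z m"
  proof (induction "n - m" arbitrary: m rule: less_induct)
    case less
    show ?case
    proof (cases "n \<le> m")
      case False
      have "hom_exact r D Z (Suc (Suc m))" by (rule less.hyps) (use False less.prems in auto)
      then show ?thesis using hom_exact_descend[OF Z G] less.prems by simp
    qed (rule n)
  qed
  then show "hom_exact r D Z m" using m by simp
qed

end

lemma bounded_at_descent_list:
  assumes "is_ideal J" "regular_seq J xs" "resolution_mod (adjoin_list J xs) r D"
  shows "\<exists>R G. resolution_mod J R G \<and> (\<forall>b. bounded_at J R G b \<longrightarrow> bounded_at (adjoin_list J xs) r D b)"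
  using assms
proof (induction xs arbitrary: J)
  case Nil
  then show ?case by auto
next
  case (Cons x xs)
  obtain r' D' where r: "resolution_mod (adjoin J x) r' D'"
    and b: "\<And>b. bounded_at (adjoin J x) r' D' b \<Longrightarrow> bounded_at (adjoin_list J (x # xs)) r D b"
    using Cons.IH[of "adjoin J x"] Cons.prems ideal_adjoin by auto
  have "\<forall>m a. \<exists>h. a < r' (Suc (Suc m)) \<longrightarrow> comb (r' (Suc m)) (D' (Suc m) a) (D' m) - x \<cdot>\<^sub>v h \<in> free_rel J (r' m)"
    using r free_rel_adjoin unfolding resolution_mod_def complex_mod_def by blast
  then obtain H where H: "\<And>m a. a < r' (Suc (Suc m)) \<Longrightarrow> comb (r' (Suc m)) (D' (Suc m) a) (D' m) - x \<cdot>\<^sub>v H m a \<in> free_rel J (r' m)"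
    by metis
  interpret descent J x r' D' H
    by standard (use Cons.prems r H in auto)
  show ?case using resolution_lift bounded_at_descend b by blast
qed


definition presented :: "'p::comm_ring_1 set \<Rightarrow> (nat \<Rightarrow> nat) \<Rightarrow> (nat \<Rightarrow> nat \<Rightarrow> 'p vec) \<Rightarrow> 'p vec set" where
  "presented J r D = {w. \<exists>u. w - comb (r (Suc 0)) u (D 0) \<in> free_rel J (r 0)}"

lemma submod_presented: "is_ideal J \<Longrightarrow> submod (presented J r D)"
  unfolding presented_def by (rule submod_comb_plus[OF submod_free_rel])

lemma row_presented: "is_ideal J \<Longrightarrow> a < r (Suc 0) \<Longrightarrow> D 0 a \<in> presented J r D"
  using submod0[OF submod_free_rel[of J "r 0"]]
  by (auto simp: presented_def intro!: exI[of _ "unit_vec a"])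

lemma chain_map_lift:
  assumes J: "is_ideal J" and D: "complex_mod J r D" and D': "resolution_mod J r' D'"
    and \<alpha>': "\<And>w. w \<in> presented J r D \<Longrightarrow> comb (r 0) w \<alpha>' \<in> presented J r' D'"
  obtains \<alpha> where "\<alpha> 0 = \<alpha>'"
    "\<And>i a. a < r (Suc i) \<Longrightarrow> comb (r i) (D i a) (\<alpha> i) - comb (r' (Suc i)) (\<alpha> (Suc i) a) (D' i) \<in> free_rel J (r' i)"
proof -
  note sub = submod_free_rel[OF J]
  define P where "P i \<alpha> \<longleftrightarrow> (i = 0 \<longrightarrow> \<alpha> = \<alpha>') \<and> (\<forall>a<r (Suc i). \<exists>u. comb (r i) (D i a) \<alpha> - comb (r' (Suc i)) u (D' i) \<in> free_rel J (r' i))" for i \<alpha>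
  define Q where "Q i \<alpha> \<beta> \<longleftrightarrow> (\<forall>a<r (Suc i). comb (r i) (D i a) \<alpha> - comb (r' (Suc i)) (\<beta> a) (D' i) \<in> free_rel J (r' i))" for i \<alpha> \<beta>
  have "\<exists>f. \<forall>i. P i (f i) \<and> Q i (f i) (f (Suc i))"
  proof (rule dependent_nat_choice)
    show "\<exists>\<alpha>. P 0 \<alpha>"
      using \<alpha>'[OF row_presented[OF J]] by (auto simp: P_def presented_def)
  next
    fix \<alpha> i assume "P i \<alpha>"
    then have "\<forall>a. \<exists>u. a < r (Suc i) \<longrightarrow> comb (r i) (D i a) \<alpha> - comb (r' (Suc i)) u (D' i) \<in> free_rel J (r' i)"
      by (auto simp: P_def)
    then obtain \<beta> where \<beta>: "\<And>a. a < r (Suc i) \<Longrightarrow> comb (r i) (D i a) \<alpha> - comb (r' (Suc i)) (\<beta> a) (D' i) \<in> free_rel J (r' i)"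
      by metis
    have "\<exists>u. comb (r (Suc i)) (D (Suc i) a) \<beta> - comb (r' (Suc (Suc i))) u (D' (Suc i)) \<in> free_rel J (r' (Suc i))"
      if a: "a < r (Suc (Suc i))" for a
    proof -
      have 1: "comb (r (Suc i)) (D (Suc i) a) (\<lambda>b. comb (r i) (D i b) \<alpha> - comb (r' (Suc i)) (\<beta> b) (D' i)) \<in> free_rel J (r' i)"
        by (rule comb_in[OF sub \<beta>])
      have 2: "comb (r i) (comb (r (Suc i)) (D (Suc i) a) (D i)) \<alpha> \<in> free_rel J (r' i)"
        by (rule comb_in_left[OF sub order_refl _ J]) (use D a in \<open>auto simp: complex_mod_def free_rel_def\<close>)
      have "comb (r' (Suc i)) (comb (r (Suc i)) (D (Suc i) a) \<beta>) (D' i) \<in> free_rel J (r' i)"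
        using submod_diff[OF sub 2 1] unfolding comb_rows comb_assoc by simp
      then show ?thesis using D' unfolding resolution_mod_def exact_mod_def by blast
    qed
    then show "\<exists>\<beta>. P (Suc i) \<beta> \<and> Q i \<alpha> \<beta>" using \<beta> by (intro exI[of _ \<beta>]) (auto simp: P_def Q_def)
  qed
  then obtain f where f: "\<And>i. P i (f i)" "\<And>i. Q i (f i) (f (Suc i))" by blast
  show thesis by (rule that[of f]) (use f(1)[of 0] f(2) in \<open>auto simp: P_def Q_def\<close>)
qed

text \<open>
  Two resolutions of the same module are homotopy equivalent, so \<open>Hom\<close> into any module has the same
  cohomology. Only exactness is compared, so a lift of each map and one homotopy are enough.
\<close>
lemma hom_exact_compare:
  assumes J: "is_ideal J" and D: "resolution_mod J r D" and D': "resolution_mod J r' D'"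
    and \<alpha>': "\<And>w. w \<in> presented J r D \<Longrightarrow> comb (r 0) w \<alpha>' \<in> presented J r' D'"
    and \<beta>': "\<And>w. w \<in> presented J r' D' \<Longrightarrow> comb (r' 0) w \<beta>' \<in> presented J r D"
    and id: "\<And>w. comb (r' 0) (comb (r 0) w \<alpha>') \<beta>' - w \<in> presented J r D"
    and V: "fg_mod J V" and ex: "hom_exact r' D' V m"
  shows "hom_exact r D V m"
proof -
  note sub = submod_free_rel[OF J]
  have sV: "submod V" using V by (simp add: fg_mod_def)
  obtain nV where nV: "free_rel J nV \<subseteq> V" using V by (auto simp: fg_mod_def)
  have inV: "comb k w h \<in> V" if "w \<in> free_rel J k" for k w h
    by (rule comb_in_left[OF sV nV _ J]) (use that in \<open>auto simp: free_rel_def\<close>)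
  have inF: "comb k w h \<in> free_rel J l" if "w \<in> free_rel J k" for k w h l
    by (rule comb_in_left[OF sub order_refl _ J]) (use that in \<open>auto simp: free_rel_def\<close>)
  have cD: "complex_mod J r D" "complex_mod J r' D'" using D D' by (simp_all add: resolution_mod_def)
  obtain \<alpha> where \<alpha>: "\<alpha> 0 = \<alpha>'"
    "\<And>i a. a < r (Suc i) \<Longrightarrow> comb (r i) (D i a) (\<alpha> i) - comb (r' (Suc i)) (\<alpha> (Suc i) a) (D' i) \<in> free_rel J (r' i)"
    by (rule chain_map_lift[where r = r and D = D and r' = r' and D' = D' and J = J and \<alpha>' = \<alpha>'])
      (use J cD D' \<alpha>' in blast)+
  obtain \<beta> where \<beta>: "\<beta> 0 = \<beta>'"
    "\<And>i a. a < r' (Suc i) \<Longrightarrow> comb (r' i) (D' i a) (\<beta> i) - comb (r (Suc i)) (\<beta> (Suc i) a) (D i) \<in> free_rel J (r i)"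
    by (rule chain_map_lift[where r = r' and D = D' and r' = r and D' = D and J = J and \<alpha>' = \<beta>'])
      (use J cD D \<beta>' in blast)+
  define \<phi> where "\<phi> i a = comb (r' i) (\<alpha> i a) (\<beta> i) - unit_vec a" for i a
  have \<phi>: "comb (r i) (D i a) (\<phi> i) - comb (r (Suc i)) (\<phi> (Suc i) a) (D i) \<in> free_rel J (r i)" if a: "a < r (Suc i)" for i a
  proof -
    have 1: "comb (r' i) (comb (r i) (D i a) (\<alpha> i) - comb (r' (Suc i)) (\<alpha> (Suc i) a) (D' i)) (\<beta> i) \<in> free_rel J (r i)"
      by (rule inF[OF \<alpha>(2)[OF a]])
    have 2: "comb (r' (Suc i)) (\<alpha> (Suc i) a) (\<lambda>b. comb (r' i) (D' i b) (\<beta> i) - comb (r (Suc i)) (\<beta> (Suc i) b) (D i)) \<in> free_rel J (r i)"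
      by (rule comb_in[OF sub \<beta>(2)])
    have 3: "D i a - comb (r i) (D i a) unit_vec \<in> free_rel J (r i)" by (rule comb_unit_diff[OF J])
    have "comb (r i) (D i a) (\<phi> i) - comb (r (Suc i)) (\<phi> (Suc i) a) (D i) =
       comb (r' i) (comb (r i) (D i a) (\<alpha> i) - comb (r' (Suc i)) (\<alpha> (Suc i) a) (D' i)) (\<beta> i) +
       comb (r' (Suc i)) (\<alpha> (Suc i) a) (\<lambda>b. comb (r' i) (D' i b) (\<beta> i) - comb (r (Suc i)) (\<beta> (Suc i) b) (D i)) +
       (D i a - comb (r i) (D i a) unit_vec)"
      using a unfolding \<phi>_def comb_rows comb_diff_left comb_assoc by simp
    then show ?thesis using submod_add[OF sub submod_add[OF sub 1 2] 3] by simp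
  qed
  define P where "P i s \<longleftrightarrow> (\<exists>t. \<forall>a<r (Suc i). \<phi> (Suc i) a - comb (r i) (D i a) s - comb (r (Suc (Suc i))) (t a) (D (Suc i)) \<in> free_rel J (r (Suc i)))" for i s
  define Q where "Q i s t \<longleftrightarrow> (\<forall>a<r (Suc i). \<phi> (Suc i) a - comb (r i) (D i a) s - comb (r (Suc (Suc i))) (t a) (D (Suc i)) \<in> free_rel J (r (Suc i)))" for i s t
  have lift: "P i s" if s: "\<And>a. a < r (Suc i) \<Longrightarrow> comb (r (Suc i)) (\<phi> (Suc i) a - comb (r i) (D i a) s) (D i) \<in> free_rel J (r i)" for i s
  proof -
    have "\<forall>a. \<exists>u. a < r (Suc i) \<longrightarrow> \<phi> (Suc i) a - comb (r i) (D i a) s - comb (r (Suc (Suc i))) u (D (Suc i)) \<in> free_rel J (r (Suc i))"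
      using s D unfolding resolution_mod_def exact_mod_def by blast
    then show ?thesis unfolding P_def by metis
  qed
  have "\<exists>s. \<forall>i. P i (s i) \<and> Q i (s i) (s (Suc i))"
  proof (rule dependent_nat_choice)
    have "\<exists>u. \<phi> 0 a - comb (r (Suc 0)) u (D 0) \<in> free_rel J (r 0)" if "a < r 0" for a
      using id[of "unit_vec a"] that by (simp add: presented_def \<phi>_def \<alpha>(1) \<beta>(1))
    then have "\<forall>a. \<exists>u. a < r 0 \<longrightarrow> \<phi> 0 a - comb (r (Suc 0)) u (D 0) \<in> free_rel J (r 0)" by blast
    then obtain s where s: "\<And>a. a < r 0 \<Longrightarrow> \<phi> 0 a - comb (r (Suc 0)) (s a) (D 0) \<in> free_rel J (r 0)" by metis
    have "P 0 s"
    proof (rule lift)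
      fix a assume a: "a < r (Suc 0)"
      have 1: "comb (r 0) (D 0 a) (\<lambda>b. \<phi> 0 b - comb (r (Suc 0)) (s b) (D 0)) \<in> free_rel J (r 0)" by (rule comb_in[OF sub s])
      show "comb (r (Suc 0)) (\<phi> (Suc 0) a - comb (r 0) (D 0 a) s) (D 0) \<in> free_rel J (r 0)"
        using submod_diff[OF sub 1 \<phi>[OF a]] unfolding comb_rows comb_diff_left comb_assoc by simp
    qed
    then show "\<exists>s. P 0 s" by blast
  next
    fix s i assume "P i s"
    then obtain t where t: "Q i s t" by (auto simp: P_def Q_def)
    have "P (Suc i) t"
    proof (rule lift)
      fix a assume a: "a < r (Suc (Suc i))"
      have 1: "comb (r (Suc i)) (D (Suc i) a) (\<lambda>b. \<phi> (Suc i) b - comb (r i) (D i b) s - comb (r (Suc (Suc i))) (t b) (D (Suc i))) \<in> free_rel J (r (Suc i))"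
        by (rule comb_in[OF sub]) (use t in \<open>auto simp: Q_def\<close>)
      have 2: "comb (r i) (comb (r (Suc i)) (D (Suc i) a) (D i)) s \<in> free_rel J (r (Suc i))"
        by (rule inF) (use cD a in \<open>auto simp: complex_mod_def\<close>)
      show "comb (r (Suc (Suc i))) (\<phi> (Suc (Suc i)) a - comb (r (Suc i)) (D (Suc i) a) t) (D (Suc i)) \<in> free_rel J (r (Suc i))"
        using submod_diff[OF sub submod_add[OF sub 1 2] \<phi>[OF a]] unfolding comb_rows comb_diff_left comb_assoc
        by simp
    qed
    then show "\<exists>t. P (Suc i) t \<and> Q i s t" using t by blast
  qed
  then obtain s where s: "\<And>i. Q i (s i) (s (Suc i))" by blast
  show ?thesis
    unfolding hom_exact_def
  proof (intro allI impI)
    fix h assume h: "\<forall>a<r (Suc (Suc m)). comb (r (Suc m)) (D (Suc m) a) h \<in> V"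
    define h' where "h' b = comb (r (Suc m)) (\<beta> (Suc m) b) h" for b
    have "comb (r' (Suc m)) (D' (Suc m) b) h' \<in> V" if b: "b < r' (Suc (Suc m))" for b
    proof -
      have 1: "comb (r (Suc m)) (comb (r' (Suc m)) (D' (Suc m) b) (\<beta> (Suc m)) - comb (r (Suc (Suc m))) (\<beta> (Suc (Suc m)) b) (D (Suc m))) h \<in> V"
        by (rule inV[OF \<beta>(2)[OF b]])
      have 2: "comb (r (Suc (Suc m))) (\<beta> (Suc (Suc m)) b) (\<lambda>c. comb (r (Suc m)) (D (Suc m) c) h) \<in> V"
        by (rule comb_in[OF sV]) (use h in simp)
      show ?thesis using submod_add[OF sV 1 2] unfolding h'_def comb_diff_left comb_assoc by simp
    qed
    then obtain g where g: "\<And>a. a < r' (Suc m) \<Longrightarrow> h' a - comb (r' m) (D' m a) g \<in> V"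
      using ex unfolding hom_exact_def by blast
    define k where "k b = comb (r' m) (\<alpha> m b) g - comb (r (Suc m)) (s m b) h" for b
    have "h a - comb (r m) (D m a) k \<in> V" if a: "a < r (Suc m)" for a
    proof -
      have 1: "comb (r (Suc m)) (\<phi> (Suc m) a - comb (r m) (D m a) (s m) - comb (r (Suc (Suc m))) (s (Suc m) a) (D (Suc m))) h \<in> V"
        by (rule inV) (use s[of m] a in \<open>auto simp: Q_def\<close>)
      have 2: "comb (r (Suc (Suc m))) (s (Suc m) a) (\<lambda>c. comb (r (Suc m)) (D (Suc m) c) h) \<in> V"
        by (rule comb_in[OF sV]) (use h in simp)
      have 3: "comb (r' (Suc m)) (\<alpha> (Suc m) a) (\<lambda>b. h' b - comb (r' m) (D' m b) g) \<in> V"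
        by (rule comb_in[OF sV g])
      have 4: "comb (r' m) (comb (r m) (D m a) (\<alpha> m) - comb (r' (Suc m)) (\<alpha> (Suc m) a) (D' m)) g \<in> V"
        by (rule inV[OF \<alpha>(2)[OF a]])
      have "h a - comb (r m) (D m a) k =
         comb (r' (Suc m)) (\<alpha> (Suc m) a) (\<lambda>b. h' b - comb (r' m) (D' m b) g)
         - comb (r' m) (comb (r m) (D m a) (\<alpha> m) - comb (r' (Suc m)) (\<alpha> (Suc m) a) (D' m)) g
         - comb (r (Suc m)) (\<phi> (Suc m) a - comb (r m) (D m a) (s m) - comb (r (Suc (Suc m))) (s (Suc m) a) (D (Suc m))) h
         - comb (r (Suc (Suc m))) (s (Suc m) a) (\<lambda>c. comb (r (Suc m)) (D (Suc m) c) h)"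
        using a unfolding k_def h'_def \<phi>_def comb_rows comb_diff_left comb_assoc by simp
      then show ?thesis
        using submod_diff[OF sV submod_diff[OF sV submod_diff[OF sV 3 4] 1] 2] by simp
    qed
    then show "\<exists>g. \<forall>a<r (Suc m). h a - comb (r m) (D m a) g \<in> V" by blast
  qed
qed

section \<open>Primes and regular sequences\<close>

subsection \<open>Primes\<close>

definition prime_id :: "'p::comm_ring_1 set \<Rightarrow> bool" where
  "prime_id P \<longleftrightarrow> is_ideal P \<and> 1 \<notin> P \<and> (\<forall>a b. a * b \<in> P \<longrightarrow> a \<in> P \<or> b \<in> P)"

text \<open>An ideal maximal among those disjoint from a multiplicative set is prime.\<close>
lemma prime_avoiding:
  fixes J :: "'p::comm_ring_1 set"
  assumes J: "is_ideal J" and T: "1 \<in> T" "\<And>a b. a \<in> T \<Longrightarrow> b \<in> T \<Longrightarrow> a * b \<in> T" "J \<inter> T = {}"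
  obtains P where "prime_id P" "J \<subseteq> P" "P \<inter> T = {}"
proof -
  let ?A = "{U. is_ideal U \<and> J \<subseteq> U \<and> U \<inter> T = {}}"
  have "\<exists>M\<in>?A. \<forall>X\<in>?A. M \<subseteq> X \<longrightarrow> X = M"
  proof (rule subset_Zorn_nonempty)
    show "?A \<noteq> {}" using assms by blast
  next
    fix C assume C: "C \<noteq> {}" "subset.chain ?A C"
    then have mem: "\<And>U. U \<in> C \<Longrightarrow> is_ideal U \<and> J \<subseteq> U \<and> U \<inter> T = {}"
      by (auto simp: subset_chain_def)
    have tot: "\<And>U U'. U \<in> C \<Longrightarrow> U' \<in> C \<Longrightarrow> U \<subseteq> U' \<or> U' \<subseteq> U" using C(2) by (auto simp: subset_chain_def)
    have "is_ideal (\<Union>C)"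
      unfolding is_ideal_def
    proof (intro conjI ballI allI)
      show "0 \<in> \<Union>C" using C(1) mem ideal0 by blast
    next
      fix v w assume "v \<in> \<Union>C" "w \<in> \<Union>C"
      then obtain U where "U \<in> C" "v \<in> U" "w \<in> U" using tot by blast
      then show "v + w \<in> \<Union>C" using mem ideal_add by blast
    next
      fix c v assume "v \<in> \<Union>C"
      then show "c * v \<in> \<Union>C" using mem ideal_mult by blast
    qed
    then show "\<Union>C \<in> ?A" using C(1) mem by blast
  qed
  then obtain P where P: "P \<in> ?A" and mx: "\<forall>X\<in>?A. P \<subseteq> X \<longrightarrow> X = P" by (rule bexE)
  have idP: "is_ideal P" "J \<subseteq> P" "P \<inter> T = {}" using P by auto
  have meet: "\<exists>t d. t \<in> T \<and> t - a * d \<in> P" if a: "a \<notin> P" for a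
  proof -
    have "adjoin P a \<notin> ?A"
      using mx adjoin_superset[OF idP(1), of a] adjoin_self[OF idP(1), of a] a by blast
    then have "adjoin P a \<inter> T \<noteq> {}"
      using ideal_adjoin[OF idP(1)] adjoin_superset[OF idP(1), of a] idP(2) by auto
    then show ?thesis by (auto simp: adjoin_def)
  qed
  have "prime_id P"
    unfolding prime_id_def
  proof (intro conjI allI impI)
    show "1 \<notin> P" using idP T by blast
    fix a b assume ab: "a * b \<in> P"
    show "a \<in> P \<or> b \<in> P"
    proof (rule ccontr)
      assume "\<not> ?thesis"
      then obtain t d t' d' where t: "t \<in> T" "t - a * d \<in> P" "t' \<in> T" "t' - b * d' \<in> P"
        using meet by meson
      have "t * t' = t' * (t - a * d) + (a * d) * (t' - b * d') + (d * d') * (a * b)"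
        by (simp add: algebra_simps)
      moreover have "t' * (t - a * d) + (a * d) * (t' - b * d') + (d * d') * (a * b) \<in> P"
        using t ab by (blast intro: ideal_add[OF idP(1)] ideal_mult(1)[OF idP(1)])
      ultimately show False using T(2)[OF t(1,3)] idP(3) by auto
    qed
  qed (rule idP)
  then show thesis using that idP by blast
qed

lemma regular_mod_pow: "regular_mod J x \<Longrightarrow> x ^ n * c \<in> J \<Longrightarrow> c \<in> J"
  by (induction n) (auto simp: regular_mod_def mult.assoc)

text \<open>
  The elements \<open>x\<^sup>n s\<close> with \<open>s\<close> outside \<open>q\<close> form a multiplicative
  set that is disjoint from \<open>J\<close> because \<open>x\<close> is regular; a prime avoiding it lies in
  \<open>q\<close> and misses \<open>x\<close>.
\<close>
lemma prime_below_regular: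
  assumes J: "is_ideal J" and x: "regular_mod J x" and q: "prime_id q" "adjoin J x \<subseteq> q"
  obtains q' where "prime_id q'" "J \<subseteq> q'" "q' \<subset> q"
proof -
  \<comment> \<open>\<open>n = 0\<close> keeps the prime inside \<open>q\<close>, and \<open>s = 1\<close> keeps \<open>x\<close> out of it.\<close>
  let ?T = "{x ^ n * s |n s. s \<notin> q}"
  have "J \<inter> ?T = {}"
    using regular_mod_pow[OF x] adjoin_superset[OF J, of x] q(2) by blast
  moreover have "1 \<in> ?T"
  proof -
    have "1 \<notin> q" using q(1) by (simp add: prime_id_def)
    moreover have "1 = x ^ 0 * 1" by simp
    ultimately show ?thesis by blast
  qed
  moreover have "a * b \<in> ?T" if ab: "a \<in> ?T" "b \<in> ?T" for a b
  proof -
    obtain n s k t where "a = x ^ n * s" "s \<notin> q" "b = x ^ k * t" "t \<notin> q" using ab by auto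
    moreover from this have "s * t \<notin> q" using q(1) by (auto simp: prime_id_def)
    moreover have "x ^ n * s * (x ^ k * t) = x ^ (n + k) * (s * t)" by (simp add: power_add algebra_simps)
    ultimately show ?thesis by blast
  qed
  ultimately obtain q' where q': "prime_id q'" "J \<subseteq> q'" "q' \<inter> ?T = {}"
    using prime_avoiding[OF J, of ?T] by blast
  have "s \<in> q" if s: "s \<in> q'" for s
  proof (rule ccontr)
    assume "s \<notin> q"
    moreover have "s = x ^ 0 * s" by simp
    ultimately have "s \<in> ?T" by blast
    then show False using q'(3) s by blast
  qed
  moreover have "x \<notin> q'"
  proof
    assume "x \<in> q'"
    moreover have "x \<in> ?T"
    proof -
      have "1 \<notin> q" using q(1) by (simp add: prime_id_def)
      moreover have "x = x ^ 1 * 1" by simp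
      ultimately show ?thesis by blast
    qed
    ultimately show False using q'(3) by blast
  qed
  ultimately have "q' \<subset> q" using adjoin_self[OF J, of x] q(2) by blast
  then show thesis using that q' by blast
qed

lemma prime_chain_below_regular_seq:
  assumes "is_ideal J" "regular_seq J xs" "prime_id q" "adjoin_list J xs \<subseteq> q"
  shows "\<exists>P. (\<forall>i\<le>length xs. prime_id (P i) \<and> J \<subseteq> P i) \<and> (\<forall>i<length xs. P i \<subset> P (Suc i)) \<and> P (length xs) = q"
  using assms
proof (induction xs arbitrary: J)
  case Nil
  then show ?case by (intro exI[of _ "\<lambda>_. q"]) auto
next
  case (Cons x xs)
  have "\<exists>P. (\<forall>i\<le>length xs. prime_id (P i) \<and> adjoin J x \<subseteq> P i) \<and> (\<forall>i<length xs. P i \<subset> P (Suc i)) \<and> P (length xs) = q"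
    by (rule Cons.IH) (use Cons.prems ideal_adjoin in auto)
  then obtain P where P: "\<And>i. i \<le> length xs \<Longrightarrow> prime_id (P i) \<and> adjoin J x \<subseteq> P i"
    "\<And>i. i < length xs \<Longrightarrow> P i \<subset> P (Suc i)" "P (length xs) = q" by blast
  obtain q' where q': "prime_id q'" "J \<subseteq> q'" "q' \<subset> P 0"
    using prime_below_regular[of J x "P 0"] Cons.prems P(1)[of 0] by auto
  have JP: "J \<subseteq> P i" if "i \<le> length xs" for i
    using P(1)[OF that] adjoin_superset[OF Cons.prems(1), of x] by blast
  show ?case
    by (intro exI[of _ "case_nat q' P"]) (use P q' JP in \<open>auto split: nat.splits\<close>)
qed

text \<open>
  An ideal maximal among those without a composition series has an element whose annihilator modulo it is prime,
  hence equal to \<open>\<mm>\<close>; adjoining this element gives a larger ideal, which has a composition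
  series.
\<close>
lemma comp_series_exists:
  assumes J: "noeth J" and only: "\<And>p. prime_id p \<Longrightarrow> J \<subseteq> p \<Longrightarrow> p = \<mm>"
  shows "\<exists>qs. comp_series \<mm> J qs"
proof (rule ccontr)
  assume no: "\<not> ?thesis"
  have idJ: "is_ideal J" using J by (simp add: noeth_def)
  define A where "A = {K. is_ideal K \<and> J \<subseteq> K \<and> (\<nexists>qs. comp_series \<mm> K qs)}"
  have "J \<in> A" using no idJ by (simp add: A_def)
  then have "A \<noteq> {}" by blast
  then obtain K where K: "K \<in> A" and mx: "\<And>X. X \<in> A \<Longrightarrow> K \<subseteq> X \<Longrightarrow> X = K"
    by (rule noeth_maximal[OF J]) (simp_all add: A_def)
  have idK: "is_ideal K" "J \<subseteq> K" and noK: "\<nexists>qs. comp_series \<mm> K qs" using K by (auto simp: A_def)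
  have "K \<noteq> UNIV" using noK comp_series.simps(1) by blast
  define C where "C = (\<lambda>q. {c. c * q \<in> K}) ` (- K)"
  have idC: "is_ideal {c. c * q \<in> K}" for q
    using idK(1) by (auto simp: is_ideal_def distrib_right mult.assoc)
  obtain M where M: "M \<in> C" and mxC: "\<And>X. X \<in> C \<Longrightarrow> M \<subseteq> X \<Longrightarrow> X = M"
  proof (rule noeth_maximal[OF J, of C])
    show "C \<noteq> {}" using \<open>K \<noteq> UNIV\<close> by (auto simp: C_def)
    show "\<And>\<aa>. \<aa> \<in> C \<Longrightarrow> is_ideal \<aa> \<and> J \<subseteq> \<aa>"
      using idC idK ideal_mult[OF idK(1)] by (auto simp: C_def)
  qed blast
  then obtain q where q: "q \<notin> K" "M = {c. c * q \<in> K}" by (auto simp: C_def)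
  have "prime_id M"
    unfolding prime_id_def
  proof (intro conjI allI impI)
    show "is_ideal M" using idC q by simp
    show "1 \<notin> M" using q by simp
    fix a b assume ab: "a * b \<in> M"
    show "a \<in> M \<or> b \<in> M"
    proof (cases "b \<in> M")
      case False
      then have "{c. c * (b * q) \<in> K} \<in> C" using q by (auto simp: C_def)
      moreover have "M \<subseteq> {c. c * (b * q) \<in> K}"
      proof
        fix c assume "c \<in> M"
        then have "b * (c * q) \<in> K" using q ideal_mult[OF idK(1)] by blast
        then show "c \<in> {c. c * (b * q) \<in> K}" by (simp add: algebra_simps)
      qed
      ultimately have "{c. c * (b * q) \<in> K} = M" by (rule mxC)
      moreover have "a * (b * q) \<in> K" using ab q by (simp add: algebra_simps)
      ultimately show ?thesis by blast
    qed simp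
  qed
  moreover have "J \<subseteq> M" using idK ideal_mult[OF idK(1)] q by auto
  ultimately have "M = \<mm>" by (rule only)
  then have mq: "\<forall>y\<in>\<mm>. y * q \<in> K" using q by auto
  have "adjoin K q \<notin> A"
    using mx[of "adjoin K q"] adjoin_superset[OF idK(1), of q] adjoin_self[OF idK(1), of q] q(1) by blast
  then obtain qs where "comp_series \<mm> (adjoin K q) qs"
    using ideal_adjoin[OF idK(1)] adjoin_superset[OF idK(1), of q] idK(2) by (auto simp: A_def)
  then have "comp_series \<mm> K (q # qs)" using mq by simp
  then show False using noK by blast
qed

text \<open>
  An ideal maximal among the counterexamples is not prime, and for \<open>a b\<close> in it the primes above it
  contain \<open>a\<close> or \<open>b\<close>.
\<close>
lemma finitely_many_minimal_primes:
  assumes J: "noeth J"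
  shows "\<exists>Ps. finite Ps \<and> (\<forall>p\<in>Ps. prime_id p \<and> J \<subseteq> p) \<and> (\<forall>p. prime_id p \<longrightarrow> J \<subseteq> p \<longrightarrow> (\<exists>p'\<in>Ps. p' \<subseteq> p))"
    (is "?Q J")
proof (rule ccontr)
  assume no: "\<not> ?Q J"
  have idJ: "is_ideal J" using J by (simp add: noeth_def)
  define A where "A = {K. is_ideal K \<and> J \<subseteq> K \<and> \<not> ?Q K}"
  have "J \<in> A" using no idJ by (simp add: A_def)
  then have "A \<noteq> {}" by blast
  then obtain K where K: "K \<in> A" and mx: "\<And>X. X \<in> A \<Longrightarrow> K \<subseteq> X \<Longrightarrow> X = K"
    by (rule noeth_maximal[OF J]) (simp_all add: A_def)
  have idK: "is_ideal K" "J \<subseteq> K" and noK: "\<not> ?Q K" using K by (auto simp: A_def)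
  have "\<not> prime_id K"
  proof
    assume "prime_id K"
    then have "?Q K" by (intro exI[of _ "{K}"]) auto
    then show False using noK by simp
  qed
  moreover have "1 \<notin> K"
  proof
    assume "1 \<in> K"
    then have "?Q K" by (intro exI[of _ "{}"]) (auto simp: prime_id_def)
    then show False using noK by simp
  qed
  ultimately obtain a b where ab: "a * b \<in> K" "a \<notin> K" "b \<notin> K" using idK by (auto simp: prime_id_def)
  have Q: "?Q (adjoin K c)" if c: "c \<notin> K" for c
  proof (rule ccontr)
    assume "\<not> ?Q (adjoin K c)"
    then have "adjoin K c \<in> A"
      using ideal_adjoin[OF idK(1)] adjoin_superset[OF idK(1), of c] idK(2) by (simp add: A_def)
    then show False using mx[of "adjoin K c"] adjoin_superset[OF idK(1), of c] adjoin_self[OF idK(1), of c] c by blast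
  qed
  obtain Pa where Pa: "finite Pa" "\<And>p. p \<in> Pa \<Longrightarrow> prime_id p \<and> adjoin K a \<subseteq> p"
    "\<And>p. prime_id p \<Longrightarrow> adjoin K a \<subseteq> p \<Longrightarrow> \<exists>p'\<in>Pa. p' \<subseteq> p" using Q[OF ab(2)] by blast
  obtain Pb where Pb: "finite Pb" "\<And>p. p \<in> Pb \<Longrightarrow> prime_id p \<and> adjoin K b \<subseteq> p"
    "\<And>p. prime_id p \<Longrightarrow> adjoin K b \<subseteq> p \<Longrightarrow> \<exists>p'\<in>Pb. p' \<subseteq> p" using Q[OF ab(3)] by blast
  have "?Q K"
  proof (intro exI[of _ "Pa \<union> Pb"] conjI ballI allI impI)
    show "finite (Pa \<union> Pb)" using Pa Pb by simp
    fix p assume "p \<in> Pa \<union> Pb"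
    then have "prime_id p \<and> (adjoin K a \<subseteq> p \<or> adjoin K b \<subseteq> p)" using Pa Pb by blast
    then show "prime_id p" "K \<subseteq> p"
      using adjoin_superset[OF idK(1), of a] adjoin_superset[OF idK(1), of b] by auto
  next
    fix p assume p: "prime_id p" "K \<subseteq> p"
    then have "is_ideal p" "a \<in> p \<or> b \<in> p" using ab by (auto simp: prime_id_def)
    then have "adjoin K a \<subseteq> p \<or> adjoin K b \<subseteq> p" using adjoin_subset[of p K] p by blast
    then show "\<exists>p'\<in>Pa \<union> Pb. p' \<subseteq> p"
    proof
      assume "adjoin K a \<subseteq> p"
      from Pa(3)[OF p(1) this] show ?thesis by auto
    next
      assume "adjoin K b \<subseteq> p"
      from Pb(3)[OF p(1) this] show ?thesis by auto
    qed
  qed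
  then show False using noK by simp
qed

lemma power_in_comp_series:
  assumes pw: "pw 0 = UNIV"
    and least: "\<And>n I. is_ideal I \<Longrightarrow> J \<subseteq> I \<Longrightarrow> (\<And>y z. y \<in> \<mm> \<Longrightarrow> z \<in> pw n \<Longrightarrow> y * z \<in> I) \<Longrightarrow> pw (Suc n) \<subseteq> I"
    and "is_ideal K" "J \<subseteq> K" "comp_series \<mm> K qs"
  shows "pw (length qs) \<subseteq> K"
  using assms(3-)
proof (induction qs arbitrary: K)
  case Nil then show ?case by simp
next
  case (Cons q qs)
  have IH: "pw (length qs) \<subseteq> adjoin K q"
    by (rule Cons.IH) (use Cons.prems ideal_adjoin adjoin_superset[of K q] in auto)
  have "pw (Suc (length qs)) \<subseteq> K"
  proof (rule least[OF Cons.prems(1,2)])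
    fix y z assume y: "y \<in> \<mm>" and "z \<in> pw (length qs)"
    then obtain d where d: "z - q * d \<in> K" using IH by (auto simp: adjoin_def)
    have "y * q \<in> K" using Cons.prems y by simp
    then have "y * (z - q * d) + d * (y * q) \<in> K"
      using d by (blast intro: ideal_add[OF Cons.prems(1)] ideal_mult(1)[OF Cons.prems(1)])
    then show "y * z \<in> K" by (simp add: algebra_simps)
  qed
  then show ?case by simp
qed

subsection \<open>Permuting regular sequences\<close>

text \<open>The quotient by \<open>K\<close> is a local ring with maximal ideal \<open>\<mm> / K\<close>.\<close>
definition local_mod :: "'p::comm_ring_1 set \<Rightarrow> 'p set \<Rightarrow> bool" where
  "local_mod \<mm> K \<longleftrightarrow> is_ideal \<mm> \<and> K \<subseteq> \<mm> \<and> (\<forall>c. c \<notin> \<mm> \<longrightarrow> (\<exists>c'. c' * c - 1 \<in> K)) \<and> 1 \<notin> \<mm>"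

lemma local_mod_residue: "local_mod \<mm> K \<Longrightarrow> residue_ideal \<mm>"
  unfolding local_mod_def residue_ideal_def by (meson subsetD)

lemma local_mod_adjoin: "local_mod \<mm> K \<Longrightarrow> is_ideal K \<Longrightarrow> x \<in> \<mm> \<Longrightarrow> local_mod \<mm> (adjoin K x)"
  using adjoin_subset[of \<mm> K x] adjoin_superset[of K x] unfolding local_mod_def by (meson subsetD)

lemma noeth_adjoin: "noeth K \<Longrightarrow> noeth (adjoin K x)"
  using noeth_mono[of K "adjoin K x"] ideal_adjoin[of K x] adjoin_superset[of K x] by (auto simp: noeth_def)

lemma noeth_adjoin_list: "noeth K \<Longrightarrow> noeth (adjoin_list K xs)"
  by (induction xs arbitrary: K) (auto simp: noeth_adjoin)

lemma local_cancel:
  assumes "local_mod \<mm> K" "is_ideal K" "x \<in> \<mm>" "b - x * (d * b) \<in> K"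
  shows "b \<in> K"
proof -
  have "1 - x * d \<notin> \<mm>"
  proof
    assume "1 - x * d \<in> \<mm>"
    moreover have im: "is_ideal \<mm>" using assms(1) by (simp add: local_mod_def)
    ultimately have "(1 - x * d) + x * d \<in> \<mm>" using ideal_add[OF im _ ideal_mult(2)[OF im assms(3)]] by blast
    then show False using assms(1) by (simp add: local_mod_def)
  qed
  then obtain c where c: "c * (1 - x * d) - 1 \<in> K" using assms(1) by (auto simp: local_mod_def)
  have "c * (b - x * (d * b)) - b * (c * (1 - x * d) - 1) \<in> K"
    by (rule ideal_diff[OF assms(2) ideal_mult(1)[OF assms(2,4)] ideal_mult(1)[OF assms(2) c]])
  then show ?thesis by (simp add: algebra_simps)
qed

text \<open>
  Krull's intersection argument: the ideals generated by the elements \<open>b n\<close> become stationary, so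
  that some \<open>b n\<close> is a multiple of \<open>x b n\<close>, hence zero in the local quotient.
\<close>
lemma infinitely_divisible:
  assumes K: "noeth K" and l: "local_mod \<mm> K" "x \<in> \<mm>" and b: "\<And>n. b n - x * b (Suc n) \<in> K"
  shows "b 0 \<in> K"
proof -
  have idK: "is_ideal K" using K by (simp add: noeth_def)
  have "adjoin K (b n) \<subseteq> adjoin K (b (Suc n))" for n
  proof (rule adjoin_subset[OF ideal_adjoin[OF idK] adjoin_superset[OF idK]])
    show "b n \<in> adjoin K (b (Suc n))" using b[of n] by (auto simp: adjoin_def mult.commute intro!: exI[of _ x])
  qed
  then obtain N where N: "\<And>i. N \<le> i \<Longrightarrow> adjoin K (b i) = adjoin K (b N)"
    by (rule noeth_chain_stable[OF K ideal_adjoin[OF idK] adjoin_superset[OF idK]]) blast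
  have "adjoin K (b (Suc N)) = adjoin K (b N)" by (rule N) simp
  then have "b (Suc N) \<in> adjoin K (b N)" using adjoin_self[OF idK] by blast
  then obtain d where d: "b (Suc N) - b N * d \<in> K" by (auto simp: adjoin_def)
  have "(b (Suc N) - b N * d) + d * (b N - x * b (Suc N)) \<in> K"
    using d b by (blast intro: ideal_add[OF idK] ideal_mult(1)[OF idK])
  then have "b (Suc N) - x * (d * b (Suc N)) \<in> K" by (simp add: algebra_simps)
  then have top: "b (Suc N) \<in> K" by (rule local_cancel[OF l(1) idK l(2)])
  have down: "b n \<in> K" if "b (Suc n) \<in> K" for n
    using ideal_add[OF idK b[of n] ideal_mult(1)[OF idK that, of x]] by simp
  have "b (Suc N - k) \<in> K" for k
  proof (induction k)
    case (Suc k)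
    show ?case
    proof (cases "k \<le> N")
      case True
      then show ?thesis using Suc.IH down[of "N - k"] by (simp add: Suc_diff_le)
    next
      case False
      then show ?thesis using Suc.IH by simp
    qed
  qed (use top in simp)
  from this[of "Suc N"] show ?thesis by simp
qed

text \<open>
  If \<open>y c = 0\<close> modulo \<open>K\<close>, then \<open>c\<close> is a multiple of \<open>x\<close>
  with a quotient that is again killed by \<open>y\<close>. Iterating, \<open>c\<close> is infinitely divisible
  by \<open>x\<close>.
\<close>
lemma regular_swap:
  assumes K: "noeth K" and l: "local_mod \<mm> K" "x \<in> \<mm>"
    and x: "regular_mod K x" and y: "regular_mod (adjoin K x) y"
  shows "regular_mod K y" "regular_mod (adjoin K y) x"
proof -
  have idK: "is_ideal K" using K by (simp add: noeth_def)
  show "regular_mod K y"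
    unfolding regular_mod_def
  proof (intro allI impI)
    fix c assume c: "y * c \<in> K"
    define P where "P n b \<longleftrightarrow> y * b \<in> K \<and> (n = 0 \<longrightarrow> b = c)" for n :: nat and b
    have "\<exists>f. \<forall>n. P n (f n) \<and> f n - x * f (Suc n) \<in> K"
    proof (rule dependent_nat_choice)
      show "\<exists>b. P 0 b" using c by (simp add: P_def)
    next
      fix b n assume "P n b"
      then have yb: "y * b \<in> K" by (simp add: P_def)
      then have "b \<in> adjoin K x" using y adjoin_superset[OF idK, of x] unfolding regular_mod_def by blast
      then obtain b1 where b1: "b - x * b1 \<in> K" by (auto simp: adjoin_def)
      have "y * b - y * (b - x * b1) \<in> K" using yb b1 by (blast intro: ideal_diff[OF idK] ideal_mult(1)[OF idK])
      then have "x * (y * b1) \<in> K" by (simp add: algebra_simps)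
      then have "y * b1 \<in> K" using x by (simp add: regular_mod_def)
      then show "\<exists>b'. P (Suc n) b' \<and> b - x * b' \<in> K" using b1 by (auto simp: P_def)
    qed
    then obtain f where f: "\<And>n. P n (f n)" "\<And>n. f n - x * f (Suc n) \<in> K" by blast
    have "f 0 \<in> K" by (rule infinitely_divisible[OF K l, where b = f, OF f(2)])
    then show "c \<in> K" using f(1)[of 0] by (simp add: P_def)
  qed
  show "regular_mod (adjoin K y) x"
    unfolding regular_mod_def
  proof (intro allI impI)
    fix b assume "x * b \<in> adjoin K y"
    then obtain c where c: "x * b - y * c \<in> K" by (auto simp: adjoin_def)
    have "y * c \<in> adjoin K x"
      using ideal_uminus[OF idK c] by (auto simp: adjoin_def intro!: exI[of _ b])
    then have "c \<in> adjoin K x" using y by (simp add: regular_mod_def)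
    then obtain c' where c': "c - x * c' \<in> K" by (auto simp: adjoin_def)
    have "(x * b - y * c) + y * (c - x * c') \<in> K" using c c' by (blast intro: ideal_add[OF idK] ideal_mult(1)[OF idK])
    then have "x * (b - y * c') \<in> K" by (simp add: algebra_simps)
    then show "b \<in> adjoin K y" using x by (auto simp: regular_mod_def adjoin_def)
  qed
qed

lemma adjoin_commute: "adjoin (adjoin K x) y = adjoin (adjoin K y) x"
proof -
  have "adjoin (adjoin K x) y \<subseteq> adjoin (adjoin K y) x" for x y
  proof
    fix c assume "c \<in> adjoin (adjoin K x) y"
    then obtain d e where "c - y * d - x * e \<in> K" by (auto simp: adjoin_def)
    then have "c - x * e - y * d \<in> K" by (simp add: diff_diff_eq add.commute)
    then show "c \<in> adjoin (adjoin K y) x" unfolding adjoin_def mem_Collect_eq by (intro exI)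
  qed
  then show ?thesis by (intro equalityI)
qed

lemma regular_mod_power: "regular_mod K x \<Longrightarrow> regular_mod K (x ^ n)"
  using regular_mod_pow[of K x n] unfolding regular_mod_def[of K "x ^ n"] by blast

lemma regular_mod_adjoin_power:
  assumes K: "is_ideal K" and x: "regular_mod K x" and y: "regular_mod (adjoin K x) y"
  shows "regular_mod (adjoin K (x ^ n)) y"
proof (induction n)
  case 0
  have "c - 1 * c \<in> K" for c using ideal0[OF K] by simp
  then have "adjoin K 1 = UNIV" unfolding adjoin_def by blast
  then show ?case by (simp add: regular_mod_def)
next
  case (Suc n)
  show ?case unfolding regular_mod_def
  proof (intro allI impI)
    fix b assume "y * b \<in> adjoin K (x ^ Suc n)"
    then obtain c where c: "y * b - x ^ Suc n * c \<in> K" by (auto simp: adjoin_def)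
    then have "y * b \<in> adjoin K x" by (auto simp: adjoin_def mult.assoc intro!: exI[of _ "x ^ n * c"])
    then have "b \<in> adjoin K x" using y by (simp add: regular_mod_def)
    then obtain b1 where b1: "b - x * b1 \<in> K" by (auto simp: adjoin_def)
    have "(y * b - x ^ Suc n * c) - y * (b - x * b1) \<in> K" using b1 c by (blast intro: ideal_diff[OF K] ideal_mult(1)[OF K])
    then have "x * (y * b1 - x ^ n * c) \<in> K" by (simp add: algebra_simps)
    then have "y * b1 - x ^ n * c \<in> K" using x by (simp add: regular_mod_def)
    then have "y * b1 \<in> adjoin K (x ^ n)" by (auto simp: adjoin_def)
    then have "b1 \<in> adjoin K (x ^ n)" using Suc.IH by (simp add: regular_mod_def)
    then obtain d where d: "b1 - x ^ n * d \<in> K" by (auto simp: adjoin_def)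
    have "(b - x * b1) + x * (b1 - x ^ n * d) \<in> K" using b1 d by (blast intro: ideal_add[OF K] ideal_mult(1)[OF K])
    then show "b \<in> adjoin K (x ^ Suc n)" by (auto simp: adjoin_def algebra_simps)
  qed
qed

lemma regular_seq_power_head:
  assumes "noeth K" "local_mod \<mm> K" "y \<in> \<mm>" "set zs \<subseteq> \<mm>" "regular_seq K (y # zs)"
  shows "regular_seq K (y ^ n # zs)"
  using assms
proof (induction zs arbitrary: K)
  case Nil
  then show ?case by (simp add: regular_mod_power)
next
  case (Cons z zs)
  have idK: "is_ideal K" using Cons.prems by (simp add: noeth_def)
  have y: "regular_mod K y" and z: "regular_mod (adjoin K y) z" and rest: "regular_seq (adjoin (adjoin K y) z) zs"
    using Cons.prems by auto
  note sw = regular_swap[OF Cons.prems(1-3) y z]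
  have "regular_seq (adjoin K z) (y ^ n # zs)"
    by (rule Cons.IH)
      (use Cons.prems sw rest noeth_adjoin local_mod_adjoin idK in \<open>auto simp: adjoin_commute[of K y z]\<close>)
  then show ?case
    using regular_mod_power[OF y] regular_mod_adjoin_power[OF idK y z] by (simp add: adjoin_commute[of K z])
qed

text \<open>
  Permutability of regular sequences in a local ring lets \<open>y\<close> be moved past the powers of the other
  elements.
\<close>
lemma regular_mod_powers_of_rest:
  assumes "noeth K" "local_mod \<mm> K" "y \<in> \<mm>" "set zs \<subseteq> \<mm>" "regular_seq K (y # zs)"
  shows "regular_mod (adjoin_list K (map (\<lambda>z. z ^ Suc n) zs)) y"
  using assms
proof (induction zs arbitrary: K)
  case Nil
  then show ?case by simp
next
  case (Cons z zs)
  have idK: "is_ideal K" using Cons.prems by (simp add: noeth_def)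
  have y: "regular_mod K y" using Cons.prems by simp
  have Ky: "noeth (adjoin K y)" "local_mod \<mm> (adjoin K y)"
    using Cons.prems noeth_adjoin local_mod_adjoin idK by auto
  have zn: "regular_seq (adjoin K y) (z ^ Suc n # zs)"
    by (rule regular_seq_power_head[OF Ky]) (use Cons.prems in auto)
  have zm: "z ^ Suc n \<in> \<mm>" using Cons.prems ideal_mult[of \<mm> z] by (auto simp: local_mod_def)
  note sw = regular_swap[OF Cons.prems(1-3) y, of "z ^ Suc n"]
  have "regular_mod (adjoin_list (adjoin K (z ^ Suc n)) (map (\<lambda>z. z ^ Suc n) zs)) y"
  proof (rule Cons.IH)
    show "regular_seq (adjoin K (z ^ Suc n)) (y # zs)"
      using sw zn by (simp add: adjoin_commute[of K y])
  qed (use Cons.prems noeth_adjoin local_mod_adjoin[OF _ idK zm] in auto)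
  then show ?case by simp
qed

subsection \<open>Adjoining a list\<close>

lemma adjoin_list_comb:
  assumes J: "is_ideal J"
  shows "adjoin_list J hs = {c. \<exists>u. c - (\<Sum>a<length hs. u a * hs ! a) \<in> J}"
  using J
proof (induction hs arbitrary: J)
  case Nil show ?case by simp
next
  case (Cons h hs)
  have eq: "(\<Sum>a<length (h # hs). u a * (h # hs) ! a) = u 0 * h + (\<Sum>a<length hs. u (Suc a) * hs ! a)" for u
    unfolding list.size(4) by (simp add: sum.lessThan_Suc_shift del: sum.lessThan_Suc)
  have mem: "c \<in> adjoin_list J (h # hs) \<longleftrightarrow> (\<exists>u d. c - (\<Sum>a<length hs. u a * hs ! a) - h * d \<in> J)" for c
    unfolding adjoin_list.simps Cons.IH[OF ideal_adjoin[OF Cons.prems]] by (simp add: adjoin_def)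
  have re: "c - (\<Sum>a<length hs. u a * hs ! a) - h * d = c - (\<Sum>a<length (h # hs). case_nat d u a * (h # hs) ! a)" for c u d
    unfolding eq by (simp add: algebra_simps)
  have er: "c - (\<Sum>a<length (h # hs). u a * (h # hs) ! a) = c - (\<Sum>a<length hs. u (Suc a) * hs ! a) - h * u 0" for c u
    unfolding eq by (simp add: algebra_simps)
  show ?case
  proof (intro Set.set_eqI iffI)
    fix c assume "c \<in> adjoin_list J (h # hs)"
    then obtain u d where "c - (\<Sum>a<length hs. u a * hs ! a) - h * d \<in> J" unfolding mem by (elim exE)
    then have "c - (\<Sum>a<length (h # hs). case_nat d u a * (h # hs) ! a) \<in> J" unfolding re .
    then show "c \<in> {c. \<exists>u. c - (\<Sum>a<length (h # hs). u a * (h # hs) ! a) \<in> J}"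
      by (intro CollectI exI)
  next
    fix c assume "c \<in> {c. \<exists>u. c - (\<Sum>a<length (h # hs). u a * (h # hs) ! a) \<in> J}"
    then obtain u where "c - (\<Sum>a<length (h # hs). u a * (h # hs) ! a) \<in> J" by (elim CollectE exE)
    then have "c - (\<Sum>a<length hs. u (Suc a) * hs ! a) - h * u 0 \<in> J" unfolding er .
    then show "c \<in> adjoin_list J (h # hs)" unfolding mem by (intro exI)
  qed
qed

section \<open>Noetherianity from a quotient\<close>

text \<open>
  The initial forms, for the powers of \<open>x\<close>, of an ideal are the ideals \<open>B n\<close>. Modulo
  \<open>x\<close> they form an ascending chain, which becomes stationary, so finitely many elements generate
  all initial forms. By completeness their multiples sum up to any element of the ideal.
\<close>
lemma noeth_from_quotient:
  assumes K: "is_ideal K" and c: "adically_complete K x" and Q: "noeth (adjoin K x)"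
  shows "noeth K"
  unfolding noeth_def
proof (intro conjI allI impI)
  fix \<bb> assume b: "is_ideal \<bb>" "K \<subseteq> \<bb>"
  define B where "B n = {c. x ^ n * c \<in> \<bb>}" for n
  have idB: "is_ideal (B n)" for n
    using b(1) by (auto simp: is_ideal_def B_def distrib_left mult.left_commute)
  have KB: "K \<subseteq> B n" for n using b ideal_mult[OF b(1)] by (auto simp: B_def)
  have BS: "B n \<subseteq> B (Suc n)" for n using ideal_mult[OF b(1)] by (auto simp: B_def mult.assoc)
  have Bmono: "B m \<subseteq> B n" if "m \<le> n" for m n using lift_Suc_mono_le[of B, OF BS that] .
  obtain N where N: "\<And>n. N \<le> n \<Longrightarrow> adjoin (B n) x = adjoin (B N) x"
    by (rule noeth_chain_stable[OF Q, of "\<lambda>n. adjoin (B n) x"])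
      (use ideal_adjoin[OF idB] adjoin_mono[OF KB] adjoin_mono[OF BS] in auto)
  have "\<exists>gs. set gs \<subseteq> B n \<and> (\<forall>c\<in>adjoin (B n) x. \<exists>u d. c - (\<Sum>a<length gs. u a * gs ! a) - x * d \<in> K)" for n
  proof -
    obtain hs where hs: "adjoin (B n) x = adjoin_list (adjoin K x) hs"
      using Q ideal_adjoin[OF idB] adjoin_mono[OF KB] unfolding noeth_def by blast
    have "\<forall>h. \<exists>d. h \<in> set hs \<longrightarrow> h - x * d \<in> B n"
      using adjoin_list_mem[OF ideal_adjoin[OF K, of x], of _ hs] unfolding hs[symmetric] by (auto simp: adjoin_def)
    then obtain d where d: "\<And>h. h \<in> set hs \<Longrightarrow> h - x * d h \<in> B n" by metis
    define gs where "gs = map (\<lambda>h. h - x * d h) hs"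
    have "\<exists>u d. c - (\<Sum>a<length gs. u a * gs ! a) - x * d \<in> K" if "c \<in> adjoin (B n) x" for c
    proof -
      from that obtain u e where ue: "c - (\<Sum>a<length hs. u a * hs ! a) - x * e \<in> K"
        unfolding hs adjoin_list_comb[OF ideal_adjoin[OF K]] by (auto simp: adjoin_def)
      have "(\<Sum>a<length hs. u a * hs ! a) = (\<Sum>a<length gs. u a * gs ! a) + x * (\<Sum>a<length hs. u a * d (hs ! a))"
        by (simp add: gs_def sum_distrib_left sum.distrib[symmetric] algebra_simps)
      then have "c - (\<Sum>a<length gs. u a * gs ! a) - x * ((\<Sum>a<length hs. u a * d (hs ! a)) + e) \<in> K"
        using ue by (simp add: algebra_simps)
      then show ?thesis by blast
    qed
    moreover have "set gs \<subseteq> B n" using d by (auto simp: gs_def)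
    ultimately show ?thesis by blast
  qed
  then obtain gs where gs: "\<And>n. set (gs n) \<subseteq> B n"
    "\<And>n c. c \<in> adjoin (B n) x \<Longrightarrow> \<exists>u d. c - (\<Sum>a<length (gs n). u a * gs n ! a) - x * d \<in> K" by metis
  have step: "\<exists>u d. d \<in> B (Suc n) \<and> c - (\<Sum>a<length (gs k). u a * gs k ! a) - x * d \<in> K"
    if c: "c \<in> B n" and k: "k \<le> n" "adjoin (B n) x = adjoin (B k) x" for c n k
  proof -
    have "c \<in> adjoin (B k) x" using c adjoin_superset[OF idB] k by blast
    from gs(2)[OF this] obtain u d where ud: "c - (\<Sum>a<length (gs k). u a * gs k ! a) - x * d \<in> K" by blast
    have "(\<Sum>a<length (gs k). u a * gs k ! a) \<in> B n"
      using subset_trans[OF gs(1)[of k] Bmono[OF k(1)]]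
      by (intro ideal_sum[OF idB] ideal_mult(1)[OF idB]) (simp add: nth_mem subset_iff)
    then have "c - (\<Sum>a<length (gs k). u a * gs k ! a) - (c - (\<Sum>a<length (gs k). u a * gs k ! a) - x * d) \<in> B n"
      using c ud KB by (blast intro: ideal_diff[OF idB])
    then have "d \<in> B (Suc n)" by (simp add: B_def power_Suc2 mult.assoc del: power_Suc)
    then show ?thesis using ud by blast
  qed
  \<comment> \<open>Generators of the ideals \<open>B n\<close> for \<open>n \<le> N\<close>, multiplied by the power of \<open>x\<close> that takes them into the ideal.\<close>
  define L where "L = concat (map (\<lambda>n. map (\<lambda>g. x ^ n * g) (gs n)) [0..<Suc N])"
  have Lb: "set L \<subseteq> \<bb>" using gs(1) by (auto simp: L_def B_def)
  have idL: "is_ideal (adjoin_list K L)" by (rule ideal_adjoin_list[OF K])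
  have KL: "K \<subseteq> adjoin_list K L" by (rule adjoin_list_superset[OF K])
  have gL: "x ^ n * g \<in> adjoin_list K L" if "n \<le> N" "g \<in> set (gs n)" for n g
  proof (rule adjoin_list_mem[OF K])
    have "n \<in> set [0..<Suc N]" using that by auto
    then show "x ^ n * g \<in> set L" using that unfolding L_def by force
  qed
  have sL: "x ^ n * (\<Sum>a<length (gs n). u a * gs n ! a) \<in> adjoin_list K L" if "n \<le> N" for n u
  proof -
    have "x ^ n * (\<Sum>a<length (gs n). u a * gs n ! a) = (\<Sum>a<length (gs n). u a * (x ^ n * gs n ! a))"
      by (simp add: sum_distrib_left algebra_simps)
    moreover have "(\<Sum>a<length (gs n). u a * (x ^ n * gs n ! a)) \<in> adjoin_list K L"
      by (rule ideal_sum[OF idL], rule ideal_mult(1)[OF idL], rule gL[OF that]) simp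
    ultimately show ?thesis by simp
  qed
  have top: "x ^ N * c \<in> adjoin_list K L" if cN: "c \<in> B N" for c
  proof -
    define P where "P n b \<longleftrightarrow> b \<in> B (N + n) \<and> (n = 0 \<longrightarrow> b = c)" for n b
    define R where "R b b' \<longleftrightarrow> (\<exists>u. b - (\<Sum>a<length (gs N). u a * gs N ! a) - x * b' \<in> K)" for b b'
    have "\<exists>f. \<forall>n. P n (f n) \<and> R (f n) (f (Suc n))"
    proof (rule dependent_nat_choice)
      show "\<exists>b. P 0 b" using cN by (simp add: P_def)
    next
      fix b n assume "P n b"
      then have "b \<in> B (N + n)" by (simp add: P_def)
      from step[OF this, of N] N[of "N + n"] show "\<exists>b'. P (Suc n) b' \<and> R b b'" by (auto simp: P_def R_def)
    qed
    then obtain f where f: "\<And>n. P n (f n)" "\<And>n. R (f n) (f (Suc n))" by blast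
    then obtain u where u: "\<And>n. f n - (\<Sum>a<length (gs N). u n a * gs N ! a) - x * f (Suc n) \<in> K"
      unfolding R_def by metis
    have f0: "f 0 = c" using f(1)[of 0] by (simp add: P_def)
    have "\<forall>a. \<exists>U. \<forall>n. \<exists>y. U - (\<Sum>t<n. x ^ t * u t a) - x ^ n * y \<in> K"
    proof
      fix a
      have "\<forall>g. \<exists>c. \<forall>n. \<exists>y. c - (\<Sum>t<n. x ^ t * g t) - x ^ n * y \<in> K" using c unfolding adically_complete_def by blast
      from this[rule_format, of "\<lambda>t. u t a"] show "\<exists>U. \<forall>n. \<exists>y. U - (\<Sum>t<n. x ^ t * u t a) - x ^ n * y \<in> K" by blast
    qed
    then obtain U where "\<forall>a n. \<exists>y. U a - (\<Sum>t<n. x ^ t * u t a) - x ^ n * y \<in> K" by metis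
    then obtain y where y: "\<And>a n. U a - (\<Sum>t<n. x ^ t * u t a) - x ^ n * y a n \<in> K" by metis
    have part: "c - (\<Sum>a<length (gs N). (\<Sum>t<n. x ^ t * u t a) * gs N ! a) - x ^ n * f n \<in> K" for n
    proof (induction n)
      case 0 then show ?case using ideal0[OF K] by (simp add: f0)
    next
      case (Suc n)
      have "(c - (\<Sum>a<length (gs N). (\<Sum>t<n. x ^ t * u t a) * gs N ! a) - x ^ n * f n)
         + x ^ n * (f n - (\<Sum>a<length (gs N). u n a * gs N ! a) - x * f (Suc n)) \<in> K"
        using Suc.IH u by (blast intro: ideal_add[OF K] ideal_mult(1)[OF K])
      then show ?case by (simp add: algebra_simps sum.distrib sum_distrib_left sum_distrib_right)
    qed
    have "c - (\<Sum>a<length (gs N). U a * gs N ! a) \<in> K"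
    proof -
      have "\<exists>z. (c - (\<Sum>a<length (gs N). U a * gs N ! a)) - x ^ n * z \<in> K" for n
      proof
        have diff: "(c - (\<Sum>a<length (gs N). (\<Sum>t<n. x ^ t * u t a) * gs N ! a) - x ^ n * f n)
          - (\<Sum>a<length (gs N). (U a - (\<Sum>t<n. x ^ t * u t a) - x ^ n * y a n) * gs N ! a) \<in> K"
          by (rule ideal_diff[OF K part ideal_sum[OF K ideal_mult(2)[OF K y]]])
        have seq: "(\<Sum>a<length (gs N). (U a - (\<Sum>t<n. x ^ t * u t a) - x ^ n * y a n) * gs N ! a) =
          (\<Sum>a<length (gs N). U a * gs N ! a) - (\<Sum>a<length (gs N). (\<Sum>t<n. x ^ t * u t a) * gs N ! a)
          - x ^ n * (\<Sum>a<length (gs N). y a n * gs N ! a)"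
          by (simp add: left_diff_distrib sum_subtractf sum_distrib_left mult.assoc)
        have alg: "(c - s0) - x ^ n * (f n - s2) = (c - s1 - x ^ n * f n) - (s0 - s1 - x ^ n * s2)" for s0 s1 s2
          by (simp add: algebra_simps)
        show "(c - (\<Sum>a<length (gs N). U a * gs N ! a)) - x ^ n * (f n - (\<Sum>a<length (gs N). y a n * gs N ! a)) \<in> K"
          using diff unfolding seq alg[of _ _ "\<Sum>a<length (gs N). (\<Sum>t<n. x ^ t * u t a) * gs N ! a"] .
      qed
      then show ?thesis using c unfolding adically_complete_def by blast
    qed
    then have "x ^ N * (c - (\<Sum>a<length (gs N). U a * gs N ! a)) + x ^ N * (\<Sum>a<length (gs N). U a * gs N ! a) \<in> adjoin_list K L"
      by (intro ideal_add[OF idL ideal_mult(1)[OF idL subsetD[OF KL]] sL]) simp_all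
    then show ?thesis by (simp add: algebra_simps)
  qed
  have all: "x ^ n * c \<in> adjoin_list K L" if "n \<le> N" "c \<in> B n" for n c
    using that
  proof (induction "N - n" arbitrary: n c)
    case 0 then show ?case using top by simp
  next
    case (Suc k)
    obtain u d where d: "d \<in> B (Suc n)" "c - (\<Sum>a<length (gs n). u a * gs n ! a) - x * d \<in> K"
      using step[OF Suc.prems(2), of n] by auto
    have IH: "x ^ Suc n * d \<in> adjoin_list K L" using Suc.hyps(1)[of "Suc n" d] Suc.hyps(2) d by simp
    have "x ^ n * (c - (\<Sum>a<length (gs n). u a * gs n ! a) - x * d) + x ^ n * (\<Sum>a<length (gs n). u a * gs n ! a)
      + x ^ Suc n * d \<in> adjoin_list K L"
      by (rule ideal_add[OF idL ideal_add[OF idL ideal_mult(1)[OF idL subsetD[OF KL d(2)]] sL[OF Suc.prems(1)]] IH])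
    then show ?case by (simp add: algebra_simps)
  qed
  have "\<bb> \<subseteq> adjoin_list K L" using all[of 0] by (auto simp: B_def)
  moreover have "adjoin_list K L \<subseteq> \<bb>" by (rule adjoin_list_least[OF b Lb])
  ultimately show "\<exists>hs. \<bb> = adjoin_list K hs" by blast
qed (rule K)

section \<open>Artin-Rees properties and completion\<close>

text \<open>
  The closure of \<open>K\<close> for the topology given by \<open>F\<close> is the set of all \<open>p\<close>
  with \<open>near F K n p\<close> for every \<open>n\<close>.
\<close>
definition near :: "(nat \<Rightarrow> 'p::comm_ring_1 set) \<Rightarrow> 'p set \<Rightarrow> nat \<Rightarrow> 'p \<Rightarrow> bool" where
  "near F K n p \<longleftrightarrow> (\<exists>z\<in>K. p - z \<in> F n)"

text \<open>
  The colon form of the Artin--Rees property: division by \<open>x\<close> modulo \<open>K\<close> is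
  continuous.
\<close>
definition artin_rees :: "(nat \<Rightarrow> 'p::comm_ring_1 set) \<Rightarrow> 'p set \<Rightarrow> 'p \<Rightarrow> bool" where
  "artin_rees F K x \<longleftrightarrow> (\<forall>n. \<exists>t. \<forall>p. near F K t (x * p) \<longrightarrow> near F K n p)"

definition closed_in :: "(nat \<Rightarrow> 'p::comm_ring_1 set) \<Rightarrow> 'p set \<Rightarrow> bool" where
  "closed_in F K \<longleftrightarrow> (\<forall>p. (\<forall>n. near F K n p) \<longrightarrow> p \<in> K)"

definition artin_rees_seq :: "(nat \<Rightarrow> 'p::comm_ring_1 set) \<Rightarrow> 'p set \<Rightarrow> 'p list \<Rightarrow> bool" where
  "artin_rees_seq F K xs \<longleftrightarrow> (\<forall>us y zs. xs = us @ y # zs \<longrightarrow> artin_rees F (adjoin_list K us) y)"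

locale filtration =
  fixes F :: "nat \<Rightarrow> 'p::comm_ring_1 set"
  assumes ideal_F: "is_ideal (F n)" and F_Suc: "F (Suc n) \<subseteq> F n"
begin

lemma F_mono: "m \<le> n \<Longrightarrow> F n \<subseteq> F m"
  using lift_Suc_antimono_le[of F m n] F_Suc by blast

lemma near_mono: "m \<le> n \<Longrightarrow> near F K n p \<Longrightarrow> near F K m p"
  using F_mono unfolding near_def by blast

lemma near_cong: "near F K n p \<Longrightarrow> p - q \<in> F n \<Longrightarrow> near F K n q"
proof -
  assume "near F K n p" and pq: "p - q \<in> F n"
  then obtain z where z: "z \<in> K" "p - z \<in> F n" by (auto simp: near_def)
  from ideal_diff[OF ideal_F z(2) pq] have "q - z \<in> F n" by simp
  then show ?thesis using z by (auto simp: near_def)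
qed

lemma near_cong_sym: "near F K n p \<Longrightarrow> q - p \<in> F n \<Longrightarrow> near F K n q"
  using near_cong[of K n p q] ideal_uminus[OF ideal_F, of "q - p" n] by simp

lemma ideal_near:
  assumes K: "is_ideal K"
  shows "is_ideal {c. near F K n c}"
  unfolding is_ideal_def
proof (intro conjI ballI allI)
  show "0 \<in> {c. near F K n c}" using ideal0[OF K] ideal0[OF ideal_F] by (auto simp: near_def intro!: bexI[of _ 0])
next
  fix a b assume "a \<in> {c. near F K n c}" "b \<in> {c. near F K n c}"
  then obtain y z where yz: "y \<in> K" "z \<in> K" and "a - y \<in> F n" "b - z \<in> F n" by (auto simp: near_def)
  from ideal_add[OF ideal_F this(3,4)] have "(a + b) - (y + z) \<in> F n" by (simp add: algebra_simps)
  then show "a + b \<in> {c. near F K n c}" using ideal_add[OF K yz] by (auto simp: near_def)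
next
  fix c a assume "a \<in> {c. near F K n c}"
  then obtain y where y: "y \<in> K" and "a - y \<in> F n" by (auto simp: near_def)
  from ideal_mult(1)[OF ideal_F this(2), of c] have "c * a - c * y \<in> F n" by (simp add: algebra_simps)
  then show "c * a \<in> {c. near F K n c}" using ideal_mult(1)[OF K y] by (auto simp: near_def)
qed

lemma near_member: "z \<in> K \<Longrightarrow> near F K n z"
  using ideal0[OF ideal_F] by (auto simp: near_def intro!: bexI[of _ z])

lemma near_F: "is_ideal K \<Longrightarrow> p \<in> F n \<Longrightarrow> near F K n p"
  using ideal0 by (auto simp: near_def intro!: bexI[of _ 0])

text \<open>Membership up to \<open>F n\<close> can be tested with coefficients from a dense set.\<close>
lemma near_adjoin_list_iff:
  assumes K: "is_ideal K" "K \<subseteq> F n" and dense: "\<And>p. \<exists>p'\<in>P0. p - p' \<in> F n"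
  shows "near F (adjoin_list K ys) n p \<longleftrightarrow> (\<exists>u. (\<forall>a. u a \<in> P0) \<and> p - (\<Sum>a<length ys. u a * ys ! a) \<in> F n)"
proof
  assume "near F (adjoin_list K ys) n p"
  then obtain z u where z: "p - z \<in> F n" "z - (\<Sum>a<length ys. u a * ys ! a) \<in> F n"
    using K(2) unfolding near_def adjoin_list_comb[OF K(1)] by blast
  obtain v where v: "\<And>c. v c \<in> P0 \<and> c - v c \<in> F n" using dense by metis
  have "(\<Sum>a<length ys. (u a - v (u a)) * ys ! a) \<in> F n"
    by (rule ideal_sum[OF ideal_F ideal_mult(2)[OF ideal_F]]) (use v in blast)
  from ideal_add[OF ideal_F ideal_add[OF ideal_F z] this]
  have "p - (\<Sum>a<length ys. v (u a) * ys ! a) \<in> F n" by (simp add: left_diff_distrib sum_subtractf)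
  then show "\<exists>u. (\<forall>a. u a \<in> P0) \<and> p - (\<Sum>a<length ys. u a * ys ! a) \<in> F n"
    using v by (intro exI[of _ "\<lambda>a. v (u a)"]) blast
next
  assume "\<exists>u. (\<forall>a. u a \<in> P0) \<and> p - (\<Sum>a<length ys. u a * ys ! a) \<in> F n"
  then obtain u where u: "p - (\<Sum>a<length ys. u a * ys ! a) \<in> F n" by blast
  have "(\<Sum>a<length ys. u a * ys ! a) \<in> adjoin_list K ys"
    by (rule ideal_sum[OF ideal_adjoin_list[OF K(1)] ideal_mult(1)[OF ideal_adjoin_list[OF K(1)]]])
      (simp add: adjoin_list_mem[OF K(1)])
  then show "near F (adjoin_list K ys) n p" using u by (auto simp: near_def)
qed

end

locale complete_filtration = filtration F for F :: "nat \<Rightarrow> 'p::comm_ring_1 set" +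
  assumes complete: "(\<And>n. p (Suc n) - p n \<in> F n) \<Longrightarrow> \<exists>q. \<forall>n. q - p n \<in> F n"
begin

text \<open>
  An approximable element is a limit of multiples of \<open>x\<close> modulo \<open>K\<close>. Continuity of
  division makes the quotients converge, and completeness supplies their limit.
\<close>
lemma closed_adjoin:
  assumes K: "is_ideal K" "closed_in F K" and ar: "artin_rees F K x"
  shows "closed_in F (adjoin K x)"
  unfolding closed_in_def
proof (intro allI impI)
  fix p assume p: "\<forall>n. near F (adjoin K x) n p"
  obtain t0 where t0: "\<And>n p. near F K (t0 n) (x * p) \<Longrightarrow> near F K n p"
    using ar unfolding artin_rees_def by metis
  define t where "t n = (\<Sum>i\<le>n. t0 i) + n" for n
  have t: "near F K n p" if "near F K (t n) (x * p)" for n p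
  proof (rule t0, rule near_mono[OF _ that])
    show "t0 n \<le> t n" unfolding t_def by (simp add: member_le_sum trans_le_add1)
  qed
  have tS: "t n \<le> t (Suc n)" and tn: "n \<le> t n" for n by (simp_all add: t_def)
  have "\<exists>a. near F K (t n) (p - x * a)" for n
  proof -
    obtain z where z: "z \<in> adjoin K x" "p - z \<in> F (t n)" using p unfolding near_def by blast
    then obtain a where "z - x * a \<in> K" by (auto simp: adjoin_def)
    moreover have "(p - x * a) - (z - x * a) \<in> F (t n)" using z by simp
    ultimately show ?thesis unfolding near_def by blast
  qed
  then obtain a where a: "\<And>n. near F K (t n) (p - x * a n)" by metis
  have near_diff: "near F K n (u - v)" if "near F K n u" "near F K n v" for n u v
    using ideal_diff[OF ideal_near[OF K(1)], of u n v] that by simp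
  have step_a: "near F K n (a (Suc n) - a n)" for n
  proof (rule t)
    have "near F K (t n) ((p - x * a n) - (p - x * a (Suc n)))"
      by (rule near_diff[OF a near_mono[OF tS a]])
    then show "near F K (t n) (x * (a (Suc n) - a n))" by (simp add: algebra_simps)
  qed
  define P where "P n b \<longleftrightarrow> b - a n \<in> K" for n b
  have "\<exists>f. \<forall>n. P n (f n) \<and> f (Suc n) - f n \<in> F n"
  proof (rule dependent_nat_choice)
    show "\<exists>b. P 0 b" using ideal0[OF K(1)] by (auto simp: P_def intro!: exI[of _ "a 0"])
  next
    fix b n assume "P n b"
    then have b: "b - a n \<in> K" by (simp add: P_def)
    have "near F K n ((a (Suc n) - a n) - (b - a n))" by (rule near_diff[OF step_a near_member[OF b]])
    then obtain z where z: "z \<in> K" "a (Suc n) - b - z \<in> F n" by (auto simp: near_def)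
    have "(a (Suc n) - z) - a (Suc n) \<in> K" using ideal_uminus[OF K(1) z(1)] by simp
    moreover have "(a (Suc n) - z) - b \<in> F n" using z(2) by (simp add: algebra_simps)
    ultimately show "\<exists>b'. P (Suc n) b' \<and> b' - b \<in> F n" unfolding P_def by blast
  qed
  then obtain f where f: "\<And>n. f n - a n \<in> K" "\<And>n. f (Suc n) - f n \<in> F n" by (auto simp: P_def)
  obtain b where b: "\<And>n. b - f n \<in> F n" using complete[OF f(2)] by blast
  have "near F K n (p - x * b)" for n
  proof -
    have "near F K n ((p - x * a n) - x * (f n - a n))"
      by (rule near_diff[OF near_mono[OF tn a] near_member[OF ideal_mult(1)[OF K(1) f(1)]]])
    moreover have "((p - x * a n) - x * (f n - a n)) - (p - x * b) \<in> F n"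
      using ideal_mult(1)[OF ideal_F b, of x n] by (simp add: algebra_simps)
    ultimately show ?thesis by (rule near_cong)
  qed
  then have "p - x * b \<in> K" using K(2) unfolding closed_in_def by blast
  then show "p \<in> adjoin K x" by (auto simp: adjoin_def)
qed

lemma regular_if_artin_rees:
  assumes K: "closed_in F K" and ar: "artin_rees F K x"
  shows "regular_mod K x"
  unfolding regular_mod_def
proof (intro allI impI)
  fix c assume "x * c \<in> K"
  then have "near F K n c" for n using ar near_member[of "x * c" K] unfolding artin_rees_def by blast
  then show "c \<in> K" using K unfolding closed_in_def by blast
qed

lemma adically_complete_if_closed:
  assumes K: "is_ideal K" "closed_in F K" and x: "\<And>n. x ^ n \<in> F n"
  shows "adically_complete K x"
  unfolding adically_complete_def
proof (intro conjI allI impI)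
  have xF: "x ^ n * y \<in> F n" for n y by (rule ideal_mult(2)[OF ideal_F x])
  fix g :: "nat \<Rightarrow> 'p"
  have "\<exists>q. \<forall>n. q - (\<Sum>t<n. x ^ t * g (k + t)) \<in> F n" for k
    by (rule complete) (simp add: xF)
  then obtain q where q: "\<And>k n. q k - (\<Sum>t<n. x ^ t * g (k + t)) \<in> F n" by metis
  show "\<exists>c. \<forall>n. \<exists>y. c - (\<Sum>t<n. x ^ t * g t) - x ^ n * y \<in> K"
  proof (rule exI[of _ "q 0"], rule allI)
    fix n
    have "near F K m (q 0 - (\<Sum>t<n. x ^ t * g t) - x ^ n * q n)" for m
    proof -
      have 1: "q 0 - (\<Sum>t<n + m. x ^ t * g t) \<in> F m" using q[of 0 "n + m"] F_mono[of m "n + m"] by auto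
      have 2: "x ^ n * (q n - (\<Sum>t<m. x ^ t * g (n + t))) \<in> F m" by (rule ideal_mult(1)[OF ideal_F q])
      have "(\<Sum>t<n + m. x ^ t * g t) = (\<Sum>t<n. x ^ t * g t) + x ^ n * (\<Sum>t<m. x ^ t * g (n + t))"
        by (induction m) (simp_all add: algebra_simps power_add)
      then have "q 0 - (\<Sum>t<n. x ^ t * g t) - x ^ n * q n =
        (q 0 - (\<Sum>t<n + m. x ^ t * g t)) - x ^ n * (q n - (\<Sum>t<m. x ^ t * g (n + t)))"
        by (simp add: right_diff_distrib)
      then show ?thesis using near_F[OF K(1) ideal_diff[OF ideal_F 1 2]] by (simp only:)
    qed
    then show "\<exists>y. q 0 - (\<Sum>t<n. x ^ t * g t) - x ^ n * y \<in> K" using K(2) unfolding closed_in_def by blast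
  qed
next
  have xF: "x ^ n * y \<in> F n" for n y by (rule ideal_mult(2)[OF ideal_F x])
  fix c assume c: "\<forall>n. \<exists>y. c - x ^ n * y \<in> K"
  have "near F K n c" for n
  proof -
    obtain y where y: "c - x ^ n * y \<in> K" using c by blast
    show ?thesis unfolding near_def by (rule bexI[OF _ y]) (simp add: xF)
  qed
  then show "c \<in> K" using K(2) unfolding closed_in_def by blast
qed

lemma complete_regular_seq:
  assumes "is_ideal K" "closed_in F K" "artin_rees_seq F K xs" "\<And>x n. x \<in> set xs \<Longrightarrow> x ^ n \<in> F n"
  shows "regular_seq K xs \<and> complete_seq K xs \<and> closed_in F (adjoin_list K xs)"
  using assms
proof (induction xs arbitrary: K)
  case Nil
  then show ?case by simp
next
  case (Cons x xs)
  have ar: "artin_rees F K x"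
    using Cons.prems(3)[unfolded artin_rees_seq_def, rule_format, of "[]" x xs] by simp
  have "artin_rees_seq F (adjoin K x) xs"
    unfolding artin_rees_seq_def
  proof (intro allI impI)
    fix us y zs assume "xs = us @ y # zs"
    then show "artin_rees F (adjoin_list (adjoin K x) us) y"
      using Cons.prems(3)[unfolded artin_rees_seq_def, rule_format, of "x # us" y zs] by simp
  qed
  from Cons.IH[OF ideal_adjoin[OF Cons.prems(1)] closed_adjoin[OF Cons.prems(1,2) ar] this]
  have "regular_seq (adjoin K x) xs \<and> complete_seq (adjoin K x) xs \<and> closed_in F (adjoin_list (adjoin K x) xs)"
    using Cons.prems(4) by simp
  then show ?case
    using regular_if_artin_rees[OF Cons.prems(2) ar] adically_complete_if_closed[OF Cons.prems(1,2)] Cons.prems(4)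
    by simp
qed

end

lemma noeth_from_quotient_list:
  "is_ideal K \<Longrightarrow> complete_seq K xs \<Longrightarrow> noeth (adjoin_list K xs) \<Longrightarrow> noeth K"
proof (induction xs arbitrary: K)
  case (Cons x xs)
  have "noeth (adjoin K x)" by (rule Cons.IH) (use Cons.prems ideal_adjoin in simp_all)
  then show ?case using noeth_from_quotient[of K x] Cons.prems by simp
qed simp

lemma regular_seq_append:
  "regular_seq K (us @ zs) \<longleftrightarrow> regular_seq K us \<and> regular_seq (adjoin_list K us) zs"
  by (induction us arbitrary: K) auto

lemma local_mod_adjoin_list:
  "local_mod \<mm> K \<Longrightarrow> is_ideal K \<Longrightarrow> set xs \<subseteq> \<mm> \<Longrightarrow> local_mod \<mm> (adjoin_list K xs)"
  by (induction xs arbitrary: K) (auto simp: local_mod_adjoin ideal_adjoin)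

lemma prime_id_power: "prime_id p \<Longrightarrow> x ^ Suc n \<in> p \<Longrightarrow> x \<in> p"
  by (induction n) (auto simp: prime_id_def)

text \<open>
  The powers of the maximal ideal of a noetherian local ring, as ideals of a ring that maps onto it. The powers
  are characterised by being the least ideals containing products.
\<close>
locale power_filtration = filtration M for M :: "nat \<Rightarrow> 'p::comm_ring_1 set" +
  fixes J \<mm> :: "'p set"
  assumes M0: "M 0 = UNIV"
    and M_least: "\<And>n I. is_ideal I \<Longrightarrow> J \<subseteq> I \<Longrightarrow> (\<And>y z. y \<in> \<mm> \<Longrightarrow> z \<in> M n \<Longrightarrow> y * z \<in> I) \<Longrightarrow> M (Suc n) \<subseteq> I"
    and M_pow: "x \<in> \<mm> \<Longrightarrow> x ^ n \<in> M n"
    and noethJ: "noeth J" and localJ: "local_mod \<mm> J"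
begin

lemma power_in_primary:
  assumes K: "is_ideal K" "J \<subseteq> K" and only: "\<And>p. prime_id p \<Longrightarrow> K \<subseteq> p \<Longrightarrow> p = \<mm>"
  obtains n where "M n \<subseteq> K"
proof -
  obtain qs where "comp_series \<mm> K qs" using comp_series_exists[OF noeth_mono[OF noethJ K] only] by blast
  from power_in_comp_series[of M J \<mm> K qs, OF M0 M_least K this] show thesis using that by blast
qed

text \<open>
  For \<open>y\<close> in the sequence, \<open>y\<close> stays regular modulo powers \<open>z\<^sup>n\<close> of
  the elements after it. If \<open>y p\<close> is close to \<open>K\<close>, then it lies in \<open>K +
  (y\<^bsup>n+1\<^esup>, z\<^bsup>n+1\<^esup>)\<close>, because this ideal contains a power of the maximal
  ideal. Cancelling \<open>y\<close> leaves \<open>p\<close> in \<open>K + (y\<^sup>n,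
  z\<^bsup>n+1\<^esup>)\<close>.
\<close>
lemma artin_rees_regular_seq:
  assumes xs: "regular_seq J xs" "set xs \<subseteq> \<mm>"
    and only: "\<And>p. prime_id p \<Longrightarrow> adjoin_list J xs \<subseteq> p \<Longrightarrow> p = \<mm>"
  shows "artin_rees_seq M J xs"
  unfolding artin_rees_seq_def artin_rees_def
proof (intro allI impI)
  fix us y zs n assume x: "xs = us @ y # zs"
  have idJ: "is_ideal J" using noethJ by (simp add: noeth_def)
  define K where "K = adjoin_list J us"
  have idK: "is_ideal K" unfolding K_def by (rule ideal_adjoin_list[OF idJ])
  have JK: "J \<subseteq> K" unfolding K_def by (rule adjoin_list_superset[OF idJ])
  have seqK: "regular_seq K (y # zs)" using xs(1) unfolding x regular_seq_append K_def by simp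
  have ym: "y \<in> \<mm>" and zm: "set zs \<subseteq> \<mm>" and um: "set us \<subseteq> \<mm>" using xs(2) x by auto
  define L where "L = adjoin_list J (map (\<lambda>x. x ^ Suc n) xs)"
  have idL: "is_ideal L" unfolding L_def by (rule ideal_adjoin_list[OF idJ])
  have JL: "J \<subseteq> L" unfolding L_def by (rule adjoin_list_superset[OF idJ])
  have "p = \<mm>" if p: "prime_id p" "L \<subseteq> p" for p
  proof (rule only[OF p(1)])
    have "x \<in> p" if "x \<in> set xs" for x
    proof (rule prime_id_power[OF p(1)])
      have "x ^ Suc n \<in> L" unfolding L_def by (rule adjoin_list_mem[OF idJ]) (use that in auto)
      then show "x ^ Suc n \<in> p" using p(2) by blast
    qed
    moreover have "is_ideal p" using p by (simp add: prime_id_def)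
    ultimately show "adjoin_list J xs \<subseteq> p" using JL p(2) by (intro adjoin_list_least) auto
  qed
  from power_in_primary[OF idL JL this] obtain t where t: "M t \<subseteq> L" by blast
  define I where "I = adjoin_list K (map (\<lambda>z. z ^ Suc n) zs)"
  have idI: "is_ideal I" unfolding I_def by (rule ideal_adjoin_list[OF idK])
  have KI: "K \<subseteq> I" unfolding I_def by (rule adjoin_list_superset[OF idK])
  have yI: "regular_mod I y" unfolding I_def
    by (rule regular_mod_powers_of_rest[OF _ _ ym zm seqK])
      (simp_all add: K_def noeth_adjoin_list[OF noethJ] local_mod_adjoin_list[OF localJ idJ um])
  have "L \<subseteq> adjoin I (y ^ Suc n)"
    unfolding L_def
  proof (rule adjoin_list_least[OF ideal_adjoin[OF idI]])
    have sup: "I \<subseteq> adjoin I (y ^ Suc n)" by (rule adjoin_superset[OF idI])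
    then show "J \<subseteq> adjoin I (y ^ Suc n)" using JK KI by blast
    have "u ^ Suc n \<in> I" if "u \<in> set us" for u
    proof -
      have "u \<in> K" unfolding K_def by (rule adjoin_list_mem[OF idJ that])
      then show ?thesis using KI ideal_mult(2)[OF idI] by auto
    qed
    moreover have "z ^ Suc n \<in> I" if "z \<in> set zs" for z
      unfolding I_def by (rule adjoin_list_mem[OF idK]) (use that in auto)
    ultimately show "set (map (\<lambda>x. x ^ Suc n) xs) \<subseteq> adjoin I (y ^ Suc n)"
      using sup adjoin_self[OF idI, of "y ^ Suc n"] by (auto simp: x simp del: power_Suc)
  qed
  then have tI: "M t \<subseteq> adjoin I (y ^ Suc n)" using t by blast
  have "near M K n p" if nt: "near M K t (y * p)" for p
  proof -
    obtain z where z: "z \<in> K" "y * p - z \<in> M t" using nt by (auto simp: near_def)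
    then obtain c where "y * p - z - y ^ Suc n * c \<in> I" using tI by (auto simp: adjoin_def)
    from ideal_add[OF idI this subsetD[OF KI z(1)]] have "y * (p - y ^ n * c) \<in> I" by (simp add: algebra_simps)
    then have pI: "p - y ^ n * c \<in> I" using yI by (simp add: regular_mod_def)
    have "I \<subseteq> {c. near M K n c}" unfolding I_def
    proof (rule adjoin_list_least[OF ideal_near[OF idK]])
      show "K \<subseteq> {c. near M K n c}" using near_member by blast
      have "z ^ Suc n \<in> M n" if "z \<in> set zs" for z using M_pow[of z "Suc n"] zm that F_Suc[of n] by blast
      then show "set (map (\<lambda>z. z ^ Suc n) zs) \<subseteq> {c. near M K n c}" using near_F[OF idK] by auto
    qed
    then have "near M K n (p - y ^ n * c)" using pI by blast
    moreover have "(p - y ^ n * c) - p \<in> M n"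
      using ideal_uminus[OF ideal_F ideal_mult(2)[OF ideal_F M_pow[OF ym]], of n c] by simp
    ultimately show ?thesis by (rule near_cong)
  qed
  then show "\<exists>t. \<forall>p. near M (adjoin_list J us) t (y * p) \<longrightarrow> near M (adjoin_list J us) n p"
    unfolding K_def by blast
qed

end

text \<open>
  One ring maps onto a local ring, with kernel \<open>J\<close>, and onto its completion, with kernel
  \<open>S\<close>. The preimages of the powers of the maximal ideal are \<open>M n\<close>, and \<open>F
  n\<close> are the kernels of the maps from the completion to the quotients by these powers. The subring
  \<open>P0\<close> consists of the elements whose two images correspond; on it both filtrations agree.
\<close>
locale completion_filtration = power_filtration M J \<mm> + F: complete_filtration F
  for M F :: "nat \<Rightarrow> 'p::comm_ring_1 set" and J \<mm> +
  fixes P0 S :: "'p set"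
  assumes P0_diff: "a \<in> P0 \<Longrightarrow> b \<in> P0 \<Longrightarrow> a - b \<in> P0"
    and P0_mult: "a \<in> P0 \<Longrightarrow> b \<in> P0 \<Longrightarrow> a * b \<in> P0"
    and dense_F: "\<exists>a\<in>P0. p - a \<in> F n" and dense_J: "\<exists>a\<in>P0. p - a \<in> J"
    and agree: "a \<in> P0 \<Longrightarrow> a \<in> F n \<longleftrightarrow> a \<in> M n"
    and JM: "J \<subseteq> M n" and S: "S = (\<Inter>n. F n)"
begin

lemma ideal_S: "is_ideal S"
  using F.ideal_F unfolding S is_ideal_def by auto

lemma closed_S: "closed_in F S"
  unfolding closed_in_def near_def
proof (intro allI impI)
  fix p assume p: "\<forall>n. \<exists>z\<in>S. p - z \<in> F n"
  have "p \<in> F n" for n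
  proof -
    obtain z where z: "z \<in> F n" "p - z \<in> F n" using p unfolding S by blast
    from ideal_add[OF F.ideal_F this(2,1)] show ?thesis by simp
  qed
  then show "p \<in> S" unfolding S by blast
qed

lemma P0_sum:
  assumes "\<And>a. u a \<in> P0" "set ys \<subseteq> P0" "p \<in> P0"
  shows "p - (\<Sum>a<length ys. u a * ys ! a) \<in> P0"
proof -
  have 0: "0 \<in> P0" using P0_diff[OF assms(3,3)] by simp
  have "(\<Sum>a<n. u a * ys ! a) \<in> P0" if "n \<le> length ys" for n
    using that
  proof (induction n)
    case (Suc n)
    have "ys ! n \<in> P0" using assms(2) Suc.prems by (auto simp: subset_iff)
    then have "u n * ys ! n \<in> P0" using P0_mult[OF assms(1)] by blast
    then have "(\<Sum>a<n. u a * ys ! a) - (0 - u n * ys ! n) \<in> P0" using Suc.IH Suc.prems P0_diff 0 by (metis Suc_leD)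
    then show ?case by simp
  qed (use 0 in simp)
  then show ?thesis using P0_diff assms by auto
qed

lemma near_transfer:
  assumes "set ys \<subseteq> P0" "p \<in> P0"
  shows "near F (adjoin_list S ys) n p \<longleftrightarrow> near M (adjoin_list J ys) n p"
proof -
  have idJ: "is_ideal J" using noethJ by (simp add: noeth_def)
  have SF: "S \<subseteq> F n" unfolding S by blast
  have dM: "\<exists>a\<in>P0. p - a \<in> M n" for p using dense_J[of p] JM by blast
  show ?thesis
    unfolding F.near_adjoin_list_iff[OF ideal_S SF dense_F] near_adjoin_list_iff[OF idJ JM dM]
    using agree P0_sum assms by blast
qed

text \<open>
  Elements can be replaced by elements of \<open>P0\<close> up to \<open>F n\<close>, where the two filtrations
  agree.
\<close>
lemma artin_rees_transfer:
  assumes "artin_rees_seq M J xs" "set xs \<subseteq> P0"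
  shows "artin_rees_seq F S xs"
  unfolding artin_rees_seq_def artin_rees_def
proof (intro allI impI)
  fix us y zs n assume x: "xs = us @ y # zs"
  have P: "set us \<subseteq> P0" "y \<in> P0" using assms x by auto
  obtain t where t: "\<And>p. near M (adjoin_list J us) t (y * p) \<Longrightarrow> near M (adjoin_list J us) n p"
    using assms(1) x unfolding artin_rees_seq_def artin_rees_def by blast
  have "near F (adjoin_list S us) n p" if nt: "near F (adjoin_list S us) (max t n) (y * p)" for p
  proof -
    obtain p0 where p0: "p0 \<in> P0" "p - p0 \<in> F (max t n)" using dense_F by blast
    have "y * p - y * p0 \<in> F (max t n)"
      using ideal_mult(1)[OF F.ideal_F p0(2), of y] by (simp add: right_diff_distrib)
    then have "near F (adjoin_list S us) (max t n) (y * p0)" by (rule F.near_cong[OF nt])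
    then have "near F (adjoin_list S us) t (y * p0)" by (rule F.near_mono[rotated]) simp
    then have "near M (adjoin_list J us) t (y * p0)" using near_transfer P p0 P0_mult by blast
    then have "near F (adjoin_list S us) n p0" using t near_transfer P p0 by blast
    moreover have "p - p0 \<in> F n" using p0(2) F.F_mono[of n "max t n"] by auto
    ultimately show ?thesis by (rule F.near_cong_sym)
  qed
  then show "\<exists>t. \<forall>p. near F (adjoin_list S us) t (y * p) \<longrightarrow> near F (adjoin_list S us) n p" by blast
qed

text \<open>
  The Artin--Rees property passes to the completion, where it gives regularity, closedness of the ideals
  generated by initial segments, and completeness along each element. Both rings have the same quotient modulo
  \<open>xs\<close> since this quotient depends only on the level \<open>k\<close>; noetherianity is lifted from
  it.
\<close>
theorem completion_properties:
  assumes xs: "regular_seq J xs" "set xs \<subseteq> \<mm>" "set xs \<subseteq> P0"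
    and only: "\<And>p. prime_id p \<Longrightarrow> adjoin_list J xs \<subseteq> p \<Longrightarrow> p = \<mm>"
    and pw: "\<And>n x. x \<in> set xs \<Longrightarrow> x ^ n \<in> F n"
    and k: "M k \<subseteq> adjoin_list J xs" "F k = M k"
  shows "regular_seq S xs" "complete_seq S xs" "adjoin_list S xs = adjoin_list J xs" "noeth S"
proof -
  have idJ: "is_ideal J" using noethJ by (simp add: noeth_def)
  have "artin_rees_seq F S xs"
    by (rule artin_rees_transfer[OF artin_rees_regular_seq[OF xs(1,2) only] xs(3)])
  from F.complete_regular_seq[OF ideal_S closed_S this pw]
  have reg: "regular_seq S xs" and com: "complete_seq S xs" and cl: "closed_in F (adjoin_list S xs)" by auto
  show "regular_seq S xs" by (rule reg)
  show "complete_seq S xs" by (rule com)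
  have "F k \<subseteq> adjoin_list S xs"
  proof
    fix p assume p: "p \<in> F k"
    have "near F (adjoin_list S xs) n p" for n
    proof (rule F.near_mono[of n "max n k"])
      obtain p0 where p0: "p0 \<in> P0" "p - p0 \<in> F (max n k)" using dense_F by blast
      have "p - p0 \<in> F k" using p0(2) F.F_mono[of k "max n k"] by auto
      from ideal_diff[OF F.ideal_F p this] have "p0 \<in> F k" by simp
      then have "p0 \<in> adjoin_list J xs" using k by blast
      then have "near F (adjoin_list S xs) (max n k) p0" using near_transfer[OF xs(3) p0(1)] near_member by blast
      then show "near F (adjoin_list S xs) (max n k) p" using p0(2) by (rule F.near_cong_sym)
    qed simp
    then show "p \<in> adjoin_list S xs" using cl unfolding closed_in_def by blast
  qed
  then have "adjoin_list J xs \<subseteq> adjoin_list S xs"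
    using JM[of k] k(2) adjoin_list_mem[OF ideal_S] by (intro adjoin_list_least[OF ideal_adjoin_list[OF ideal_S]]) auto
  moreover have "adjoin_list S xs \<subseteq> adjoin_list J xs"
    using S k adjoin_list_mem[OF idJ] by (intro adjoin_list_least[OF ideal_adjoin_list[OF idJ]]) auto
  ultimately show eq: "adjoin_list S xs = adjoin_list J xs" by blast
  have "noeth (adjoin_list S xs)" unfolding eq by (rule noeth_adjoin_list[OF noethJ])
  then show "noeth S" by (rule noeth_from_quotient_list[OF ideal_S com])
qed

end

section \<open>Modules and resolutions as matrices\<close>

lemma set_eqI_on_range:
  "(\<And>w. f w \<in> X \<longleftrightarrow> f w \<in> Y) \<Longrightarrow> X \<subseteq> range f \<Longrightarrow> Y \<subseteq> range f \<Longrightarrow> X = Y"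
  by blast

locale ring_presentation =
  fixes A :: "('a, 'm) ring_scheme" and \<epsilon> :: "'p::comm_ring_1 \<Rightarrow> 'a"
  assumes A: "cring A"
    and eps_carrier: "\<epsilon> p \<in> carrier A"
    and eps_add: "\<epsilon> (p + q) = \<epsilon> p \<oplus>\<^bsub>A\<^esub> \<epsilon> q"
    and eps_mult: "\<epsilon> (p * q) = \<epsilon> p \<otimes>\<^bsub>A\<^esub> \<epsilon> q"
    and eps_one: "\<epsilon> 1 = \<one>\<^bsub>A\<^esub>"
    and eps_onto: "a \<in> carrier A \<Longrightarrow> \<exists>p. \<epsilon> p = a"
begin

interpretation A: cring A by (rule A)

definition J :: "'p set" where "J = {p. \<epsilon> p = \<zero>\<^bsub>A\<^esub>}"

lemma eps_zero: "\<epsilon> 0 = \<zero>\<^bsub>A\<^esub>"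
  using eps_add[of 0 0] eps_carrier[of 0] A.add.l_cancel_one[of "\<epsilon> 0" "\<epsilon> 0"] by simp

lemma eps_uminus: "\<epsilon> (- p) = \<ominus>\<^bsub>A\<^esub> \<epsilon> p"
  using eps_add[of "- p" p] eps_carrier A.minus_equality[of "\<epsilon> (- p)" "\<epsilon> p"] by (simp add: eps_zero)

lemma eps_eq_iff: "\<epsilon> p = \<epsilon> q \<longleftrightarrow> p - q \<in> J"
proof -
  have "\<epsilon> (p - q) = \<epsilon> p \<ominus>\<^bsub>A\<^esub> \<epsilon> q"
    using eps_add[of p "- q"] by (simp add: eps_uminus A.minus_eq)
  then show ?thesis using A.r_right_minus_eq[OF eps_carrier eps_carrier, of p q] by (simp add: J_def)
qed

lemma ideal_J: "is_ideal J"
  unfolding is_ideal_def J_def using eps_carrier by (auto simp: eps_zero eps_add eps_mult)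

subsection \<open>Presentations of modules\<close>

text \<open>
  \<open>N\<close> is the module of vectors modulo the relations \<open>V\<close>, by the surjection
  \<open>\<kappa>\<close>.
\<close>
definition presents :: "'p vec set \<Rightarrow> ('p vec \<Rightarrow> 'b) \<Rightarrow> ('a, 'b, 'n) module_scheme \<Rightarrow> bool" where
  "presents V \<kappa> N \<longleftrightarrow> carrier N = range \<kappa> \<and> (\<forall>v w. \<kappa> v \<oplus>\<^bsub>N\<^esub> \<kappa> w = \<kappa> (v + w)) \<and>
     (\<forall>c w. \<epsilon> c \<odot>\<^bsub>N\<^esub> \<kappa> w = \<kappa> (c \<cdot>\<^sub>v w)) \<and> \<zero>\<^bsub>N\<^esub> = \<kappa> 0 \<and> (\<forall>w. \<kappa> w = \<zero>\<^bsub>N\<^esub> \<longleftrightarrow> w \<in> V)"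

context
  fixes V \<kappa> and N :: "('a, 'b, 'n) module_scheme"
  assumes pres: "presents V \<kappa> N"
begin

lemma pres_carrier: "carrier N = range \<kappa>"
  and pres_add: "\<kappa> v \<oplus>\<^bsub>N\<^esub> \<kappa> w = \<kappa> (v + w)"
  and pres_smult: "\<epsilon> c \<odot>\<^bsub>N\<^esub> \<kappa> w = \<kappa> (c \<cdot>\<^sub>v w)"
  and pres_zero: "\<zero>\<^bsub>N\<^esub> = \<kappa> 0"
  and pres_ker: "\<kappa> w = \<zero>\<^bsub>N\<^esub> \<longleftrightarrow> w \<in> V"
  using pres unfolding presents_def by blast+

lemma pres_module: "module A N"
proof (rule moduleI)
  show "cring A" by (rule A)
  show "abelian_group N"
  proof (rule abelian_groupI)
    fix x assume "x \<in> carrier N"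
    then obtain v where v: "x = \<kappa> v" by (auto simp: pres_carrier)
    have "\<kappa> (- v) \<oplus>\<^bsub>N\<^esub> x = \<zero>\<^bsub>N\<^esub>" unfolding v pres_add pres_zero by simp
    then show "\<exists>y\<in>carrier N. y \<oplus>\<^bsub>N\<^esub> x = \<zero>\<^bsub>N\<^esub>" by (auto simp: pres_carrier)
  qed (auto simp: pres_carrier pres_add pres_zero ac_simps)
next
  fix a x assume "a \<in> carrier A" "x \<in> carrier N"
  then obtain c v where "a = \<epsilon> c" "x = \<kappa> v" using eps_onto by (auto simp: pres_carrier) metis
  then show "a \<odot>\<^bsub>N\<^esub> x \<in> carrier N" by (simp add: pres_carrier pres_smult)
next
  fix a b x assume "a \<in> carrier A" "b \<in> carrier A" "x \<in> carrier N"
  then obtain c d v where *: "a = \<epsilon> c" "b = \<epsilon> d" "x = \<kappa> v" using eps_onto by (auto simp: pres_carrier) metis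
  show "(a \<oplus>\<^bsub>A\<^esub> b) \<odot>\<^bsub>N\<^esub> x = a \<odot>\<^bsub>N\<^esub> x \<oplus>\<^bsub>N\<^esub> b \<odot>\<^bsub>N\<^esub> x"
    unfolding * eps_add[symmetric] pres_smult pres_add scale_left_add ..
  show "(a \<otimes>\<^bsub>A\<^esub> b) \<odot>\<^bsub>N\<^esub> x = a \<odot>\<^bsub>N\<^esub> (b \<odot>\<^bsub>N\<^esub> x)"
    unfolding * eps_mult[symmetric] pres_smult scale_scale ..
next
  fix a x y assume "a \<in> carrier A" "x \<in> carrier N" "y \<in> carrier N"
  then obtain c v w where *: "a = \<epsilon> c" "x = \<kappa> v" "y = \<kappa> w" using eps_onto by (auto simp: pres_carrier) metis
  show "a \<odot>\<^bsub>N\<^esub> (x \<oplus>\<^bsub>N\<^esub> y) = a \<odot>\<^bsub>N\<^esub> x \<oplus>\<^bsub>N\<^esub> a \<odot>\<^bsub>N\<^esub> y"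
    unfolding * pres_smult pres_add scale_add ..
next
  fix x assume "x \<in> carrier N"
  then obtain v where "x = \<kappa> v" by (auto simp: pres_carrier)
  then show "\<one>\<^bsub>A\<^esub> \<odot>\<^bsub>N\<^esub> x = x" by (simp add: eps_one[symmetric] pres_smult)
qed

lemma pres_eq_iff: "\<kappa> v = \<kappa> w \<longleftrightarrow> v - w \<in> V"
proof -
  interpret N: module A N by (rule pres_module)
  have c: "\<kappa> u \<in> carrier N" for u by (simp add: pres_carrier)
  have "\<kappa> (v - w) \<oplus>\<^bsub>N\<^esub> \<kappa> w = \<kappa> v" by (simp add: pres_add)
  then show ?thesis using N.M.add.l_cancel_one[OF c c] N.M.add.r_cancel_one'[OF c c]
    by (metis N.M.add.r_cancel_one c pres_ker)
qed

lemma pres_submod: "submod V"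
proof -
  have 1: "0 \<in> V" using pres_ker[of 0] pres_zero by simp
  have 2: "v + w \<in> V" if "v \<in> V" "w \<in> V" for v w
  proof -
    have "\<kappa> (v + w) = \<kappa> w" unfolding pres_eq_iff using that by simp
    then show ?thesis using that pres_ker by metis
  qed
  have 3: "c \<cdot>\<^sub>v v \<in> V" if "v \<in> V" for c v
  proof -
    have "\<kappa> v = \<kappa> 0" using that pres_ker pres_zero by simp
    then have "\<kappa> (c \<cdot>\<^sub>v v) = \<kappa> (c \<cdot>\<^sub>v 0)" unfolding pres_smult[symmetric] by simp
    then show ?thesis using pres_ker pres_zero by simp
  qed
  show ?thesis using 1 2 3 by (simp add: submod_def)
qed

lemma pres_J: "c \<in> J \<Longrightarrow> c \<cdot>\<^sub>v w \<in> V"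
proof -
  assume "c \<in> J"
  then have "\<epsilon> c = \<epsilon> 0" by (simp add: J_def eps_zero)
  then have "\<kappa> (c \<cdot>\<^sub>v w) = \<kappa> (0 \<cdot>\<^sub>v w)" unfolding pres_smult[symmetric] by simp
  then show ?thesis using pres_ker pres_zero by simp
qed

lemma pres_comb_J: "w \<in> free_rel J k \<Longrightarrow> comb k w H \<in> V"
  unfolding comb_alt using pres_J by (auto simp: free_rel_def intro!: submod_sum[OF pres_submod])

lemma pres_fg:
  assumes n: "free_rel J n \<subseteq> V"
  shows "fg_module A N"
  unfolding fg_module_def
proof (intro conjI exI[of _ "(\<lambda>i. \<kappa> (unit_vec i)) ` {..<n}"] allI impI)
  show "module A N" by (rule pres_module)
  show "(\<lambda>i. \<kappa> (unit_vec i)) ` {..<n} \<subseteq> carrier N" by (auto simp: pres_carrier)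
  show "finite ((\<lambda>i. \<kappa> (unit_vec i)) ` {..<n})" by simp
  fix U assume U: "submodule U A N \<and> (\<lambda>i. \<kappa> (unit_vec i)) ` {..<n} \<subseteq> U"
  have sub: "U \<subseteq> carrier N" "\<zero>\<^bsub>N\<^esub> \<in> U" "\<And>x y. x \<in> U \<Longrightarrow> y \<in> U \<Longrightarrow> x \<oplus>\<^bsub>N\<^esub> y \<in> U"
    "\<And>a x. a \<in> carrier A \<Longrightarrow> x \<in> U \<Longrightarrow> a \<odot>\<^bsub>N\<^esub> x \<in> U"
    using U submodule.axioms[of U A N] subgroup.subset[of U "add_monoid N"] subgroup.one_closed[of U "add_monoid N"]
      subgroup.m_closed[of U "add_monoid N"] by (auto simp: submodule_axioms_def)
  have "\<kappa> (comb k w unit_vec) \<in> U" if "k \<le> n" for k w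
    using that
  proof (induction k)
    case 0
    then show ?case using sub(2) by (simp add: comb_alt pres_zero)
  next
    case (Suc k)
    have "\<kappa> (comb (Suc k) w unit_vec) = \<kappa> (comb k w unit_vec) \<oplus>\<^bsub>N\<^esub> \<epsilon> (w k) \<odot>\<^bsub>N\<^esub> \<kappa> (unit_vec k)"
      by (simp add: comb_alt pres_add pres_smult)
    moreover have "\<kappa> (unit_vec k) \<in> U" using U Suc.prems by auto
    ultimately show ?case using Suc sub(3,4) eps_carrier by simp
  qed
  moreover have "\<kappa> w = \<kappa> (comb n w unit_vec)" for w
    unfolding pres_eq_iff using comb_unit_diff[OF ideal_J] n by blast
  ultimately have "\<kappa> w \<in> U" for w by (metis order_refl)
  then show "U = carrier N" using sub(1) by (auto simp: pres_carrier)
qed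

end

primrec lin_comb_list :: "('a, 'b, 'n) module_scheme \<Rightarrow> 'b list \<Rightarrow> 'p vec \<Rightarrow> 'b" where
  "lin_comb_list N [] w = \<zero>\<^bsub>N\<^esub>"
| "lin_comb_list N (x # xs) w = \<epsilon> (w 0) \<odot>\<^bsub>N\<^esub> x \<oplus>\<^bsub>N\<^esub> lin_comb_list N xs (\<lambda>i. w (Suc i))"

lemma fg_module_presented:
  assumes "fg_module A N"
  obtains n V \<kappa> where "presents V \<kappa> N" "free_rel J n \<subseteq> V"
proof -
  interpret N: module A N using assms by (simp add: fg_module_def)
  obtain S where S: "S \<subseteq> carrier N" "finite S" and gen: "\<And>U. submodule U A N \<Longrightarrow> S \<subseteq> U \<Longrightarrow> U = carrier N"
    using assms unfolding fg_module_def by blast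
  obtain xs where xs: "set xs = S" using S(2) finite_list by blast
  define \<kappa> where "\<kappa> = lin_comb_list N xs"
  have c: "lin_comb_list N xs w \<in> carrier N" if "set xs \<subseteq> carrier N" for xs w
    using that by (induction xs arbitrary: w) (auto simp: eps_carrier)
  have add: "lin_comb_list N xs (v + w) = lin_comb_list N xs v \<oplus>\<^bsub>N\<^esub> lin_comb_list N xs w" if "set xs \<subseteq> carrier N" for xs v w
    using that
  proof (induction xs arbitrary: v w)
    case (Cons x xs)
    have "(\<lambda>i. (v + w) (Suc i)) = (\<lambda>i. v (Suc i)) + (\<lambda>i. w (Suc i))" by (simp add: fun_eq_iff vec_simps)
    then have "lin_comb_list N (x # xs) (v + w) = \<epsilon> (v 0 + w 0) \<odot>\<^bsub>N\<^esub> x \<oplus>\<^bsub>N\<^esub>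
        (lin_comb_list N xs (\<lambda>i. v (Suc i)) \<oplus>\<^bsub>N\<^esub> lin_comb_list N xs (\<lambda>i. w (Suc i)))"
      using Cons.IH[of "\<lambda>i. v (Suc i)" "\<lambda>i. w (Suc i)"] Cons.prems by (simp only: lin_comb_list.simps plus_fun_apply) simp
    then show ?case
      using Cons.prems c[of xs] eps_carrier by (simp add: eps_add N.smult_l_distr N.M.a_ac)
  qed simp
  have smult: "lin_comb_list N xs (a \<cdot>\<^sub>v w) = \<epsilon> a \<odot>\<^bsub>N\<^esub> lin_comb_list N xs w" if "set xs \<subseteq> carrier N" for xs a w
    using that
  proof (induction xs arbitrary: w)
    case Nil then show ?case by (simp add: eps_carrier N.smult_r_null)
  next
    case (Cons x xs)
    have "(\<lambda>i. (a \<cdot>\<^sub>v w) (Suc i)) = a \<cdot>\<^sub>v (\<lambda>i. w (Suc i))" by (simp add: fun_eq_iff vec_simps)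
    then have "lin_comb_list N (x # xs) (a \<cdot>\<^sub>v w) = \<epsilon> (a * w 0) \<odot>\<^bsub>N\<^esub> x \<oplus>\<^bsub>N\<^esub> \<epsilon> a \<odot>\<^bsub>N\<^esub> lin_comb_list N xs (\<lambda>i. w (Suc i))"
      using Cons.IH[of "\<lambda>i. w (Suc i)"] Cons.prems by (simp only: lin_comb_list.simps scale_apply) simp
    then show ?case
      using Cons.prems c[of xs] eps_carrier by (simp add: eps_mult N.smult_assoc1 N.smult_r_distr)
  qed
  have nth: "lin_comb_list N xs (unit_vec i) = xs ! i" if "set xs \<subseteq> carrier N" "i < length xs" for xs i
    using that
  proof (induction xs arbitrary: i)
    case (Cons x xs)
    have z: "lin_comb_list N xs 0 = \<zero>\<^bsub>N\<^esub>"
      using smult[of xs 0 0] c[of xs 0] Cons.prems by (simp add: eps_zero)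
    show ?case
    proof (cases i)
      case 0
      have "(\<lambda>j. unit_vec 0 (Suc j)) = (0 :: 'p vec)" by (simp add: fun_eq_iff vec_simps)
      then show ?thesis using Cons.prems 0 z by (simp add: vec_simps(2) eps_one N.M.r_zero)
    next
      case (Suc k)
      have "(\<lambda>j. unit_vec (Suc k) (Suc j)) = (unit_vec k :: 'p vec)" by (simp add: fun_eq_iff vec_simps)
      moreover have "xs ! k \<in> carrier N" using Cons.prems Suc by auto
      ultimately show ?thesis using Cons.IH[of k] Cons.prems Suc by (auto simp: unit_vec_apply[of "Suc k" 0] eps_zero)
    qed
  qed simp
  have van: "lin_comb_list N xs w = \<zero>\<^bsub>N\<^esub>" if "set xs \<subseteq> carrier N" "w \<in> free_rel J (length xs)" for xs w
    using that
  proof (induction xs arbitrary: w)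
    case (Cons x xs)
    have "\<epsilon> (w 0) = \<zero>\<^bsub>A\<^esub>" "(\<lambda>i. w (Suc i)) \<in> free_rel J (length xs)"
      using Cons.prems(2) by (auto simp: free_rel_def J_def)
    then show ?case using Cons by simp
  qed simp
  have sc: "set xs \<subseteq> carrier N" using xs S by simp
  have "submodule (range \<kappa>) A N"
  proof (rule N.submoduleI)
    show "range \<kappa> \<subseteq> carrier N" using c[OF sc] by (auto simp: \<kappa>_def)
    have "\<kappa> 0 = \<zero>\<^bsub>N\<^esub>" using van[OF sc] ideal0[OF ideal_J] by (simp add: \<kappa>_def free_rel_def vec_simps)
    then show "\<zero>\<^bsub>N\<^esub> \<in> range \<kappa>" by (metis rangeI)
  next
    fix a assume "a \<in> range \<kappa>"
    then obtain w where w: "a = \<kappa> w" by blast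
    have "\<kappa> ((- 1) \<cdot>\<^sub>v w) = \<ominus>\<^bsub>N\<^esub> a"
      using smult[OF sc, of "-1" w] c[OF sc, of w] by (simp add: w \<kappa>_def eps_uminus eps_one N.smult_l_minus)
    then show "\<ominus>\<^bsub>N\<^esub> a \<in> range \<kappa>" by (metis rangeI)
  next
    fix a b assume "a \<in> range \<kappa>" "b \<in> range \<kappa>"
    then obtain v w where "a = \<kappa> v" "b = \<kappa> w" by blast
    then have "a \<oplus>\<^bsub>N\<^esub> b = \<kappa> (v + w)" unfolding \<kappa>_def by (simp only: add[OF sc])
    then show "a \<oplus>\<^bsub>N\<^esub> b \<in> range \<kappa>" by simp
  next
    fix a x assume "a \<in> carrier A" "x \<in> range \<kappa>"
    then obtain c w where "a = \<epsilon> c" "x = \<kappa> w" using eps_onto by blast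
    then have "a \<odot>\<^bsub>N\<^esub> x = \<kappa> (c \<cdot>\<^sub>v w)" unfolding \<kappa>_def by (simp only: smult[OF sc])
    then show "a \<odot>\<^bsub>N\<^esub> x \<in> range \<kappa>" by simp
  qed
  moreover have "S \<subseteq> range \<kappa>"
  proof
    fix x assume "x \<in> S"
    then obtain i where "i < length xs" "x = xs ! i" using xs by (auto simp: in_set_conv_nth)
    then have "x = \<kappa> (unit_vec i)" using nth[OF sc] by (simp add: \<kappa>_def)
    then show "x \<in> range \<kappa>" by simp
  qed
  ultimately have onto: "range \<kappa> = carrier N" by (rule gen)
  have "\<kappa> 0 = \<zero>\<^bsub>N\<^esub>" using van[OF sc] ideal0[OF ideal_J] by (simp add: \<kappa>_def free_rel_def vec_simps)
  then have "presents {w. \<kappa> w = \<zero>\<^bsub>N\<^esub>} \<kappa> N"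
    unfolding presents_def using onto add[OF sc] smult[OF sc] by (auto simp: \<kappa>_def)
  then show thesis using that[of "{w. \<kappa> w = \<zero>\<^bsub>N\<^esub>}" \<kappa> "length xs"] van[OF sc] by (auto simp: \<kappa>_def)
qed

text \<open>
  A chosen representative of a vector modulo \<open>V\<close>, restricted to its first \<open>n\<close> entries,
  is a list over the ring that determines the class. In this way the quotient is realised on lists.
\<close>
lemma module_of_relations:
  assumes V: "submod V" "free_rel J n \<subseteq> V"
  obtains \<kappa> and N :: "('a, 'a list) module" where "presents V \<kappa> N"
proof -
  define rep where "rep w = (SOME w'. w' - w \<in> V)" for w
  define \<kappa> where "\<kappa> w = map (\<lambda>i. \<epsilon> (rep w i)) [0..<n]" for w
  have rep: "rep w - w \<in> V" for w unfolding rep_def by (rule someI[of _ w]) (simp add: submod0[OF V(1)])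
  have keq: "\<kappa> v = \<kappa> w \<longleftrightarrow> v - w \<in> V" for v w
  proof
    assume "\<kappa> v = \<kappa> w"
    then have "rep v i - rep w i \<in> J" if "i < n" for i
      using that by (auto simp: \<kappa>_def eps_eq_iff[symmetric])
    then have "rep v - rep w \<in> V" using V(2) by (auto simp: free_rel_def vec_simps)
    from submod_add[OF V(1) submod_diff[OF V(1) this rep[of v]] rep[of w]]
    show "v - w \<in> V" by simp
  next
    assume vw: "v - w \<in> V"
    have "u - v \<in> V \<longleftrightarrow> u - w \<in> V" for u
      using submod_add_iff(1)[OF V(1) vw, of "u - v"] by simp
    then have "rep v = rep w" by (simp add: rep_def)
    then show "\<kappa> v = \<kappa> w" by (simp add: \<kappa>_def)
  qed
  define l where "l x = (SOME w. \<kappa> w = x)" for x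
  have l: "\<kappa> (l (\<kappa> w)) = \<kappa> w" for w unfolding l_def by (rule someI[of _ w]) simp
  define e where "e a = (SOME p. \<epsilon> p = a)" for a
  have e: "\<epsilon> (e (\<epsilon> c)) = \<epsilon> c" for c unfolding e_def by (rule someI[of _ c]) simp
  define N :: "('a, 'a list) module" where
    "N = \<lparr>carrier = range \<kappa>, mult = undefined, one = undefined, zero = \<kappa> 0,
          add = (\<lambda>x y. \<kappa> (l x + l y)), smult = (\<lambda>a x. \<kappa> (e a \<cdot>\<^sub>v l x))\<rparr>"
  have "presents V \<kappa> N"
    unfolding presents_def
  proof (intro conjI allI)
    show "carrier N = range \<kappa>" "\<zero>\<^bsub>N\<^esub> = \<kappa> 0" by (simp_all add: N_def)
    show "\<kappa> w = \<zero>\<^bsub>N\<^esub> \<longleftrightarrow> w \<in> V" for w using keq[of w 0] by (simp add: N_def)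
    fix v w
    have "(l (\<kappa> v) - v) + (l (\<kappa> w) - w) \<in> V"
      using submod_add[OF V(1)] l[of v] l[of w] unfolding keq by blast
    then have "\<kappa> (l (\<kappa> v) + l (\<kappa> w)) = \<kappa> (v + w)" unfolding keq by (simp add: algebra_simps)
    then show "\<kappa> v \<oplus>\<^bsub>N\<^esub> \<kappa> w = \<kappa> (v + w)" by (simp add: N_def)
  next
    fix c w
    have "e (\<epsilon> c) - c \<in> J" using e[of c] by (simp add: eps_eq_iff)
    then have "(e (\<epsilon> c) - c) \<cdot>\<^sub>v w \<in> V" using scale_free_rel[OF ideal_J] V(2) by blast
    moreover have "e (\<epsilon> c) \<cdot>\<^sub>v (l (\<kappa> w) - w) \<in> V"
      using submod_scale[OF V(1)] l[of w] unfolding keq by blast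
    ultimately have "(e (\<epsilon> c) - c) \<cdot>\<^sub>v w + e (\<epsilon> c) \<cdot>\<^sub>v (l (\<kappa> w) - w) \<in> V" by (rule submod_add[OF V(1)])
    then have "\<kappa> (e (\<epsilon> c) \<cdot>\<^sub>v l (\<kappa> w)) = \<kappa> (c \<cdot>\<^sub>v w)"
      unfolding keq scale_diff scale_left_diff by simp
    then show "\<epsilon> c \<odot>\<^bsub>N\<^esub> \<kappa> w = \<kappa> (c \<cdot>\<^sub>v w)" by (simp add: N_def)
  qed
  then show thesis by (rule that)
qed

definition free_map :: "nat \<Rightarrow> 'p vec \<Rightarrow> (nat \<Rightarrow> 'a)" where
  "free_map r w = (\<lambda>i\<in>{..<r}. \<epsilon> (w i))"

lemma presents_free: "presents (free_rel J r) (free_map r) (free_module A r)"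
  unfolding presents_def
proof (intro conjI allI)
  show "carrier (free_module A r) = range (free_map r)"
  proof (intro equalityI subsetI)
    fix v assume v: "v \<in> carrier (free_module A r)"
    have "\<forall>i. \<exists>p. i < r \<longrightarrow> \<epsilon> p = v i" using v eps_onto by (auto simp: free_module_def)
    then obtain w where "\<And>i. i < r \<Longrightarrow> \<epsilon> (w i) = v i" by metis
    then have "v = free_map r w" using v by (auto simp: free_map_def free_module_def fun_eq_iff PiE_def extensional_def)
    then show "v \<in> range (free_map r)" by blast
  qed (use eps_carrier in \<open>auto simp: free_module_def free_map_def PiE_iff extensional_def\<close>)
  show "\<zero>\<^bsub>free_module A r\<^esub> = free_map r 0"
    by (auto simp: free_module_def free_map_def eps_zero vec_simps)
  show "free_map r w = \<zero>\<^bsub>free_module A r\<^esub> \<longleftrightarrow> w \<in> free_rel J r" for w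
    by (auto simp: free_module_def free_map_def free_rel_def J_def fun_eq_iff)
  show "free_map r v \<oplus>\<^bsub>free_module A r\<^esub> free_map r w = free_map r (v + w)" for v w
    by (auto simp: free_module_def free_map_def eps_add vec_simps fun_eq_iff)
  show "\<epsilon> c \<odot>\<^bsub>free_module A r\<^esub> free_map r w = free_map r (c \<cdot>\<^sub>v w)" for c w
    by (auto simp: free_module_def free_map_def eps_mult vec_simps fun_eq_iff)
qed

lemmas free_carrier = pres_carrier[OF presents_free]
  and free_eq_iff = pres_eq_iff[OF presents_free]

lemma free_map_cong: "(\<And>i. i < r \<Longrightarrow> v i = w i) \<Longrightarrow> free_map r v = free_map r w"
  by (auto simp: free_map_def)

lemma free_map_comb_unit: "free_map r (comb r w unit_vec) = free_map r w"
  by (rule free_map_cong) (simp add: comb_unit_vec)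

subsection \<open>Linear maps out of free modules are matrices\<close>

lemma lin_map_matrix:
  assumes N: "presents V \<kappa> N" and h: "h \<in> lin_maps A (free_module A r) N"
  obtains H where "\<And>w. h (free_map r w) = \<kappa> (comb r w H)"
proof -
  have hc: "h (free_map r w) \<in> carrier N" for w
    using h by (auto simp: lin_maps_def free_carrier)
  then have "\<forall>a. \<exists>w. h (free_map r (unit_vec a)) = \<kappa> w" by (auto simp: pres_carrier[OF N])
  then obtain H where H: "\<And>a. h (free_map r (unit_vec a)) = \<kappa> (H a)" by metis
  have hadd: "h (free_map r (v + w)) = h (free_map r v) \<oplus>\<^bsub>N\<^esub> h (free_map r w)" for v w
    using h by (auto simp: lin_maps_def free_carrier pres_add[OF presents_free, symmetric])
  have hsm: "h (free_map r (c \<cdot>\<^sub>v w)) = \<epsilon> c \<odot>\<^bsub>N\<^esub> h (free_map r w)" for c w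
    using h eps_carrier by (auto simp: lin_maps_def free_carrier pres_smult[OF presents_free, symmetric])
  have "h (free_map r (comb k w unit_vec)) = \<kappa> (comb k w H)" for k w
  proof (induction k)
    case 0
    have "h (free_map r (0 \<cdot>\<^sub>v 0)) = \<kappa> (0 \<cdot>\<^sub>v H 0)"
      using pres_smult[OF N, of 0 "H 0"] hsm[of 0 "unit_vec 0"] H[of 0] by simp
    then show ?case by (simp add: comb_alt)
  next
    case (Suc k)
    have "comb (Suc k) w B = comb k w B + w k \<cdot>\<^sub>v B k" for B :: "nat \<Rightarrow> 'p vec" by (simp add: comb_alt)
    then show ?case using Suc by (simp add: hadd hsm H pres_smult[OF N] pres_add[OF N])
  qed
  from this[of r] show thesis by (intro that[of H]) (simp add: free_map_comb_unit)
qed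

definition matrix_lin_map :: "nat \<Rightarrow> ('p vec \<Rightarrow> 'b) \<Rightarrow> (nat \<Rightarrow> 'p vec) \<Rightarrow> (nat \<Rightarrow> 'a) \<Rightarrow> 'b" where
  "matrix_lin_map r \<kappa> H = (\<lambda>v\<in>carrier (free_module A r). \<kappa> (comb r (SOME w. free_map r w = v) H))"

lemma matrix_lin_map_apply:
  assumes N: "presents V \<kappa> N"
  shows "matrix_lin_map r \<kappa> H (free_map r w) = \<kappa> (comb r w H)"
proof -
  let ?w = "SOME u. free_map r u = free_map r w"
  have "free_map r ?w = free_map r w" by (rule someI[of _ w]) simp
  then have "comb r (?w - w) H \<in> V" unfolding free_eq_iff by (rule pres_comb_J[OF N])
  then have "\<kappa> (comb r ?w H) = \<kappa> (comb r w H)" unfolding pres_eq_iff[OF N] comb_diff_left .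
  then show ?thesis by (simp add: matrix_lin_map_def free_carrier)
qed

lemma matrix_lin_map_in:
  assumes N: "presents V \<kappa> N"
  shows "matrix_lin_map r \<kappa> H \<in> lin_maps A (free_module A r) N"
  unfolding lin_maps_def mem_Collect_eq
proof (intro conjI ballI)
  show "matrix_lin_map r \<kappa> H \<in> carrier (free_module A r) \<rightarrow>\<^sub>E carrier N"
    by (auto simp: matrix_lin_map_def pres_carrier[OF N])
next
  fix x y assume "x \<in> carrier (free_module A r)" "y \<in> carrier (free_module A r)"
  then obtain v w where *: "x = free_map r v" "y = free_map r w" by (auto simp: free_carrier)
  show "matrix_lin_map r \<kappa> H (x \<oplus>\<^bsub>free_module A r\<^esub> y) = matrix_lin_map r \<kappa> H x \<oplus>\<^bsub>N\<^esub> matrix_lin_map r \<kappa> H y"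
    unfolding * pres_add[OF presents_free] matrix_lin_map_apply[OF N] pres_add[OF N] comb_add_left ..
next
  fix a x assume "a \<in> carrier A" "x \<in> carrier (free_module A r)"
  then obtain c v where *: "a = \<epsilon> c" "x = free_map r v" using eps_onto by (auto simp: free_carrier) metis
  show "matrix_lin_map r \<kappa> H (a \<odot>\<^bsub>free_module A r\<^esub> x) = a \<odot>\<^bsub>N\<^esub> matrix_lin_map r \<kappa> H x"
    unfolding * pres_smult[OF presents_free] matrix_lin_map_apply[OF N] pres_smult[OF N] comb_scale_left ..
qed

lemma lin_map_eqI:
  assumes "f \<in> lin_maps A (free_module A r) N" "g \<in> lin_maps A (free_module A r) N"
    and "\<And>w. f (free_map r w) = g (free_map r w)"
  shows "f = g"
proof (rule PiE_ext)
  show "f \<in> carrier (free_module A r) \<rightarrow>\<^sub>E carrier N" "g \<in> carrier (free_module A r) \<rightarrow>\<^sub>E carrier N"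
    using assms by (simp_all add: lin_maps_def)
  show "f x = g x" if "x \<in> carrier (free_module A r)" for x
    using that assms(3) by (auto simp: free_carrier)
qed

subsection \<open>Resolutions and Ext\<close>

text \<open>The rows of the matrices \<open>D i\<close> are lifts of the images of the basis vectors.\<close>
definition represents :: "('a, 'b) resolution \<Rightarrow> (nat \<Rightarrow> nat \<Rightarrow> 'p vec) \<Rightarrow> bool" where
  "represents F D \<longleftrightarrow> (\<forall>i w. differential F i (free_map (rank F (Suc i)) w) = free_map (rank F i) (comb (rank F (Suc i)) w (D i)))"

lemma resolution_to_matrices:
  assumes F: "free_resolution A M F"
  obtains D where "represents F D" "resolution_mod J (rank F) D"
    "presented J (rank F) D = {w. augmentation F (free_map (rank F 0) w) = \<zero>\<^bsub>M\<^esub>}"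
proof -
  let ?r = "rank F"
  have d: "differential F i \<in> lin_maps A (free_module A (?r (Suc i))) (free_module A (?r i))" for i
    using F by (auto simp: free_resolution_def)
  have "\<forall>i. \<exists>H. \<forall>w. differential F i (free_map (?r (Suc i)) w) = free_map (?r i) (comb (?r (Suc i)) w H)"
    using lin_map_matrix[OF presents_free d] by metis
  then obtain D where D: "\<And>i w. differential F i (free_map (?r (Suc i)) w) = free_map (?r i) (comb (?r (Suc i)) w (D i))"
    by metis
  have im0: "v \<in> differential F 0 ` carrier (free_module A (?r 1)) \<longleftrightarrow>
      v \<in> carrier (free_module A (?r 0)) \<and> augmentation F v = \<zero>\<^bsub>M\<^esub>" for v
    using F by (auto simp: free_resolution_def)
  have imS: "v \<in> differential F (Suc i) ` carrier (free_module A (?r (Suc (Suc i)))) \<longleftrightarrow>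
      v \<in> carrier (free_module A (?r (Suc i))) \<and> differential F i v = \<zero>\<^bsub>free_module A (?r i)\<^esub>" for i v
    using F by (auto simp: free_resolution_def)
  have img: "free_map (?r i) w \<in> differential F i ` carrier (free_module A (?r (Suc i))) \<longleftrightarrow>
      (\<exists>u. w - comb (?r (Suc i)) u (D i) \<in> free_rel J (?r i))" for i w
    by (auto simp: free_carrier D image_iff free_eq_iff)
  have ker: "differential F i (free_map (?r (Suc i)) w) = \<zero>\<^bsub>free_module A (?r i)\<^esub> \<longleftrightarrow>
      comb (?r (Suc i)) w (D i) \<in> free_rel J (?r i)" for i w
    unfolding D pres_ker[OF presents_free] ..
  have eq: "(\<exists>u. w - comb (?r (Suc (Suc i))) u (D (Suc i)) \<in> free_rel J (?r (Suc i))) \<longleftrightarrow>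
      comb (?r (Suc i)) w (D i) \<in> free_rel J (?r i)" for i w
    using imS[of "free_map (?r (Suc i)) w" i] unfolding img ker by (simp add: free_carrier)
  have "resolution_mod J ?r D"
    unfolding resolution_mod_def complex_mod_def exact_mod_def
  proof (intro conjI allI impI)
    fix m a assume "a < ?r (Suc (Suc m))"
    then have "D (Suc m) a - comb (?r (Suc (Suc m))) (unit_vec a) (D (Suc m)) \<in> free_rel J (?r (Suc m))"
      using submod0[OF submod_free_rel[OF ideal_J]] by simp
    then show "comb (?r (Suc m)) (D (Suc m) a) (D m) \<in> free_rel J (?r m)" using eq by blast
  next
    fix m w assume "comb (?r (Suc m)) w (D m) \<in> free_rel J (?r m)"
    then show "\<exists>u. w - comb (?r (Suc (Suc m))) u (D (Suc m)) \<in> free_rel J (?r (Suc m))" using eq by blast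
  qed
  moreover have "presented J ?r D = {w. augmentation F (free_map (?r 0) w) = \<zero>\<^bsub>M\<^esub>}"
    using im0[of "free_map (?r 0) _"] img[of 0] by (auto simp: presented_def free_carrier)
  moreover have "represents F D" using D by (simp add: represents_def)
  ultimately show thesis using that by blast
qed

lemma matrices_to_resolution:
  assumes M: "presents (presented J r D) \<kappa> M" and D: "resolution_mod J r D"
  shows "\<exists>F. free_resolution A M F"
proof -
  define F where "F = \<lparr>rank = r, differential = (\<lambda>i. matrix_lin_map (r (Suc i)) (free_map (r i)) (D i)),
    augmentation = matrix_lin_map (r 0) \<kappa> unit_vec\<rparr>"
  have dF: "differential F i (free_map (r (Suc i)) w) = free_map (r i) (comb (r (Suc i)) w (D i))" for i w
    by (simp add: F_def matrix_lin_map_apply[OF presents_free])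
  have kap: "\<kappa> (comb (r 0) w unit_vec) = \<kappa> w" for w
  proof -
    have "w - comb (r 0) w unit_vec \<in> presented J r D"
      unfolding presented_def using comb_unit_diff[OF ideal_J, of w "r 0"] by (auto intro!: exI[of _ 0])
    from submod_swap[OF pres_submod[OF M] this] show ?thesis unfolding pres_eq_iff[OF M] .
  qed
  have aF: "augmentation F (free_map (r 0) w) = \<kappa> w" for w
    by (simp add: F_def matrix_lin_map_apply[OF M] kap)
  have eq: "(\<exists>u. w - comb (r (Suc (Suc i))) u (D (Suc i)) \<in> free_rel J (r (Suc i))) \<longleftrightarrow>
      comb (r (Suc i)) w (D i) \<in> free_rel J (r i)" for i w
  proof
    assume "\<exists>u. w - comb (r (Suc (Suc i))) u (D (Suc i)) \<in> free_rel J (r (Suc i))"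
    then obtain u where u: "w - comb (r (Suc (Suc i))) u (D (Suc i)) \<in> free_rel J (r (Suc i))" by blast
    have 1: "comb (r (Suc i)) (w - comb (r (Suc (Suc i))) u (D (Suc i))) (D i) \<in> free_rel J (r i)"
      by (rule pres_comb_J[OF presents_free u])
    have 2: "comb (r (Suc i)) (comb (r (Suc (Suc i))) u (D (Suc i))) (D i) \<in> free_rel J (r i)"
      unfolding comb_assoc
      by (rule comb_in[OF submod_free_rel[OF ideal_J]]) (use D in \<open>auto simp: resolution_mod_def complex_mod_def\<close>)
    show "comb (r (Suc i)) w (D i) \<in> free_rel J (r i)"
      using submod_add[OF submod_free_rel[OF ideal_J] 1 2] unfolding comb_diff_left by simp
  qed (use D in \<open>auto simp: resolution_mod_def exact_mod_def\<close>)
  have rF: "rank F = r" by (simp add: F_def)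
  have "free_resolution A M F"
    unfolding free_resolution_def rF
  proof (intro conjI allI)
    show "augmentation F \<in> lin_maps A (free_module A (r 0)) M"
      by (simp add: F_def matrix_lin_map_in[OF M])
    show "augmentation F ` carrier (free_module A (r 0)) = carrier M"
      by (auto simp: free_carrier aF pres_carrier[OF M] image_image)
    show "differential F i \<in> lin_maps A (free_module A (r (Suc i))) (free_module A (r i))" for i
      by (simp add: F_def matrix_lin_map_in[OF presents_free])
    show "differential F 0 ` carrier (free_module A (r 1)) = {v \<in> carrier (free_module A (r 0)). augmentation F v = \<zero>\<^bsub>M\<^esub>}"
      (is "?L = ?R")
    proof -
      have "free_map (r 0) w \<in> ?L \<longleftrightarrow> free_map (r 0) w \<in> ?R" for w
        by (auto simp: free_carrier dF[of 0, simplified] aF pres_ker[OF M] presented_def image_iff free_eq_iff)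
      moreover have "?L \<subseteq> range (free_map (r 0))" using dF[of 0] by (auto simp: free_carrier)
      moreover have "?R \<subseteq> range (free_map (r 0))" by (auto simp: free_carrier)
      ultimately show ?thesis by (intro set_eqI_on_range)
    qed
    fix i
    show "differential F (Suc i) ` carrier (free_module A (r (Suc (Suc i)))) =
      {v \<in> carrier (free_module A (r (Suc i))). differential F i v = \<zero>\<^bsub>free_module A (r i)\<^esub>}" (is "?L = ?R")
    proof -
      have "free_map (r (Suc i)) w \<in> ?L \<longleftrightarrow> free_map (r (Suc i)) w \<in> ?R" for w
        unfolding mem_Collect_eq dF pres_ker[OF presents_free] eq[symmetric]
        by (auto simp: free_carrier dF image_iff free_eq_iff)
      moreover have "?L \<subseteq> range (free_map (r (Suc i)))" using dF[of "Suc i"] by (auto simp: free_carrier)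
      moreover have "?R \<subseteq> range (free_map (r (Suc i)))" by (auto simp: free_carrier)
      ultimately show ?thesis by (intro set_eqI_on_range)
    qed
  qed
  then show ?thesis by blast
qed

end

section \<open>Vanishing of Ext as exactness of matrices\<close>

definition ext_bounded :: "('a, 'm) ring_scheme \<Rightarrow> ('a, 'a list) module \<Rightarrow> int \<Rightarrow> bool" where
  "ext_bounded A M b \<longleftrightarrow> (\<forall>N :: ('a, 'a list) module. fg_module A N \<longrightarrow>
     (\<exists>n. \<forall>i\<ge>n. Ext_vanishes A i M N) \<longrightarrow> (\<forall>i. int i > b \<longrightarrow> Ext_vanishes A i M N))"

lemma image_eq_singleton_iff:
  assumes "z0 \<in> Z" "\<And>z. z \<in> Z \<Longrightarrow> f z = B \<longleftrightarrow> z \<in> B"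
  shows "f ` Z = {B} \<longleftrightarrow> Z \<subseteq> B"
proof -
  have "f ` Z = {B} \<longleftrightarrow> (\<forall>z\<in>Z. f z = B)"
  proof
    assume eq: "f ` Z = {B}"
    show "\<forall>z\<in>Z. f z = B"
    proof
      fix z assume "z \<in> Z"
      then have "f z \<in> f ` Z" by (rule imageI)
      then show "f z = B" unfolding eq by simp
    qed
  next
    assume "\<forall>z\<in>Z. f z = B"
    then have "f ` Z = (\<lambda>_. B) ` Z" by (intro image_cong) auto
    then show "f ` Z = {B}" using image_constant[OF assms(1), of B] by simp
  qed
  also have "\<dots> \<longleftrightarrow> (\<forall>z\<in>Z. z \<in> B)" using assms(2) by (rule ball_cong[OF refl])
  finally show ?thesis by (simp only: subset_eq)
qed

lemma carrier_quotient_trivial_iff: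
  assumes Z: "b0 \<in> Z" and b0: "b0 \<in> B" "\<And>z. z \<in> Z \<Longrightarrow> b0 \<oplus>\<^bsub>M\<^esub> z = z" "\<And>b. b \<in> B \<Longrightarrow> b \<oplus>\<^bsub>M\<^esub> b0 = b"
    and add: "\<And>a b. a \<in> B \<Longrightarrow> b \<in> B \<Longrightarrow> a \<oplus>\<^bsub>M\<^esub> b \<in> B"
    and diff: "\<And>a b. a \<in> B \<Longrightarrow> b \<in> B \<Longrightarrow> \<exists>c\<in>B. a = c \<oplus>\<^bsub>M\<^esub> b"
  shows "carrier (quotient_module (M\<lparr>carrier := Z\<rparr>) B) = {B} \<longleftrightarrow> Z \<subseteq> B"
proof -
  have eq: "carrier (quotient_module (M\<lparr>carrier := Z\<rparr>) B) = (\<lambda>z. {b \<oplus>\<^bsub>M\<^esub> z |b. b \<in> B}) ` Z"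
    by (auto simp: quotient_module_def A_RCOSETS_def RCOSETS_def r_coset_def)
  have "{b \<oplus>\<^bsub>M\<^esub> z |b. b \<in> B} = B \<longleftrightarrow> z \<in> B" if "z \<in> Z" for z
  proof
    assume "{b \<oplus>\<^bsub>M\<^esub> z |b. b \<in> B} = B"
    moreover have "z \<in> {b \<oplus>\<^bsub>M\<^esub> z |b. b \<in> B}" using b0(1) b0(2)[OF that] by force
    ultimately show "z \<in> B" by simp
  next
    assume z: "z \<in> B"
    show "{b \<oplus>\<^bsub>M\<^esub> z |b. b \<in> B} = B"
    proof (intro equalityI subsetI)
      fix y assume "y \<in> {b \<oplus>\<^bsub>M\<^esub> z |b. b \<in> B}"
      then show "y \<in> B" using add z by auto
    next
      fix y assume "y \<in> B"
      then show "y \<in> {b \<oplus>\<^bsub>M\<^esub> z |b. b \<in> B}" using diff[OF _ z] by blast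
    qed
  qed
  then have "(\<lambda>z. {b \<oplus>\<^bsub>M\<^esub> z |b. b \<in> B}) ` Z = {B} \<longleftrightarrow> Z \<subseteq> B" by (rule image_eq_singleton_iff[OF Z])
  then show ?thesis by (simp only: eq)
qed

context ring_presentation
begin

lemma matrix_lin_map_eq_iff:
  assumes N: "presents V \<kappa> N"
  shows "matrix_lin_map r \<kappa> H = matrix_lin_map r \<kappa> G \<longleftrightarrow> (\<forall>a<r. H a - G a \<in> V)"
proof
  assume "matrix_lin_map r \<kappa> H = matrix_lin_map r \<kappa> G"
  then have "\<kappa> (comb r w H) = \<kappa> (comb r w G)" for w
    unfolding matrix_lin_map_apply[OF N, symmetric] by simp
  then have "comb r w (H - G) \<in> V" for w unfolding pres_eq_iff[OF N] comb_diff_right .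
  then have "comb r (unit_vec a) (H - G) \<in> V" for a .
  then show "\<forall>a<r. H a - G a \<in> V" by (metis comb_unit minus_apply)
next
  assume HG: "\<forall>a<r. H a - G a \<in> V"
  show "matrix_lin_map r \<kappa> H = matrix_lin_map r \<kappa> G"
  proof (rule lin_map_eqI[OF matrix_lin_map_in[OF N] matrix_lin_map_in[OF N]])
    fix w
    have "comb r w (H - G) \<in> V"
      by (rule comb_in[OF pres_submod[OF N]]) (use HG in \<open>simp add: minus_apply\<close>)
    then show "matrix_lin_map r \<kappa> H (free_map r w) = matrix_lin_map r \<kappa> G (free_map r w)"
      unfolding matrix_lin_map_apply[OF N] pres_eq_iff[OF N] comb_diff_right .
  qed
qed

lemma Hom_carrier:
  assumes N: "presents V \<kappa> N"
  shows "carrier (Hom_module A (free_module A r) N) = range (matrix_lin_map r \<kappa>)"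
proof (intro equalityI subsetI)
  fix h assume "h \<in> carrier (Hom_module A (free_module A r) N)"
  then have h: "h \<in> lin_maps A (free_module A r) N" by (simp add: Hom_module_def)
  obtain H where "\<And>w. h (free_map r w) = \<kappa> (comb r w H)" using lin_map_matrix[OF N h] by blast
  then have "h = matrix_lin_map r \<kappa> H"
    by (intro lin_map_eqI[OF h matrix_lin_map_in[OF N]]) (simp add: matrix_lin_map_apply[OF N])
  then show "h \<in> range (matrix_lin_map r \<kappa>)" by blast
qed (auto simp: Hom_module_def matrix_lin_map_in[OF N])

lemma Hom_add:
  assumes N: "presents V \<kappa> N"
  shows "matrix_lin_map r \<kappa> H \<oplus>\<^bsub>Hom_module A (free_module A r) N\<^esub> matrix_lin_map r \<kappa> G = matrix_lin_map r \<kappa> (H + G)"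
proof
  fix v
  show "(matrix_lin_map r \<kappa> H \<oplus>\<^bsub>Hom_module A (free_module A r) N\<^esub> matrix_lin_map r \<kappa> G) v = matrix_lin_map r \<kappa> (H + G) v"
    by (simp add: Hom_module_def matrix_lin_map_def restrict_def pres_add[OF N] comb_add_right)
qed

lemma Hom_zero:
  assumes N: "presents V \<kappa> N"
  shows "\<zero>\<^bsub>Hom_module A (free_module A r) N\<^esub> = matrix_lin_map r \<kappa> 0"
proof
  fix v
  have "comb r w 0 = (0 :: 'p vec)" for w by (simp add: comb_def fun_eq_iff zero_fun_apply)
  then show "\<zero>\<^bsub>Hom_module A (free_module A r) N\<^esub> v = matrix_lin_map r \<kappa> 0 v"
    by (simp add: Hom_module_def matrix_lin_map_def restrict_def pres_zero[OF N])
qed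

lemma coboundary_matrix:
  assumes N: "presents V \<kappa> N" and D: "represents F D"
  shows "coboundary_map A F i (matrix_lin_map (rank F i) \<kappa> G) =
    matrix_lin_map (rank F (Suc i)) \<kappa> (\<lambda>a. comb (rank F i) (D i a) G)"
proof
  fix v
  show "coboundary_map A F i (matrix_lin_map (rank F i) \<kappa> G) v =
    matrix_lin_map (rank F (Suc i)) \<kappa> (\<lambda>a. comb (rank F i) (D i a) G) v"
  proof (cases "v \<in> carrier (free_module A (rank F (Suc i)))")
    case True
    then obtain w where w: "v = free_map (rank F (Suc i)) w" by (auto simp: free_carrier)
    have "coboundary_map A F i (matrix_lin_map (rank F i) \<kappa> G) v =
        matrix_lin_map (rank F i) \<kappa> G (free_map (rank F i) (comb (rank F (Suc i)) w (D i)))"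
      using True D by (simp add: coboundary_map_def w represents_def)
    then show ?thesis by (simp add: matrix_lin_map_apply[OF N] w comb_assoc)
  qed (simp add: coboundary_map_def matrix_lin_map_def)
qed

text \<open>Cocycles and coboundaries are given by matrices, and Ext is trivial exactly if every cocycle is a coboundary.\<close>
lemma Ext_vanishes_iff_hom_exact:
  assumes F: "F = (SOME F. free_resolution A M F)" and ex: "free_resolution A M F"
    and D: "represents F D" "resolution_mod J (rank F) D" and N: "presents V \<kappa> N"
  shows "Ext_vanishes A (Suc m) M N \<longleftrightarrow> hom_exact (rank F) D V m"
proof -
  let ?r = "rank F"
  let ?H = "Hom_module A (free_module A (?r (Suc m))) N"
  define T where "T = matrix_lin_map (?r (Suc m)) \<kappa>"
  define \<delta> where "\<delta> G = (\<lambda>a. comb (?r m) (D m a) G)" for G :: "nat \<Rightarrow> 'p vec"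
  have Teq: "T H = T G \<longleftrightarrow> (\<forall>a<?r (Suc m). H a - G a \<in> V)" for H G
    unfolding T_def by (rule matrix_lin_map_eq_iff[OF N])
  have Tadd: "T H \<oplus>\<^bsub>?H\<^esub> T G = T (H + G)" for H G unfolding T_def by (rule Hom_add[OF N])
  define Z where "Z = cocycles A F N (Suc m)"
  define B where "B = coboundaries A F N (Suc m)"
  have B: "B = range (\<lambda>G. T (\<delta> G))"
    unfolding B_def coboundaries.simps Hom_carrier[OF N]
    by (auto simp: coboundary_matrix[OF N D(1)] T_def \<delta>_def image_image)
  have sV: "submod V" by (rule pres_submod[OF N])
  have Z: "Z = T ` {H. \<forall>a<?r (Suc (Suc m)). comb (?r (Suc m)) (D (Suc m) a) H \<in> V}"
  proof -
    have "(matrix_lin_map (?r (Suc (Suc m))) \<kappa> (\<lambda>a. comb (?r (Suc m)) (D (Suc m) a) H) =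
        matrix_lin_map (?r (Suc (Suc m))) \<kappa> 0) \<longleftrightarrow>
        (\<forall>a<?r (Suc (Suc m)). comb (?r (Suc m)) (D (Suc m) a) H \<in> V)" for H
      unfolding matrix_lin_map_eq_iff[OF N] by (simp add: zero_fun_apply)
    then show ?thesis
      unfolding Z_def cocycles_def Hom_carrier[OF N] Hom_zero[OF N] T_def
      by (auto simp: coboundary_matrix[OF N D(1)])
  qed
  have \<delta>add: "\<delta> (G + G') = \<delta> G + \<delta> G'" and \<delta>diff: "\<delta> (G - G') = \<delta> G - \<delta> G'" for G G'
    by (auto simp: \<delta>_def comb_add_right comb_diff_right plus_fun_apply minus_apply)
  have comb0: "comb k w 0 = (0 :: 'p vec)" for k w by (simp add: comb_def fun_eq_iff zero_fun_apply)
  then have \<delta>0: "\<delta> 0 = 0" by (simp add: \<delta>_def fun_eq_iff zero_fun_apply)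
  have "carrier (quotient_module (?H\<lparr>carrier := Z\<rparr>) B) = {B} \<longleftrightarrow> Z \<subseteq> B"
  proof (rule carrier_quotient_trivial_iff)
    show "T 0 \<in> Z" unfolding Z using comb0 submod0[OF sV] by (auto intro!: imageI)
    show "T 0 \<in> B" unfolding B using \<delta>0 by (metis rangeI)
    show "T 0 \<oplus>\<^bsub>?H\<^esub> z = z" if "z \<in> Z" for z using that unfolding Z by (auto simp: Tadd)
    show "b \<oplus>\<^bsub>?H\<^esub> T 0 = b" if "b \<in> B" for b using that unfolding B by (auto simp: Tadd)
    fix a b assume "a \<in> B" "b \<in> B"
    then obtain G G' where *: "a = T (\<delta> G)" "b = T (\<delta> G')" unfolding B by blast
    show "a \<oplus>\<^bsub>?H\<^esub> b \<in> B" unfolding * Tadd \<delta>add[symmetric] B by blast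
    show "\<exists>c\<in>B. a = c \<oplus>\<^bsub>?H\<^esub> b"
    proof (rule bexI)
      show "a = T (\<delta> (G - G')) \<oplus>\<^bsub>?H\<^esub> b" unfolding * Tadd \<delta>diff by simp
      show "T (\<delta> (G - G')) \<in> B" unfolding B by blast
    qed
  qed
  moreover have "Ext_vanishes A (Suc m) M N \<longleftrightarrow> carrier (quotient_module (?H\<lparr>carrier := Z\<rparr>) B) = {B}"
    unfolding Ext_vanishes_def Ext_def F[symmetric] Let_def Z_def B_def by (simp add: quotient_module_def)
  moreover have "Z \<subseteq> B \<longleftrightarrow> hom_exact ?r D V m"
  proof -
    have "T H \<in> B \<longleftrightarrow> (\<exists>G. \<forall>a<?r (Suc m). H a - comb (?r m) (D m a) G \<in> V)" for H
      unfolding B image_iff Teq by (simp add: \<delta>_def)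
    then show ?thesis unfolding hom_exact_def Z image_subset_iff by simp
  qed
  ultimately show ?thesis by blast
qed

text \<open>
  The resolution chosen in the definition of Ext can be compared with \<open>D\<close>, both resolving the same
  module.
\<close>
lemma chosen_resolution:
  assumes M: "presents (presented J r D) \<kappa> M" and D: "resolution_mod J r D"
  obtains F D' where "F = (SOME F. free_resolution A M F)" "free_resolution A M F" "represents F D'"
    "resolution_mod J (rank F) D'"
    "\<And>V m. fg_mod J V \<Longrightarrow> hom_exact (rank F) D' V m \<longleftrightarrow> hom_exact r D V m"
proof -
  define F where "F = (SOME F. free_resolution A M F)"
  have F: "free_resolution A M F"
    unfolding F_def by (rule someI_ex[OF matrices_to_resolution[OF M D]])
  let ?r = "rank F"
  obtain D' where D': "represents F D'" "resolution_mod J ?r D'"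
    "presented J ?r D' = {w. augmentation F (free_map (?r 0) w) = \<zero>\<^bsub>M\<^esub>}"
    using resolution_to_matrices[OF F] by blast
  let ?V = "presented J r D"
  have sub: "submod ?V" by (rule pres_submod[OF M])
  have aug: "augmentation F \<in> lin_maps A (free_module A (?r 0)) M"
    "augmentation F ` carrier (free_module A (?r 0)) = carrier M"
    using F by (auto simp: free_resolution_def)
  \<comment> \<open>\<open>\<beta>\<close> and \<open>\<alpha>\<close> lift the identity of the module to the free modules in degree 0, in both directions.\<close>
  obtain \<beta> where \<beta>: "\<And>w. augmentation F (free_map (?r 0) w) = \<kappa> (comb (?r 0) w \<beta>)"
    using lin_map_matrix[OF M aug(1)] by blast
  have V': "w \<in> presented J ?r D' \<longleftrightarrow> comb (?r 0) w \<beta> \<in> ?V" for w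
    unfolding D'(3) by (simp add: \<beta> pres_ker[OF M])
  have "\<forall>a. \<exists>w. \<kappa> (unit_vec a) = augmentation F (free_map (?r 0) w)"
    using aug(2) by (auto simp: pres_carrier[OF M] free_carrier)
  then obtain \<alpha> where \<alpha>: "\<And>a. \<kappa> (unit_vec a) = augmentation F (free_map (?r 0) (\<alpha> a))" by metis
  have \<alpha>\<beta>: "comb (?r 0) (\<alpha> a) \<beta> - unit_vec a \<in> ?V" for a
    using \<alpha>[of a] unfolding \<beta> by (simp add: pres_eq_iff[OF M, symmetric])
  have unit: "comb (r 0) w unit_vec - w \<in> ?V" for w
  proof -
    have "w - comb (r 0) w unit_vec \<in> ?V"
      unfolding presented_def using comb_unit_diff[OF ideal_J, of w "r 0"] by (auto intro!: exI[of _ 0])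
    from submod_swap[OF sub this] show ?thesis .
  qed
  have id: "comb (?r 0) (comb (r 0) w \<alpha>) \<beta> - w \<in> ?V" for w
  proof -
    have "comb (r 0) w ((\<lambda>a. comb (?r 0) (\<alpha> a) \<beta>) - unit_vec) \<in> ?V"
      by (rule comb_in[OF sub]) (use \<alpha>\<beta> in \<open>simp add: minus_apply\<close>)
    from submod_add[OF sub this unit[of w]] show ?thesis unfolding comb_diff_right comb_assoc by simp
  qed
  have id': "comb (r 0) (comb (?r 0) w \<beta>) \<alpha> - w \<in> presented J ?r D'" for w
    unfolding V' comb_diff_left by (rule id)
  have to: "comb (r 0) w \<alpha> \<in> presented J ?r D'" if "w \<in> ?V" for w
    unfolding V' using submod_add[OF sub id[of w] that] by simp
  have fro: "comb (?r 0) w \<beta> \<in> ?V" if "w \<in> presented J ?r D'" for w using that V' by blast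
  have "hom_exact ?r D' V m \<longleftrightarrow> hom_exact r D V m" if V: "fg_mod J V" for V m
    using hom_exact_compare[OF ideal_J D D'(2) to fro id V] hom_exact_compare[OF ideal_J D'(2) D fro to id' V]
    by blast
  with F D'(1,2) show thesis using that F_def by blast
qed

lemma fg_module_iff_relations:
  "fg_module A N \<longleftrightarrow> (\<exists>V \<kappa>. fg_mod J V \<and> presents V \<kappa> N)"
proof
  assume "fg_module A N"
  then obtain n V \<kappa> where "presents V \<kappa> N" "free_rel J n \<subseteq> V" by (rule fg_module_presented)
  then show "\<exists>V \<kappa>. fg_mod J V \<and> presents V \<kappa> N" using pres_submod unfolding fg_mod_def by blast
qed (auto simp: fg_mod_def intro: pres_fg)

theorem ext_bounded_imp_bounded_at:
  assumes D: "resolution_mod J r D"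
  obtains M where "fg_module A M" "\<And>b. ext_bounded A M b \<Longrightarrow> bounded_at J r D (nat b)"
proof -
  let ?V = "presented J r D"
  have sub: "submod ?V" "free_rel J (r 0) \<subseteq> ?V"
    using submod_presented[OF ideal_J] by (auto simp: presented_def intro!: exI[of _ 0])
  obtain \<kappa> and M :: "('a, 'a list) module" where M: "presents ?V \<kappa> M"
    using module_of_relations[OF sub] by blast
  obtain F D' where F: "F = (SOME F. free_resolution A M F)" "free_resolution A M F" "represents F D'"
    "resolution_mod J (rank F) D'"
    and eq: "\<And>V m. fg_mod J V \<Longrightarrow> hom_exact (rank F) D' V m \<longleftrightarrow> hom_exact r D V m"
    by (rule chosen_resolution[OF M D]) blast
  have "bounded_at J r D (nat b)" if b: "ext_bounded A M b" for b
    unfolding bounded_at_def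
  proof (intro allI impI)
    fix V m assume V: "fg_mod J V" and ev: "\<exists>n. \<forall>m\<ge>n. hom_exact r D V m" and m: "nat b \<le> m"
    have "submod V" "\<exists>n. free_rel J n \<subseteq> V" using V by (auto simp: fg_mod_def)
    then obtain \<nu> and N :: "('a, 'a list) module" where N: "presents V \<nu> N"
      using module_of_relations by metis
    have ext: "Ext_vanishes A (Suc m) M N \<longleftrightarrow> hom_exact r D V m" for m
      unfolding Ext_vanishes_iff_hom_exact[OF F N] by (rule eq[OF V])
    obtain n where n: "\<And>m. m \<ge> n \<Longrightarrow> hom_exact r D V m" using ev by blast
    have "\<forall>i\<ge>Suc n. Ext_vanishes A i M N"
    proof (intro allI impI)
      fix i assume "Suc n \<le> i"
      then obtain k where "i = Suc k" "n \<le> k" by (cases i) auto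
      then show "Ext_vanishes A i M N" using ext n by simp
    qed
    moreover have "fg_module A N" using fg_module_iff_relations V N by blast
    moreover have "int (Suc m) > b" using m by linarith
    ultimately have "Ext_vanishes A (Suc m) M N" using b unfolding ext_bounded_def by blast
    then show "hom_exact r D V m" using ext by blast
  qed
  moreover have "fg_module A M" by (rule pres_fg[OF M sub(2)])
  ultimately show thesis using that by blast
qed

theorem bounded_at_imp_ext_bounded:
  fixes M :: "('a, 'a list) module"
  assumes noe: "noeth J" and M: "fg_module A M"
  obtains r D where "resolution_mod J r D" "\<And>b. bounded_at J r D b \<Longrightarrow> ext_bounded A M (int b)"
proof -
  obtain n V \<kappa> where V: "presents V \<kappa> M" "free_rel J n \<subseteq> V" by (rule fg_module_presented[OF M])
  obtain r D where r: "r 0 = n" "resolution_mod J r D"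
    "V = {w. \<exists>u. w - comb (r (Suc 0)) u (D 0) \<in> free_rel J n}"
    by (rule resolution_exists[OF noe pres_submod[OF V(1)] V(2)])
  have Vp: "V = presented J r D" by (simp add: r presented_def)
  obtain F D' where F: "F = (SOME F. free_resolution A M F)" "free_resolution A M F" "represents F D'"
    "resolution_mod J (rank F) D'"
    and eq: "\<And>V m. fg_mod J V \<Longrightarrow> hom_exact (rank F) D' V m \<longleftrightarrow> hom_exact r D V m"
    by (rule chosen_resolution[OF V(1)[unfolded Vp] r(2)]) blast
  have "ext_bounded A M (int b)" if b: "bounded_at J r D b" for b
    unfolding ext_bounded_def
  proof (intro allI impI)
    fix N :: "('a, 'a list) module" and i
    assume N: "fg_module A N" and ev: "\<exists>n. \<forall>i\<ge>n. Ext_vanishes A i M N" and i: "int b < int i"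
    obtain W \<nu> where W: "fg_mod J W" "presents W \<nu> N" using iffD1[OF fg_module_iff_relations N] by blast
    have ext: "Ext_vanishes A (Suc m) M N \<longleftrightarrow> hom_exact r D W m" for m
      unfolding Ext_vanishes_iff_hom_exact[OF F W(2)] by (rule eq[OF W(1)])
    obtain n where n: "\<And>i. i \<ge> n \<Longrightarrow> Ext_vanishes A i M N" using ev by blast
    have "\<forall>m\<ge>n. hom_exact r D W m" using n ext[symmetric] by simp
    then have all: "\<forall>m\<ge>b. hom_exact r D W m" using b W(1) unfolding bounded_at_def by blast
    obtain k where "i = Suc k" "b \<le> k" using i by (cases i) auto
    then show "Ext_vanishes A i M N" using all ext by blast
  qed
  with r(2) show thesis by (rule that)
qed

end

section \<open>Presentations by polynomial rings\<close>

subsection \<open>Generators and relations\<close>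

type_synonym 't int_poly = "'t multiset \<Rightarrow>\<^sub>0 int"

definition pvar :: "'t \<Rightarrow> 't int_poly" where
  "pvar t = Poly_Mapping.single {#t#} 1"

text \<open>The variables generate the polynomial ring.\<close>
lemma int_poly_induct [case_names var one uminus add mult]:
  assumes var: "\<And>t. X (pvar t)" and one: "X 1" and um: "\<And>p. X p \<Longrightarrow> X (- p)"
    and add: "\<And>p q. X p \<Longrightarrow> X q \<Longrightarrow> X (p + q)" and mult: "\<And>p q. X p \<Longrightarrow> X q \<Longrightarrow> X (p * q)"
  shows "X (p :: 't int_poly)"
proof -
  have mon: "X (Poly_Mapping.single m 1)" for m :: "'t multiset"
  proof (induction m)
    case empty then show ?case using one by simp
  next
    case (add t m)
    have "pvar t * Poly_Mapping.single m (1::int) = Poly_Mapping.single (add_mset t m) 1"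
      by (simp add: pvar_def mult_single)
    then show ?case using mult[OF var[of t] add] by simp
  qed
  have zero: "X 0" using add[OF one um[OF one]] by simp
  have nat: "X (Poly_Mapping.single m (int n))" for m :: "'t multiset" and n
  proof (induction n)
    case (Suc n)
    have "Poly_Mapping.single m (int (Suc n)) = Poly_Mapping.single m 1 + Poly_Mapping.single m (int n)"
      by (simp add: single_add[symmetric])
    then show ?case using add[OF mon[of m] Suc] by simp
  qed (simp add: zero)
  have sing: "X (Poly_Mapping.single m c)" for m :: "'t multiset" and c
  proof (cases c)
    case (neg n)
    have "Poly_Mapping.single m c = - Poly_Mapping.single m (int (Suc n))" unfolding neg by (simp only: single_uminus)
    then show ?thesis by (simp only: um[OF nat])
  qed (simp only: nat)
  show ?thesis
  proof (induction p rule: update_induct)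
    case (update f a b)
    have "Poly_Mapping.update a b f = f + Poly_Mapping.single a b"
      using update(1) by (intro poly_mapping_eqI) (auto simp: lookup_update lookup_add lookup_single when_def in_keys_iff)
    then show ?case using add[OF update(3) sing] by simp
  qed (rule zero)
qed

text \<open>The case distinction makes the folded function commutative for all arguments, not only for ring elements.\<close>
definition mon_eval :: "('a, 'm) ring_scheme \<Rightarrow> ('t \<Rightarrow> 'a) \<Rightarrow> 't multiset \<Rightarrow> 'a" where
  "mon_eval A \<sigma> = fold_mset (\<lambda>t x. if x \<in> carrier A then \<sigma> t \<otimes>\<^bsub>A\<^esub> x else x) \<one>\<^bsub>A\<^esub>"

text \<open>The ring homomorphism from the integral polynomial ring that sends the variables to \<open>\<sigma>\<close>.\<close>
definition poly_eval :: "('a, 'm) ring_scheme \<Rightarrow> ('t \<Rightarrow> 'a) \<Rightarrow> 't int_poly \<Rightarrow> 'a" where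
  "poly_eval A \<sigma> p = (\<Oplus>\<^bsub>A\<^esub>m\<in>Poly_Mapping.keys p. [Poly_Mapping.lookup p m] \<cdot>\<^bsub>A\<^esub> mon_eval A \<sigma> m)"

context cring
begin

lemma mon_eval_add_mset:
  assumes \<sigma>: "\<And>t. \<sigma> t \<in> carrier R"
  shows "mon_eval R \<sigma> m \<in> carrier R \<and> mon_eval R \<sigma> (add_mset t m) = \<sigma> t \<otimes> mon_eval R \<sigma> m"
proof -
  interpret comp_fun_commute "\<lambda>t x. if x \<in> carrier R then \<sigma> t \<otimes> x else x"
    by unfold_locales (simp add: fun_eq_iff \<sigma> m_lcomm)
  have c: "mon_eval R \<sigma> m \<in> carrier R"
    unfolding mon_eval_def by (induction m) (simp_all add: \<sigma>)
  then show ?thesis by (simp add: mon_eval_def)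
qed

lemma mon_eval_empty [simp]: "mon_eval R \<sigma> {#} = \<one>"
  by (simp add: mon_eval_def)

lemma mon_eval_closed: "(\<And>t. \<sigma> t \<in> carrier R) \<Longrightarrow> mon_eval R \<sigma> m \<in> carrier R"
  by (rule conjunct1[OF mon_eval_add_mset])

context
  fixes \<sigma> :: "'t \<Rightarrow> 'a" assumes \<sigma>: "\<And>t. \<sigma> t \<in> carrier R"
begin

lemma term_closed: "add_pow R (c::int) (mon_eval R \<sigma> m) \<in> carrier R"
  by (intro add.int_pow_closed mon_eval_closed \<sigma>)

lemma poly_eval_closed: "poly_eval R \<sigma> p \<in> carrier R"
  unfolding poly_eval_def using term_closed by (intro finsum_closed) auto

lemma poly_eval_superset:
  assumes "finite K" "Poly_Mapping.keys p \<subseteq> K"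
  shows "poly_eval R \<sigma> p = (\<Oplus>m\<in>K. add_pow R (Poly_Mapping.lookup p m) (mon_eval R \<sigma> m))"
  unfolding poly_eval_def
proof (rule add.finprod_mono_neutral_cong_left)
  fix m assume "m \<in> K - Poly_Mapping.keys p"
  then show "add_pow R (Poly_Mapping.lookup p m) (mon_eval R \<sigma> m) = \<zero>" by (simp add: in_keys_iff add_pow_def)
qed (use assms term_closed in auto)

lemma poly_eval_add: "poly_eval R \<sigma> (p + q) = poly_eval R \<sigma> p \<oplus> poly_eval R \<sigma> q"
proof -
  let ?K = "Poly_Mapping.keys p \<union> Poly_Mapping.keys q"
  have "poly_eval R \<sigma> (p + q) = (\<Oplus>m\<in>?K. add_pow R (Poly_Mapping.lookup (p + q) m) (mon_eval R \<sigma> m))"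
    by (rule poly_eval_superset) (auto simp: keys_add)
  also have "\<dots> = (\<Oplus>m\<in>?K. add_pow R (Poly_Mapping.lookup p m) (mon_eval R \<sigma> m) \<oplus> add_pow R (Poly_Mapping.lookup q m) (mon_eval R \<sigma> m))"
    by (rule finsum_cong')
      (auto simp: lookup_add term_closed add.int_pow_mult mon_eval_closed[OF \<sigma>])
  also have "\<dots> = (\<Oplus>m\<in>?K. add_pow R (Poly_Mapping.lookup p m) (mon_eval R \<sigma> m)) \<oplus> (\<Oplus>m\<in>?K. add_pow R (Poly_Mapping.lookup q m) (mon_eval R \<sigma> m))"
    by (rule finsum_addf) (auto simp: term_closed)
  also have "\<dots> = poly_eval R \<sigma> p \<oplus> poly_eval R \<sigma> q"
    by (simp add: poly_eval_superset[of ?K])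
  finally show ?thesis .
qed

lemma poly_eval_single: "poly_eval R \<sigma> (Poly_Mapping.single m c) = add_pow R (c) (mon_eval R \<sigma> m)"
proof -
  have "poly_eval R \<sigma> (Poly_Mapping.single m c) = (\<Oplus>m'\<in>{m}. add_pow R (Poly_Mapping.lookup (Poly_Mapping.single m c) m') (mon_eval R \<sigma> m'))"
    by (rule poly_eval_superset) auto
  then show ?thesis using term_closed[of c m] by simp
qed

lemma poly_eval_var: "poly_eval R \<sigma> (pvar t) = \<sigma> t"
  using mon_eval_add_mset[OF \<sigma>, where m = "{#}" and t = t] \<sigma>[of t]
  by (simp add: pvar_def poly_eval_single add.int_pow_1)

lemma poly_eval_one: "poly_eval R \<sigma> 1 = \<one>"
  using poly_eval_single[of 0 1] by (simp add: add.int_pow_1)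

lemma poly_eval_zero: "poly_eval R \<sigma> 0 = \<zero>"
  by (simp add: poly_eval_def)

lemma poly_eval_uminus: "poly_eval R \<sigma> (- p) = \<ominus> poly_eval R \<sigma> p"
  using poly_eval_add[of "- p" p] poly_eval_closed minus_equality[of "poly_eval R \<sigma> (- p)" "poly_eval R \<sigma> p"]
  by (simp add: poly_eval_zero)

lemma poly_eval_mult_var: "poly_eval R \<sigma> (pvar t * q) = \<sigma> t \<otimes> poly_eval R \<sigma> q"
proof (induction q rule: update_induct)
  case const show ?case using \<sigma>[of t] by (simp add: poly_eval_zero)
next
  case (update f a b)
  have eq: "Poly_Mapping.update a b f = f + Poly_Mapping.single a b"
    using update(1) by (intro poly_mapping_eqI) (auto simp: lookup_update lookup_add lookup_single when_def in_keys_iff)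
  have "pvar t * Poly_Mapping.single a b = Poly_Mapping.single (add_mset t a) b"
    by (simp add: pvar_def mult_single)
  then have "poly_eval R \<sigma> (pvar t * Poly_Mapping.single a b) = \<sigma> t \<otimes> poly_eval R \<sigma> (Poly_Mapping.single a b)"
    using mon_eval_add_mset[OF \<sigma>, where m = a and t = t] \<sigma>[of t]
    by (simp add: poly_eval_single add_pow_rdistr_int)
  then show ?case unfolding eq distrib_left poly_eval_add update(3)
    using \<sigma>[of t] poly_eval_closed by (simp add: r_distr)
qed

lemma poly_eval_mult: "poly_eval R \<sigma> (p * q) = poly_eval R \<sigma> p \<otimes> poly_eval R \<sigma> q"
proof (induction p arbitrary: q rule: int_poly_induct)
  case (var t) show ?case by (simp add: poly_eval_mult_var poly_eval_var)
next
  case one show ?case by (simp add: poly_eval_one poly_eval_closed)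
next
  case (uminus p) then show ?case by (simp add: poly_eval_uminus poly_eval_closed l_minus)
next
  case (add p p') then show ?case by (simp add: distrib_right poly_eval_add poly_eval_closed l_distr)
next
  case (mult p p') then show ?case by (simp add: mult.assoc poly_eval_closed m_assoc)
qed

end

lemma presentation_of_generators:
  assumes \<sigma>: "\<And>t. \<sigma> t \<in> carrier R" and onto: "carrier R \<subseteq> range \<sigma>"
  shows "ring_presentation R (poly_eval R \<sigma>)"
proof (rule ring_presentation.intro)
  show "cring R" by (rule is_cring)
  show "\<exists>p. poly_eval R \<sigma> p = a" if a: "a \<in> carrier R" for a
  proof -
    obtain t where "a = \<sigma> t" using subsetD[OF onto a] by auto
    then show ?thesis using poly_eval_var[of \<sigma> t, OF \<sigma>] by (intro exI[of _ "pvar t"]) simp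
  qed
qed (simp_all add: poly_eval_closed[of \<sigma>, OF \<sigma>] poly_eval_add[of \<sigma>, OF \<sigma>] poly_eval_mult[of \<sigma>, OF \<sigma>] poly_eval_one[of \<sigma>, OF \<sigma>])

end

subsection \<open>Ideals of a presented ring\<close>

context ring_presentation
begin

interpretation A: cring A by (rule A)

lemma is_ideal_preimage: "ideal I A \<Longrightarrow> is_ideal (\<epsilon> -` I) \<and> J \<subseteq> \<epsilon> -` I"
proof -
  assume "ideal I A"
  then interpret I: ideal I A .
  show ?thesis
    using I.a_closed I.zero_closed I.I_l_closed eps_carrier
    by (auto simp: is_ideal_def J_def eps_zero eps_add eps_mult)
qed

lemma preimage_image: "is_ideal K \<Longrightarrow> J \<subseteq> K \<Longrightarrow> \<epsilon> -` \<epsilon> ` K = K"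
proof (intro equalityI subsetI)
  fix p assume K: "is_ideal K" "J \<subseteq> K" and "p \<in> \<epsilon> -` \<epsilon> ` K"
  then obtain q where q: "q \<in> K" "\<epsilon> p = \<epsilon> q" by auto
  then have "p - q \<in> K" using K(2) eps_eq_iff by blast
  from ideal_add[OF K(1) this q(1)] show "p \<in> K" by simp
qed auto

lemma image_preimage: "I \<subseteq> carrier A \<Longrightarrow> \<epsilon> ` (\<epsilon> -` I) = I"
  using eps_onto by (auto simp: image_iff) blast

lemma ideal_image: "is_ideal K \<Longrightarrow> ideal (\<epsilon> ` K) A"
proof (rule idealI)
  assume K: "is_ideal K"
  show "ring A" by (rule A.ring_axioms)
  show "subgroup (\<epsilon> ` K) (add_monoid A)"
  proof (rule A.add.subgroupI)
    show "\<epsilon> ` K \<subseteq> carrier A" using eps_carrier by auto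
    show "\<epsilon> ` K \<noteq> {}" using ideal0[OF K] by blast
  next
    fix a assume "a \<in> \<epsilon> ` K"
    then obtain p where p: "p \<in> K" "a = \<epsilon> p" by blast
    have "\<epsilon> (- p) \<in> \<epsilon> ` K" by (rule imageI) (rule ideal_uminus[OF K p(1)])
    then show "\<ominus>\<^bsub>A\<^esub> a \<in> \<epsilon> ` K" using p by (simp add: eps_uminus)
  next
    fix a b assume "a \<in> \<epsilon> ` K" "b \<in> \<epsilon> ` K"
    then obtain p q where p: "p \<in> K" "a = \<epsilon> p" "q \<in> K" "b = \<epsilon> q" by blast
    have "\<epsilon> (p + q) \<in> \<epsilon> ` K" by (rule imageI) (rule ideal_add[OF K p(1,3)])
    then show "a \<oplus>\<^bsub>A\<^esub> b \<in> \<epsilon> ` K" using p by (simp add: eps_add)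
  qed
  fix a x assume ax: "a \<in> \<epsilon> ` K" "x \<in> carrier A"
  then obtain p q where p: "p \<in> K" "a = \<epsilon> p" "x = \<epsilon> q" using eps_onto[OF ax(2)] by blast
  have "\<epsilon> (q * p) \<in> \<epsilon> ` K" by (rule imageI) (rule ideal_mult(1)[OF K p(1)])
  then show "x \<otimes>\<^bsub>A\<^esub> a \<in> \<epsilon> ` K" using p by (simp add: eps_mult)
  then show "a \<otimes>\<^bsub>A\<^esub> x \<in> \<epsilon> ` K" using p eps_carrier by (simp add: A.m_comm)
qed

lemma prime_preimage: "primeideal I A \<Longrightarrow> prime_id (\<epsilon> -` I) \<and> J \<subseteq> \<epsilon> -` I"
proof -
  assume I: "primeideal I A"
  then interpret I: primeideal I A .
  have "\<one>\<^bsub>A\<^esub> \<notin> I" using I.I_notcarr I.one_imp_carrier by blast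
  then show ?thesis
    using is_ideal_preimage[OF I.is_ideal] I.I_prime[OF eps_carrier eps_carrier]
    by (auto simp: prime_id_def eps_one eps_mult)
qed

lemma prime_image: "prime_id K \<Longrightarrow> J \<subseteq> K \<Longrightarrow> primeideal (\<epsilon> ` K) A"
proof (rule primeidealI)
  assume K: "prime_id K" "J \<subseteq> K"
  then have idK: "is_ideal K" by (simp add: prime_id_def)
  show "ideal (\<epsilon> ` K) A" by (rule ideal_image[OF idK])
  show "cring A" by (rule A)
  have mem: "\<epsilon> p \<in> \<epsilon> ` K \<longleftrightarrow> p \<in> K" for p using preimage_image[OF idK K(2)] by auto
  have "\<one>\<^bsub>A\<^esub> \<notin> \<epsilon> ` K" using mem[of 1] K(1) by (simp add: prime_id_def eps_one)
  then show "carrier A \<noteq> \<epsilon> ` K" by auto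
  fix a b assume ab: "a \<in> carrier A" "b \<in> carrier A" "a \<otimes>\<^bsub>A\<^esub> b \<in> \<epsilon> ` K"
  then obtain p q where "a = \<epsilon> p" "b = \<epsilon> q" using eps_onto by metis
  then show "a \<in> \<epsilon> ` K \<or> b \<in> \<epsilon> ` K"
    using ab(3) K(1) by (auto simp: eps_mult[symmetric] mem prime_id_def)
qed

lemma adjoin_list_preimage: "adjoin_list J hs = \<epsilon> -` genideal A (\<epsilon> ` set hs)"
proof
  have sub: "\<epsilon> ` set hs \<subseteq> carrier A" using eps_carrier by auto
  have gen: "ideal (genideal A (\<epsilon> ` set hs)) A" by (rule A.genideal_ideal[OF sub])
  show "adjoin_list J hs \<subseteq> \<epsilon> -` genideal A (\<epsilon> ` set hs)"
    by (rule adjoin_list_least) (use is_ideal_preimage[OF gen] A.genideal_self[OF sub] in auto)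
  have idl: "is_ideal (adjoin_list J hs)" "J \<subseteq> adjoin_list J hs"
    using ideal_adjoin_list[OF ideal_J] adjoin_list_superset[OF ideal_J] by auto
  have "genideal A (\<epsilon> ` set hs) \<subseteq> \<epsilon> ` adjoin_list J hs"
    by (rule A.genideal_minimal[OF ideal_image[OF idl(1)]])
      (use adjoin_list_mem[OF ideal_J] in auto)
  then show "\<epsilon> -` genideal A (\<epsilon> ` set hs) \<subseteq> adjoin_list J hs"
    using preimage_image[OF idl] by blast
qed

lemma list_lift:
  assumes "set xs \<subseteq> carrier A" obtains hs where "map \<epsilon> hs = xs"
proof -
  have "\<exists>hs. map \<epsilon> hs = xs"
    using assms
  proof (induction xs)
    case (Cons x xs)
    then obtain hs h where "map \<epsilon> hs = xs" "\<epsilon> h = x" using eps_onto by auto metis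
    then have "map \<epsilon> (h # hs) = x # xs" by simp
    then show ?case by (rule exI)
  qed simp
  then show thesis using that by blast
qed

lemma noeth_J:
  assumes "noetherian_ring A" shows "noeth J"
  unfolding noeth_def
proof (intro conjI allI impI)
  fix K assume K: "is_ideal K" "J \<subseteq> K"
  obtain G where G: "G \<subseteq> carrier A" "finite G" "\<epsilon> ` K = genideal A G"
    using noetherian_ring.finetely_gen[OF assms ideal_image[OF K(1)]] by blast
  obtain xs where xs: "set xs = G" using finite_list[OF G(2)] by blast
  then obtain hs where "map \<epsilon> hs = xs" using list_lift G(1) by metis
  then have "\<epsilon> ` set hs = G" using xs by (metis set_map)
  then have "adjoin_list J hs = \<epsilon> -` \<epsilon> ` K" by (simp add: adjoin_list_preimage G(3))
  then show "\<exists>hs. K = adjoin_list J hs" using preimage_image[OF K] by metis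
qed (rule ideal_J)

text \<open>
  A non-unit outside the maximal ideal would generate a proper ideal; an ideal maximal among those containing it
  is a second maximal ideal.
\<close>
lemma local_mod_max_ideal:
  assumes loc: "noetherian_local_ring A"
  shows "local_mod (\<epsilon> -` max_ideal A) J"
proof -
  have m: "maximalideal I A \<longleftrightarrow> I = max_ideal A" for I
    using loc the1_equality[of "\<lambda>I. maximalideal I A"] theI'[of "\<lambda>I. maximalideal I A"]
    unfolding noetherian_local_ring_def max_ideal_def by metis
  interpret m: maximalideal "max_ideal A" A by (rule iffD2[OF m refl])
  have noe: "noeth J" using loc noeth_J by (simp add: noetherian_local_ring_def)
  have one: "\<one>\<^bsub>A\<^esub> \<notin> max_ideal A" using m.I_notcarr m.one_imp_carrier by blast
  have "\<exists>c'. c' * c - 1 \<in> J" if c: "\<epsilon> c \<notin> max_ideal A" for c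
  proof (rule ccontr)
    assume no: "\<not> ?thesis"
    define S where "S = {K. is_ideal K \<and> J \<subseteq> K \<and> c \<in> K \<and> 1 \<notin> K}"
    have "1 \<notin> adjoin J c"
    proof
      assume "1 \<in> adjoin J c"
      then obtain d where "1 - c * d \<in> J" by (auto simp: adjoin_def)
      from ideal_uminus[OF ideal_J this] have "d * c - 1 \<in> J" by (simp add: mult.commute)
      then show False using no by blast
    qed
    then have "adjoin J c \<in> S"
      using ideal_adjoin[OF ideal_J] adjoin_superset[OF ideal_J] adjoin_self[OF ideal_J] by (simp add: S_def)
    then obtain K where K: "K \<in> S" and max: "\<And>X. X \<in> S \<Longrightarrow> K \<subseteq> X \<Longrightarrow> X = K"
      using noeth_maximal[OF noe, of S] unfolding S_def by blast
    have idK: "is_ideal K" "J \<subseteq> K" "c \<in> K" "1 \<notin> K" using K by (auto simp: S_def)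
    have "maximalideal (\<epsilon> ` K) A"
    proof (rule maximalidealI[OF ideal_image[OF idK(1)]])
      have "\<one>\<^bsub>A\<^esub> \<notin> \<epsilon> ` K" using preimage_image[OF idK(1,2)] idK(4) by (auto simp: eps_one[symmetric])
      then show "carrier A \<noteq> \<epsilon> ` K" by auto
      fix I assume I: "ideal I A" "\<epsilon> ` K \<subseteq> I" "I \<subseteq> carrier A"
      show "I = \<epsilon> ` K \<or> I = carrier A"
      proof (cases "\<one>\<^bsub>A\<^esub> \<in> I")
        case True
        then show ?thesis using ideal.one_imp_carrier[OF I(1)] by blast
      next
        case False
        then have "\<epsilon> -` I \<in> S"
          using is_ideal_preimage[OF I(1)] I(2) idK(3) by (auto simp: S_def eps_one)
        then have "\<epsilon> -` I = K" using max I(2) by blast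
        then show ?thesis using image_preimage[OF I(3)] by simp
      qed
    qed
    then have "\<epsilon> ` K = max_ideal A" by (rule iffD1[OF m])
    moreover have "\<epsilon> c \<in> \<epsilon> ` K" by (rule imageI[OF idK(3)])
    ultimately show False using c by simp
  qed
  then show ?thesis
    using is_ideal_preimage[OF m.is_ideal] one by (auto simp: local_mod_def eps_one)
qed

lemma regular_seq_iff_nth:
  "regular_seq K hs \<longleftrightarrow> (\<forall>i<length hs. regular_mod (adjoin_list K (take i hs)) (hs ! i))"
proof (induction hs arbitrary: K)
  case (Cons h hs)
  show ?case by (simp add: Cons.IH All_less_Suc2)
qed simp

lemma regular_sequence_lift:
  assumes "regular_sequence A (map \<epsilon> hs)"
  shows "regular_seq J hs"
  unfolding regular_seq_iff_nth regular_mod_def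
proof (intro allI impI)
  fix i c assume i: "i < length hs" and c: "hs ! i * c \<in> adjoin_list J (take i hs)"
  have set: "\<epsilon> ` set (take i hs) = set (take i (map \<epsilon> hs))" by (simp add: take_map)
  have "map \<epsilon> hs ! i \<otimes>\<^bsub>A\<^esub> \<epsilon> c \<in> genideal A (set (take i (map \<epsilon> hs)))"
    using c i unfolding adjoin_list_preimage set by (simp add: eps_mult)
  then have "\<epsilon> c \<in> genideal A (set (take i (map \<epsilon> hs)))"
    using assms i eps_carrier[of c] unfolding regular_sequence_def by simp
  then show "c \<in> adjoin_list J (take i hs)" unfolding adjoin_list_preimage set by simp
qed

lemma prime_chain_image:
  assumes "\<And>i. i \<le> n \<Longrightarrow> prime_id (P i) \<and> J \<subseteq> P i" "\<And>i. i < n \<Longrightarrow> P i \<subset> P (Suc i)"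
  shows "prime_chain A (\<lambda>i. \<epsilon> ` P i) n"
  unfolding prime_chain_def
proof (rule conjI; rule allI; rule impI)
  fix i assume "i \<le> n"
  from assms(1)[OF this] show "primeideal (\<epsilon> ` P i) A" by (intro prime_image) simp_all
next
  fix i assume i: "i < n"
  have idl: "is_ideal (P i)" "J \<subseteq> P i" using assms(1)[of i] i by (simp_all add: prime_id_def)
  have "\<epsilon> -` \<epsilon> ` P i = P i" by (rule preimage_image[OF idl])
  with assms(2)[OF i] show "\<epsilon> ` P i \<subset> \<epsilon> ` P (Suc i)" by blast
qed

lemma prime_chain_preimage:
  assumes "prime_chain A P n"
  shows "(\<forall>i\<le>n. prime_id (\<epsilon> -` P i) \<and> J \<subseteq> \<epsilon> -` P i) \<and> (\<forall>i<n. \<epsilon> -` P i \<subset> \<epsilon> -` P (Suc i))"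
proof (rule conjI; rule allI; rule impI)
  fix i assume "i \<le> n"
  then have "primeideal (P i) A" using assms by (simp add: prime_chain_def)
  then show "prime_id (\<epsilon> -` P i) \<and> J \<subseteq> \<epsilon> -` P i" by (rule prime_preimage)
next
  fix i assume i: "i < n"
  then have sub: "P i \<subset> P (Suc i)" and "primeideal (P (Suc i)) A"
    using assms by (simp_all add: prime_chain_def)
  then have idl: "ideal (P (Suc i)) A" by (simp add: primeideal_def)
  obtain x where x: "x \<in> P (Suc i)" "x \<notin> P i" using sub by blast
  obtain p where "\<epsilon> p = x" using eps_onto[OF ideal.Icarr[OF idl x(1)]] by blast
  then have "p \<in> \<epsilon> -` P (Suc i)" "p \<notin> \<epsilon> -` P i" using x by auto
  moreover have "\<epsilon> -` P i \<subseteq> \<epsilon> -` P (Suc i)" using sub by (intro vimage_mono) blast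
  ultimately show "\<epsilon> -` P i \<subset> \<epsilon> -` P (Suc i)" by blast
qed

end

section \<open>Dimension and adic completion\<close>

lemma cring_of_image:
  fixes \<kappa> :: "'q::comm_ring_1 \<Rightarrow> 'b" and B :: "('b, 'n) ring_scheme"
  assumes c: "carrier B = \<kappa> ` K" and K0: "0 \<in> K" "1 \<in> K"
    and K: "\<And>a b. a \<in> K \<Longrightarrow> b \<in> K \<Longrightarrow> a + b \<in> K" "\<And>a b. a \<in> K \<Longrightarrow> b \<in> K \<Longrightarrow> a * b \<in> K" "\<And>a. a \<in> K \<Longrightarrow> - a \<in> K"
    and add: "\<And>a b. a \<in> K \<Longrightarrow> b \<in> K \<Longrightarrow> \<kappa> a \<oplus>\<^bsub>B\<^esub> \<kappa> b = \<kappa> (a + b)"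
    and mult: "\<And>a b. a \<in> K \<Longrightarrow> b \<in> K \<Longrightarrow> \<kappa> a \<otimes>\<^bsub>B\<^esub> \<kappa> b = \<kappa> (a * b)"
    and one: "\<one>\<^bsub>B\<^esub> = \<kappa> 1" and zero: "\<zero>\<^bsub>B\<^esub> = \<kappa> 0"
  shows "cring B"
proof (rule cringI)
  show "abelian_group B"
  proof (rule abelian_groupI)
    fix x assume "x \<in> carrier B"
    then obtain a where a: "a \<in> K" "x = \<kappa> a" by (auto simp: c)
    show "\<exists>y\<in>carrier B. y \<oplus>\<^bsub>B\<^esub> x = \<zero>\<^bsub>B\<^esub>"
      by (rule bexI[of _ "\<kappa> (- a)"]) (use a K in \<open>simp_all add: add zero c\<close>)
  qed (auto simp: c add zero K0 K ac_simps)
  show "comm_monoid B"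
    by (rule comm_monoidI) (auto simp: c mult one K0 K ac_simps)
qed (auto simp: c add mult K distrib_right)

context ring_presentation
begin

interpretation A: cring A by (rule A)

subsection \<open>Chains of primes\<close>

text \<open>
  A copy of the ring whose carrier consists of one-element lists, which is the type over which universal
  catenarity quantifies algebras.
\<close>
definition list_copy :: "'a list ring" where
  "list_copy = \<lparr>carrier = (\<lambda>a. [a]) ` carrier A, mult = (\<lambda>x y. [hd x \<otimes>\<^bsub>A\<^esub> hd y]), one = [\<one>\<^bsub>A\<^esub>],
     zero = [\<zero>\<^bsub>A\<^esub>], add = (\<lambda>x y. [hd x \<oplus>\<^bsub>A\<^esub> hd y])\<rparr>"

lemma presentation_list_copy: "ring_presentation list_copy (\<lambda>p. [\<epsilon> p])"
proof (rule ring_presentation.intro)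
  have c: "carrier A = range \<epsilon>" using eps_carrier eps_onto by blast
  show "cring list_copy"
    by (rule cring_of_image[where \<kappa> = "\<lambda>p. [\<epsilon> p]" and K = UNIV])
      (auto simp: list_copy_def c eps_add eps_mult eps_one eps_zero)
  show "\<exists>p. [\<epsilon> p] = a" if "a \<in> carrier list_copy" for a
    using that by (auto simp: list_copy_def c)
qed (auto simp: list_copy_def eps_carrier eps_add eps_mult eps_one)

lemma fg_algebra_list_copy: "fg_algebra A list_copy (\<lambda>a. [a])"
  unfolding fg_algebra_def
proof (intro conjI exI[of _ "{}"])
  interpret B: ring_presentation list_copy "\<lambda>p. [\<epsilon> p]" by (rule presentation_list_copy)
  show cr: "cring list_copy" by (rule B.A)
  then interpret Bc: cring list_copy .
  show "(\<lambda>a. [a]) \<in> ring_hom A list_copy"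
    by (rule ring_hom_memI) (auto simp: list_copy_def)
  have "(\<lambda>a. [a]) ` carrier A = carrier list_copy" by (simp add: list_copy_def)
  then show "generate_ring list_copy ((\<lambda>a. [a]) ` carrier A \<union> {}) = carrier list_copy"
    using Bc.generate_ring_incl[of "carrier list_copy"] by (auto intro: generate_ring.incl)
qed (simp_all add: A)

lemma local_mod_prime:
  assumes loc: "local_mod \<mm> J" shows "prime_id \<mm>"
proof -
  have id: "is_ideal \<mm>" and "J \<subseteq> \<mm>" and one: "1 \<notin> \<mm>" using loc by (auto simp: local_mod_def)
  have "b \<in> \<mm>" if ab: "a * b \<in> \<mm>" "a \<notin> \<mm>" for a b
  proof -
    obtain a' where "a' * a - 1 \<in> J" using loc ab(2) by (auto simp: local_mod_def)
    then have "a' * a - 1 \<in> \<mm>" using \<open>J \<subseteq> \<mm>\<close> by blast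
    from ideal_mult(1)[OF id this, of b] ideal_mult(1)[OF id ab(1), of a']
    have "a' * (a * b) - b * (a' * a - 1) \<in> \<mm>" by (intro ideal_diff[OF id])
    then show ?thesis by (simp add: algebra_simps)
  qed
  then show ?thesis using id one by (auto simp: prime_id_def)
qed

lemma prime_below_max:
  assumes loc: "local_mod \<mm> J" and p: "prime_id p" "J \<subseteq> p" shows "p \<subseteq> \<mm>"
proof
  fix c assume c: "c \<in> p"
  show "c \<in> \<mm>"
  proof (rule ccontr)
    assume "c \<notin> \<mm>"
    then obtain c' where "c' * c - 1 \<in> J" using loc by (auto simp: local_mod_def)
    then have "c' * c - 1 \<in> p" using p(2) by blast
    have idp: "is_ideal p" using p by (simp add: prime_id_def)
    from ideal_diff[OF idp ideal_mult(1)[OF idp c, of c'] \<open>c' * c - 1 \<in> p\<close>] have "1 \<in> p" by simp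
    then show False using p by (simp add: prime_id_def)
  qed
qed

text \<open>
  A chain of primes can be prolonged to one from a minimal prime to the maximal ideal without becoming shorter.
  The bounds for these finitely many pairs add up to a common bound.
\<close>
lemma prime_chains_bounded:
  assumes loc: "noetherian_local_ring A" and cat: "universally_catenary_ring A"
  obtains N where "\<And>P n. prime_chain A P n \<Longrightarrow> n \<le> N"
proof -
  interpret B: ring_presentation list_copy "\<lambda>p. [\<epsilon> p]" by (rule presentation_list_copy)
  have BJ: "B.J = J" unfolding B.J_def J_def by (simp add: list_copy_def)
  have catB: "catenary_ring list_copy"
    using cat fg_algebra_list_copy unfolding universally_catenary_ring_def by blast
  define \<mm> where "\<mm> = \<epsilon> -` max_ideal A"
  have lm: "local_mod \<mm> J" unfolding \<mm>_def by (rule local_mod_max_ideal[OF loc])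
  have pm: "prime_id \<mm>" "J \<subseteq> \<mm>" using local_mod_prime[OF lm] lm by (auto simp: local_mod_def)
  have noe: "noeth J" using loc noeth_J by (simp add: noetherian_local_ring_def)
  obtain Ps where Ps: "finite Ps" "\<And>p. p \<in> Ps \<Longrightarrow> prime_id p \<and> J \<subseteq> p"
    "\<And>p. prime_id p \<Longrightarrow> J \<subseteq> p \<Longrightarrow> \<exists>p'\<in>Ps. p' \<subseteq> p"
    using finitely_many_minimal_primes[OF noe] by blast
  define bound where "bound p N \<longleftrightarrow> (\<forall>Q n. (\<forall>i\<le>n. prime_id (Q i) \<and> J \<subseteq> Q i) \<longrightarrow>
      (\<forall>i<n. Q i \<subset> Q (Suc i)) \<longrightarrow> Q 0 = p \<longrightarrow> Q n = \<mm> \<longrightarrow> n \<le> N)" for p N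
  have ex: "\<exists>N. bound p N"
    if p: "p \<in> Ps" for p
  proof -
    let ?f = "\<lambda>K. (\<lambda>p. [\<epsilon> p]) ` K"
    have "primeideal (?f p) list_copy" "primeideal (?f \<mm>) list_copy" "?f p \<subseteq> ?f \<mm>"
      using B.prime_image[of p] B.prime_image[of \<mm>] Ps(2)[OF p] pm prime_below_max[OF lm, of p]
      by (simp_all add: BJ image_mono)
    then have "primeideal (?f p) list_copy \<and> primeideal (?f \<mm>) list_copy \<and> ?f p \<subseteq> ?f \<mm>" by simp
    from catB[unfolded catenary_ring_def, THEN spec[of _ "?f p"], THEN spec[of _ "?f \<mm>"], THEN mp, OF this, THEN conjunct1]
    obtain N where N: "\<forall>P n. prime_chain list_copy P n \<and> P 0 = ?f p \<and> P n = ?f \<mm> \<longrightarrow> n \<le> N" by (rule exE)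
    show ?thesis
    unfolding bound_def
    proof (rule exI[of _ N], rule allI, rule allI, rule impI, rule impI, rule impI, rule impI)
      fix Q n assume Q: "\<forall>i\<le>n. prime_id (Q i) \<and> J \<subseteq> Q i" "\<forall>i<n. Q i \<subset> Q (Suc i)" "Q 0 = p" "Q n = \<mm>"
      have "prime_chain list_copy (\<lambda>i. ?f (Q i)) n"
        by (rule B.prime_chain_image) (use Q in \<open>simp_all add: BJ\<close>)
      then show "n \<le> N" using N[rule_format, of "\<lambda>i. ?f (Q i)" n] Q(3,4) by simp
    qed
  qed
  have "\<forall>p\<in>Ps. \<exists>N. bound p N" using ex by (rule ballI)
  from bchoice[OF this] obtain N0 where "\<forall>p\<in>Ps. bound p (N0 p)" by (rule exE)
  then have N0: "n \<le> N0 p" if "p \<in> Ps" "\<forall>i\<le>n. prime_id (Q i) \<and> J \<subseteq> Q i"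
    "\<forall>i<n. Q i \<subset> Q (Suc i)" "Q 0 = p" "Q n = \<mm>" for p Q n
    using that unfolding bound_def by simp
  \<comment> \<open>The sum serves as a common bound for the finitely many minimal primes.\<close>
  define N where "N = sum N0 Ps"
  have "n \<le> N" if P: "prime_chain A P n" for P n
  proof (cases "n = 0")
    case False
    define Q where "Q i = \<epsilon> -` P i" for i
    have Q: "\<And>i. i \<le> n \<Longrightarrow> prime_id (Q i) \<and> J \<subseteq> Q i" "\<And>i. i < n \<Longrightarrow> Q i \<subset> Q (Suc i)"
      using prime_chain_preimage[OF P] unfolding Q_def by simp_all
    obtain p where p: "p \<in> Ps" "p \<subseteq> Q 0" using Ps(3)[of "Q 0"] Q(1)[of 0] by auto
    \<comment> \<open>The ends of the chain are moved to a minimal prime and to the maximal ideal; this keeps the inclusions strict.\<close>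
    define Q' where "Q' i = (if i = 0 then p else if i = n then \<mm> else Q i)" for i
    have "n \<le> N0 p"
    proof (rule N0[OF p(1)])
      show "\<forall>i\<le>n. prime_id (Q' i) \<and> J \<subseteq> Q' i" using Q(1) Ps(2)[OF p(1)] pm by (simp add: Q'_def)
      show "\<forall>i<n. Q' i \<subset> Q' (Suc i)"
      proof (intro allI impI)
        fix i assume i: "i < n"
        have "Q' i \<subseteq> Q i" using i p(2) by (simp add: Q'_def)
        moreover have "Q (Suc i) \<subseteq> Q' (Suc i)"
          using prime_below_max[OF lm, of "Q (Suc i)"] Q(1)[of "Suc i"] i by (auto simp: Q'_def)
        ultimately show "Q' i \<subset> Q' (Suc i)" using Q(2)[OF i] by (meson psubset_subset_trans subset_psubset_trans)
      qed
    qed (use False in \<open>simp_all add: Q'_def\<close>)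
    also have "\<dots> \<le> N" unfolding N_def by (rule member_le_sum) (use Ps(1) p(1) in auto)
    finally show ?thesis .
  qed simp
  then show thesis by (rule that)
qed

text \<open>The supremum that defines the depth is finite, so it is attained.\<close>
lemma maximal_regular_sequence:
  assumes cm: "cohen_macaulay_local_ring A" and cat: "universally_catenary_ring A"
  obtains xs where "regular_sequence A xs" "set xs \<subseteq> max_ideal A"
    "\<And>P n. prime_chain A P n \<Longrightarrow> n \<le> length xs"
proof -
  have loc: "noetherian_local_ring A" and eq: "depth A = krull_dim A"
    using cm by (auto simp: cohen_macaulay_local_ring_def)
  obtain N where N: "\<And>P n. prime_chain A P n \<Longrightarrow> n \<le> N" using prime_chains_bounded[OF loc cat] by blast
  define L where "L = {length xs |xs. regular_sequence A xs \<and> set xs \<subseteq> max_ideal A}"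
  have dep: "depth A = Sup (enat ` L)"
    unfolding depth_def L_def by (rule arg_cong[of _ _ Sup]) auto
  have "krull_dim A \<le> enat N"
    unfolding krull_dim_def by (rule Sup_least) (use N in auto)
  then have le: "l \<le> N" if "l \<in> L" for l
    using that Sup_upper[of "enat l" "enat ` L"] dep eq by (metis (no_types) enat_ord_simps(1) imageI order_trans)
  have "maximalideal (max_ideal A) A"
    using loc theI'[of "\<lambda>I. maximalideal I A"] unfolding noetherian_local_ring_def max_ideal_def by blast
  then interpret m: maximalideal "max_ideal A" A .
  have "genideal A {} \<noteq> carrier A"
    using A.genideal_minimal[OF m.is_ideal, of "{}"] m.I_notcarr m.a_subset by auto
  then have "regular_sequence A []" by (simp add: regular_sequence_def)
  then have "0 \<in> L" by (force simp: L_def)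
  have fin: "finite L" using le by (meson finite_nat_set_iff_bounded_le)
  have "Max L \<in> L" using fin \<open>0 \<in> L\<close> by (intro Max_in) auto
  then obtain xs where xs: "regular_sequence A xs" "set xs \<subseteq> max_ideal A" "length xs = Max L"
    by (auto simp: L_def)
  have "krull_dim A \<le> enat (length xs)"
    unfolding eq[symmetric] dep xs(3) by (rule Sup_least) (use fin in auto)
  moreover have "enat n \<le> krull_dim A" if "prime_chain A P n" for P n
    unfolding krull_dim_def by (rule Sup_upper) (use that in blast)
  ultimately have "n \<le> length xs" if "prime_chain A P n" for P n
    using that by (metis enat_ord_simps(1) order_trans)
  with xs show thesis using that by blast
qed

text \<open>
  Below a prime that contains a regular sequence there is a chain of primes as long as the sequence. If the
  prime were not maximal, the maximal ideal would prolong this chain.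
\<close>
lemma prime_over_maximal_regular_sequence:
  assumes lm: "local_mod \<mm> J" and hs: "regular_seq J hs"
    and ch: "\<And>P n. prime_chain A P n \<Longrightarrow> n \<le> length hs"
    and p: "prime_id p" "adjoin_list J hs \<subseteq> p"
  shows "p = \<mm>"
proof (rule ccontr)
  assume ne: "p \<noteq> \<mm>"
  have Jp: "J \<subseteq> p" using p(2) adjoin_list_superset[OF ideal_J] by blast
  have sub: "p \<subset> \<mm>" using ne prime_below_max[OF lm p(1) Jp] by blast
  obtain P where P: "\<And>i. i \<le> length hs \<Longrightarrow> prime_id (P i) \<and> J \<subseteq> P i" "\<And>i. i < length hs \<Longrightarrow> P i \<subset> P (Suc i)"
    "P (length hs) = p" using prime_chain_below_regular_seq[OF ideal_J hs p] by blast
  define Q where "Q i = (if i \<le> length hs then P i else \<mm>)" for i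
  have "prime_chain A (\<lambda>i. \<epsilon> ` Q i) (Suc (length hs))"
  proof (rule prime_chain_image)
    fix i assume "i \<le> Suc (length hs)"
    then show "prime_id (Q i) \<and> J \<subseteq> Q i"
      using P(1)[of i] local_mod_prime[OF lm] lm by (simp add: Q_def local_mod_def)
  next
    fix i assume "i < Suc (length hs)"
    then show "Q i \<subset> Q (Suc i)"
      using P(2)[of i] P(3) sub by (cases "i = length hs") (simp_all add: Q_def)
  qed
  from ch[OF this] show False by simp
qed

subsection \<open>Powers of the maximal ideal\<close>

definition pw :: "'a set \<Rightarrow> nat \<Rightarrow> 'p set" where
  "pw I n = \<epsilon> -` ideal_power A I n"

definition coset :: "'a set \<Rightarrow> nat \<Rightarrow> 'p \<Rightarrow> 'a set" where
  "coset I n p = ideal_power A I n +>\<^bsub>A\<^esub> \<epsilon> p"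

text \<open>
  Compatible families of cosets are the same as sequences with \<open>s (n + 1) - s n\<close> in the
  \<open>n\<close>-th power.
\<close>
definition cauchy :: "'a set \<Rightarrow> (nat \<Rightarrow> 'p) set" where
  "cauchy I = {s. \<forall>n. s (Suc n) - s n \<in> pw I n}"

context
  fixes I assumes I: "ideal I A"
begin

lemma ideals_set_simps: "\<one>\<^bsub>ideals_set A\<^esub> = carrier A" "X \<otimes>\<^bsub>ideals_set A\<^esub> Y = ideal_prod A X Y"
  by (simp_all add: ideals_set_def)

lemma ideal_power_rec: "ideal_power A I 0 = carrier A" "ideal_power A I (Suc n) = ideal_prod A (ideal_power A I n) I"
  by (simp_all add: nat_pow_def ideals_set_def)

lemma ideal_ideal_power: "ideal (ideal_power A I n) A"
  by (induction n) (simp_all add: ideals_set_simps A.oneideal A.ideal_prod_is_ideal I)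

lemma ideal_pw: "is_ideal (pw I n)" "J \<subseteq> pw I n"
  using is_ideal_preimage[OF ideal_ideal_power] by (simp_all add: pw_def)

lemma pw_Suc: "pw I (Suc n) \<subseteq> pw I n"
  using A.ideal_prod_inter[OF ideal_ideal_power I] unfolding pw_def ideal_power_rec by blast

lemma pw_0: "pw I 0 = UNIV"
  using eps_carrier by (auto simp: pw_def ideals_set_simps)

lemma pw_least:
  assumes K: "is_ideal K" "J \<subseteq> K" and yz: "\<And>y z. y \<in> \<epsilon> -` I \<Longrightarrow> z \<in> pw I n \<Longrightarrow> y * z \<in> K"
  shows "pw I (Suc n) \<subseteq> K"
proof -
  interpret IK: ideal "\<epsilon> ` K" A by (rule ideal_image[OF K(1)])
  have "x \<in> \<epsilon> ` K" if "x \<in> ideal_prod A (ideal_power A I n) I" for x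
    using that
  proof induction
    case (prod i j)
    obtain z where z: "\<epsilon> z = i" using eps_onto[OF ideal.Icarr[OF ideal_ideal_power prod(1)]] by blast
    obtain y where y: "\<epsilon> y = j" using eps_onto[OF ideal.Icarr[OF I prod(2)]] by blast
    have "y * z \<in> K" by (rule yz) (use prod y z in \<open>simp_all add: pw_def\<close>)
    then have "\<epsilon> (z * y) \<in> \<epsilon> ` K" by (simp add: mult.commute)
    then show ?case by (simp add: eps_mult y z)
  qed (rule IK.a_closed)
  then have "pw I (Suc n) \<subseteq> \<epsilon> -` \<epsilon> ` K" unfolding pw_def ideal_power_rec by blast
  then show ?thesis by (simp only: preimage_image[OF K])
qed

lemma pw_power: "x \<in> \<epsilon> -` I \<Longrightarrow> x ^ n \<in> pw I n"
proof (induction n)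
  case (Suc n)
  have "\<epsilon> (x ^ n) \<otimes>\<^bsub>A\<^esub> \<epsilon> x \<in> ideal_prod A (ideal_power A I n) I"
    by (rule ideal_prod.prod) (use Suc in \<open>simp_all add: pw_def\<close>)
  then show ?case by (simp add: pw_def ideals_set_simps eps_mult[symmetric] mult.commute)
qed (simp add: pw_0)

subsection \<open>Completion\<close>

lemma coset_eq_iff: "coset I n p = coset I n q \<longleftrightarrow> p - q \<in> pw I n"
proof -
  have "\<epsilon> (p - q) = \<epsilon> p \<ominus>\<^bsub>A\<^esub> \<epsilon> q" using eps_add[of p "- q"] by (simp add: eps_uminus A.minus_eq)
  then show ?thesis
    using A.quotient_eq_iff_same_a_r_cos[OF ideal_ideal_power[of n] eps_carrier[of p] eps_carrier[of q]]
    by (simp add: coset_def pw_def)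
qed

lemma coset_ops:
  "coset I n p \<oplus>\<^bsub>A Quot ideal_power A I n\<^esub> coset I n q = coset I n (p + q)"
  "coset I n p \<otimes>\<^bsub>A Quot ideal_power A I n\<^esub> coset I n q = coset I n (p * q)"
  "\<one>\<^bsub>A Quot ideal_power A I n\<^esub> = coset I n 1"
  "\<zero>\<^bsub>A Quot ideal_power A I n\<^esub> = coset I n 0"
  "carrier (A Quot ideal_power A I n) = range (coset I n)"
proof -
  interpret P: ideal "ideal_power A I n" A by (rule ideal_ideal_power)
  show "coset I n p \<oplus>\<^bsub>A Quot ideal_power A I n\<^esub> coset I n q = coset I n (p + q)"
    by (simp add: coset_def FactRing_def eps_add P.a_rcos_sum eps_carrier)
  show "coset I n p \<otimes>\<^bsub>A Quot ideal_power A I n\<^esub> coset I n q = coset I n (p * q)"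
    by (simp add: coset_def FactRing_def eps_mult P.rcoset_mult_add eps_carrier)
  show "\<one>\<^bsub>A Quot ideal_power A I n\<^esub> = coset I n 1" by (simp add: coset_def FactRing_def eps_one)
  show "\<zero>\<^bsub>A Quot ideal_power A I n\<^esub> = coset I n 0"
    using A.a_coset_add_zero[OF P.a_subset] by (simp add: coset_def FactRing_def eps_zero)
  have im: "carrier (A Quot ideal_power A I n) = (\<lambda>a. ideal_power A I n +>\<^bsub>A\<^esub> a) ` carrier A"
    by (auto simp: FactRing_simps)
  have "carrier A = range \<epsilon>" using eps_carrier eps_onto by blast
  then show "carrier (A Quot ideal_power A I n) = range (coset I n)"
    by (simp add: im image_image coset_def[abs_def])
qed

text \<open>Compatibility of cosets, which is inclusion, is expressed by differences.\<close>
lemma coset_Suc_subset: "coset I (Suc n) p \<subseteq> coset I n q \<longleftrightarrow> p - q \<in> pw I n"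
proof
  interpret P: ideal "ideal_power A I (Suc n)" A by (rule ideal_ideal_power)
  interpret P': ideal "ideal_power A I n" A by (rule ideal_ideal_power)
  assume "coset I (Suc n) p \<subseteq> coset I n q"
  moreover have "\<epsilon> p \<in> coset I (Suc n) p" unfolding coset_def by (rule P.a_rcos_self[OF eps_carrier])
  ultimately have "\<epsilon> p \<in> ideal_power A I n +>\<^bsub>A\<^esub> \<epsilon> q" by (auto simp: coset_def)
  then have "\<epsilon> p \<ominus>\<^bsub>A\<^esub> \<epsilon> q \<in> ideal_power A I n"
    using P'.a_rcos_module_minus[OF A.ring_axioms eps_carrier eps_carrier] by blast
  moreover have "\<epsilon> (p - q) = \<epsilon> p \<ominus>\<^bsub>A\<^esub> \<epsilon> q" using eps_add[of p "- q"] by (simp add: eps_uminus A.minus_eq)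
  ultimately show "p - q \<in> pw I n" by (simp add: pw_def)
next
  assume "p - q \<in> pw I n"
  then have "coset I n p = coset I n q" by (simp add: coset_eq_iff)
  moreover have "ideal_power A I (Suc n) \<subseteq> ideal_power A I n"
    using A.ideal_prod_inter[OF ideal_ideal_power I] unfolding ideal_power_rec by blast
  then have "coset I (Suc n) p \<subseteq> coset I n p" unfolding coset_def a_r_coset_def' by blast
  ultimately show "coset I (Suc n) p \<subseteq> coset I n q" by simp
qed

lemma completion_carrier: "carrier (adic_completion A I) = (\<lambda>s n. coset I n (s n)) ` cauchy I"
proof (intro equalityI subsetI)
  fix x assume x: "x \<in> carrier (adic_completion A I)"
  then have r: "x n \<in> range (coset I n)" for n by (simp add: adic_completion_def coset_ops(5))
  have "\<exists>p. x n = coset I n p" for n using r[of n] by auto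
  then obtain s where s: "\<And>n. x n = coset I n (s n)" by metis
  have "s \<in> cauchy I" using x by (simp add: cauchy_def adic_completion_def s coset_Suc_subset)
  moreover have "x = (\<lambda>n. coset I n (s n))" using s by blast
  ultimately show "x \<in> (\<lambda>s n. coset I n (s n)) ` cauchy I" by blast
next
  fix x assume "x \<in> (\<lambda>s n. coset I n (s n)) ` cauchy I"
  then obtain s where s: "s \<in> cauchy I" "x = (\<lambda>n. coset I n (s n))" by blast
  have "coset I (Suc n) (s (Suc n)) \<subseteq> coset I n (s n)" for n
    unfolding coset_Suc_subset using s by (simp add: cauchy_def)
  then show "x \<in> carrier (adic_completion A I)" by (simp add: s adic_completion_def coset_ops(5))
qed

lemma completion_ops:
  "(\<lambda>n. coset I n (s n)) \<oplus>\<^bsub>adic_completion A I\<^esub> (\<lambda>n. coset I n (t n)) = (\<lambda>n. coset I n (s n + t n))"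
  "(\<lambda>n. coset I n (s n)) \<otimes>\<^bsub>adic_completion A I\<^esub> (\<lambda>n. coset I n (t n)) = (\<lambda>n. coset I n (s n * t n))"
  "\<one>\<^bsub>adic_completion A I\<^esub> = (\<lambda>n. coset I n 1)" "\<zero>\<^bsub>adic_completion A I\<^esub> = (\<lambda>n. coset I n 0)"
  by (simp_all add: adic_completion_def coset_ops)

lemma cring_completion: "cring (adic_completion A I)"
proof (rule cring_of_image[OF completion_carrier])
  show "0 \<in> cauchy I" "1 \<in> cauchy I" using ideal0[OF ideal_pw(1)] by (auto simp: cauchy_def zero_fun_apply)
  fix s t assume st: "s \<in> cauchy I" "t \<in> cauchy I"
  have "(s (Suc n) + t (Suc n)) - (s n + t n) \<in> pw I n" for n
  proof -
    have "(s (Suc n) - s n) + (t (Suc n) - t n) \<in> pw I n"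
      using st by (intro ideal_add[OF ideal_pw(1)]) (simp_all add: cauchy_def)
    then show ?thesis by (simp add: algebra_simps)
  qed
  then show "s + t \<in> cauchy I" by (simp add: cauchy_def plus_fun_apply)
  have "s (Suc n) * t (Suc n) - s n * t n \<in> pw I n" for n
  proof -
    have "t (Suc n) * (s (Suc n) - s n) + s n * (t (Suc n) - t n) \<in> pw I n"
      using st by (intro ideal_add[OF ideal_pw(1)] ideal_mult(1)[OF ideal_pw(1)]) (simp_all add: cauchy_def)
    then show ?thesis by (simp add: algebra_simps)
  qed
  then show "s * t \<in> cauchy I" by (simp add: cauchy_def)
  have "- s (Suc n) - - s n \<in> pw I n" for n
  proof -
    have "- (s (Suc n) - s n) \<in> pw I n" using st by (intro ideal_uminus[OF ideal_pw(1)]) (simp add: cauchy_def)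
    then show ?thesis by simp
  qed
  then show "- s \<in> cauchy I" by (simp add: cauchy_def uminus_apply)
qed (simp_all add: completion_ops plus_fun_apply zero_fun_apply)

end

lemma ideal_max_ideal: "noetherian_local_ring A \<Longrightarrow> ideal (max_ideal A) A"
  using theI'[of "\<lambda>I. maximalideal I A"]
  unfolding noetherian_local_ring_def max_ideal_def maximalideal_def by blast

lemma power_filtration_max_ideal:
  assumes loc: "noetherian_local_ring A"
  shows "power_filtration (pw (max_ideal A)) J (\<epsilon> -` max_ideal A)"
proof -
  note I = ideal_max_ideal[OF loc]
  have "noeth J" using loc noeth_J by (simp add: noetherian_local_ring_def)
  then show ?thesis
    by unfold_locales
      (rule ideal_pw(1)[OF I] pw_Suc[OF I] pw_0[OF I] pw_least[OF I] pw_power[OF I] local_mod_max_ideal[OF loc] | assumption)+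
qed

end

section \<open>The completion of a Cohen-Macaulay local ring\<close>

text \<open>
  The polynomial ring has a variable for each element of \<open>R\<close> and one for each sequence of subsets,
  in particular for each element of the completion. A variable of the first kind goes to corresponding elements
  in both rings. A variable of the second kind goes to that element of the completion and, in \<open>R\<close>,
  to a representative of its coset modulo the \<open>k\<close>-th power of the maximal ideal. Thus both maps
  agree modulo this power.
\<close>
lemma completion_presentation:
  fixes R :: "('a, 'm) ring_scheme" and k :: nat
  assumes loc: "noetherian_local_ring R"
  obtains \<epsilon>R :: "('a + (nat \<Rightarrow> 'a set)) int_poly \<Rightarrow> 'a" and \<epsilon>S where
    "ring_presentation R \<epsilon>R" "ring_presentation (completion R) \<epsilon>S"
    "completion_filtration (ring_presentation.pw R \<epsilon>R (max_ideal R))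
       (\<lambda>n. {p. \<epsilon>S p n = ideal_power R (max_ideal R) n}) (ring_presentation.J R \<epsilon>R) (\<epsilon>R -` max_ideal R)
       {p. \<epsilon>S p = completion_map R (\<epsilon>R p)} (ring_presentation.J (completion R) \<epsilon>S)"
    "{p. \<epsilon>S p k = ideal_power R (max_ideal R) k} = ring_presentation.pw R \<epsilon>R (max_ideal R) k"
    "\<forall>a\<in>carrier R. \<exists>p. \<epsilon>R p = a \<and> \<epsilon>S p = completion_map R a"
proof -
  define I where "I = max_ideal R"
  define S where "S = completion R"
  have Sad: "S = adic_completion R I" by (simp add: S_def I_def completion_def)
  interpret R: cring R using loc by (simp add: noetherian_local_ring_def)
  define \<sigma>1 where "\<sigma>1 a = (if a \<in> carrier R then a else \<zero>\<^bsub>R\<^esub>)" for a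
  have \<sigma>1: "\<sigma>1 a \<in> carrier R" for a by (simp add: \<sigma>1_def)
  interpret P: ring_presentation R "poly_eval R \<sigma>1"
    by (rule R.presentation_of_generators[OF \<sigma>1]) (force simp: \<sigma>1_def image_iff)
  have I: "ideal I R" unfolding I_def by (rule P.ideal_max_ideal[OF loc])
  interpret S: cring S unfolding Sad by (rule P.cring_completion[OF I])
  define pick where "pick s = (SOME a. a \<in> carrier R \<and> s k = ideal_power R I k +>\<^bsub>R\<^esub> a)" for s
  have pick: "pick s \<in> carrier R \<and> s k = ideal_power R I k +>\<^bsub>R\<^esub> pick s" if s: "s \<in> carrier S" for s
    unfolding pick_def
  proof (rule someI_ex)
    have "s k \<in> range (P.coset I k)" using s by (simp add: Sad adic_completion_def P.coset_ops(5)[OF I])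
    then show "\<exists>a. a \<in> carrier R \<and> s k = ideal_power R I k +>\<^bsub>R\<^esub> a"
      using P.eps_carrier by (auto simp: P.coset_def)
  qed
  define \<sigma>R :: "'a + (nat \<Rightarrow> 'a set) \<Rightarrow> 'a" where
    "\<sigma>R t = (case t of Inl a \<Rightarrow> \<sigma>1 a | Inr s \<Rightarrow> if s \<in> carrier S then pick s else \<zero>\<^bsub>R\<^esub>)" for t
  define \<sigma>S :: "'a + (nat \<Rightarrow> 'a set) \<Rightarrow> nat \<Rightarrow> 'a set" where
    "\<sigma>S t = (case t of Inl a \<Rightarrow> completion_map R (\<sigma>1 a) | Inr s \<Rightarrow> if s \<in> carrier S then s else \<zero>\<^bsub>S\<^esub>)" for t
  have cm: "completion_map R a \<in> carrier S" if a: "a \<in> carrier R" for a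
  proof -
    obtain p where p: "poly_eval R \<sigma>1 p = a" using P.eps_onto[OF a] by blast
    have "(\<lambda>_. p) \<in> P.cauchy I" using ideal0[OF P.ideal_pw(1)[OF I]] by (simp add: P.cauchy_def)
    moreover have "completion_map R a = (\<lambda>n. P.coset I n p)" by (simp add: completion_map_def P.coset_def p I_def)
    ultimately show ?thesis unfolding Sad P.completion_carrier[OF I] by (rule_tac image_eqI) auto
  qed
  have \<sigma>R: "\<sigma>R t \<in> carrier R" for t using pick by (auto simp: \<sigma>R_def \<sigma>1 split: sum.split)
  have \<sigma>S: "\<sigma>S t \<in> carrier S" for t using cm[OF \<sigma>1] by (auto simp: \<sigma>S_def split: sum.split)
  define \<epsilon>R where "\<epsilon>R = poly_eval R \<sigma>R"
  define \<epsilon>S where "\<epsilon>S = poly_eval S \<sigma>S"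
  have eval_var: "\<epsilon>R (pvar t) = \<sigma>R t" "\<epsilon>S (pvar t) = \<sigma>S t" for t
    using R.poly_eval_var[of \<sigma>R, OF \<sigma>R] S.poly_eval_var[of \<sigma>S, OF \<sigma>S] by (simp_all add: \<epsilon>R_def \<epsilon>S_def)
  have ontoR: "carrier R \<subseteq> range \<sigma>R"
  proof
    fix a assume "a \<in> carrier R"
    then have "a = \<sigma>R (Inl a)" by (simp add: \<sigma>R_def \<sigma>1_def)
    then show "a \<in> range \<sigma>R" by (rule range_eqI)
  qed
  have ontoS: "carrier S \<subseteq> range \<sigma>S"
  proof
    fix s assume "s \<in> carrier S"
    then have "s = \<sigma>S (Inr s)" by (simp add: \<sigma>S_def)
    then show "s \<in> range \<sigma>S" by (rule range_eqI)
  qed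
  have hR: "ring_presentation R \<epsilon>R" unfolding \<epsilon>R_def by (rule R.presentation_of_generators[OF \<sigma>R ontoR])
  have hS: "ring_presentation S \<epsilon>S" unfolding \<epsilon>S_def by (rule S.presentation_of_generators[OF \<sigma>S ontoS])
  interpret hR: ring_presentation R \<epsilon>R by (rule hR)
  interpret hS: ring_presentation S \<epsilon>S by (rule hS)
  let ?pw = "hR.pw I" and ?c = "hR.coset I"
  note pw = hR.ideal_pw[OF I] and ceq = hR.coset_eq_iff[OF I]
  have "\<forall>p. \<exists>s\<in>hR.cauchy I. \<epsilon>S p = (\<lambda>n. ?c n (s n))"
    using hS.eps_carrier unfolding Sad hR.completion_carrier[OF I] by blast
  then obtain l where l: "\<And>p. l p \<in> hR.cauchy I" "\<And>p. \<epsilon>S p = (\<lambda>n. ?c n (l p n))" by metis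
  have lS: "\<epsilon>S p n = ?c n (l p n)" for p n by (simp add: l(2))
  have step: "l p (Suc n) - l p n \<in> ?pw n" for p n using l(1) by (simp add: hR.cauchy_def)
  have c0: "?c n 0 = ideal_power R I n" for n
    using hR.coset_ops(4)[OF I, of n] by (simp add: FactRing_def)
  have l_add: "l (p + q) n - (l p n + l q n) \<in> ?pw n" for p q n
  proof -
    have "\<epsilon>S (p + q) = (\<lambda>n. ?c n (l p n + l q n))"
      unfolding hS.eps_add l(2)[of p] l(2)[of q] unfolding Sad by (rule hR.completion_ops(1)[OF I])
    then have "?c n (l (p + q) n) = ?c n (l p n + l q n)" unfolding lS[symmetric] by simp
    then show ?thesis unfolding ceq .
  qed
  have l_mult: "l (p * q) n - l p n * l q n \<in> ?pw n" for p q n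
  proof -
    have "\<epsilon>S (p * q) = (\<lambda>n. ?c n (l p n * l q n))"
      unfolding hS.eps_mult l(2)[of p] l(2)[of q] unfolding Sad by (rule hR.completion_ops(2)[OF I])
    then have "?c n (l (p * q) n) = ?c n (l p n * l q n)" unfolding lS[symmetric] by simp
    then show ?thesis unfolding ceq .
  qed
  have zero: "l 0 n \<in> ?pw n" for n
  proof -
    have "\<epsilon>S 0 = (\<lambda>n. ?c n 0)" unfolding hS.eps_zero unfolding Sad by (rule hR.completion_ops(4)[OF I])
    then have "?c n (l 0 n) = ?c n 0" unfolding lS[symmetric] by simp
    then show ?thesis unfolding ceq by simp
  qed
  have l_one: "l 1 n - 1 \<in> ?pw n" for n
  proof -
    have "\<epsilon>S 1 = (\<lambda>n. ?c n 1)" unfolding hS.eps_one unfolding Sad by (rule hR.completion_ops(3)[OF I])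
    then have "?c n (l 1 n) = ?c n 1" unfolding lS[symmetric] by simp
    then show ?thesis unfolding ceq .
  qed
  have diff: "l (p - q) n - (l p n - l q n) \<in> ?pw n" for p q n
  proof -
    from ideal_uminus[OF pw(1) l_add[of "p - q" q n]] show ?thesis by (simp add: algebra_simps)
  qed
  define F where "F n = {p. \<epsilon>S p n = ideal_power R I n}" for n
  \<comment> \<open>The image of \<open>p\<close> in the completion has \<open>n\<close>-th coset represented by \<open>l p n\<close>, so all statements about it become congruences for \<open>l\<close>.\<close>
  define P0 where "P0 = {p. \<epsilon>S p = completion_map R (\<epsilon>R p)}"
  have F: "p \<in> F n \<longleftrightarrow> l p n \<in> ?pw n" for p n unfolding F_def mem_Collect_eq lS c0[symmetric] ceq by simp
  have Fdiff: "p - q \<in> F n \<longleftrightarrow> \<epsilon>S p n = \<epsilon>S q n" for p q n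
  proof -
    have "l (p - q) n \<in> ?pw n \<longleftrightarrow> l p n - l q n \<in> ?pw n"
      using ideal_diff[OF pw(1) _ diff[of p q n], of "l (p - q) n"] ideal_add[OF pw(1) diff[of p q n], of "l p n - l q n"] by auto
    then show ?thesis unfolding F lS ceq .
  qed
  have P0n: "\<epsilon>S p n = ?c n p" if "p \<in> P0" for p n
    using that by (simp add: P0_def completion_map_def hR.coset_def I_def)
  have P0I: "p \<in> P0" if p: "\<And>n. \<epsilon>S p n = ?c n p" for p
    unfolding P0_def mem_Collect_eq using p by (auto simp: completion_map_def hR.coset_def I_def)
  have P0l: "p \<in> P0 \<longleftrightarrow> (\<forall>n. l p n - p \<in> ?pw n)" for p
    using P0n[of p] P0I[of p] unfolding lS ceq by blast
  have const: "\<epsilon>R (pvar (Inl a)) = a \<and> \<epsilon>S (pvar (Inl a)) = completion_map R a" if "a \<in> carrier R" for a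
    using that by (simp add: eval_var \<sigma>R_def \<sigma>S_def \<sigma>1_def)
  have constP0: "pvar (Inl a) \<in> P0" if "a \<in> carrier R" for a using const[OF that] by (simp add: P0_def)
  \<comment> \<open>It suffices to check the variables, where the choice of representatives applies.\<close>
  have agree_k: "l p k - p \<in> ?pw k" for p
  proof (induction p rule: int_poly_induct)
    case (var t)
    have "\<epsilon>S (pvar t) k = ?c k (pvar t)"
    proof (cases t)
      case (Inl a)
      then show ?thesis by (simp add: eval_var hR.coset_def \<sigma>R_def \<sigma>S_def completion_map_def I_def)
    next
      case (Inr s)
      show ?thesis
      proof (cases "s \<in> carrier S")
        case True
        then show ?thesis using pick[OF True] Inr by (simp add: eval_var hR.coset_def \<sigma>R_def \<sigma>S_def)
      next
        case False
        then have "\<epsilon>S (pvar t) = \<epsilon>S 0" "\<epsilon>R (pvar t) = \<epsilon>R 0"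
          using Inr by (simp_all add: eval_var \<sigma>R_def \<sigma>S_def hS.eps_zero hR.eps_zero)
        moreover have "\<epsilon>S 0 k = ?c k 0" unfolding lS ceq using zero by simp
        ultimately show ?thesis by (simp add: hR.coset_def)
      qed
    qed
    then show ?case unfolding lS ceq .
  next
    case one show ?case by (rule l_one)
  next
    case (uminus p)
    have "(l (0 - p) k - (l 0 k - l p k)) + l 0 k - (l p k - p) \<in> ?pw k"
      by (intro ideal_diff[OF pw(1)] ideal_add[OF pw(1)] diff uminus zero)
    then show ?case by (simp add: algebra_simps)
  next
    case (add p q)
    have "(l (p + q) k - (l p k + l q k)) + ((l p k - p) + (l q k - q)) \<in> ?pw k"
      using add by (intro ideal_add[OF pw(1)] l_add)
    then show ?case by (simp add: algebra_simps)
  next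
    case (mult p q)
    have "(l (p * q) k - l p k * l q k) + (l q k * (l p k - p) + p * (l q k - q)) \<in> ?pw k"
      using mult by (intro ideal_add[OF pw(1)] ideal_mult(1)[OF pw(1)] l_mult)
    then show ?case by (simp add: algebra_simps)
  qed
  have Fk: "F k = ?pw k"
  proof (rule Set.set_eqI)
    fix p
    show "p \<in> F k \<longleftrightarrow> p \<in> ?pw k"
      unfolding F using ideal_diff[OF pw(1) _ agree_k[of p], of "l p k"] ideal_add[OF pw(1) agree_k[of p], of p] by auto
  qed
  have idF: "is_ideal (F n)" for n
    unfolding is_ideal_def
  proof (intro conjI ballI allI)
    show "0 \<in> F n" unfolding F by (rule zero)
  next
    fix a b assume ab: "a \<in> F n" "b \<in> F n"
    from ideal_add[OF pw(1) l_add[of a b n] ideal_add[OF pw(1) ab[unfolded F]]] show "a + b \<in> F n" unfolding F by simp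
  next
    fix c a assume a: "a \<in> F n"
    from ideal_add[OF pw(1) l_mult[of c a n] ideal_mult(1)[OF pw(1) a[unfolded F], of "l c n"]] show "c * a \<in> F n"
      unfolding F by simp
  qed
  have FSuc: "F (Suc n) \<subseteq> F n" for n
  proof
    fix p assume "p \<in> F (Suc n)"
    then have "l p (Suc n) \<in> ?pw n" using hR.pw_Suc[OF I] unfolding F by blast
    from ideal_diff[OF pw(1) this step[of p n]] show "p \<in> F n" unfolding F by simp
  qed
  \<comment> \<open>Completeness: the diagonal of the sequence of representatives is an element of the completion, which is the image of a variable.\<close>
  have comp: "\<exists>q. \<forall>n. q - p n \<in> F n" if p: "\<And>n. p (Suc n) - p n \<in> F n" for p
  proof -
    define s where "s n = l (p n) n" for n
    have "s (Suc n) - s n \<in> ?pw n" for n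
    proof -
      have "l (p (Suc n)) n - l (p n) n \<in> ?pw n" using p[of n] unfolding Fdiff lS ceq .
      from ideal_add[OF pw(1) step[of "p (Suc n)" n] this] show ?thesis by (simp add: s_def)
    qed
    then have "s \<in> hR.cauchy I" by (simp add: hR.cauchy_def)
    then have "(\<lambda>n. ?c n (s n)) \<in> carrier S" unfolding Sad hR.completion_carrier[OF I] by (rule imageI)
    then obtain q where q: "\<epsilon>S q = (\<lambda>n. ?c n (s n))" using hS.eps_onto by blast
    have "q - p n \<in> F n" for n unfolding Fdiff by (simp add: q lS s_def)
    then show ?thesis by blast
  qed
  have SJ: "hS.J = (\<Inter>n. F n)"
  proof (rule Set.set_eqI)
    fix p
    have z: "\<zero>\<^bsub>S\<^esub> = (\<lambda>n. ideal_power R I n)" using hR.completion_ops(4)[OF I] by (simp add: Sad c0)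
    show "p \<in> hS.J \<longleftrightarrow> p \<in> (\<Inter>n. F n)" unfolding hS.J_def z F_def by (auto simp: fun_eq_iff)
  qed
  have "completion_filtration ?pw F hR.J (\<epsilon>R -` max_ideal R) P0 hS.J"
  proof (intro completion_filtration.intro complete_filtration.intro filtration.intro complete_filtration_axioms.intro
      completion_filtration_axioms.intro)
    show "power_filtration ?pw hR.J (\<epsilon>R -` max_ideal R)"
      unfolding I_def by (rule hR.power_filtration_max_ideal[OF loc])
    show "is_ideal (F n)" "F (Suc n) \<subseteq> F n" for n by (rule idF FSuc)+
    show "\<exists>q. \<forall>n. q - p n \<in> F n" if "\<And>n. p (Suc n) - p n \<in> F n" for p by (rule comp[OF that])
    fix a b assume ab: "a \<in> P0" "b \<in> P0"
    then have ab': "\<And>n. l a n - a \<in> ?pw n" "\<And>n. l b n - b \<in> ?pw n" unfolding P0l by blast+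
    have "(l (a - b) n - (l a n - l b n)) + ((l a n - a) - (l b n - b)) \<in> ?pw n" for n
      by (intro ideal_add[OF pw(1)] ideal_diff[OF pw(1) ab'] diff)
    then show "a - b \<in> P0" unfolding P0l by (simp add: algebra_simps)
    have "(l (a * b) n - l a n * l b n) + (l b n * (l a n - a) + a * (l b n - b)) \<in> ?pw n" for n
      by (intro ideal_add[OF pw(1)] ideal_mult(1)[OF pw(1)] l_mult ab')
    then show "a * b \<in> P0" unfolding P0l by (simp add: algebra_simps)
  next
    fix p n
    have "\<epsilon>S (pvar (Inl (\<epsilon>R (l p n)))) n = \<epsilon>S p n"
      using const[OF hR.eps_carrier[of "l p n"]] by (simp add: lS[of p] hR.coset_def completion_map_def I_def)
    then have "p - pvar (Inl (\<epsilon>R (l p n))) \<in> F n" unfolding Fdiff by simp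
    then show "\<exists>a\<in>P0. p - a \<in> F n" using constP0[OF hR.eps_carrier] by blast
    have "p - pvar (Inl (\<epsilon>R p)) \<in> hR.J"
      unfolding hR.eps_eq_iff[symmetric] using const[OF hR.eps_carrier[of p]] by simp
    then show "\<exists>a\<in>P0. p - a \<in> hR.J" using constP0[OF hR.eps_carrier] by blast
  next
    fix a n assume "a \<in> P0"
    then have la: "l a n - a \<in> ?pw n" unfolding P0l by blast
    show "a \<in> F n \<longleftrightarrow> a \<in> ?pw n"
      unfolding F using ideal_diff[OF pw(1) _ la, of "l a n"] ideal_add[OF pw(1) la, of a] by auto
  next
    show "hR.J \<subseteq> ?pw n" for n by (rule pw(2))
    show "hS.J = (\<Inter>n. F n)" by (rule SJ)
  qed
  note cf = this
  show thesis
  proof (rule that[of \<epsilon>R \<epsilon>S])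
    show "ring_presentation R \<epsilon>R" by (rule hR)
    show "ring_presentation (completion R) \<epsilon>S" using hS by (simp add: S_def)
    show "completion_filtration (hR.pw (max_ideal R)) (\<lambda>n. {p. \<epsilon>S p n = ideal_power R (max_ideal R) n}) hR.J
        (\<epsilon>R -` max_ideal R) {p. \<epsilon>S p = completion_map R (\<epsilon>R p)} (ring_presentation.J (completion R) \<epsilon>S)"
      using cf unfolding F_def[abs_def] P0_def I_def S_def .
    show "{p. \<epsilon>S p k = ideal_power R (max_ideal R) k} = hR.pw (max_ideal R) k"
      using Fk unfolding F_def I_def .
    show "\<forall>a\<in>carrier R. \<exists>p. \<epsilon>R p = a \<and> \<epsilon>S p = completion_map R a"
      using const by blast
  qed
qed

lemma auslander_condition_iff:
  "auslander_condition A \<longleftrightarrow> (\<forall>M :: ('a, 'a list) module. fg_module A M \<longrightarrow> (\<exists>b. ext_bounded A M b))"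
  for A :: "('a, 'm) ring_scheme"
  unfolding auslander_condition_def ext_bounded_def ..

lemma uniform_auslander_condition_iff:
  "uniform_auslander_condition A \<longleftrightarrow>
    (\<exists>b\<ge>0. \<forall>M :: ('a, 'a list) module. fg_module A M \<longrightarrow> ext_bounded A M b)"
  for A :: "('a, 'm) ring_scheme"
  unfolding uniform_auslander_condition_def ext_bounded_def by simp

text \<open>
  A resolution over the completion becomes, shifted by the length \<open>d\<close> of a maximal regular
  sequence, a resolution over the common artinian quotient. The module over \<open>R\<close> with the same
  resolution there provides the bound.
\<close>
theorem ext_bounds_ascend_to_completion:
  fixes R :: "('a, 'm) ring_scheme"
  assumes cm: "cohen_macaulay_local_ring R" and cat: "universally_catenary_ring R"
  obtains d where "\<And>M' :: (nat \<Rightarrow> 'a set, (nat \<Rightarrow> 'a set) list) module. fg_module (completion R) M' \<Longrightarrow>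
    \<exists>M. fg_module R M \<and> (\<forall>b. ext_bounded R M b \<longrightarrow> ext_bounded (completion R) M' (int (nat b + d)))"
proof -
  have loc: "noetherian_local_ring R" using cm by (simp add: cohen_macaulay_local_ring_def)
  interpret R: cring R using loc by (simp add: noetherian_local_ring_def)
  let ?I = "max_ideal R"
  \<comment> \<open>The exponent \<open>k\<close> is determined by the sequence \<open>xs\<close> of elements of \<open>R\<close> with the help of a first presentation; the second one is built for this \<open>k\<close>.\<close>
  obtain e1 :: "('a + (nat \<Rightarrow> 'a set)) int_poly \<Rightarrow> 'a" where e1: "ring_presentation R e1"
    by (rule completion_presentation[OF loc])
  interpret P: ring_presentation R e1 by (rule e1)
  obtain xs where xs: "regular_sequence R xs" "set xs \<subseteq> ?I" and ch: "\<And>P n. prime_chain R P n \<Longrightarrow> n \<le> length xs"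
    by (rule P.maximal_regular_sequence[OF cm cat]) blast
  have xc: "set xs \<subseteq> carrier R" using xs(1) by (simp add: regular_sequence_def)
  interpret P: power_filtration "P.pw ?I" P.J "e1 -` ?I" by (rule P.power_filtration_max_ideal[OF loc])
  obtain hs1 where hs1: "map e1 hs1 = xs" by (rule P.list_lift[OF xc])
  have reg1: "regular_seq P.J hs1" by (rule P.regular_sequence_lift) (simp add: hs1 xs(1))
  obtain k where k: "P.pw ?I k \<subseteq> adjoin_list P.J hs1"
  proof (rule P.power_in_primary)
    show "is_ideal (adjoin_list P.J hs1)" "P.J \<subseteq> adjoin_list P.J hs1"
      using ideal_adjoin_list[OF P.ideal_J] adjoin_list_superset[OF P.ideal_J] by auto
    show "p = e1 -` ?I" if "prime_id p" "adjoin_list P.J hs1 \<subseteq> p" for p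
      by (rule P.prime_over_maximal_regular_sequence[OF P.localJ reg1 _ that]) (use ch hs1 in \<open>metis length_map\<close>)
  qed (rule that)
  have kR: "a \<in> genideal R (set xs)" if a: "a \<in> ideal_power R ?I k" for a
  proof -
    obtain p where p: "e1 p = a"
      using P.eps_onto[OF ideal.Icarr[OF P.ideal_ideal_power[OF P.ideal_max_ideal[OF loc]] a]] by blast
    then have "p \<in> P.pw ?I k" using a by (simp add: P.pw_def)
    then have "p \<in> adjoin_list P.J hs1" using k by blast
    then show ?thesis unfolding P.adjoin_list_preimage by (simp add: p hs1[symmetric])
  qed
  obtain \<epsilon>R :: "('a + (nat \<Rightarrow> 'a set)) int_poly \<Rightarrow> 'a" and \<epsilon>S where
    eR: "ring_presentation R \<epsilon>R" and eS: "ring_presentation (completion R) \<epsilon>S"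
    and cf: "completion_filtration (ring_presentation.pw R \<epsilon>R ?I)
       (\<lambda>n. {p. \<epsilon>S p n = ideal_power R ?I n}) (ring_presentation.J R \<epsilon>R) (\<epsilon>R -` ?I)
       {p. \<epsilon>S p = completion_map R (\<epsilon>R p)} (ring_presentation.J (completion R) \<epsilon>S)"
    and Fk: "{p. \<epsilon>S p k = ideal_power R ?I k} = ring_presentation.pw R \<epsilon>R ?I k"
    and lift: "\<forall>a\<in>carrier R. \<exists>p. \<epsilon>R p = a \<and> \<epsilon>S p = completion_map R a"
    by (rule completion_presentation[OF loc, of k])
  interpret hR: ring_presentation R \<epsilon>R by (rule eR)
  interpret hS: ring_presentation "completion R" \<epsilon>S by (rule eS)
  define F where "F n = {p. \<epsilon>S p n = ideal_power R ?I n}" for n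
  define P0 where "P0 = {p. \<epsilon>S p = completion_map R (\<epsilon>R p)}"
  interpret C: completion_filtration "hR.pw ?I" F hR.J "\<epsilon>R -` ?I" P0 hS.J
    using cf unfolding F_def[abs_def] P0_def .
  have "\<exists>hs. map \<epsilon>R hs = xs \<and> set hs \<subseteq> P0"
    using xc
  proof (induction xs)
    case (Cons x xs)
    then obtain hs where hs: "map \<epsilon>R hs = xs" "set hs \<subseteq> P0" by auto
    obtain p where p: "\<epsilon>R p = x" "\<epsilon>S p = completion_map R x" using bspec[OF lift, of x] Cons.prems by auto
    then have "map \<epsilon>R (p # hs) = x # xs \<and> set (p # hs) \<subseteq> P0" using hs by (simp add: P0_def)
    then show ?case by (rule exI)
  qed simp
  then obtain hs where hs: "map \<epsilon>R hs = xs" "set hs \<subseteq> P0" by blast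
  have len: "length hs = length xs" using hs(1) by (metis length_map)
  have img: "\<epsilon>R ` set hs = set xs" using hs(1) by (metis set_map)
  have reg: "regular_seq hR.J hs" by (rule hR.regular_sequence_lift) (simp add: hs xs(1))
  have hm: "set hs \<subseteq> \<epsilon>R -` ?I" using img xs(2) by blast
  have only: "p = \<epsilon>R -` ?I" if "prime_id p" "adjoin_list hR.J hs \<subseteq> p" for p
    by (rule hR.prime_over_maximal_regular_sequence[OF C.localJ reg _ that]) (use ch len in simp)
  have one: "1 \<in> P0"
  proof -
    have "completion_map R \<one>\<^bsub>R\<^esub> = \<one>\<^bsub>completion R\<^esub>"
      by (simp add: completion_map_def completion_def adic_completion_def FactRing_def)
    then show ?thesis by (simp add: P0_def hR.eps_one hS.eps_one)
  qed
  have pow: "x ^ n \<in> F n" if x: "x \<in> set hs" for n x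
  proof -
    have "x ^ n \<in> P0" using x hs(2) by (induction n) (auto intro: one C.P0_mult)
    then show ?thesis using C.agree C.M_pow[of x n] hm x by blast
  qed
  have kM: "hR.pw ?I k \<subseteq> adjoin_list hR.J hs"
    unfolding hR.adjoin_list_preimage img hR.pw_def using kR by blast
  have FM: "F k = hR.pw ?I k" unfolding F_def by (rule Fk)
  note cp = C.completion_properties[OF reg hm hs(2) only pow kM FM]
  have regS: "regular_seq hS.J hs" and comS: "complete_seq hS.J hs"
    and eq: "adjoin_list hS.J hs = adjoin_list hR.J hs" and noeS: "noeth hS.J"
    by (rule cp; assumption)+
  obtain qs where qs: "comp_series (\<epsilon>R -` ?I) (adjoin_list hS.J hs) qs"
    using comp_series_exists[OF noeth_adjoin_list[OF noeS, of hs]] only unfolding eq by blast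
  let ?d = "length hs"
  have "\<exists>M. fg_module R M \<and> (\<forall>b. ext_bounded R M b \<longrightarrow> ext_bounded (completion R) M' (int (nat b + ?d)))"
    if M': "fg_module (completion R) M'" for M' :: "(nat \<Rightarrow> 'a set, (nat \<Rightarrow> 'a set) list) module"
  proof -
    obtain r D where D: "resolution_mod hS.J r D"
      and up: "\<And>b. bounded_at hS.J r D b \<Longrightarrow> ext_bounded (completion R) M' (int b)"
      by (rule hS.bounded_at_imp_ext_bounded[OF noeS M']) blast
    let ?r = "\<lambda>i. r (i + ?d)" and ?D = "\<lambda>i. D (i + ?d)"
    have "resolution_mod (adjoin_list hR.J hs) ?r ?D"
      using resolution_shift[OF hS.ideal_J D regS] unfolding eq .
    from bounded_at_descent_list[OF hR.ideal_J reg this] obtain r' G where G: "resolution_mod hR.J r' G"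
      and down: "\<And>b. bounded_at hR.J r' G b \<Longrightarrow> bounded_at (adjoin_list hR.J hs) ?r ?D b" by blast
    obtain M where M: "fg_module R M" and low: "\<And>b. ext_bounded R M b \<Longrightarrow> bounded_at hR.J r' G (nat b)"
      by (rule hR.ext_bounded_imp_bounded_at[OF G]) blast
    have "ext_bounded (completion R) M' (int (nat b + ?d))" if b: "ext_bounded R M b" for b
    proof (rule up, rule bounded_at_ascent[OF noeS regS comS local_mod_residue[OF C.localJ] qs D])
      show "bounded_at (adjoin_list hS.J hs) ?r ?D (nat b)" unfolding eq by (rule down[OF low[OF b]])
    qed
    with M show ?thesis by blast
  qed
  then show thesis by (rule that)
qed

theorem theoremC:
  fixes R :: "('a, 'm) ring_scheme"
  assumes "noetherian_local_ring R"
    and "excellent_ring R"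
    and "henselian_local_ring R"
    and "cohen_macaulay_local_ring R"
  shows "(auslander_condition R \<longrightarrow> auslander_condition (completion R)) \<and>
    (uniform_auslander_condition R \<longrightarrow> uniform_auslander_condition (completion R))"
proof -
  have cat: "universally_catenary_ring R" using assms(2) by (simp add: excellent_ring_def)
  obtain d where d: "\<And>M' :: (nat \<Rightarrow> 'a set, (nat \<Rightarrow> 'a set) list) module. fg_module (completion R) M' \<Longrightarrow>
    \<exists>M. fg_module R M \<and> (\<forall>b. ext_bounded R M b \<longrightarrow> ext_bounded (completion R) M' (int (nat b + d)))"
    using ext_bounds_ascend_to_completion[OF assms(4) cat] by blast
  show ?thesis
    unfolding auslander_condition_iff uniform_auslander_condition_iff
  proof (intro conjI impI allI)
    fix M' :: "(nat \<Rightarrow> 'a set, (nat \<Rightarrow> 'a set) list) module"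
    assume ac: "\<forall>M :: ('a, 'a list) module. fg_module R M \<longrightarrow> (\<exists>b. ext_bounded R M b)" and "fg_module (completion R) M'"
    from d[OF this(2)] obtain M where M: "fg_module R M"
      "\<forall>b. ext_bounded R M b \<longrightarrow> ext_bounded (completion R) M' (int (nat b + d))" by blast
    obtain b where "ext_bounded R M b" using ac M(1) by blast
    then show "\<exists>b. ext_bounded (completion R) M' b" using M(2) by blast
  next
    assume "\<exists>b\<ge>0. \<forall>M :: ('a, 'a list) module. fg_module R M \<longrightarrow> ext_bounded R M b"
    then obtain b where b: "\<And>M :: ('a, 'a list) module. fg_module R M \<Longrightarrow> ext_bounded R M b" by blast
    have "ext_bounded (completion R) M' (int (nat b + d))" if "fg_module (completion R) M'"
      for M' :: "(nat \<Rightarrow> 'a set, (nat \<Rightarrow> 'a set) list) module"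
      using d[OF that] b by blast
    then show "\<exists>b\<ge>0. \<forall>M' :: (nat \<Rightarrow> 'a set, (nat \<Rightarrow> 'a set) list) module. fg_module (completion R) M' \<longrightarrow>
        ext_bounded (completion R) M' b" by (intro exI[of _ "int (nat b + d)"]) simp
  qed
qed

end
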